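(* For all prime numbers $p<q$, $$\mathbf D\left(\sin\mathbf a_{pq}\bmod \mathbb Q^{\mathrm{ab}\times 2}\right)=e_p\wedge e_q .$$
   Context: Let $\overline{\mathbb Q}$ be the algebraic closure of $\mathbb Q$ in $\mathbb C$, $G=\mathrm{Gal}(\overline{\mathbb Q}/\mathbb Q)$, $\mathbb Q^{\mathrm{ab}}\subset\overline{\mathbb Q}$ the maximal abelian extension of $\mathbb Q$, $G^{\mathrm{ab}}=\mathrm{Gal}(\mathbb Q^{\mathrm{ab}}/\mathbb Q)$. Put $[\sigma,\tau]=\sigma\tau\sigma^{-1}\tau^{-1}$. Let $[G,G]$ be the closed subgroup of $G$ topologically generated by all $[\sigma,\tau]$, and $[G,G]^\epsilon$ the closed subgroup topologically generated by all $[\sigma,\tau]^2$ and $[\sigma,[\tau,\eta]]$ ($\sigma,\tau,\eta\in G$). Put $G^{\mathrm{ab}+\epsilon}=G/[G,G]^\epsilon$ and $G^\epsilon=[G,G]/[G,G]^\epsilon$; there is a canonical central extension $\Sigma^\epsilon_G:\ 1\to G^\epsilon\to G^{\mathrm{ab}+\epsilon}\to G^{\mathrm{ab}}\to1$. Cohomology is continuous cochain cohomology, with $\mathbb Z/2\mathbb Z$ a discrete trivial module. Let $H^2(G^{\mathrm{ab}},\mathbb Z/2\mathbb Z)^-$ be the quotient of $H^2(G^{\mathrm{ab}},\mathbb Z/2\mathbb Z)$ by the subgroup of classes of extensions of $G^{\mathrm{ab}}$ by $\mathbb Z/2\mathbb Z$ whose middle group is abelian. Definition of the injective homomorphism $\mathbf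 D:H^0(G^{\mathrm{ab}},\mathbb Q^{\mathrm{ab}\times}/\mathbb Q^{\mathrm{ab}\times2})\to\bigwedge^2H^1(G^{\mathrm{ab}},\mathbb Z/2\mathbb Z)$ (exterior square over $\mathbb Z/2\mathbb Z$): it is the composite of (i) the Kummer isomorphism $H^0(G^{\mathrm{ab}},\mathbb Q^{\mathrm{ab}\times}/\mathbb Q^{\mathrm{ab}\times2})\to H^1(G^\epsilon,\mathbb Z/2\mathbb Z)$ sending $u\bmod\mathbb Q^{\mathrm{ab}\times2}$ to the homomorphism $c$ with $\sigma\sqrt u=(-1)^{c_\sigma}\sqrt u$ for $\sigma\in G^\epsilon$; (ii) the injective homomorphism $H^1(G^\epsilon,\mathbb Z/2\mathbb Z)\to H^2(G^{\mathrm{ab}},\mathbb Z/2\mathbb Z)^-$ sending $c$ to the image of the class $c\circ[\Sigma_G^\epsilon]$, i.e. of the class of the 2-cocycle $(\sigma,\tau)\mapsto c(\vartheta(\sigma)\vartheta(\tau)\vartheta(\sigma\tau)^{-1})$ for any continuous section $\vartheta:G^{\mathrm{ab}}\to G^{\mathrm{ab}+\epsilon}$; (iii) the inverse of the isomorphism $\bigwedge^2H^1(G^{\mathrm{ab}},\mathbb Z/2\mathbb Z)\to H^2(G^{\mathrm{ab}},\mathbb Z/2\mathbb Z)^-$ induced by cup product. For each prime $p$ let $e_p\in H^1(G^{\mathrm{ab}},\mathbb Z/2\mathbb Z)$ be the homomorphism defined by $\sigma\sqrt p=(-1)^{(e_p)_\sigma}\sqrt p$ ($\sigma\in G^{\mathrm{ab}}$).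 Let $\mathcal A$ be the free abelian group on symbols $[a]$ ($a\in\mathbb Q$) modulo the identifications $[a]=[b]\Leftrightarrow a-b\in\mathbb Z$. Let $\sin:\mathcal A\to\mathbb Q^{\mathrm{ab}\times}$ be the homomorphism with $\sin[a]=2\sin\pi a$ for $a\in\mathbb Q$, $0<a<1$, and $\sin[0]=1$. For primes $p<q$ with $2<p$ put $$\mathbf a_{pq}:=\sum_{i=1}^{\frac{p-1}{2}}\left(\left[\tfrac{i}{p}\right]-\sum_{k=0}^{\frac{q-1}{2}}\left[\tfrac{i}{pq}+\tfrac{k}{q}\right]\right)-\sum_{j=1}^{\frac{q-1}{2}}\left(\left[\tfrac{j}{q}\right]-\sum_{l=0}^{\frac{p-1}{2}}\left[\tfrac{j}{pq}+\tfrac{l}{p}\right]\right),$$ and for $2=p<q$ put $$\mathbf a_{2q}:=\left(\left[\tfrac14\right]-\sum_{k=0}^{\frac{q-1}{2}}\left[\tfrac{1}{4q}+\tfrac{k}{q}\right]\right)-\sum_{j=1}^{\frac{q-1}{2}}\left(\left[\tfrac{j}{q}\right]+\left[-\tfrac{1}{2q}+\tfrac{j}{q}\right]-\left[\tfrac{j}{2q}\right]-\left[-\tfrac{1}{4q}+\tfrac{j}{2q}\right]\right).$$ The class of $\sin\mathbf a_{pq}$ in $\mathbb Q^{\mathrm{ab}\times}/\mathbb Q^{\mathrm{ab}\times2}$ is $G^{\mathrm{ab}}$-invariant. *)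

theory Defs
  imports
    "HOL-Analysis.Analysis"
    "HOL-Computational_Algebra.Computational_Algebra"
    "HOL-Algebra.Bij"
    "HOL-Algebra.Generated_Groups"
    "HOL-Algebra.Free_Abelian_Groups"
    "HOL-Library.Z2"
    "HOL-Library.Function_Algebras"
begin

section \<open>Groups and topologies\<close>

definition additive_group :: "'a::ab_group_add set \<Rightarrow> 'a monoid" where
  "additive_group S = \<lparr>carrier = S, monoid.mult = (+), one = 0\<rparr>"

definition commutator :: "('a, 'b) monoid_scheme \<Rightarrow> 'a \<Rightarrow> 'a \<Rightarrow> 'a" where
  "commutator \<Gamma> x y = x \<otimes>\<^bsub>\<Gamma>\<^esub> y \<otimes>\<^bsub>\<Gamma>\<^esub> inv\<^bsub>\<Gamma>\<^esub> x \<otimes>\<^bsub>\<Gamma>\<^esub> inv\<^bsub>\<Gamma>\<^esub> y"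

definition quotient_topology :: "'a topology \<Rightarrow> ('a \<Rightarrow> 'b) \<Rightarrow> 'b topology" where
  "quotient_topology T q =
     topology (\<lambda>U. U \<subseteq> q ` topspace T \<and> openin T {x \<in> topspace T. q x \<in> U})"

lemma openin_quotient_topology:
  "openin (quotient_topology T q) U \<longleftrightarrow>
     U \<subseteq> q ` topspace T \<and> openin T {x \<in> topspace T. q x \<in> U}"
proof -
  have "istopology (\<lambda>U. U \<subseteq> q ` topspace T \<and> openin T {x \<in> topspace T. q x \<in> U})"
    unfolding istopology_def
  proof (rule conjI; intro allI impI)
    fix S S'
    assume S: "S \<subseteq> q ` topspace T \<and> openin T {x \<in> topspace T. q x \<in> S}"
      and S': "S' \<subseteq> q ` topspace T \<and> openin T {x \<in> topspace T. q x \<in> S'}"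
    have "{x \<in> topspace T. q x \<in> S \<inter> S'} =
        {x \<in> topspace T. q x \<in> S} \<inter> {x \<in> topspace T. q x \<in> S'}"
      by auto
    with S S' show "S \<inter> S' \<subseteq> q ` topspace T \<and> openin T {x \<in> topspace T. q x \<in> S \<inter> S'}"
      by auto
  next
    fix \<K>
    assume K: "\<forall>S\<in>\<K>. S \<subseteq> q ` topspace T \<and> openin T {x \<in> topspace T. q x \<in> S}"
    have "{x \<in> topspace T. q x \<in> \<Union>\<K>} = (\<Union>S\<in>\<K>. {x \<in> topspace T. q x \<in> S})"
      by auto
    with K show "\<Union>\<K> \<subseteq> q ` topspace T \<and> openin T {x \<in> topspace T. q x \<in> \<Union>\<K>}"
      by auto
  qed
  then show ?thesis
    by (simp add: quotient_topology_def)
qed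

section \<open>Galois groups\<close>

definition is_subfield :: "complex set \<Rightarrow> bool" where
  "is_subfield K \<longleftrightarrow> 0 \<in> K \<and> 1 \<in> K \<and>
     (\<forall>x\<in>K. \<forall>y\<in>K. x + y \<in> K \<and> x * y \<in> K) \<and> (\<forall>x\<in>K. - x \<in> K \<and> inverse x \<in> K)"

text \<open>Field automorphisms of a subfield \<open>K\<close> of the complex numbers fix the rational numbers,
  so this is Gal(K/Q) when K is Galois over Q.\<close>

definition gal :: "complex set \<Rightarrow> (complex \<Rightarrow> complex) monoid" where
  "gal K = (BijGroup K)\<lparr>carrier :=
     {\<sigma> \<in> Bij K. \<forall>x\<in>K. \<forall>y\<in>K. \<sigma> (x + y) = \<sigma> x + \<sigma> y \<and> \<sigma> (x * y) = \<sigma> x * \<sigma> y}\<rparr>"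

text \<open>The topology of pointwise convergence with respect to the discrete topology on \<open>K\<close>:
  the automorphisms agreeing with \<open>\<sigma>\<close> on a given finite subset of \<open>K\<close> form a basic
  neighbourhood of \<open>\<sigma>\<close>.  For algebraic \<open>K\<close> this is the Krull topology.\<close>

definition krull :: "complex set \<Rightarrow> (complex \<Rightarrow> complex) topology" where
  "krull K = subtopology (product_topology (\<lambda>_. discrete_topology K) K) (carrier (gal K))"

definition Qbar :: "complex set" where
  "Qbar = {z. algebraic z}"

text \<open>Since the characteristic is 0, Galois means algebraic and normal.\<close>

definition abelian_extension :: "complex set \<Rightarrow> bool" where
  "abelian_extension K \<longleftrightarrow> is_subfield K \<and> K \<subseteq> Qbar \<and>
     (\<forall>f::rat poly. irreducible f \<and> (\<exists>x\<in>K. poly (map_poly of_rat f) x = 0) \<longrightarrow>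
        (\<forall>y::complex. poly (map_poly of_rat f) y = 0 \<longrightarrow> y \<in> K)) \<and>
     comm_group (gal K)"

text \<open>The abelian extensions of Q have a largest member, which is therefore their union.\<close>

definition Qab :: "complex set" where
  "Qab = \<Union>{K. abelian_extension K}"

abbreviation "G_Q \<equiv> gal Qbar"

abbreviation "Gab \<equiv> gal Qab"

abbreviation "topGab \<equiv> krull Qab"

definition closed_subgroup_generated :: "(complex \<Rightarrow> complex) set \<Rightarrow> (complex \<Rightarrow> complex) set" where
  "closed_subgroup_generated S = krull Qbar closure_of generate G_Q S"

definition comm_G :: "(complex \<Rightarrow> complex) set" where
  "comm_G = closed_subgroup_generated {commutator G_Q \<sigma> \<tau> |\<sigma> \<tau>. \<sigma> \<in> carrier G_Q \<and> \<tau> \<in> carrier G_Q}"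

definition comm_G_eps :: "(complex \<Rightarrow> complex) set" where
  "comm_G_eps = closed_subgroup_generated
     ({commutator G_Q \<sigma> \<tau> [^]\<^bsub>G_Q\<^esub> (2::nat) |\<sigma> \<tau>. \<sigma> \<in> carrier G_Q \<and> \<tau> \<in> carrier G_Q} \<union>
      {commutator G_Q \<sigma> (commutator G_Q \<tau> \<eta>) |\<sigma> \<tau> \<eta>.
         \<sigma> \<in> carrier G_Q \<and> \<tau> \<in> carrier G_Q \<and> \<eta> \<in> carrier G_Q})"

definition Gab_eps :: "(complex \<Rightarrow> complex) set monoid" where
  "Gab_eps = G_Q Mod comm_G_eps"

definition topGab_eps :: "(complex \<Rightarrow> complex) set topology" where
  "topGab_eps = quotient_topology (krull Qbar) (\<lambda>\<sigma>. comm_G_eps #>\<^bsub>G_Q\<^esub> \<sigma>)"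

text \<open>The elements of \<open>G_eps\<close> are literally elements of \<open>Gab_eps\<close>, so the inclusion of
  the kernel in the extension \<open>\<Sigma>\<close> is the identity on representatives.\<close>

definition G_eps :: "(complex \<Rightarrow> complex) set monoid" where
  "G_eps = G_Q\<lparr>carrier := comm_G\<rparr> Mod comm_G_eps"

definition topG_eps :: "(complex \<Rightarrow> complex) set topology" where
  "topG_eps = subtopology topGab_eps (carrier G_eps)"

section \<open>Continuous cohomology with coefficients Z/2Z\<close>

text \<open>Cochains are functions into the field \<open>bit\<close> with two elements.  They are normalised to
  vanish off the group (respectively off pairs of group elements), which makes the pointwise
  addition of functions the addition of cochains.\<close>

definition cochains1 :: "'g monoid \<Rightarrow> 'g topology \<Rightarrow> ('g \<Rightarrow> bit) set" where
  "cochains1 \<Gamma> T = {f. (\<forall>x. x \<notin> carrier \<Gamma> \<longrightarrow> f x = 0) \<and>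
     continuous_map T (discrete_topology UNIV) f}"

definition cochains2 :: "'g monoid \<Rightarrow> 'g topology \<Rightarrow> ('g \<times> 'g \<Rightarrow> bit) set" where
  "cochains2 \<Gamma> T = {f. (\<forall>z. z \<notin> carrier \<Gamma> \<times> carrier \<Gamma> \<longrightarrow> f z = 0) \<and>
     continuous_map (prod_topology T T) (discrete_topology UNIV) f}"

text \<open>The action on the coefficients is trivial, so 1-coboundaries vanish and \<open>H1\<close> consists of
  the 1-cocycles, i.e. the continuous homomorphisms.\<close>

definition H1 :: "'g monoid \<Rightarrow> 'g topology \<Rightarrow> ('g \<Rightarrow> bit) set" where
  "H1 \<Gamma> T = {f \<in> cochains1 \<Gamma> T.
     \<forall>x\<in>carrier \<Gamma>. \<forall>y\<in>carrier \<Gamma>. f (x \<otimes>\<^bsub>\<Gamma>\<^esub> y) = f x + f y}"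

definition cocycles2 :: "'g monoid \<Rightarrow> 'g topology \<Rightarrow> ('g \<times> 'g \<Rightarrow> bit) set" where
  "cocycles2 \<Gamma> T = {f \<in> cochains2 \<Gamma> T.
     \<forall>x\<in>carrier \<Gamma>. \<forall>y\<in>carrier \<Gamma>. \<forall>z\<in>carrier \<Gamma>.
       f (y, z) - f (x \<otimes>\<^bsub>\<Gamma>\<^esub> y, z) + f (x, y \<otimes>\<^bsub>\<Gamma>\<^esub> z) - f (x, y) = 0}"

definition coboundary2 :: "'g monoid \<Rightarrow> ('g \<Rightarrow> bit) \<Rightarrow> 'g \<times> 'g \<Rightarrow> bit" where
  "coboundary2 \<Gamma> f = (\<lambda>(x, y). if x \<in> carrier \<Gamma> \<and> y \<in> carrier \<Gamma>
     then f y - f (x \<otimes>\<^bsub>\<Gamma>\<^esub> y) + f x else 0)"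

definition H2 :: "'g monoid \<Rightarrow> 'g topology \<Rightarrow> ('g \<times> 'g \<Rightarrow> bit) set monoid" where
  "H2 \<Gamma> T = additive_group (cocycles2 \<Gamma> T) Mod (coboundary2 \<Gamma> ` cochains1 \<Gamma> T)"

definition H2_class :: "'g monoid \<Rightarrow> 'g topology \<Rightarrow> ('g \<times> 'g \<Rightarrow> bit) \<Rightarrow> ('g \<times> 'g \<Rightarrow> bit) set" where
  "H2_class \<Gamma> T f = (coboundary2 \<Gamma> ` cochains1 \<Gamma> T) #>\<^bsub>additive_group (cocycles2 \<Gamma> T)\<^esub> f"

text \<open>The middle group of the extension of \<open>\<Gamma>\<close> by Z/2Z given by the 2-cocycle \<open>f\<close>.  Every
  extension with class \<open>[f]\<close> is isomorphic to this one.\<close>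

definition extension_group :: "'g monoid \<Rightarrow> ('g \<times> 'g \<Rightarrow> bit) \<Rightarrow> (bit \<times> 'g) monoid" where
  "extension_group \<Gamma> f =
     \<lparr>carrier = UNIV \<times> carrier \<Gamma>,
      monoid.mult = (\<lambda>(a, x) (b, y). (a + b + f (x, y), x \<otimes>\<^bsub>\<Gamma>\<^esub> y)),
      one = (- f (\<one>\<^bsub>\<Gamma>\<^esub>, \<one>\<^bsub>\<Gamma>\<^esub>), \<one>\<^bsub>\<Gamma>\<^esub>)\<rparr>"

definition abelian_classes :: "'g monoid \<Rightarrow> 'g topology \<Rightarrow> ('g \<times> 'g \<Rightarrow> bit) set set" where
  "abelian_classes \<Gamma> T = {X \<in> carrier (H2 \<Gamma> T). \<exists>f\<in>X. comm_group (extension_group \<Gamma> f)}"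

definition H2_minus :: "'g monoid \<Rightarrow> 'g topology \<Rightarrow> ('g \<times> 'g \<Rightarrow> bit) set set monoid" where
  "H2_minus \<Gamma> T = H2 \<Gamma> T Mod abelian_classes \<Gamma> T"

definition H2_minus_class ::
    "'g monoid \<Rightarrow> 'g topology \<Rightarrow> ('g \<times> 'g \<Rightarrow> bit) \<Rightarrow> ('g \<times> 'g \<Rightarrow> bit) set set" where
  "H2_minus_class \<Gamma> T f = abelian_classes \<Gamma> T #>\<^bsub>H2 \<Gamma> T\<^esub> H2_class \<Gamma> T f"

definition cup :: "('g \<Rightarrow> bit) \<Rightarrow> ('g \<Rightarrow> bit) \<Rightarrow> 'g \<times> 'g \<Rightarrow> bit" where
  "cup x y = (\<lambda>(\<sigma>, \<tau>). x \<sigma> * y \<tau>)"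

section \<open>Exterior square over Z/2Z\<close>

text \<open>\<open>V\<close> is an additive subgroup of an ambient group of exponent 2, i.e. a vector space over
  \<open>bit\<close>.  The exterior square is the quotient of the free \<open>bit\<close>-vector space on \<open>V \<times> V\<close> by the
  relations making the class of \<open>(v, w)\<close> bilinear and alternating.  Over the field with two
  elements additivity implies linearity, and additive subgroups are subspaces.\<close>

definition free_on_pairs :: "'v::ab_group_add set \<Rightarrow> ('v \<times> 'v \<Rightarrow>\<^sub>0 bit) monoid" where
  "free_on_pairs V = additive_group {r. Poly_Mapping.keys r \<subseteq> V \<times> V}"

definition ext_relations :: "'v::ab_group_add set \<Rightarrow> ('v \<times> 'v \<Rightarrow>\<^sub>0 bit) set" where
  "ext_relations V = generate (free_on_pairs V)
     ({Poly_Mapping.single (u + v, w) 1 - Poly_Mapping.single (u, w) 1 -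
         Poly_Mapping.single (v, w) 1 |u v w. u \<in> V \<and> v \<in> V \<and> w \<in> V} \<union>
      {Poly_Mapping.single (u, v + w) 1 - Poly_Mapping.single (u, v) 1 -
         Poly_Mapping.single (u, w) 1 |u v w. u \<in> V \<and> v \<in> V \<and> w \<in> V} \<union>
      {Poly_Mapping.single (v, v) 1 |v. v \<in> V})"

definition ext_square :: "'v::ab_group_add set \<Rightarrow> ('v \<times> 'v \<Rightarrow>\<^sub>0 bit) set monoid" where
  "ext_square V = free_on_pairs V Mod ext_relations V"

definition wedge :: "'v::ab_group_add set \<Rightarrow> 'v \<Rightarrow> 'v \<Rightarrow> ('v \<times> 'v \<Rightarrow>\<^sub>0 bit) set" where
  "wedge V x y = ext_relations V #>\<^bsub>free_on_pairs V\<^esub> Poly_Mapping.single (x, y) 1"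

section \<open>The homomorphism D\<close>

abbreviation "H1ab \<equiv> H1 Gab topGab"

definition Qab_units :: "complex monoid" where
  "Qab_units = \<lparr>carrier = Qab - {0}, monoid.mult = (*), one = 1\<rparr>"

definition Qab_squares :: "complex set" where
  "Qab_squares = {x\<^sup>2 |x. x \<in> Qab - {0}}"

definition mod_squares :: "complex \<Rightarrow> complex set" where
  "mod_squares u = Qab_squares #>\<^bsub>Qab_units\<^esub> u"

definition H0 :: "complex set set" where
  "H0 = {X \<in> carrier (Qab_units Mod Qab_squares). \<forall>\<sigma>\<in>carrier Gab. \<sigma> ` X = X}"

definition bit_sign :: "bit \<Rightarrow> complex" where
  "bit_sign b = (if b = 0 then 1 else - 1)"

text \<open>The condition ranges over all representatives \<open>u = w\<^sup>2\<close> of the class \<open>X\<close>, both of their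
  square roots \<open>w\<close>, and all representatives \<open>\<sigma>\<close> of the element \<open>s\<close> of \<open>G_eps\<close>.\<close>

definition kummer :: "complex set \<Rightarrow> (complex \<Rightarrow> complex) set \<Rightarrow> bit" where
  "kummer X = (THE c. c \<in> H1 G_eps topG_eps \<and>
     (\<forall>w. w\<^sup>2 \<in> X \<longrightarrow> (\<forall>s\<in>carrier G_eps. \<forall>\<sigma>\<in>s. \<sigma> w = bit_sign (c s) * w)))"

text \<open>The projection from \<open>Gab_eps\<close> to \<open>Gab\<close> is induced by restriction to \<open>Qab\<close>.\<close>

definition continuous_section :: "((complex \<Rightarrow> complex) \<Rightarrow> (complex \<Rightarrow> complex) set) \<Rightarrow> bool" where
  "continuous_section \<theta> \<longleftrightarrow> continuous_map topGab topGab_eps \<theta> \<and>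
     (\<forall>\<sigma>\<in>carrier Gab. \<forall>g\<in>\<theta> \<sigma>. restrict g Qab = \<sigma>)"

definition section_cocycle ::
    "((complex \<Rightarrow> complex) \<Rightarrow> (complex \<Rightarrow> complex) set) \<Rightarrow> ((complex \<Rightarrow> complex) set \<Rightarrow> bit) \<Rightarrow>
     (complex \<Rightarrow> complex) \<times> (complex \<Rightarrow> complex) \<Rightarrow> bit" where
  "section_cocycle \<theta> c = (\<lambda>(\<sigma>, \<tau>). if \<sigma> \<in> carrier Gab \<and> \<tau> \<in> carrier Gab
     then c (\<theta> \<sigma> \<otimes>\<^bsub>Gab_eps\<^esub> \<theta> \<tau> \<otimes>\<^bsub>Gab_eps\<^esub> inv\<^bsub>Gab_eps\<^esub> (\<theta> (\<sigma> \<otimes>\<^bsub>Gab\<^esub> \<tau>))) else 0)"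

text \<open>The class does not depend on the continuous section.\<close>

definition push_extension ::
    "((complex \<Rightarrow> complex) set \<Rightarrow> bit) \<Rightarrow> ((complex \<Rightarrow> complex) \<times> (complex \<Rightarrow> complex) \<Rightarrow> bit) set set"
  where
  "push_extension c =
     H2_minus_class Gab topGab (section_cocycle (SOME \<theta>. continuous_section \<theta>) c)"

definition cup_iso ::
    "(((complex \<Rightarrow> complex) \<Rightarrow> bit) \<times> ((complex \<Rightarrow> complex) \<Rightarrow> bit) \<Rightarrow>\<^sub>0 bit) set \<Rightarrow>
     ((complex \<Rightarrow> complex) \<times> (complex \<Rightarrow> complex) \<Rightarrow> bit) set set" where
  "cup_iso = (THE h. h \<in> hom (ext_square H1ab) (H2_minus Gab topGab) \<and>
     h \<in> extensional (carrier (ext_square H1ab)) \<and>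
     (\<forall>x\<in>H1ab. \<forall>y\<in>H1ab. h (wedge H1ab x y) = H2_minus_class Gab topGab (cup x y)))"

definition D_map ::
    "complex set \<Rightarrow>
     (((complex \<Rightarrow> complex) \<Rightarrow> bit) \<times> ((complex \<Rightarrow> complex) \<Rightarrow> bit) \<Rightarrow>\<^sub>0 bit) set" where
  "D_map = (\<lambda>X\<in>H0. inv_into (carrier (ext_square H1ab)) cup_iso (push_extension (kummer X)))"

definition e_char :: "nat \<Rightarrow> (complex \<Rightarrow> complex) \<Rightarrow> bit" where
  "e_char p = (THE c. c \<in> H1ab \<and>
     (\<forall>\<sigma>\<in>carrier Gab. \<sigma> (of_real (sqrt p)) = bit_sign (c \<sigma>) * of_real (sqrt p)))"

section \<open>The group A and the elements \<open>a_pq\<close>\<close>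

definition A_relations :: "(rat \<Rightarrow>\<^sub>0 int) set" where
  "A_relations = generate (free_Abelian_group UNIV) {frag_of a - frag_of b |a b. a - b \<in> \<int>}"

definition A_group :: "(rat \<Rightarrow>\<^sub>0 int) set monoid" where
  "A_group = free_Abelian_group UNIV Mod A_relations"

definition A_class :: "(rat \<Rightarrow>\<^sub>0 int) \<Rightarrow> (rat \<Rightarrow>\<^sub>0 int) set" where
  "A_class x = A_relations #>\<^bsub>free_Abelian_group UNIV\<^esub> x"

definition sin_A :: "(rat \<Rightarrow>\<^sub>0 int) set \<Rightarrow> complex" where
  "sin_A = (THE h. h \<in> hom A_group Qab_units \<and> h \<in> extensional (carrier A_group) \<and>
     (\<forall>a. 0 < a \<and> a < 1 \<longrightarrow> h (A_class (frag_of a)) = of_real (2 * sin (pi * of_rat a))) \<and>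
     h (A_class (frag_of 0)) = 1)"

definition a_odd :: "nat \<Rightarrow> nat \<Rightarrow> rat \<Rightarrow>\<^sub>0 int" where
  "a_odd p q =
     (\<Sum>i = 1..(p - 1) div 2. frag_of (of_nat i / of_nat p)
        - (\<Sum>k = 0..(q - 1) div 2. frag_of (of_nat i / of_nat (p * q) + of_nat k / of_nat q)))
   - (\<Sum>j = 1..(q - 1) div 2. frag_of (of_nat j / of_nat q)
        - (\<Sum>l = 0..(p - 1) div 2. frag_of (of_nat j / of_nat (p * q) + of_nat l / of_nat p)))"

definition a_two :: "nat \<Rightarrow> rat \<Rightarrow>\<^sub>0 int" where
  "a_two q =
     (frag_of (1 / 4)
        - (\<Sum>k = 0..(q - 1) div 2. frag_of (1 / of_nat (4 * q) + of_nat k / of_nat q)))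
   - (\<Sum>j = 1..(q - 1) div 2.
        frag_of (of_nat j / of_nat q) + frag_of (- 1 / of_nat (2 * q) + of_nat j / of_nat q)
        - frag_of (of_nat j / of_nat (2 * q))
        - frag_of (- 1 / of_nat (4 * q) + of_nat j / of_nat (2 * q)))"

definition a_elem :: "nat \<Rightarrow> nat \<Rightarrow> (rat \<Rightarrow>\<^sub>0 int) set" where
  "a_elem p q = A_class (if p = 2 then a_two q else a_odd p q)"

end

theory Submission
  imports "HOL-Number_Theory.Residue_Primitive_Roots" Defs "Jordan_Normal_Form.Char_Poly"
begin

text \<open>If \<open>w\<^sup>2 = u\<close>, where the class of \<open>u\<close> modulo squares is invariant, then every \<open>g\<close> in \<open>G_Q\<close>
  multiplies \<open>w\<close> by an element of \<open>Qab\<close>, and \<open>g (h w) = \<plusminus> h (g w)\<close> with a sign that is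
  bimultiplicative in \<open>g\<close> and \<open>h\<close>.  This sign is the commutator pairing of the extension attached to
  \<open>u\<close>.  As a class in the second cohomology modulo abelian extensions is determined by its commutator
  pairing, \<open>D(u) = e\<^sub>p \<wedge> e\<^sub>q\<close> means that the sign is \<open>e\<^sub>p(g) e\<^sub>q(h) + e\<^sub>p(h) e\<^sub>q(g)\<close>, and it
  suffices to verify this on generators of \<open>G_Q\<close> over the stabiliser of finitely many roots of unity.

  Modulo squares, distribution relations and the Chinese remainder theorem turn \<open>sin a\<^sub>p\<^sub>q\<close> into a
  product \<open>V\<close> over half systems: the product of \<open>x\<^sup>a y\<^sup>b - x\<^sup>-\<^sup>a y\<^sup>-\<^sup>b\<close> over \<open>1 \<le> a < p/2\<close> and
  \<open>1 \<le> b < q/2\<close>, where \<open>x\<close> and \<open>y\<close> are primitive roots of unity of orders \<open>p\<close> and \<open>q\<close>, times factors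
  involving only \<open>x\<close> or only \<open>y\<close>.  As in Gauss' lemma, the automorphism \<open>x \<mapsto> x\<^sup>g\<close> permutes a half
  system up to signs, and the factors with a changed sign make up an explicit square root of
  \<open>\<sigma>(V)/V\<close>.  For \<open>p = 2\<close> an eighth root of unity takes the place of \<open>x\<close>.\<close>

text \<open>The double product alone does not suffice. When the generator \<open>x -> x^g\<close>
  acts on it, the factors with changed sign leave, by a reflection formula, a square times a sign
  times a quotient \<open>U q / U 1\<close> of products in \<open>x\<close> alone, where
  \<open>U n\<close> collects the factors \<open>x^(n g a) - x^(-n g a)\<close> over the sign
  changes \<open>a\<close>. This quotient is not visibly a square, so \<open>V\<close> carries a
  further factor in \<open>x\<close> that produces the same quotient once more: the product of the
  conjugates \<open>U (g^j)\<close> over \<open>j < k\<close>, where \<open>g\<close> is a primitive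
  root and \<open>g^k = q\<close> modulo \<open>p\<close>. The generator shifts \<open>j\<close> and
  the product telescopes. A cocycle relation for Gauss' lemma modulo squares shows that just this
  factor comes out of the sines. The remaining sign has a power of \<open>\<i>\<close> as square
  root; an automorphism that negates \<open>\<i>\<close> and fixes \<open>x\<close> and
  \<open>y\<close> detects it, matching the powers of \<open>\<i>\<close> in the expressions of the
  square roots of \<open>p\<close> and \<open>q\<close> by products over half systems. For
  \<open>p = 2\<close> the telescoping uses \<open>h^k = 2\<close> modulo \<open>q\<close>, and a
  power of a square root of -2 restores invariance under negation of the eighth root of
  unity.\<close>

abbreviation gq_mult (infixl "\<cdot>" 70) where "g \<cdot> h \<equiv> g \<otimes>\<^bsub>G_Q\<^esub> h"

abbreviation "ginv g \<equiv> inv\<^bsub>G_Q\<^esub> g"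


section \<open>Algebraic numbers\<close>

text \<open>\<open>h\<close> will be the inclusion of the integers or of the rationals. The
  characteristic polynomial of \<open>M\<close> is monic over the base ring, so an eigenvalue is an
  algebraic integer in the first case and an algebraic number in the second.\<close>

lemma monic_root_of_eigenvector:
 fixes h :: "'a::comm_ring_1 \<Rightarrow> complex" and v :: "nat \<Rightarrow> complex"
 assumes h: "inj_comm_ring_hom h" and nz: "\<exists>i<n. v i \<noteq> 0"
  and ev: "\<And>i. i < n ==> z * v i = (\<Sum>j<n. h (M i j) * v j)"
 shows "\<exists>p. lead_coeff p = 1 \<and> poly (map_poly h p) z = 0"
proof -
 interpret h: inj_comm_ring_hom h by (fact h)
 define A where "A = mat n n (\<lambda>(i, j). M i j)"
 have A: "A \<in> carrier_mat n n" by (simp add: A_def)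
 have hA: "map_mat h A \<in> carrier_mat n n" using A by simp
 have "eigenvector (map_mat h A) (vec n v) z"
  unfolding eigenvector_def
 proof (intro conjI)
  show "vec n v \<noteq> 0\<^sub>v (dim_row (map_mat h A))"
   using nz A by (auto simp: vec_eq_iff)
  show "map_mat h A *\<^sub>v vec n v = z \<cdot>\<^sub>v vec n v"
   using A by (auto simp: A_def vec_eq_iff scalar_prod_def ev lessThan_atLeast0 intro!: sum.cong)
 qed (use A in auto)
 then have "poly (char_poly (map_mat h A)) z = 0"
  using eigenvalue_root_char_poly[OF hA] by (auto simp: eigenvalue_def)
 moreover have "lead_coeff (char_poly A) = 1"
  using degree_monic_char_poly[OF A] by simp
 ultimately show ?thesis
  using h.char_poly_hom[OF A] by metis
qed

text \<open>The monomials \<open>x ^ i * y ^ j\<close> with exponents below the two degrees span a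
  module stable under multiplication by \<open>x\<close> and \<open>y\<close>, hence by
  \<open>x + y\<close> and \<open>x * y\<close>. The matrix of such a multiplication has the vector
  of monomials as eigenvector.\<close>

lemma monic_root_plus_times:
 fixes h :: "'a::comm_ring_1 \<Rightarrow> complex" and p q :: "'a poly"
 assumes h: "inj_comm_ring_hom h"
  and p: "lead_coeff p = 1" "poly (map_poly h p) x = 0"
  and q: "lead_coeff q = 1" "poly (map_poly h q) y = 0"
 shows "\<exists>r. lead_coeff r = 1 \<and> poly (map_poly h r) (x + y) = 0"
  and "\<exists>r. lead_coeff r = 1 \<and> poly (map_poly h r) (x * y) = 0"
proof -
 interpret h: inj_comm_ring_hom h by (fact h)
 interpret hm: Modules.module "\<lambda>c z. h c * z"
  by unfold_locales (auto simp: algebra_simps h.hom_add h.hom_mult)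
 define m n where "m = degree p" and "n = degree q"
 have pow: "w ^ degree f = - (\<Sum>i<degree f. h (coeff f i) * w ^ i)"
  if "lead_coeff f = 1" "poly (map_poly h f) w = 0" for f w
 proof -
  have "0 = (\<Sum>i\<le>degree f. h (coeff f i) * w ^ i)"
   using that(2) by (simp add: poly_altdef)
  also have "{..degree f} = insert (degree f) {..<degree f}" by auto
  finally show ?thesis using that(1) by (simp add: eq_neg_iff_add_eq_0)
 qed
 have m0: "m > 0" and n0: "n > 0"
  using p q by (auto intro!: Nat.gr0I elim!: degree_eq_zeroE simp: m_def n_def)
 define B where "B = (\<lambda>(i, j). x ^ i * y ^ j) ` ({..<m} \<times> {..<n})"
 have B: "x ^ i * y ^ j \<in> B" if "i < m" "j < n" for i j
  using that by (auto simp: B_def)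
 \<comment> \<open>The monomial 1 is the nonzero coordinate that an eigenvector requires.\<close>
 have "1 \<in> B" using B[of 0 0] m0 n0 by simp
 have xB: "x * b \<in> hm.span B" if b: "b \<in> B" for b
 proof -
  obtain i j where ij: "i < m" "j < n" "b = x ^ i * y ^ j"
   using b by (auto simp: B_def)
  show ?thesis
  proof (cases "Suc i < m")
   case True
   then show ?thesis using hm.span_base[OF B[OF True ij(2)]] ij by (simp add: mult_ac)
  next
   case False
   then have "Suc i = m" using ij by simp
   then have "x * b = x ^ m * y ^ j" using ij by (simp add: mult_ac flip: power_Suc)
   also have "\<dots> = - (\<Sum>i<m. h (coeff p i) * (x ^ i * y ^ j))"
    using pow[OF p] by (simp add: m_def sum_distrib_left mult_ac)
   also have "\<dots> \<in> hm.span B"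
    by (intro hm.span_neg hm.span_sum hm.span_scale hm.span_base B) (use ij in auto)
   finally show ?thesis .
  qed
 qed
 have yB: "y * b \<in> hm.span B" if b: "b \<in> B" for b
 proof -
  obtain i j where ij: "i < m" "j < n" "b = x ^ i * y ^ j"
   using b by (auto simp: B_def)
  show ?thesis
  proof (cases "Suc j < n")
   case True
   then show ?thesis using hm.span_base[OF B[OF ij(1) True]] ij by (simp add: mult_ac)
  next
   case False
   then have "Suc j = n" using ij by simp
   then have "y * b = x ^ i * y ^ n" using ij by (simp add: mult_ac flip: power_Suc)
   also have "\<dots> = - (\<Sum>j<n. h (coeff q j) * (x ^ i * y ^ j))"
    using pow[OF q] by (simp add: n_def sum_distrib_left mult_ac)
   also have "\<dots> \<in> hm.span B"
    by (intro hm.span_neg hm.span_sum hm.span_scale hm.span_base B) (use ij in auto)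
   finally show ?thesis .
  qed
 qed
 have span_mult: "w * s \<in> hm.span B" if "s \<in> hm.span B" "\<And>b. b \<in> B ==> w * b \<in> hm.span B" for w s
  using that(1)
 proof (induction rule: hm.span_induct_alt)
  case base
  then show ?case by (simp add: hm.span_zero)
 next
  case (step c b s)
  have "w * (h c * b + s) = h c * (w * b) + w * s" by (simp add: algebra_simps)
  then show ?case using step that(2) by (simp add: hm.span_add hm.span_scale)
 qed
 have key: "\<exists>r. lead_coeff r = 1 \<and> poly (map_poly h r) z = 0"
  if z: "\<And>b. b \<in> B ==> z * b \<in> hm.span B" for z
 proof -
  have fin: "finite B" by (simp add: B_def)
  obtain f where f: "bij_betw f {..<card B} B"
   using ex_bij_betw_nat_finite[OF fin] by (auto simp: lessThan_atLeast0)
  have "\<exists>u. z * b = (\<Sum>c\<in>B. h (u c) * c)" if "b \<in> B" for b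
   using z[OF that] by (auto simp: hm.span_finite[OF fin])
  then obtain u where u: "\<And>b. b \<in> B ==> z * b = (\<Sum>c\<in>B. h (u b c) * c)" by metis
  show ?thesis
  proof (rule monic_root_of_eigenvector[OF h, of "card B" f z "\<lambda>i j. u (f i) (f j)"])
   show "\<exists>i<card B. f i \<noteq> 0"
    using f \<open>1 \<in> B\<close> by (metis bij_betw_iff_bijections lessThan_iff zero_neq_one)
   show "z * f i = (\<Sum>j<card B. h (u (f i) (f j)) * f j)" if "i < card B" for i
   proof -
    have "f i \<in> B" using f that by (auto simp: bij_betw_def)
    then show ?thesis using u sum.reindex_bij_betw[OF f, of "\<lambda>c. h (u (f i) c) * c"] by simp
   qed
  qed
 qed
 show "\<exists>r. lead_coeff r = 1 \<and> poly (map_poly h r) (x + y) = 0"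
  by (rule key) (simp add: distrib_right hm.span_add xB yB)
 show "\<exists>r. lead_coeff r = 1 \<and> poly (map_poly h r) (x * y) = 0"
  by (rule key) (simp add: mult.assoc span_mult xB yB)
qed

lemma inj_comm_ring_hom_of_int: "inj_comm_ring_hom (of_int :: int \<Rightarrow> complex)"
 by unfold_locales auto

lemma inj_comm_ring_hom_of_rat: "inj_comm_ring_hom (of_rat :: rat \<Rightarrow> complex)"
 by unfold_locales (auto simp: of_rat_add of_rat_mult)

lemma algebraic_int_monic:
 "algebraic_int (x::complex) \<longleftrightarrow> (\<exists>p. lead_coeff p = (1::int) \<and> poly (map_poly of_int p) x = 0)"
 by (auto simp: algebraic_int_altdef_ipoly)

lemma algebraic_int_add: "algebraic_int x ==> algebraic_int y ==> algebraic_int (x + y)"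
 and algebraic_int_mult: "algebraic_int x ==> algebraic_int y ==> algebraic_int (x * y)"
 for x y :: complex
 using monic_root_plus_times[OF inj_comm_ring_hom_of_int] by (metis algebraic_int_monic)+

lemma algebraic_rat_poly:
 "algebraic (x::complex) \<longleftrightarrow> (\<exists>p::rat poly. p \<noteq> 0 \<and> poly (map_poly of_rat p) x = 0)"
proof
 assume "algebraic x"
 then obtain p where p: "p \<noteq> 0" "poly (map_poly of_int p) x = 0" by (erule algebraicE')
 have "map_poly of_rat (map_poly rat_of_int p) = (map_poly of_int p :: complex poly)"
  by (intro poly_eqI) (simp add: coeff_map_poly)
 moreover have "map_poly rat_of_int p \<noteq> 0" using p(1) by (simp add: map_poly_eq_0_iff)
 ultimately show "\<exists>p::rat poly. p \<noteq> 0 \<and> poly (map_poly of_rat p) x = 0" using p by metis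
next
 assume "\<exists>p::rat poly. p \<noteq> 0 \<and> poly (map_poly of_rat p) x = 0"
 then obtain p :: "rat poly" where "p \<noteq> 0" "poly (map_poly of_rat p) x = 0" by blast
 then show "algebraic x"
  by (intro algebraicI'[of "map_poly of_rat p"]) (auto simp: coeff_map_poly map_poly_eq_0_iff)
qed

lemma algebraic_monic:
 "algebraic (x::complex) \<longleftrightarrow> (\<exists>p. lead_coeff p = (1::rat) \<and> poly (map_poly of_rat p) x = 0)"
proof
 assume "algebraic x"
 then obtain p :: "rat poly" where p: "p \<noteq> 0" "poly (map_poly of_rat p) x = 0"
  by (auto simp: algebraic_rat_poly)
 let ?q = "Polynomial.smult (inverse (lead_coeff p)) p"
 have "map_poly of_rat ?q = Polynomial.smult (of_rat (inverse (lead_coeff p))) (map_poly of_rat p :: complex poly)"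
  by (intro poly_eqI) (simp add: coeff_map_poly of_rat_mult)
 with p show "\<exists>p. lead_coeff p = (1::rat) \<and> poly (map_poly of_rat p) x = 0"
  by (intro exI[of _ ?q]) simp
next
 assume "\<exists>p. lead_coeff p = (1::rat) \<and> poly (map_poly of_rat p) x = 0"
 then obtain p :: "rat poly" where "lead_coeff p = 1" "poly (map_poly of_rat p) x = 0" by blast
 then show "algebraic x"
  unfolding algebraic_rat_poly by (intro exI[of _ p]) auto
qed

lemma algebraic_add: "algebraic x ==> algebraic y ==> algebraic (x + y)"
 and algebraic_mult: "algebraic x ==> algebraic y ==> algebraic (x * y)"
 for x y :: complex
 using monic_root_plus_times[OF inj_comm_ring_hom_of_rat] by (metis algebraic_monic)+

lemma is_subfield_Qbar: "is_subfield Qbar"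
 by (auto simp: is_subfield_def Qbar_def algebraic_add algebraic_mult)

section \<open>Automorphisms of subfields of the complex numbers\<close>

lemma carrier_gal:
 "\<sigma> \<in> carrier (gal K) \<longleftrightarrow> \<sigma> \<in> extensional K \<and> bij_betw \<sigma> K K \<and>
  (\<forall>x\<in>K. \<forall>y\<in>K. \<sigma> (x + y) = \<sigma> x + \<sigma> y \<and> \<sigma> (x * y) = \<sigma> x * \<sigma> y)"
 by (auto simp: gal_def Bij_def)

lemma gal_mult: "\<sigma> \<in> carrier (gal K) ==> \<tau> \<in> carrier (gal K) ==> \<sigma> \<otimes>\<^bsub>gal K\<^esub> \<tau> = compose K \<sigma> \<tau>"
 by (simp add: gal_def BijGroup_def)

lemma gal_one: "\<one>\<^bsub>gal K\<^esub> = (\<lambda>x\<in>K. x)"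
 by (simp add: gal_def BijGroup_def)

lemma gal_mult_apply [simp]:
 "\<sigma> \<in> carrier (gal K) ==> \<tau> \<in> carrier (gal K) ==> x \<in> K ==> (\<sigma> \<otimes>\<^bsub>gal K\<^esub> \<tau>) x = \<sigma> (\<tau> x)"
 by (simp add: gal_mult compose_def)

lemma gal_one_apply [simp]: "x \<in> K ==> \<one>\<^bsub>gal K\<^esub> x = x"
 by (simp add: gal_one)

lemma gal_closed [simp]: "\<sigma> \<in> carrier (gal K) ==> x \<in> K ==> \<sigma> x \<in> K"
 by (auto simp: carrier_gal bij_betw_def)

lemma gal_add: "\<sigma> \<in> carrier (gal K) ==> x \<in> K ==> y \<in> K ==> \<sigma> (x + y) = \<sigma> x + \<sigma> y"
 and gal_times: "\<sigma> \<in> carrier (gal K) ==> x \<in> K ==> y \<in> K ==> \<sigma> (x * y) = \<sigma> x * \<sigma> y"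
 by (auto simp: carrier_gal)

lemma gal_inj: "\<sigma> \<in> carrier (gal K) ==> x \<in> K ==> y \<in> K ==> \<sigma> x = \<sigma> y \<longleftrightarrow> x = y"
 unfolding carrier_gal bij_betw_def by (meson inj_on_eq_iff)

lemma gal_eqI:
 "\<sigma> \<in> carrier (gal K) ==> \<tau> \<in> carrier (gal K) ==> (\<And>x. x \<in> K ==> \<sigma> x = \<tau> x) ==> \<sigma> = \<tau>"
 by (auto simp: carrier_gal intro: extensionalityI)

lemma subfieldD:
 assumes "is_subfield K"
 shows "0 \<in> K" "1 \<in> K" "x \<in> K ==> y \<in> K ==> x + y \<in> K" "x \<in> K ==> y \<in> K ==> x * y \<in> K"
  "x \<in> K ==> - x \<in> K" "x \<in> K ==> inverse x \<in> K"
 using assms by (auto simp: is_subfield_def)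

lemma subfield_diff: "is_subfield K ==> x \<in> K ==> y \<in> K ==> x - y \<in> K"
 using subfieldD(3)[of K x "- y"] subfieldD(5)[of K y] by simp

lemma subfield_divide: "is_subfield K ==> x \<in> K ==> y \<in> K ==> x / y \<in> K"
 by (simp add: divide_inverse subfieldD)

lemma subfield_power: "is_subfield K ==> x \<in> K ==> x ^ n \<in> K"
 by (induction n) (auto simp: subfieldD)

lemma subfield_power_int: "is_subfield K ==> x \<in> K ==> x powi n \<in> K"
 by (auto simp: power_int_def subfield_power subfieldD)

lemma subfield_sum: "is_subfield K ==> (\<And>i. i \<in> A ==> f i \<in> K) ==> sum f A \<in> K"
 by (induction A rule: infinite_finite_induct) (auto simp: subfieldD)

lemma subfield_prod: "is_subfield K ==> (\<And>i. i \<in> A ==> f i \<in> K) ==> prod f A \<in> K"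
 by (induction A rule: infinite_finite_induct) (auto simp: subfieldD)

lemma subfield_of_nat: "is_subfield K ==> of_nat n \<in> K"
 by (induction n) (auto simp: subfieldD)

lemma subfield_of_int: "is_subfield K ==> of_int n \<in> K"
 by (cases n rule: int_cases2) (auto simp: subfieldD subfield_of_nat)

lemma subfield_of_rat: "is_subfield K ==> of_rat r \<in> K"
 by (cases r) (simp add: of_rat_rat subfield_divide subfield_of_int)

lemma subfield_poly: "is_subfield K ==> (\<And>i. coeff f i \<in> K) ==> x \<in> K ==> poly f x \<in> K"
 by (simp add: poly_altdef subfield_sum subfieldD subfield_power)

context
 fixes K :: "complex set" and \<sigma> :: "complex \<Rightarrow> complex"
 assumes K: "is_subfield K" and \<sigma>: "\<sigma> \<in> carrier (gal K)"
begin

lemma gal_0 [simp]: "\<sigma> 0 = 0"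
 using gal_add[OF \<sigma>, of 0 0] K by (simp add: subfieldD)

lemma gal_1 [simp]: "\<sigma> 1 = 1"
proof -
 have "\<sigma> 1 * \<sigma> 1 = \<sigma> 1" using gal_times[OF \<sigma>, of 1 1] K by (simp add: subfieldD)
 moreover have "\<sigma> 1 \<noteq> 0" using gal_inj[OF \<sigma>, of 1 0] K by (simp add: subfieldD)
 ultimately show ?thesis by simp
qed

lemma gal_eq_0_iff: "x \<in> K ==> \<sigma> x = 0 \<longleftrightarrow> x = 0"
 using gal_inj[OF \<sigma>, of x 0] K by (simp add: subfieldD)

lemma gal_minus: "x \<in> K ==> \<sigma> (- x) = - \<sigma> x"
 using gal_add[OF \<sigma>, of x "- x"] K by (simp add: subfieldD eq_neg_iff_add_eq_0 add.commute)

lemma gal_diff: "x \<in> K ==> y \<in> K ==> \<sigma> (x - y) = \<sigma> x - \<sigma> y"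
 using gal_add[OF \<sigma>, of x "- y"] K by (simp add: subfieldD gal_minus)

lemma gal_inverse: "x \<in> K ==> \<sigma> (inverse x) = inverse (\<sigma> x)"
proof (cases "x = 0")
 case False
 assume x: "x \<in> K"
 have "\<sigma> x * \<sigma> (inverse x) = 1"
  using gal_times[OF \<sigma> x subfieldD(6)[OF K x]] False by simp
 then show ?thesis by (metis inverse_unique)
qed simp

lemma gal_divide: "x \<in> K ==> y \<in> K ==> \<sigma> (x / y) = \<sigma> x / \<sigma> y"
 using K by (simp add: divide_inverse gal_times[OF \<sigma>] gal_inverse subfieldD)

lemma gal_power: "x \<in> K ==> \<sigma> (x ^ n) = \<sigma> x ^ n"
 using K by (induction n) (auto simp: gal_times[OF \<sigma>] subfield_power)

lemma gal_power_int: "x \<in> K ==> \<sigma> (x powi n) = \<sigma> x powi n"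
 using K by (auto simp: power_int_def gal_power gal_inverse subfieldD)

lemma gal_sum: "(\<And>i. i \<in> A ==> f i \<in> K) ==> \<sigma> (sum f A) = (\<Sum>i\<in>A. \<sigma> (f i))"
 using K by (induction A rule: infinite_finite_induct) (auto simp: gal_add[OF \<sigma>] subfield_sum)

lemma gal_prod: "(\<And>i. i \<in> A ==> f i \<in> K) ==> \<sigma> (prod f A) = (\<Prod>i\<in>A. \<sigma> (f i))"
 using K by (induction A rule: infinite_finite_induct) (auto simp: gal_times[OF \<sigma>] subfield_prod)

lemma gal_of_nat [simp]: "\<sigma> (of_nat n) = of_nat n"
 using K by (induction n) (auto simp: gal_add[OF \<sigma>] subfieldD subfield_of_nat)

lemma gal_of_int [simp]: "\<sigma> (of_int n) = of_int n"
 using K by (cases n rule: int_cases2) (auto simp: gal_minus subfield_of_nat)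

lemma gal_of_rat [simp]: "\<sigma> (of_rat r) = of_rat r"
 using K by (cases r) (simp add: of_rat_rat gal_divide subfield_of_int)

lemma gal_poly:
 "(\<And>i. coeff f i \<in> K) ==> x \<in> K ==> \<sigma> (poly f x) = (\<Sum>i\<le>degree f. \<sigma> (coeff f i) * \<sigma> x ^ i)"
 using K by (simp add: poly_altdef gal_sum subfieldD subfield_power gal_times[OF \<sigma>] gal_power)

lemma gal_poly_of_rat:
 "x \<in> K ==> \<sigma> (poly (map_poly of_rat f) x) = poly (map_poly of_rat f) (\<sigma> x)"
 using K by (subst gal_poly) (auto simp: coeff_map_poly subfield_of_rat poly_altdef)

end

lemma group_gal:
 assumes K: "is_subfield K"
 shows "group (gal K)"
proof -
 interpret B: group "BijGroup K" by (rule group_BijGroup)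
 have "subgroup (carrier (gal K)) (BijGroup K)"
 proof (rule B.subgroupI)
  show "carrier (gal K) \<subseteq> carrier (BijGroup K)" by (auto simp: gal_def BijGroup_def)
  show "carrier (gal K) \<noteq> {}"
  proof -
   have "(\<lambda>x\<in>K. x) \<in> carrier (gal K)" using id_Bij[of K] K by (auto simp: gal_def subfieldD)
   then show ?thesis by blast
  qed
 next
  fix \<sigma> assume \<sigma>: "\<sigma> \<in> carrier (gal K)"
  then have B: "\<sigma> \<in> Bij K" by (auto simp: gal_def)
  have "inv\<^bsub>BijGroup K\<^esub> \<sigma> = restrict (inv_into K \<sigma>) K" by (rule inv_BijGroup[OF B])
  moreover have "inv_into K \<sigma> (x + y) = inv_into K \<sigma> x + inv_into K \<sigma> y" if "x \<in> K" "y \<in> K" for x y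
   by (rule Bij_inv_into_lemma[of K \<sigma> "(+)"]) (use \<sigma> B K that in \<open>auto simp: gal_add subfieldD\<close>)
  moreover have "inv_into K \<sigma> (x * y) = inv_into K \<sigma> x * inv_into K \<sigma> y" if "x \<in> K" "y \<in> K" for x y
   by (rule Bij_inv_into_lemma[of K \<sigma> "(*)"]) (use \<sigma> B K that in \<open>auto simp: gal_times subfieldD\<close>)
  ultimately show "inv\<^bsub>BijGroup K\<^esub> \<sigma> \<in> carrier (gal K)"
   using restrict_inv_into_Bij[OF B] K by (auto simp: gal_def subfieldD)
 next
  fix \<sigma> \<tau> assume *: "\<sigma> \<in> carrier (gal K)" "\<tau> \<in> carrier (gal K)"
  then have "\<sigma> \<otimes>\<^bsub>BijGroup K\<^esub> \<tau> = compose K \<sigma> \<tau>" by (simp add: gal_def BijGroup_def)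
  moreover have "compose K \<sigma> \<tau> \<in> Bij K" using * by (intro compose_Bij) (auto simp: gal_def)
  moreover have "\<forall>x\<in>K. \<forall>y\<in>K. compose K \<sigma> \<tau> (x + y) = compose K \<sigma> \<tau> x + compose K \<sigma> \<tau> y \<and>
    compose K \<sigma> \<tau> (x * y) = compose K \<sigma> \<tau> x * compose K \<sigma> \<tau> y"
   using * K by (simp add: compose_def subfieldD gal_add gal_times)
  ultimately show "\<sigma> \<otimes>\<^bsub>BijGroup K\<^esub> \<tau> \<in> carrier (gal K)"
   by (simp add: carrier_gal[of "compose K \<sigma> \<tau>"] Bij_def)
 qed
 moreover have "gal K = (BijGroup K)\<lparr>carrier := carrier (gal K)\<rparr>" by (simp add: gal_def)
 ultimately show ?thesis using subgroup.subgroup_is_group[OF _ B.group_axioms] by metis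
qed

interpretation GQ: group G_Q by (rule group_gal[OF is_subfield_Qbar])

lemmas Qbar = is_subfield_Qbar

lemma gal_inv_apply:
 assumes "is_subfield K" "\<sigma> \<in> carrier (gal K)" "x \<in> K"
 shows "(inv\<^bsub>gal K\<^esub> \<sigma>) (\<sigma> x) = x" "\<sigma> ((inv\<^bsub>gal K\<^esub> \<sigma>) x) = x"
proof -
 interpret group "gal K" using group_gal assms by blast
 note app = gal_mult_apply[symmetric, OF _ _ assms(3)]
 show "(inv\<^bsub>gal K\<^esub> \<sigma>) (\<sigma> x) = x" "\<sigma> ((inv\<^bsub>gal K\<^esub> \<sigma>) x) = x"
  using assms app[OF inv_closed[OF assms(2)] assms(2)] app[OF assms(2) inv_closed[OF assms(2)]]
  by (simp_all only: l_inv r_inv gal_one_apply)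
qed

lemma GQ_inv_apply [simp]:
 assumes "\<sigma> \<in> carrier G_Q" "x \<in> Qbar"
 shows "(ginv \<sigma>) (\<sigma> x) = x" "\<sigma> ((ginv \<sigma>) x) = x"
 using gal_inv_apply[OF Qbar assms] by auto

lemma int_root_Qbar:
 assumes "p \<noteq> 0" "poly (map_poly of_int p) x = 0"
 shows "x \<in> Qbar"
 using assms algebraicI[of "map_poly of_int p" x] by (auto simp: Qbar_def coeff_map_poly map_poly_eq_0_iff)

lemma Qbar_int_root:
 assumes "x \<in> Qbar"
 obtains p where "p \<noteq> 0" "poly (map_poly of_int p) x = 0"
 using assms algebraicE'[of x] unfolding Qbar_def by blast

text \<open>Bijectivity is automatic: a homomorphism of fields is injective and maps the finite root
  set of each integer polynomial into itself, so it permutes that set, and these sets cover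
  \<open>Qbar\<close>.\<close>

lemma gal_QbarI:
 assumes 1: "f 1 = 1" and add: "\<And>x y. x \<in> Qbar ==> y \<in> Qbar ==> f (x + y) = f x + f y"
  and mult: "\<And>x y. x \<in> Qbar ==> y \<in> Qbar ==> f (x * y) = f x * f y"
 shows "restrict f Qbar \<in> carrier G_Q"
proof -
 note K = Qbar subfieldD[OF Qbar]
 have f0: "f 0 = 0" using add[of 0 0] K by simp
 have fm: "f (- x) = - f x" if "x \<in> Qbar" for x
  using add[of x "- x"] K that f0 by (simp add: eq_neg_iff_add_eq_0 add.commute)
 have inj: "inj_on f Qbar"
 proof (rule inj_onI)
  fix x y assume xy: "x \<in> Qbar" "y \<in> Qbar" "f x = f y"
  show "x = y"
  proof (rule ccontr)
   assume "x \<noteq> y"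
   then have "f ((x - y) * inverse (x - y)) = 1" using 1 by simp
   moreover have "f (x - y) = 0" using add[of x "- y"] fm[of y] K xy by simp
   ultimately show False using mult[of "x - y" "inverse (x - y)"] K xy by (simp add: subfield_diff)
  qed
 qed
 have int: "f (of_nat n) = of_nat n" for n
  by (induction n) (use f0 1 add K in \<open>auto simp: subfield_of_nat\<close>)
 have int: "f (of_int n) = of_int n" for n
  by (cases n rule: int_cases2) (use fm int K in \<open>auto simp: subfield_of_nat\<close>)
 have fpoly: "f (poly (map_poly of_int p) x) = poly (map_poly of_int p) (f x)" if x: "x \<in> Qbar" for p x
 proof (induction p)
  case (pCons a p)
  have "poly (map_poly of_int p) x \<in> Qbar"
   using K x by (intro subfield_poly) (auto simp: coeff_map_poly subfield_of_int)
  with pCons show ?case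
   using K x by (simp add: map_poly_pCons add mult int subfield_of_int)
 qed (simp add: f0)
 have conj: "f ` {z. poly (map_poly of_int p) z = 0} = {z. poly (map_poly of_int p) z = 0}"
  if "p \<noteq> 0" for p
 proof -
  have "map_poly of_int p \<noteq> (0::complex poly)" using that by (simp add: map_poly_eq_0_iff)
  then have fin: "finite {z::complex. poly (map_poly of_int p) z = 0}" by (rule poly_roots_finite)
  have sub: "{z::complex. poly (map_poly of_int p) z = 0} \<subseteq> Qbar"
   using that by (auto intro: int_root_Qbar)
  show ?thesis
  proof (rule endo_inj_surj[OF fin])
   show "inj_on f {z. poly (map_poly of_int p) z = 0}" by (rule inj_on_subset[OF inj sub])
   show "f ` {z. poly (map_poly of_int p) z = 0} \<subseteq> {z. poly (map_poly of_int p) z = 0}"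
   proof clarify
    fix z :: complex assume z: "poly (map_poly of_int p) z = 0"
    then show "poly (map_poly of_int p) (f z) = 0" using fpoly[of z p] sub f0 by auto
   qed
  qed
 qed
 have "f ` Qbar = Qbar"
 proof (intro equalityI subsetI)
  fix y assume y: "y \<in> Qbar"
  then obtain p where p: "p \<noteq> 0" "poly (map_poly of_int p) y = 0"
   by (rule Qbar_int_root)
  then have "y \<in> f ` {z. poly (map_poly of_int p) z = 0}" unfolding conj[OF p(1)] by simp
  then obtain x where x: "poly (map_poly of_int p) x = 0" "y = f x" by auto
  show "y \<in> f ` Qbar" unfolding x(2) by (rule imageI) (rule int_root_Qbar[OF p(1) x(1)])
 next
  fix y assume "y \<in> f ` Qbar"
  then obtain x where x: "x \<in> Qbar" "y = f x" by blast
  from x(1) obtain p where p: "p \<noteq> 0" "poly (map_poly of_int p) x = 0"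
   by (rule Qbar_int_root)
  then have "poly (map_poly of_int p) y = 0" using x fpoly[of x p] f0 by simp
  then show "y \<in> Qbar" using int_root_Qbar[OF p(1)] by blast
 qed
 with inj have "bij_betw f Qbar Qbar" by (simp add: bij_betw_def)
 moreover have "bij_betw (restrict f Qbar) Qbar Qbar \<longleftrightarrow> bij_betw f Qbar Qbar"
  by (rule bij_betw_cong) simp
 moreover have "x + y \<in> Qbar" "x * y \<in> Qbar" if "x \<in> Qbar" "y \<in> Qbar" for x y
  using subfieldD(3,4)[OF Qbar that] by blast+
 ultimately show ?thesis unfolding carrier_gal by (simp add: add mult)
qed

section \<open>Extension of homomorphisms\<close>

text \<open>The graph of a ring homomorphism from a ring of algebraic numbers to the complex numbers.\<close>

definition ring_graph :: "(complex \<times> complex) set \<Rightarrow> bool" where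
 "ring_graph R \<longleftrightarrow> (1, 1) \<in> R \<and>
  (\<forall>a b c d. (a, b) \<in> R \<longrightarrow> (c, d) \<in> R \<longrightarrow> (a + c, b + d) \<in> R \<and> (a * c, b * d) \<in> R) \<and>
  (\<forall>a b. (a, b) \<in> R \<longrightarrow> (- a, - b) \<in> R \<and> a \<in> Qbar) \<and> (\<forall>b. (0, b) \<in> R \<longrightarrow> b = 0)"

context
 fixes R assumes R: "ring_graph R"
begin

lemma ring_graph_1: "(1, 1) \<in> R"
 and ring_graph_add: "(a, b) \<in> R ==> (c, d) \<in> R ==> (a + c, b + d) \<in> R"
 and ring_graph_mult: "(a, b) \<in> R ==> (c, d) \<in> R ==> (a * c, b * d) \<in> R"
 and ring_graph_minus: "(a, b) \<in> R ==> (- a, - b) \<in> R"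
 and ring_graph_Qbar: "(a, b) \<in> R ==> a \<in> Qbar"
 and ring_graph_0D: "(0, b) \<in> R ==> b = 0"
 using R unfolding ring_graph_def by blast+

lemma ring_graph_0: "(0, 0) \<in> R"
 using ring_graph_add[OF ring_graph_1 ring_graph_minus[OF ring_graph_1]] by simp

lemma ring_graph_diff: "(a, b) \<in> R ==> (c, d) \<in> R ==> (a - c, b - d) \<in> R"
 using ring_graph_add[of a b "- c" "- d"] ring_graph_minus[of c d] by simp

lemma ring_graph_unique: "(a, b) \<in> R ==> (a, c) \<in> R ==> b = c"
 using ring_graph_0D[of "b - c"] ring_graph_diff[of a b a c] by simp

lemma ring_graph_sum: "(\<And>i. i \<in> A ==> (f i, g i) \<in> R) ==> (sum f A, sum g A) \<in> R"
 by (induction A rule: infinite_finite_induct) (auto simp: ring_graph_0 ring_graph_add)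

lemma ring_graph_of_int: "(of_int n, of_int n) \<in> R"
proof -
 have nat: "(of_nat n, of_nat n) \<in> R" for n
  by (induction n) (auto simp: ring_graph_0 ring_graph_add ring_graph_1)
 show ?thesis using nat ring_graph_minus[OF nat] by (cases n rule: int_cases2) auto
qed

text \<open>The domain is a ring and may fail to be a field, so injectivity has to come from
  algebraicity. If \<open>a\<close> maps to 0, then a polynomial relation of \<open>a\<close> with
  nonzero constant term maps to that constant term, which would have to be 0.\<close>

lemma ring_graph_nonzero:
 assumes "(a, 0) \<in> R" shows "a = 0"
proof (rule ccontr)
 assume "a \<noteq> 0"
 moreover have "algebraic a" using ring_graph_Qbar[OF assms] by (simp add: Qbar_def)
 ultimately obtain p where p: "coeff p 0 \<noteq> 0" "poly (map_poly of_int p) a = 0"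
  by (elim algebraicE'_nonzero) auto
 have "(poly (map_poly of_int p) a, poly (map_poly of_int p) 0) \<in> R" for p
 proof (induction p)
  case (pCons c p)
  then show ?case
   using ring_graph_add[OF ring_graph_of_int[of c] ring_graph_mult[OF assms pCons(2)]]
   by (simp add: map_poly_pCons)
 qed (simp add: ring_graph_0)
 from this[of p] show False
  using p ring_graph_0D by (fastforce simp: poly_0_coeff_0 coeff_map_poly)
qed

text \<open>Take a polynomial \<open>m\<close> of least degree over the domain with
  \<open>m(x) = 0\<close>, let \<open>n\<close> be its image and send \<open>x\<close> to a complex
  root \<open>y\<close> of \<open>n\<close>. This is well defined because \<open>f(x) = 0\<close>
  forces \<open>g(y) = 0\<close> for the image \<open>g\<close> of \<open>f\<close>, as reduction of
  \<open>f\<close> modulo \<open>m\<close> shows.\<close>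

lemma ring_graph_adjoin:
 assumes x: "x \<in> Qbar"
 shows "\<exists>R'. ring_graph R' \<and> R \<subseteq> R' \<and> x \<in> fst ` R'"
proof -
 define C where "C f g \<longleftrightarrow> (\<forall>i. (coeff f i, coeff g i) \<in> R)" for f g
 define P where "P m n \<longleftrightarrow> C m n \<and> m \<noteq> 0 \<and> poly m x = 0" for m n
 obtain p where p: "p \<noteq> 0" "poly (map_poly of_int p) x = 0"
  using x by (rule Qbar_int_root)
 have "P (map_poly of_int p) (map_poly of_int p)"
  using p by (auto simp: P_def C_def coeff_map_poly ring_graph_of_int map_poly_eq_0_iff)
 then have ex: "\<exists>m. \<exists>n. P m n" by blast
 define m where "m = arg_min degree (\<lambda>m. \<exists>n. P m n)"
 obtain n where mn: "P m n" and min: "\<And>m' n'. P m' n' ==> degree m \<le> degree m'"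
  using arg_min_nat_lemma[of "\<lambda>m. \<exists>n. P m n" _ degree] ex unfolding m_def by blast
 have iff: "coeff m i = 0 \<longleftrightarrow> coeff n i = 0" for i
  using mn ring_graph_nonzero ring_graph_0D unfolding P_def C_def by metis
 have deg: "degree n = degree m"
 proof (rule antisym)
  show "degree n \<le> degree m" by (rule degree_le) (metis iff coeff_eq_0)
  show "degree m \<le> degree n" by (rule degree_le) (metis iff coeff_eq_0)
 qed
 have m0: "m \<noteq> 0" "poly m x = 0" and Cmn: "C m n" using mn by (auto simp: P_def)
 have "degree m \<noteq> 0"
  using m0 by (auto elim!: degree_eq_zeroE)
 then have "\<not> constant (poly n)" using deg by (simp add: constant_degree)
 then obtain y where y: "poly n y = 0" using fundamental_theorem_of_algebra by blast
 have lcn: "coeff n (degree m) \<noteq> 0" using iff m0 leading_coeff_0_iff by blast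
 have root: "poly g y = 0" if "C f g" "poly f x = 0" for f g
  using that
 proof (induction "degree f" arbitrary: f g rule: less_induct)
  case less
  show ?case
  proof (cases "f = 0")
   case True
   then have "coeff g i = 0" for i using less(2) ring_graph_0D by (auto simp: C_def)
   then have "g = 0" by (simp add: poly_eq_iff)
   then show ?thesis by simp
  next
   case False
   then have le: "degree m \<le> degree f" using min[of f g] less by (auto simp: P_def)
   \<comment> \<open>Pseudo-division: coefficients cannot be inverted in the domain, so leading
     coefficients are multiplied crosswise before the top terms cancel. The image \<open>g'\<close>
     takes the coefficient of \<open>g\<close> at \<open>degree f\<close>, the partner of the
     leading coefficient of \<open>f\<close>.\<close>
   define d where "d = degree f - degree m"
   define f' where "f' = Polynomial.smult (coeff m (degree m)) f - Polynomial.smult (coeff f (degree f)) (Polynomial.monom 1 d * m)"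
   define g' where "g' = Polynomial.smult (coeff n (degree m)) g - Polynomial.smult (coeff g (degree f)) (Polynomial.monom 1 d * n)"
   have "C f' g'"
    using less(2) Cmn unfolding C_def f'_def g'_def
    by (auto simp: coeff_monom_mult intro!: ring_graph_diff ring_graph_mult ring_graph_0)
   moreover have f'0: "poly f' x = 0" using less m0 by (simp add: f'_def)
   moreover have "degree f' < degree f \<or> f' = 0"
   proof -
    have "degree f' \<le> degree f"
     unfolding f'_def using le m0
     by (intro degree_diff_le order.trans[OF degree_smult_le]) (auto simp: degree_mult_eq degree_monom_eq d_def Polynomial.monom_eq_0_iff)
    moreover have "coeff f' (degree f) = 0"
     using le by (simp add: f'_def coeff_monom_mult d_def)
    ultimately show ?thesis by (metis leading_coeff_0_iff le_neq_implies_less)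
   qed
   ultimately have "poly g' y = 0"
   proof (elim disjE)
    assume C: "C f' g'" and "f' = 0"
    then have "coeff g' i = 0" for i using ring_graph_0D by (auto simp: C_def)
    then have "g' = 0" by (simp add: poly_eq_iff)
    then show ?thesis by simp
   qed (use less(1) in blast)
   then show ?thesis using y lcn by (simp add: g'_def)
  qed
 qed
 define R' where "R' = {(poly f x, poly g y) |f g. C f g}"
 have "ring_graph R'"
  unfolding ring_graph_def
 proof (intro conjI allI impI)
  have "C 1 1" by (auto simp: C_def coeff_1 ring_graph_1 ring_graph_0)
  then show "(1, 1) \<in> R'" unfolding R'_def by force
 next
  fix a b c d assume "(a, b) \<in> R'" "(c, d) \<in> R'"
  then obtain f g f' g' where *: "a = poly f x" "b = poly g y" "c = poly f' x" "d = poly g' y" "C f g" "C f' g'"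
   unfolding R'_def by blast
  have "C (f + f') (g + g')" using * by (auto simp: C_def ring_graph_add)
  then show "(a + c, b + d) \<in> R'" using * unfolding R'_def by force
  have "C (f * f') (g * g')"
   using * by (auto simp: C_def coeff_mult intro!: ring_graph_sum ring_graph_mult)
  then show "(a * c, b * d) \<in> R'" using * unfolding R'_def by force
 next
  fix a b assume "(a, b) \<in> R'"
  then obtain f g where *: "a = poly f x" "b = poly g y" "C f g" unfolding R'_def by blast
  have "C (- f) (- g)" using * by (auto simp: C_def ring_graph_minus)
  then show "(- a, - b) \<in> R'" using * unfolding R'_def by force
  show "a \<in> Qbar"
   unfolding *(1)
  proof (rule subfield_poly[OF Qbar _ x])
   show "coeff f i \<in> Qbar" for i using *(3) ring_graph_Qbar unfolding C_def by blast
  qed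
 next
  fix b assume "(0, b) \<in> R'"
  then show "b = 0" using root unfolding R'_def by force
 qed
 moreover have "R \<subseteq> R'"
 proof
  fix z assume z: "z \<in> R"
  obtain a b where ab: "z = (a, b)" by (cases z)
  have "C [:a:] [:b:]" using z ab by (auto simp: C_def coeff_pCons ring_graph_0 split: nat.splits)
  then have "(poly [:a:] x, poly [:b:] y) \<in> R'" unfolding R'_def by blast
  then show "z \<in> R'" by (simp add: ab)
 qed
 moreover have "x \<in> fst ` R'"
 proof -
  have "C [:0, 1:] [:0, 1:]" by (auto simp: C_def coeff_pCons ring_graph_0 ring_graph_1 split: nat.splits)
  then have "(poly [:0, 1:] x, poly [:0, 1:] y) \<in> R'" unfolding R'_def by blast
  then show ?thesis by force
 qed
 ultimately show ?thesis by blast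
qed

end

text \<open>By \<open>ring_graph_adjoin\<close>, a graph that is maximal under inclusion is defined
  on all of \<open>Qbar\<close>.\<close>

theorem ring_graph_extends:
 assumes R: "ring_graph R"
 shows "\<exists>\<sigma>\<in>carrier G_Q. \<forall>(a, b)\<in>R. \<sigma> a = b"
proof -
 have "\<exists>M\<in>{S. ring_graph S \<and> R \<subseteq> S}. \<forall>X\<in>{S. ring_graph S \<and> R \<subseteq> S}. M \<subseteq> X \<longrightarrow> X = M"
 proof (rule subset_Zorn_nonempty)
  fix \<C> assume ne: "\<C> \<noteq> {}" and ch: "subset.chain {S. ring_graph S \<and> R \<subseteq> S} \<C>"
  then have rg: "\<And>S. S \<in> \<C> ==> ring_graph S" and sub: "\<And>S. S \<in> \<C> ==> R \<subseteq> S"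
   unfolding subset.chain_def by auto
  have two: "\<exists>S\<in>\<C>. u \<in> S \<and> v \<in> S" if "u \<in> \<Union>\<C>" "v \<in> \<Union>\<C>" for u v
   using that ch unfolding subset.chain_def by blast
  have "ring_graph (\<Union>\<C>)"
   unfolding ring_graph_def
  proof (intro conjI allI impI)
   show "(1, 1) \<in> \<Union>\<C>" using ne rg ring_graph_1 by blast
  next
   fix a b c d assume "(a, b) \<in> \<Union>\<C>" "(c, d) \<in> \<Union>\<C>"
   then obtain S where S: "S \<in> \<C>" "(a, b) \<in> S" "(c, d) \<in> S" using two by meson
   then show "(a + c, b + d) \<in> \<Union>\<C>" "(a * c, b * d) \<in> \<Union>\<C>"
    using ring_graph_add[OF rg[OF S(1)] S(2,3)] ring_graph_mult[OF rg[OF S(1)] S(2,3)] by blast+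
  next
   fix a b assume "(a, b) \<in> \<Union>\<C>"
   then obtain S where S: "S \<in> \<C>" "(a, b) \<in> S" by blast
   then show "(- a, - b) \<in> \<Union>\<C>" "a \<in> Qbar"
    using ring_graph_minus[OF rg[OF S(1)] S(2)] ring_graph_Qbar[OF rg[OF S(1)] S(2)] by blast+
  next
   fix b assume "(0, b) \<in> \<Union>\<C>"
   then show "b = 0" using rg ring_graph_0D by blast
  qed
  then show "\<Union>\<C> \<in> {S. ring_graph S \<and> R \<subseteq> S}" using ne sub by blast
 qed (use R in blast)
 then obtain M where M: "ring_graph M" "R \<subseteq> M" and max: "\<And>X. ring_graph X ==> M \<subseteq> X ==> X = M"
  by (metis (mono_tags, lifting) mem_Collect_eq order.trans)
 have "\<exists>y. (x, y) \<in> M" if "x \<in> Qbar" for x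
  using ring_graph_adjoin[OF M(1) that] max by force
 then obtain f where f: "\<And>x. x \<in> Qbar ==> (x, f x) \<in> M" by metis
 have feq: "f a = b" if "(a, b) \<in> M" for a b
  using that f[of a] ring_graph_Qbar[OF M(1)] ring_graph_unique[OF M(1)] by blast
 have "restrict f Qbar \<in> carrier G_Q"
 proof (rule gal_QbarI)
  show "f 1 = 1" using feq ring_graph_1[OF M(1)] by blast
  show "f (x + y) = f x + f y" "f (x * y) = f x * f y" if "x \<in> Qbar" "y \<in> Qbar" for x y
   using feq ring_graph_add[OF M(1) f f] ring_graph_mult[OF M(1) f f] that by blast+
 qed
 moreover have "\<forall>(a, b)\<in>R. restrict f Qbar a = b"
  using feq M ring_graph_Qbar[OF M(1)] by (auto simp: restrict_def)
 ultimately show ?thesis by blast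
qed

lemma gal_extend:
 assumes K: "is_subfield K" "K \<subseteq> Qbar" and \<sigma>: "\<sigma> \<in> carrier (gal K)"
 shows "\<exists>g\<in>carrier G_Q. \<forall>x\<in>K. g x = \<sigma> x"
proof -
 have "ring_graph {(x, \<sigma> x) |x. x \<in> K}"
  unfolding ring_graph_def using K \<sigma> by (auto simp: subfieldD gal_add gal_times gal_minus)
 from ring_graph_extends[OF this] obtain g where "g \<in> carrier G_Q" "\<forall>(a, b)\<in>{(x, \<sigma> x) |x. x \<in> K}. g a = b"
  by blast
 then show ?thesis by (intro bexI[of _ g]) auto
qed

lemma map_poly_of_rat_add: "map_poly of_rat (f + g) = map_poly of_rat f + (map_poly of_rat g :: complex poly)"
 and map_poly_of_rat_mult: "map_poly of_rat (f * g) = map_poly of_rat f * (map_poly of_rat g :: complex poly)"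
 and map_poly_of_rat_minus: "map_poly of_rat (- f) = - (map_poly of_rat f :: complex poly)"
 by (auto intro!: poly_eqI simp: coeff_map_poly of_rat_add coeff_mult of_rat_sum of_rat_mult of_rat_minus)

text \<open>Every rational relation of \<open>x\<close> holds for \<open>y\<close>, so evaluation at
  \<open>y\<close> is well defined on the ring generated by \<open>x\<close> and its graph
  extends.\<close>

lemma gal_conjugate:
 assumes x: "x \<in> Qbar"
  and xy: "\<And>f::rat poly. poly (map_poly of_rat f) x = 0 ==> poly (map_poly of_rat f) y = 0"
 shows "\<exists>g\<in>carrier G_Q. g x = y"
proof -
 let ?p = "\<lambda>f z. poly (map_poly of_rat f) z :: complex"
 have "ring_graph {(?p f x, ?p f y) |f. True}"
  unfolding ring_graph_def
 proof (intro conjI allI impI)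
  show "(1, 1) \<in> {(?p f x, ?p f y) |f. True}" by (auto intro!: exI[of _ 1])
 next
  fix a b c d assume "(a, b) \<in> {(?p f x, ?p f y) |f. True}" "(c, d) \<in> {(?p f x, ?p f y) |f. True}"
  then obtain f g where "a = ?p f x" "b = ?p f y" "c = ?p g x" "d = ?p g y" by blast
  then have "(a + c, b + d) = (?p (f + g) x, ?p (f + g) y)" "(a * c, b * d) = (?p (f * g) x, ?p (f * g) y)"
   by (simp_all add: map_poly_of_rat_add map_poly_of_rat_mult)
  then show "(a + c, b + d) \<in> {(?p f x, ?p f y) |f. True}" "(a * c, b * d) \<in> {(?p f x, ?p f y) |f. True}"
   by blast+
 next
  fix a b assume "(a, b) \<in> {(?p f x, ?p f y) |f. True}"
  then obtain f where f: "a = ?p f x" "b = ?p f y" by blast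
  then show "(- a, - b) \<in> {(?p f x, ?p f y) |f. True}"
   by (auto intro!: exI[of _ "- f"] simp: map_poly_of_rat_minus)
  show "a \<in> Qbar" using f x by (auto intro!: subfield_poly[OF Qbar] simp: coeff_map_poly subfield_of_rat[OF Qbar])
 next
  fix b assume "(0, b) \<in> {(?p f x, ?p f y) |f. True}"
  then obtain f where "0 = ?p f x" "b = ?p f y" by blast
  then show "b = 0" using xy[of f] by simp
 qed
 from ring_graph_extends[OF this] obtain g where g: "g \<in> carrier G_Q"
  and gR: "\<forall>(a, b)\<in>{(?p f x, ?p f y) |f. True}. g a = b" by (elim bexE)
 have g2: "g (?p f x) = ?p f y" for f
  using bspec[OF gR, of "(?p f x, ?p f y)"] by auto
 have "g x = y" using g2[of "[:0, 1:]"] by (simp add: map_poly_pCons)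
 then show ?thesis using g by blast
qed

lemma finite_conjugates:
 assumes "x \<in> Qbar" shows "finite {g x |g. g \<in> carrier G_Q}"
proof -
 obtain p :: "rat poly" where p: "p \<noteq> 0" "poly (map_poly of_rat p) x = 0"
  using assms by (auto simp: Qbar_def algebraic_rat_poly)
 have "map_poly of_rat p \<noteq> (0::complex poly)" using p by (simp add: map_poly_eq_0_iff)
 moreover have "{g x |g. g \<in> carrier G_Q} \<subseteq> {z. poly (map_poly of_rat p) z = 0}"
  using p(2) assms gal_poly_of_rat[OF Qbar] by (force simp: gal_0[OF Qbar] dest: sym)
 ultimately show ?thesis using poly_roots_finite finite_subset by blast
qed

section \<open>The maximal abelian extension\<close>

lemma Qbar_rat_root:
 assumes "x \<in> Qbar"
 obtains f :: "rat poly" where "Factorial_Ring.irreducible f" "poly (map_poly of_rat f) x = 0"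
proof -
 let ?P = "\<lambda>f::rat poly. f \<noteq> 0 \<and> poly (map_poly of_rat f) x = 0"
 have ex: "\<exists>f. ?P f" using assms by (auto simp: Qbar_def algebraic_rat_poly)
 define f where "f = arg_min degree ?P"
 have f: "?P f" and min: "\<And>g. ?P g ==> degree f \<le> degree g"
  using ex arg_min_nat_lemma[of ?P _ degree] unfolding f_def by blast+
 have "Factorial_Ring.irreducible f"
 proof (rule irreducibleI)
  show "f \<noteq> 0" using f by simp
  show "\<not> f dvd 1"
  proof
   assume "f dvd 1"
   then have "degree f = 0" using f by (simp add: is_unit_iff_degree)
   then obtain c where "f = [:c:]" by (rule degree_eq_zeroE)
   then show False using f by (simp add: Polynomial.map_poly_pCons)
  qed
  fix a b assume ab: "f = a * b"
  then have nz: "a \<noteq> 0" "b \<noteq> 0" using f by auto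
  then have deg: "degree f = degree a + degree b" using ab by (simp add: degree_mult_eq)
  have "poly (map_poly of_rat a) x = 0 \<or> poly (map_poly of_rat b) x = 0"
   using f by (simp add: ab map_poly_of_rat_mult)
  then have "degree a = 0 \<or> degree b = 0" using min[of a] min[of b] nz deg by auto
  then show "a dvd 1 \<or> b dvd 1" using nz by (auto simp: is_unit_iff_degree)
 qed
 with f that show thesis by blast
qed

text \<open>\<open>f\<close> is a unit multiple of the polynomial \<open>m\<close> of least degree
  that kills \<open>x\<close>, and \<open>m\<close> divides \<open>h\<close> by division with
  remainder.\<close>

lemma irreducible_common_root_dvd:
 fixes f h :: "rat poly" and x :: complex
 assumes f: "Factorial_Ring.irreducible f" "poly (map_poly of_rat f) x = 0"
  and h: "poly (map_poly of_rat h) x = 0"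
 shows "f dvd h"
proof -
 let ?P = "\<lambda>f::rat poly. f \<noteq> 0 \<and> poly (map_poly of_rat f) x = 0"
 have "?P f" using f by auto
 then have ex: "\<exists>f. ?P f" by blast
 define m where "m = arg_min degree ?P"
 have m: "?P m" and min: "\<And>g. ?P g ==> degree m \<le> degree g"
  using ex arg_min_nat_lemma[of ?P _ degree] unfolding m_def by blast+
 have dvd: "m dvd k" if k: "poly (map_poly of_rat k) x = 0" for k
 proof (rule ccontr)
  assume "\<not> m dvd k"
  then have nz: "k mod m \<noteq> 0" by (simp add: mod_eq_0_iff_dvd)
  have eq: "k + - (k div m * m) = k mod m" by (simp add: minus_div_mult_eq_mod)
  have "poly (map_poly of_rat (k + - (k div m * m))) x = 0"
   unfolding map_poly_of_rat_add map_poly_of_rat_minus map_poly_of_rat_mult using k m by simp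
  then have "?P (k mod m)" using nz unfolding eq by blast
  moreover have "degree (k mod m) < degree m" using m nz by (intro degree_mod_less') auto
  ultimately show False using min[of "k mod m"] by simp
 qed
 obtain k where k: "f = m * k" using dvd[OF f(2)] by blast
 have "\<not> m dvd 1"
 proof
  assume "m dvd 1"
  then have "degree m = 0" using m by (simp add: is_unit_iff_degree)
  then obtain c where "m = [:c:]" by (rule degree_eq_zeroE)
  then show False using m by (simp add: Polynomial.map_poly_pCons)
 qed
 then have "k dvd 1" using f(1) k by (auto dest: irreducibleD)
 then have "f dvd m" unfolding k by (simp add: mult_unit_dvd_iff)
 then show ?thesis using dvd[OF h] dvd_trans by blast
qed

lemma irreducible_conjugate:
 fixes f :: "rat poly"
 assumes f: "Factorial_Ring.irreducible f" "poly (map_poly of_rat f) x = 0" "poly (map_poly of_rat f) y = 0"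
 shows "\<exists>g\<in>carrier G_Q. g x = y"
proof (rule gal_conjugate)
 have "f \<noteq> 0" using f by auto
 then show "x \<in> Qbar" using f by (auto simp: Qbar_def algebraic_rat_poly)
 fix h :: "rat poly" assume "poly (map_poly of_rat h) x = 0"
 then obtain k where "h = f * k" using irreducible_common_root_dvd[OF f(1,2)] by blast
 then show "poly (map_poly of_rat h) y = 0" using f(3) by (simp add: map_poly_of_rat_mult)
qed

text \<open>The fixed field of all commutators, in the form in which \<open>Qab_eq\<close>
  identifies it with \<open>Qab\<close>.\<close>

lemma comm_fixed_subfield:
 "is_subfield {x\<in>Qbar. \<forall>\<sigma>\<in>carrier G_Q. \<forall>\<tau>\<in>carrier G_Q. \<sigma> (\<tau> x) = \<tau> (\<sigma> x)}"
 unfolding is_subfield_def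
 by (auto simp: subfieldD[OF Qbar] gal_0[OF Qbar] gal_1[OF Qbar] gal_add gal_times
   gal_minus[OF Qbar] gal_inverse[OF Qbar])

text \<open>Normality lets every element of \<open>G_Q\<close> restrict to \<open>K\<close>, and the
  restrictions commute.\<close>

lemma Qab_subset_comm_fixed:
 assumes K: "abelian_extension K" and x: "x \<in> K" and g: "\<sigma> \<in> carrier G_Q" "\<tau> \<in> carrier G_Q"
 shows "\<sigma> (\<tau> x) = \<tau> (\<sigma> x)"
proof -
 have sub: "is_subfield K" and KQ: "K \<subseteq> Qbar" and comm: "comm_group (gal K)"
  and normal: "\<And>(f::rat poly) x y. Factorial_Ring.irreducible f ==> x \<in> K ==>
   poly (map_poly of_rat f) x = 0 ==> poly (map_poly of_rat f) y = 0 ==> y \<in> K"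
  using K by (auto simp: abelian_extension_def)
 have closed: "g y \<in> K" if g: "g \<in> carrier G_Q" and y: "y \<in> K" for g y
 proof -
  have yQ: "y \<in> Qbar" using y KQ by blast
  obtain f :: "rat poly" where f: "Factorial_Ring.irreducible f" "poly (map_poly of_rat f) y = 0"
   using Qbar_rat_root[OF yQ] by blast
  then have "poly (map_poly of_rat f) (g y) = 0"
   using gal_poly_of_rat[OF Qbar g yQ, of f] gal_0[OF Qbar g] by simp
  then show ?thesis using normal f y by blast
 qed
 have res: "restrict g K \<in> carrier (gal K)" if g: "g \<in> carrier G_Q" for g
 proof -
  have "bij_betw g K K"
  proof (rule bij_betw_imageI)
   show "inj_on g K" by (rule inj_onI) (use KQ gal_inj[OF g] in blast)
   show "g ` K = K"
   proof (intro equalityI subsetI)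
    fix y assume y: "y \<in> K"
    then have "y = g ((ginv g) y)" using KQ g GQ_inv_apply(2) by (metis subsetD)
    then show "y \<in> g ` K" using closed[OF GQ.inv_closed[OF g] y] by blast
   qed (use closed[OF g] in blast)
  qed
  moreover have "bij_betw (restrict g K) K K \<longleftrightarrow> bij_betw g K K" by (rule bij_betw_cong) simp
  ultimately show ?thesis
   using g KQ subfieldD(3,4)[OF sub] unfolding carrier_gal[of "restrict g K"]
   by (auto simp: gal_add gal_times subset_iff)
 qed
 interpret comm_group "gal K" by (fact comm)
 have "(restrict \<sigma> K \<otimes>\<^bsub>gal K\<^esub> restrict \<tau> K) x = (restrict \<tau> K \<otimes>\<^bsub>gal K\<^esub> restrict \<sigma> K) x"
  using m_comm[OF res[OF g(1)] res[OF g(2)]] by simp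
 then show ?thesis using res[OF g(1)] res[OF g(2)] x closed g by simp
qed

text \<open>Replaces the union of abelian extensions by a condition that can be tested on single
  elements. The field \<open>?E\<close> is normal because commutation at \<open>x\<close> passes to
  each conjugate \<open>g x\<close>, and its group is commutative because its automorphisms extend
  to \<open>Qbar\<close>.\<close>

theorem Qab_eq: "Qab = {x\<in>Qbar. \<forall>\<sigma>\<in>carrier G_Q. \<forall>\<tau>\<in>carrier G_Q. \<sigma> (\<tau> x) = \<tau> (\<sigma> x)}" (is "_ = ?E")
proof (intro equalityI subsetI)
 fix x assume "x \<in> Qab"
 then obtain K where K: "abelian_extension K" "x \<in> K" by (auto simp: Qab_def)
 then show "x \<in> ?E" using Qab_subset_comm_fixed[OF K] by (auto simp: abelian_extension_def)
next
 have "abelian_extension ?E"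
  unfolding abelian_extension_def
 proof (intro conjI allI impI)
  show E: "is_subfield ?E" by (rule comm_fixed_subfield)
  show "?E \<subseteq> Qbar" by blast
  fix f :: "rat poly" and y :: complex
  assume "Factorial_Ring.irreducible f \<and> (\<exists>x\<in>?E. poly (map_poly of_rat f) x = 0)"
   and y: "poly (map_poly of_rat f) y = 0"
  then obtain x where f: "Factorial_Ring.irreducible f" and x: "x \<in> ?E" "poly (map_poly of_rat f) x = 0" by blast
  obtain g where g: "g \<in> carrier G_Q" "g x = y" using irreducible_conjugate[OF f x(2) y] by blast
  have xQ: "x \<in> Qbar" using x by blast
  have c: "\<sigma> (\<tau> x) = \<tau> (\<sigma> x)" if "\<sigma> \<in> carrier G_Q" "\<tau> \<in> carrier G_Q" for \<sigma> \<tau>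
   using x that by blast
  have "\<sigma> (\<tau> y) = \<tau> (\<sigma> y)" if s: "\<sigma> \<in> carrier G_Q" "\<tau> \<in> carrier G_Q" for \<sigma> \<tau>
  proof -
   have "\<sigma> (\<tau> (g x)) = (\<sigma> \<cdot> \<tau>) (g x)" using s g(1) xQ by simp
   also have "\<dots> = g ((\<sigma> \<cdot> \<tau>) x)" using c[of "\<sigma> \<cdot> \<tau>" g] s g(1) by blast
   also have "\<dots> = g ((\<tau> \<cdot> \<sigma>) x)" using c[OF s] s xQ by simp
   also have "\<dots> = (\<tau> \<cdot> \<sigma>) (g x)" using c[of g "\<tau> \<cdot> \<sigma>"] s g(1) by blast
   also have "\<dots> = \<tau> (\<sigma> (g x))" using s g(1) xQ by simp
   finally show ?thesis by (simp add: g(2))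
  qed
  moreover have "y \<in> Qbar" using g xQ by auto
  ultimately show "y \<in> ?E" by blast
 next
  interpret group "gal ?E" by (rule group_gal[OF comm_fixed_subfield])
  show "comm_group (gal ?E)"
  proof (rule group_comm_groupI)
   fix \<sigma> \<tau> assume s: "\<sigma> \<in> carrier (gal ?E)" "\<tau> \<in> carrier (gal ?E)"
   have sub: "?E \<subseteq> Qbar" by blast
   obtain g where g: "g \<in> carrier G_Q" "\<And>x. x \<in> ?E ==> g x = \<sigma> x"
    using gal_extend[OF comm_fixed_subfield sub s(1)] by blast
   obtain h where h: "h \<in> carrier G_Q" "\<And>x. x \<in> ?E ==> h x = \<tau> x"
    using gal_extend[OF comm_fixed_subfield sub s(2)] by blast
   have "\<sigma> (\<tau> x) = \<tau> (\<sigma> x)" if x: "x \<in> ?E" for x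
   proof -
    have "\<sigma> (\<tau> x) = g (h x)" "\<tau> (\<sigma> x) = h (g x)"
     by (simp_all only: g(2)[OF x] h(2)[OF x] g(2)[OF gal_closed[OF s(2) x]] h(2)[OF gal_closed[OF s(1) x]])
    then show ?thesis using x g(1) h(1) by simp
   qed
   then show "\<sigma> \<otimes>\<^bsub>gal ?E\<^esub> \<tau> = \<tau> \<otimes>\<^bsub>gal ?E\<^esub> \<sigma>"
    unfolding gal_mult[OF s] gal_mult[OF s(2,1)] compose_def by (intro restrict_ext) blast
  qed
 qed
 then show "x \<in> Qab" if "x \<in> ?E" for x using that unfolding Qab_def by blast
qed

lemma Qab_subset: "Qab \<subseteq> Qbar"
 and Qab_comm: "x \<in> Qab ==> \<sigma> \<in> carrier G_Q ==> \<tau> \<in> carrier G_Q ==> \<sigma> (\<tau> x) = \<tau> (\<sigma> x)"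
 unfolding Qab_eq by blast+

lemma QabI:
 "x \<in> Qbar ==> (\<And>\<sigma> \<tau>. \<sigma> \<in> carrier G_Q ==> \<tau> \<in> carrier G_Q ==> \<sigma> (\<tau> x) = \<tau> (\<sigma> x)) ==> x \<in> Qab"
 unfolding Qab_eq by blast

lemma Qab: "is_subfield Qab"
 unfolding Qab_eq by (rule comm_fixed_subfield)

lemma Qab_Qbar [simp]: "x \<in> Qab ==> x \<in> Qbar"
 using Qab_subset by blast

lemma GQ_Qab [simp]:
 assumes "g \<in> carrier G_Q" "x \<in> Qab" shows "g x \<in> Qab"
proof (rule QabI)
 show "g x \<in> Qbar" using assms by simp
 fix \<sigma> \<tau> assume s: "\<sigma> \<in> carrier G_Q" "\<tau> \<in> carrier G_Q"
 have xQ: "x \<in> Qbar" using assms by simp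
 have "\<sigma> (\<tau> (g x)) = (\<sigma> \<cdot> \<tau>) (g x)" using s assms xQ by simp
 also have "\<dots> = g ((\<sigma> \<cdot> \<tau>) x)" using Qab_comm[OF assms(2), of "\<sigma> \<cdot> \<tau>" g] s assms(1) by blast
 also have "\<dots> = g ((\<tau> \<cdot> \<sigma>) x)" using Qab_comm[OF assms(2) s] s xQ by simp
 also have "\<dots> = (\<tau> \<cdot> \<sigma>) (g x)" using Qab_comm[OF assms(2), of g "\<tau> \<cdot> \<sigma>"] s assms(1) by blast
 also have "\<dots> = \<tau> (\<sigma> (g x))" using s assms xQ by simp
 finally show "\<sigma> (\<tau> (g x)) = \<tau> (\<sigma> (g x))" .
qed

text \<open>All \<open>n\<close>-th roots of unity are powers of \<open>e\<close>, so automorphisms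
  act on \<open>e\<close> as power maps, and power maps commute.\<close>

lemma root_of_unity_Qab:
 assumes z: "z ^ n = 1" and n: "n > 0"
 shows "z \<in> Qab"
proof -
 define e where "e = cis (2 * pi / real n)"
 have pow: "\<exists>k. w = e ^ k" if "w ^ n = 1" for w
 proof -
  have "w \<in> (\<lambda>k. cis (2 * pi * real k / real n)) ` {..<n}"
   using Complex.bij_betw_roots_unity[OF n] that by (simp add: bij_betw_def)
  then obtain k where "w = cis (2 * pi * real k / real n)" by blast
  moreover have "real k * (2 * pi / real n) = 2 * pi * real k / real n" by simp
  ultimately have "w = e ^ k" by (simp only: e_def Complex.DeMoivre)
  then show ?thesis ..
 qed
 have en: "e ^ n = 1" using n by (simp add: e_def Complex.DeMoivre)
 have "e \<in> Qab"
 proof (rule QabI)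
  have "poly (Polynomial.monom 1 n - 1) e = 0" using en by (simp add: poly_monom)
  moreover have "Polynomial.monom 1 n - 1 \<noteq> (0::complex poly)"
  proof
   assume "Polynomial.monom 1 n - 1 = (0::complex poly)"
   then have "coeff (Polynomial.monom 1 n - 1 :: complex poly) n = 0" by simp
   then show False using n by (simp add: coeff_1)
  qed
  moreover have "coeff (Polynomial.monom 1 n - 1 :: complex poly) i \<in> \<int>" for i
   by (simp add: coeff_1)
  ultimately show eQ: "e \<in> Qbar" unfolding Qbar_def mem_Collect_eq by (intro algebraicI)
  have epow: "\<exists>k. \<sigma> e = e ^ k" if s: "\<sigma> \<in> carrier G_Q" for \<sigma>
  proof (rule pow)
   show "\<sigma> e ^ n = 1" using gal_power[OF Qbar s eQ, of n] en gal_1[OF Qbar s] by simp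
  qed
  fix \<sigma> \<tau> assume s: "\<sigma> \<in> carrier G_Q" "\<tau> \<in> carrier G_Q"
  obtain k l where "\<sigma> e = e ^ k" "\<tau> e = e ^ l" using epow s by meson
  then show "\<sigma> (\<tau> e) = \<tau> (\<sigma> e)"
   by (simp add: gal_power[OF Qbar s(1) eQ] gal_power[OF Qbar s(2) eQ] flip: power_mult) (simp add: mult.commute)
 qed
 then show ?thesis using pow[OF z] subfield_power[OF Qab] by auto
qed

lemma restrict_Qab:
 assumes g: "g \<in> carrier G_Q" shows "restrict g Qab \<in> carrier Gab"
proof -
 have "bij_betw g Qab Qab"
 proof (rule bij_betw_imageI)
  show "inj_on g Qab" by (rule inj_onI) (use gal_inj[OF g] in auto)
  show "g ` Qab = Qab"
  proof (intro equalityI subsetI)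
   fix y assume y: "y \<in> Qab"
   then have "y = g ((ginv g) y)" using g by simp
   then show "y \<in> g ` Qab" using GQ_Qab[OF GQ.inv_closed[OF g] y] by blast
  qed (use g in auto)
 qed
 moreover have "bij_betw (restrict g Qab) Qab Qab \<longleftrightarrow> bij_betw g Qab Qab" by (rule bij_betw_cong) simp
 ultimately show ?thesis
  using g subfieldD(3,4)[OF Qab] unfolding carrier_gal[of "restrict g Qab"]
  by (auto simp: gal_add gal_times)
qed

lemma Gab_lift:
 assumes "\<sigma> \<in> carrier Gab"
 obtains g where "g \<in> carrier G_Q" "restrict g Qab = \<sigma>"
proof -
 obtain g where g: "g \<in> carrier G_Q" "\<And>x. x \<in> Qab ==> g x = \<sigma> x"
  using gal_extend[OF Qab Qab_subset assms] by blast
 have "restrict g Qab = \<sigma>"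
  by (rule gal_eqI[OF restrict_Qab[OF g(1)] assms]) (simp add: g)
 then show thesis using that g by blast
qed

lemma restrict_Qab_mult:
 assumes "g \<in> carrier G_Q" "h \<in> carrier G_Q"
 shows "restrict (g \<cdot> h) Qab = restrict g Qab \<otimes>\<^bsub>Gab\<^esub> restrict h Qab"
 using assms by (auto simp: gal_mult[OF restrict_Qab restrict_Qab] compose_def)

lemma comm_group_Gab: "comm_group Gab"
proof -
 interpret group Gab by (rule group_gal[OF Qab])
 show ?thesis
 proof (rule group_comm_groupI)
  fix \<sigma> \<tau> assume s: "\<sigma> \<in> carrier Gab" "\<tau> \<in> carrier Gab"
  obtain g where g: "g \<in> carrier G_Q" "restrict g Qab = \<sigma>" using Gab_lift[OF s(1)] .
  obtain h where h: "h \<in> carrier G_Q" "restrict h Qab = \<tau>" using Gab_lift[OF s(2)] .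
  show "\<sigma> \<otimes>\<^bsub>Gab\<^esub> \<tau> = \<tau> \<otimes>\<^bsub>Gab\<^esub> \<sigma>"
   using g h by (auto simp: gal_mult s compose_def Qab_comm intro!: restrict_ext)
 qed
qed

section \<open>Approximation by subgroups\<close>

lemma prod_root_poly_gal:
 assumes g: "g \<in> carrier G_Q" and "finite S" "S \<subseteq> Qbar"
 shows "coeff (\<Prod>y\<in>S. [:-y, 1:]) i \<in> Qbar \<and>
  g (coeff (\<Prod>y\<in>S. [:-y, 1:]) i) = coeff (\<Prod>y\<in>g ` S. [:-y, 1:]) i"
 using assms(2,3)
proof (induction S arbitrary: i rule: finite_induct)
 case empty
 then show ?case using g by (auto simp: coeff_1 subfieldD[OF Qbar] gal_0[OF Qbar] gal_1[OF Qbar])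
next
 case (insert y S)
 have ny: "g y \<notin> g ` S" using insert gal_inj[OF g] by auto
 have yQ: "y \<in> Qbar" using insert by auto
 have IH: "coeff (\<Prod>y\<in>S. [:-y, 1:]) i \<in> Qbar"
  "g (coeff (\<Prod>y\<in>S. [:-y, 1:]) i) = coeff (\<Prod>y\<in>g ` S. [:-y, 1:]) i" for i
  using insert by auto
 have c: "coeff ([:-y, 1:] * p) i = (if i = 0 then 0 else coeff p (i - 1)) - y * coeff p i" for y and p :: "complex poly"
  by (cases i) auto
 show ?case
  unfolding image_insert prod.insert[OF insert(1,2)] prod.insert[OF finite_imageI[OF insert(1)] ny] c
  using yQ IH g by (auto simp: subfieldD[OF Qbar] subfield_diff[OF Qbar] gal_diff[OF Qbar] gal_times gal_0[OF Qbar])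
qed

lemma finite_tuples:
 assumes "finite Z" "Z \<subseteq> Qbar"
 shows "finite {restrict g Z |g. g \<in> carrier G_Q}"
proof (rule finite_subset)
 show "{restrict g Z |g. g \<in> carrier G_Q} \<subseteq> PiE Z (\<lambda>x. {g x |g. g \<in> carrier G_Q})" by auto
 show "finite (PiE Z (\<lambda>x. {g x |g. g \<in> carrier G_Q}))"
  using assms finite_conjugates by (intro finite_PiE) auto
qed

text \<open>A primitive element for the finite set \<open>Z\<close>.\<close>

lemma separating_element:
 assumes Z: "finite Z" "Z \<subseteq> Qbar"
 obtains l where "l \<in> Qbar" "\<And>g h z. g \<in> carrier G_Q ==> h \<in> carrier G_Q ==> g l = h l ==> z \<in> Z ==> g z = h z"
proof -
 obtain f where f: "bij_betw f {..<card Z} Z"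
  using ex_bij_betw_nat_finite[OF Z(1)] by (auto simp: lessThan_atLeast0)
 define T where "T = {restrict g Z |g. g \<in> carrier G_Q}"
 \<comment> \<open>The value of \<open>P s t\<close> at \<open>c\<close> is the difference of the
   values that \<open>s\<close> and \<open>t\<close> give to \<open>l\<close>, the combination of
   the elements of \<open>Z\<close> with coefficients \<open>c ^ i\<close>. There are finitely many
   restrictions to \<open>Z\<close>, so some natural number \<open>c\<close> is a zero of none of
   these polynomials.\<close>
 define P where "P s t = (\<Sum>i<card Z. Polynomial.monom (s (f i) - t (f i)) i)" for s t :: "complex \<Rightarrow> complex"
 have Pnz: "P s t \<noteq> 0" if "s \<in> T" "t \<in> T" "s \<noteq> t" for s t
 proof
  assume 0: "P s t = 0"
  have "s z = t z" if z: "z \<in> Z" for z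
  proof -
   obtain i where i: "i < card Z" "z = f i" using f z by (auto simp: bij_betw_def)
   have "coeff (P s t) i = s (f i) - t (f i)" using i(1) by (simp add: P_def coeff_sum)
   then show ?thesis using 0 i by simp
  qed
  then have "s = t" using that(1,2) unfolding T_def by (auto intro!: extensionalityI[of _ Z])
  with that(3) show False ..
 qed
 have "finite (\<Union>(s, t)\<in>{(s, t). s \<in> T \<and> t \<in> T \<and> s \<noteq> t}. {c. poly (P s t) (of_nat c) = 0})" (is "finite ?B")
 proof (rule finite_UN_I)
  have "finite T" unfolding T_def by (rule finite_tuples[OF Z])
  then show "finite {(s, t). s \<in> T \<and> t \<in> T \<and> s \<noteq> t}"
   by (intro finite_subset[of "{(s, t). s \<in> T \<and> t \<in> T \<and> s \<noteq> t}" "T \<times> T"]) auto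
  fix st assume "st \<in> {(s, t). s \<in> T \<and> t \<in> T \<and> s \<noteq> t}"
  then obtain s t where st: "st = (s, t)" "P s t \<noteq> 0" using Pnz by auto
  have "finite (of_nat -` {z::complex. poly (P s t) z = 0} :: nat set)"
   by (rule finite_vimageI[OF poly_roots_finite[OF st(2)]]) (simp add: inj_of_nat)
  then show "finite (case st of (s, t) \<Rightarrow> {c. poly (P s t) (of_nat c) = 0})"
   by (simp add: st vimage_def)
 qed
 then obtain c where c: "c \<notin> ?B" using ex_new_if_finite[OF infinite_UNIV_nat] by blast
 define l where "l = (\<Sum>i<card Z. f i * of_nat c ^ i)"
 have fQ: "f i \<in> Qbar" if "i < card Z" for i using f that Z by (auto simp: bij_betw_def)
 have gl: "g l = (\<Sum>i<card Z. g (f i) * of_nat c ^ i)" if g: "g \<in> carrier G_Q" for g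
 proof -
  have "f i * of_nat c ^ i \<in> Qbar" if "i < card Z" for i
   using fQ[OF that] by (intro subfieldD(4)[OF Qbar] subfield_power[OF Qbar] subfield_of_nat[OF Qbar])
  then have "g l = (\<Sum>i<card Z. g (f i * of_nat c ^ i))"
   unfolding l_def by (intro gal_sum[OF Qbar g]) simp
  also have "\<dots> = (\<Sum>i<card Z. g (f i) * of_nat c ^ i)"
   using fQ gal_times[OF g] gal_power[OF Qbar g] gal_of_nat[OF Qbar g]
    subfield_power[OF Qbar] subfield_of_nat[OF Qbar] by (intro sum.cong refl) simp
  finally show ?thesis .
 qed
 show thesis
 proof (rule that)
  show "l \<in> Qbar" unfolding l_def
   by (intro subfield_sum[OF Qbar] subfieldD(4)[OF Qbar] subfield_power[OF Qbar] subfield_of_nat[OF Qbar]) (auto simp: fQ)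
  fix g h z assume *: "g \<in> carrier G_Q" "h \<in> carrier G_Q" "g l = h l" "z \<in> Z"
  have fZ: "f i \<in> Z" if "i < card Z" for i using f that by (auto simp: bij_betw_def)
  have "poly (P (restrict g Z) (restrict h Z)) (of_nat c) = g l - h l"
   using *(1,2) fZ by (simp add: P_def gl poly_sum poly_monom sum_subtractf left_diff_distrib)
  then have "restrict g Z = restrict h Z" using c * unfolding T_def by auto
  then show "g z = h z" using *(4) by (metis restrict_apply')
 qed
qed

text \<open>An automorphism that fixes sufficiently many
 elements of the fixed field of \<open>N\<close> agrees with an element of \<open>N\<close> on a given finite set.  The
 elements to be fixed are the coefficients of the polynomial whose roots are the \<open>N\<close>-conjugates of a
 primitive element.\<close>

lemma subgroup_approx:
 assumes N: "subgroup N G_Q" and Z: "finite Z" "Z \<subseteq> Qbar"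
 shows "\<exists>F. finite F \<and> F \<subseteq> {x\<in>Qbar. \<forall>n\<in>N. n x = x} \<and>
  (\<forall>g\<in>carrier G_Q. (\<forall>x\<in>F. g x = x) \<longrightarrow> (\<exists>n\<in>N. \<forall>z\<in>Z. g z = n z))"
proof -
 have NG: "N \<subseteq> carrier G_Q" using N by (rule subgroup.subset)
 obtain l where lQ: "l \<in> Qbar"
  and sep: "\<And>g h z. g \<in> carrier G_Q ==> h \<in> carrier G_Q ==> g l = h l ==> z \<in> Z ==> g z = h z"
  using separating_element[OF Z] by blast
 define S where "S = {n l |n. n \<in> N}"
 have S: "finite S" "S \<subseteq> Qbar"
  using finite_subset[OF _ finite_conjugates[OF lQ], of S] NG lQ by (auto simp: S_def)
 have "l = \<one>\<^bsub>G_Q\<^esub> l" using lQ by simp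
 then have lS: "l \<in> S" using subgroup.one_closed[OF N] unfolding S_def by blast
 have NS: "n ` S = S" if n: "n \<in> N" for n
 proof (rule endo_inj_surj[OF S(1)])
  show "n ` S \<subseteq> S"
  proof
   fix y assume "y \<in> n ` S"
   then obtain m where m: "m \<in> N" "y = n (m l)" by (auto simp: S_def)
   then have "y = (n \<cdot> m) l" using n NG lQ by (simp add: subset_iff)
   then show "y \<in> S" using subgroup.m_closed[OF N n m(1)] by (auto simp: S_def)
  qed
  show "inj_on n S" using gal_inj n NG S by (intro inj_onI) (metis subsetD)
 qed
 define p where "p = (\<Prod>y\<in>S. [:-y, 1:])"
 have p_root: "poly (\<Prod>y\<in>A. [:-y, 1:]) x = 0 \<longleftrightarrow> x \<in> A" if "finite A" for A and x :: complex
  using that by (simp add: poly_prod prod_zero_iff)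
 define F where "F = coeff p ` {..degree p}"
 show ?thesis
 proof (intro exI[of _ F] conjI ballI impI)
  show "finite F" by (simp add: F_def)
  show "F \<subseteq> {x\<in>Qbar. \<forall>n\<in>N. n x = x}"
  proof
   fix x assume "x \<in> F"
   then obtain i where x: "x = coeff p i" by (auto simp: F_def)
   have "x \<in> Qbar" using prod_root_poly_gal[OF GQ.one_closed S, of i] by (simp add: x p_def)
   moreover have "n x = x" if "n \<in> N" for n
   proof -
    have "n \<in> carrier G_Q" using that NG by blast
    from prod_root_poly_gal[OF this S, of i] show ?thesis by (simp only: x p_def NS[OF that])
   qed
   ultimately show "x \<in> {x\<in>Qbar. \<forall>n\<in>N. n x = x}" by blast
  qed
  fix g assume g: "g \<in> carrier G_Q" and fx: "\<forall>x\<in>F. g x = x"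
  have "(\<Prod>y\<in>g ` S. [:-y, 1:]) = p"
  proof (rule poly_eqI)
   fix i
   show "coeff (\<Prod>y\<in>g ` S. [:-y, 1:]) i = coeff p i"
   proof (cases "i \<le> degree p")
    case True
    then show ?thesis using prod_root_poly_gal[OF g S, of i] bspec[OF fx, of "coeff p i"] by (simp add: p_def F_def)
   next
    case False
    then have "coeff p i = 0" by (simp add: coeff_eq_0)
    then show ?thesis using prod_root_poly_gal[OF g S, of i] gal_0[OF Qbar g] by (simp add: p_def)
   qed
  qed
  then have "g l \<in> S"
   using p_root[OF S(1), of "g l"] p_root[OF finite_imageI[OF S(1), of g], of "g l"] lS by (simp add: p_def)
  then obtain n where n: "n \<in> N" "g l = n l" by (auto simp: S_def)
  have "n \<in> carrier G_Q" using n NG by blast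
  from sep[OF g this n(2)] n(1) show "\<exists>n\<in>N. \<forall>z\<in>Z. g z = n z" by blast
 qed
qed

section \<open>The Krull topology\<close>

lemma topspace_krull [simp]: "topspace (krull K) = carrier (gal K)"
 by (auto simp: krull_def PiE_iff carrier_gal extensional_def)

lemma openin_krull:
 "openin (krull K) U \<longleftrightarrow> U \<subseteq> carrier (gal K) \<and>
  (\<forall>\<sigma>\<in>U. \<exists>F. finite F \<and> F \<subseteq> K \<and> (\<forall>\<tau>\<in>carrier (gal K). (\<forall>x\<in>F. \<tau> x = \<sigma> x) \<longrightarrow> \<tau> \<in> U))"
  (is "_ \<longleftrightarrow> _ \<and> ?R")
proof safe
 fix \<sigma> assume U: "openin (krull K) U"
 then show "\<sigma> \<in> carrier (gal K)" if "\<sigma> \<in> U" using openin_subset[OF U] that by auto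
 assume \<sigma>: "\<sigma> \<in> U"
 obtain T where T: "openin (product_topology (\<lambda>_. discrete_topology K) K) T" "U = T \<inter> carrier (gal K)"
  using U by (auto simp: krull_def openin_subtopology)
 then obtain V where V: "finite {i\<in>K. V i \<noteq> K}" "\<sigma> \<in> PiE K V" "PiE K V \<subseteq> T"
  using \<sigma> unfolding openin_product_topology_alt by auto
 have "\<tau> \<in> U" if "\<tau> \<in> carrier (gal K)" "\<forall>x\<in>{i\<in>K. V i \<noteq> K}. \<tau> x = \<sigma> x" for \<tau>
 proof -
  have "\<tau> x \<in> V x" if "x \<in> K" for x
   using that V(2) \<open>\<forall>x\<in>_. _\<close> gal_closed[OF \<open>\<tau> \<in> _\<close> that] by (cases "V x = K") (auto simp: PiE_iff)
  then have "\<tau> \<in> PiE K V" using that(1) unfolding PiE_iff carrier_gal by blast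
  then show ?thesis using V(3) T(2) that(1) by blast
 qed
 then show "\<exists>F. finite F \<and> F \<subseteq> K \<and> (\<forall>\<tau>\<in>carrier (gal K). (\<forall>x\<in>F. \<tau> x = \<sigma> x) \<longrightarrow> \<tau> \<in> U)"
  using V(1) by (intro exI[of _ "{i\<in>K. V i \<noteq> K}"]) auto
next
 assume U: "U \<subseteq> carrier (gal K)" and ?R
 then obtain F where F: "\<And>\<sigma>. \<sigma> \<in> U ==> finite (F \<sigma>) \<and> F \<sigma> \<subseteq> K \<and>
   (\<forall>\<tau>\<in>carrier (gal K). (\<forall>x\<in>F \<sigma>. \<tau> x = \<sigma> x) \<longrightarrow> \<tau> \<in> U)" by metis
 define B where "B \<sigma> = PiE K (\<lambda>x. if x \<in> F \<sigma> then {\<sigma> x} else K)" for \<sigma> :: "complex \<Rightarrow> complex"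
 have "openin (product_topology (\<lambda>_. discrete_topology K) K) (B \<sigma>)" if "\<sigma> \<in> U" for \<sigma>
  unfolding B_def
 proof (rule product_topology_basis)
  show "finite {i. (if i \<in> F \<sigma> then {\<sigma> i} else K) \<noteq> topspace (discrete_topology K)}"
   using F[OF that] by (auto intro: finite_subset[of _ "F \<sigma>"])
  have FK: "F \<sigma> \<subseteq> K" using F[OF that] by (elim conjE)
  have s: "\<sigma> \<in> carrier (gal K)" using U that by (rule subsetD)
  have "\<sigma> x \<in> K" if "x \<in> F \<sigma>" for x using FK that by (intro gal_closed[OF s]) (rule subsetD)
  then show "openin (discrete_topology K) (if i \<in> F \<sigma> then {\<sigma> i} else K)" for i by auto
 qed
 then have "openin (product_topology (\<lambda>_. discrete_topology K) K) (\<Union>\<sigma>\<in>U. B \<sigma>)" by blast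
 moreover have "U = (\<Union>\<sigma>\<in>U. B \<sigma>) \<inter> carrier (gal K)"
 proof (intro equalityI subsetI)
  fix \<sigma> assume "\<sigma> \<in> U"
  then have "\<sigma> \<in> B \<sigma>" using U by (auto simp: B_def PiE_iff carrier_gal bij_betw_def)
  then show "\<sigma> \<in> (\<Union>\<sigma>\<in>U. B \<sigma>) \<inter> carrier (gal K)" using U \<open>\<sigma> \<in> U\<close> by blast
 next
  fix \<tau> assume "\<tau> \<in> (\<Union>\<sigma>\<in>U. B \<sigma>) \<inter> carrier (gal K)"
  then obtain \<sigma> where s: "\<sigma> \<in> U" "\<tau> \<in> B \<sigma>" "\<tau> \<in> carrier (gal K)" by blast
  have "\<tau> x = \<sigma> x" if "x \<in> F \<sigma>" for x
   using s(2) that F[OF s(1)] by (fastforce simp: B_def PiE_iff)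
  then show "\<tau> \<in> U" using F[OF s(1)] s(3) by blast
 qed
 ultimately show "openin (krull K) U" unfolding krull_def openin_subtopology by blast
qed

lemma openin_krull_agree:
 "F \<subseteq> K ==> finite F ==> openin (krull K) {\<tau>\<in>carrier (gal K). \<forall>x\<in>F. \<tau> x = \<sigma> x}"
 unfolding openin_krull by (auto intro!: exI[of _ F])

lemma in_closure_krull:
 assumes "A \<subseteq> carrier (gal K)"
 shows "g \<in> krull K closure_of A \<longleftrightarrow> g \<in> carrier (gal K) \<and> (\<forall>F. finite F \<longrightarrow> F \<subseteq> K \<longrightarrow> (\<exists>a\<in>A. \<forall>x\<in>F. a x = g x))"
proof (intro iffI conjI allI impI)
 assume g: "g \<in> krull K closure_of A"
 then show "g \<in> carrier (gal K)" by (simp add: in_closure_of)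
 fix F assume F: "finite F" "F \<subseteq> K"
 define T where "T = {\<tau>\<in>carrier (gal K). \<forall>x\<in>F. \<tau> x = g x}"
 have "g \<in> T" "openin (krull K) T"
  using g openin_krull_agree[OF F(2,1), of g] by (auto simp: in_closure_of T_def)
 moreover have "\<forall>T. g \<in> T \<and> openin (krull K) T \<longrightarrow> (\<exists>y. y \<in> A \<and> y \<in> T)"
  using g by (simp add: in_closure_of)
 ultimately obtain a where "a \<in> A" "a \<in> T" by blast
 then show "\<exists>a\<in>A. \<forall>x\<in>F. a x = g x" unfolding T_def by blast
next
 assume *: "g \<in> carrier (gal K) \<and> (\<forall>F. finite F \<longrightarrow> F \<subseteq> K \<longrightarrow> (\<exists>a\<in>A. \<forall>x\<in>F. a x = g x))"
 show "g \<in> krull K closure_of A"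
  unfolding in_closure_of
 proof (intro conjI allI impI)
  show "g \<in> topspace (krull K)" using * by simp
  fix T assume "g \<in> T \<and> openin (krull K) T"
  then obtain F where F: "finite F" "F \<subseteq> K" "\<forall>\<tau>\<in>carrier (gal K). (\<forall>x\<in>F. \<tau> x = g x) \<longrightarrow> \<tau> \<in> T"
   unfolding openin_krull by blast
  then obtain a where "a \<in> A" "\<forall>x\<in>F. a x = g x" using * by blast
  then show "\<exists>y. y \<in> A \<and> y \<in> T" using F(3) assms by blast
 qed
qed

section \<open>Closed subgroups of the absolute Galois group\<close>

lemma subgroup_closure:
 assumes N: "subgroup N G_Q"
 shows "subgroup (krull Qbar closure_of N) G_Q"
proof -
 have NG: "N \<subseteq> carrier G_Q" using N by (rule subgroup.subset)
 note cl = in_closure_krull[OF NG]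
 show ?thesis
 proof (rule GQ.subgroupI)
  show "krull Qbar closure_of N \<subseteq> carrier G_Q" using cl by blast
  have "\<one>\<^bsub>G_Q\<^esub> \<in> krull Qbar closure_of N"
   unfolding cl using subgroup.one_closed[OF N] by auto
  then show "krull Qbar closure_of N \<noteq> {}" by blast
 next
  fix g assume g: "g \<in> krull Qbar closure_of N"
  then have gG: "g \<in> carrier G_Q" using cl by blast
  have "\<exists>a\<in>N. \<forall>x\<in>F. a x = (ginv g) x" if F: "finite F" "F \<subseteq> Qbar" for F
  proof -
   \<comment> \<open>Agreement of \<open>a\<close> and \<open>g\<close> on the \<open>ginv g\<close>
     image of \<open>F\<close> becomes agreement of their inverses on \<open>F\<close>.\<close>
   have "finite ((ginv g) ` F)" "(ginv g) ` F \<subseteq> Qbar" using F gG by auto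
   then obtain a where a: "a \<in> N" "\<forall>x\<in>(ginv g) ` F. a x = g x" using g cl by blast
   have aG: "a \<in> carrier G_Q" using a NG by blast
   have "(ginv a) x = (ginv g) x" if x: "x \<in> F" for x
   proof -
    have xQ: "x \<in> Qbar" using x F by blast
    have "a ((ginv g) x) = x" using a(2) x gG xQ by simp
    then have "(ginv a) x = (ginv a) (a ((ginv g) x))" by simp
    also have "\<dots> = (ginv g) x" using aG gG xQ by (intro GQ_inv_apply) auto
    finally show ?thesis .
   qed
   then show ?thesis using subgroup.m_inv_closed[OF N a(1)] by blast
  qed
  then show "ginv g \<in> krull Qbar closure_of N" unfolding cl using gG by simp
 next
  fix g h assume "g \<in> krull Qbar closure_of N" "h \<in> krull Qbar closure_of N"
  then have g: "g \<in> carrier G_Q" "\<And>F. finite F ==> F \<subseteq> Qbar ==> \<exists>a\<in>N. \<forall>x\<in>F. a x = g x"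
   and h: "h \<in> carrier G_Q" "\<And>F. finite F ==> F \<subseteq> Qbar ==> \<exists>a\<in>N. \<forall>x\<in>F. a x = h x"
   unfolding cl by blast+
  have "\<exists>a\<in>N. \<forall>x\<in>F. a x = (g \<cdot> h) x" if F: "finite F" "F \<subseteq> Qbar" for F
  proof -
   obtain b where b: "b \<in> N" "\<forall>x\<in>F. b x = h x" using h(2)[OF F] by blast
   have "finite (h ` F)" "h ` F \<subseteq> Qbar" using F h(1) by auto
   then obtain a where a: "a \<in> N" "\<forall>x\<in>h ` F. a x = g x" using g(2) by blast
   have "a \<in> carrier G_Q" "b \<in> carrier G_Q" using a b NG by blast+
   then have "\<forall>x\<in>F. (a \<cdot> b) x = (g \<cdot> h) x" using a(2) b(2) g(1) h(1) F(2) by auto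
   then show ?thesis using subgroup.m_closed[OF N a(1) b(1)] by blast
  qed
  then show "g \<cdot> h \<in> krull Qbar closure_of N" unfolding cl using g(1) h(1) by simp
 qed
qed

lemma normal_closure:
 assumes N: "N \<lhd> G_Q"
 shows "krull Qbar closure_of N \<lhd> G_Q"
proof (rule GQ.normal_invI)
 have sN: "subgroup N G_Q" using N by (rule normal_imp_subgroup)
 then have NG: "N \<subseteq> carrier G_Q" by (rule subgroup.subset)
 note cl = in_closure_krull[OF NG]
 show "subgroup (krull Qbar closure_of N) G_Q" by (rule subgroup_closure[OF sN])
 fix h g assume h: "h \<in> carrier G_Q" and "g \<in> krull Qbar closure_of N"
 then have g: "g \<in> carrier G_Q" "\<And>F. finite F ==> F \<subseteq> Qbar ==> \<exists>a\<in>N. \<forall>x\<in>F. a x = g x"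
  unfolding cl by blast+
 have "\<exists>a\<in>N. \<forall>x\<in>F. a x = (h \<cdot> g \<cdot> ginv h) x" if F: "finite F" "F \<subseteq> Qbar" for F
 proof -
  have "finite ((ginv h) ` F)" "(ginv h) ` F \<subseteq> Qbar" using F h by auto
  then obtain a where a: "a \<in> N" "\<forall>x\<in>(ginv h) ` F. a x = g x" using g(2) by blast
  have "a \<in> carrier G_Q" using a NG by blast
  then have "\<forall>x\<in>F. (h \<cdot> a \<cdot> ginv h) x = (h \<cdot> g \<cdot> ginv h) x"
   using a(2) g(1) h F(2) by auto
  then show ?thesis using normal.inv_op_closed2[OF N h a(1)] by blast
 qed
 then show "h \<cdot> g \<cdot> ginv h \<in> krull Qbar closure_of N" unfolding cl using g(1) h by simp
qed

text \<open>The stabiliser of \<open>w\<close> is a subgroup, and membership in the closure can be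
  tested on the finite set consisting of \<open>w\<close> alone.\<close>

lemma stabilizer_closed_subgroup:
 assumes S: "S \<subseteq> carrier G_Q" and w: "w \<in> Qbar" "\<And>s. s \<in> S ==> s w = w"
  and g: "g \<in> closed_subgroup_generated S"
 shows "g w = w"
proof -
 have "subgroup {g\<in>carrier G_Q. g w = w} G_Q"
 proof (rule GQ.subgroupI)
  show "{g\<in>carrier G_Q. g w = w} \<noteq> {}" using w by (auto intro!: exI[of _ "\<one>\<^bsub>G_Q\<^esub>"])
  show "ginv g \<in> {g\<in>carrier G_Q. g w = w}" if "g \<in> {g\<in>carrier G_Q. g w = w}" for g
  proof -
   from that have g: "g \<in> carrier G_Q" "g w = w" by simp_all
   have "(ginv g) w = w" using GQ_inv_apply(1)[OF g(1) w(1)] by (simp only: g(2))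
   then show ?thesis using g(1) by simp
  qed
 qed (use w in auto)
 then have "generate G_Q S \<subseteq> {g\<in>carrier G_Q. g w = w}"
  using S w by (intro GQ.generate_subgroup_incl) auto
 moreover obtain a where "a \<in> generate G_Q S" "\<forall>x\<in>{w}. a x = g x"
  using g w(1) unfolding closed_subgroup_generated_def in_closure_krull[OF GQ.generate_incl[OF S]] by blast
 ultimately show ?thesis by auto
qed

lemma closed_subgroup_generated_subset:
 assumes S: "S \<subseteq> carrier G_Q" shows "S \<subseteq> closed_subgroup_generated S"
proof
 fix s assume s: "s \<in> S"
 then have "s \<in> generate G_Q S" by (rule generate.incl)
 then show "s \<in> closed_subgroup_generated S"
  unfolding closed_subgroup_generated_def in_closure_krull[OF GQ.generate_incl[OF S]] using s S by auto
qed

lemma commutator_closed [simp]: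
 "\<sigma> \<in> carrier G_Q ==> \<tau> \<in> carrier G_Q ==> commutator G_Q \<sigma> \<tau> \<in> carrier G_Q"
 by (simp add: commutator_def)

lemma commutator_apply:
 assumes "\<sigma> \<in> carrier G_Q" "\<tau> \<in> carrier G_Q" "x \<in> Qbar"
 shows "commutator G_Q \<sigma> \<tau> x = \<sigma> (\<tau> ((ginv \<sigma>) ((ginv \<tau>) x)))"
 using assms by (simp add: commutator_def)

abbreviation commutators :: "(complex \<Rightarrow> complex) set" where
 "commutators \<equiv> {commutator G_Q \<sigma> \<tau> |\<sigma> \<tau>. \<sigma> \<in> carrier G_Q \<and> \<tau> \<in> carrier G_Q}"

abbreviation eps_generators :: "(complex \<Rightarrow> complex) set" where
 "eps_generators \<equiv> {commutator G_Q \<sigma> \<tau> [^]\<^bsub>G_Q\<^esub> (2::nat) |\<sigma> \<tau>. \<sigma> \<in> carrier G_Q \<and> \<tau> \<in> carrier G_Q} \<union>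
   {commutator G_Q \<sigma> (commutator G_Q \<tau> \<eta>) |\<sigma> \<tau> \<eta>.
    \<sigma> \<in> carrier G_Q \<and> \<tau> \<in> carrier G_Q \<and> \<eta> \<in> carrier G_Q}"

lemma commutator_mem: "\<sigma> \<in> carrier G_Q ==> \<tau> \<in> carrier G_Q ==> commutator G_Q \<sigma> \<tau> \<in> commutators"
 by blast

lemma commutators_subset: "commutators \<subseteq> carrier G_Q"
 and eps_generators_subset: "eps_generators \<subseteq> carrier G_Q"
 by auto

lemma Qab_commutator_fixed:
 assumes "x \<in> Qbar" "\<And>g. g \<in> commutators ==> g x = x"
 shows "x \<in> Qab"
proof (rule QabI[OF assms(1)])
 fix \<sigma> \<tau> assume s: "\<sigma> \<in> carrier G_Q" "\<tau> \<in> carrier G_Q"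
 have "commutator G_Q (ginv \<sigma>) (ginv \<tau>) x = x"
  by (intro assms(2) commutator_mem GQ.inv_closed s)
 then have "(ginv \<sigma>) ((ginv \<tau>) (\<sigma> (\<tau> x))) = x" using s assms(1) by (simp add: commutator_apply)
 then have "\<tau> (\<sigma> ((ginv \<sigma>) ((ginv \<tau>) (\<sigma> (\<tau> x))))) = \<tau> (\<sigma> x)" by simp
 then show "\<sigma> (\<tau> x) = \<tau> (\<sigma> x)" using s assms(1) by simp
qed

lemma commutator_fixes_Qab: "x \<in> Qab ==> g \<in> commutators ==> g x = x"
proof clarify
 fix \<sigma> \<tau> assume x: "x \<in> Qab" and s: "\<sigma> \<in> carrier G_Q" "\<tau> \<in> carrier G_Q"
 have "(ginv \<sigma>) ((ginv \<tau>) x) = (ginv \<tau>) ((ginv \<sigma>) x)"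
  using Qab_comm[OF x] s by simp
 then show "commutator G_Q \<sigma> \<tau> x = x" using s x by (simp add: commutator_apply)
qed

text \<open>The Galois correspondence for \<open>comm_G\<close>. An automorphism trivial on
  \<open>Qab\<close> agrees on any finite set with an element of the generated subgroup, because the
  set \<open>F\<close> supplied by \<open>subgroup_approx\<close> is fixed by all commutators and
  hence lies in \<open>Qab\<close>.\<close>

lemma comm_G_eq: "comm_G = {g\<in>carrier G_Q. \<forall>x\<in>Qab. g x = x}"
proof (intro equalityI subsetI)
 fix g assume g: "g \<in> comm_G"
 then have "g \<in> carrier G_Q"
  unfolding comm_G_def closed_subgroup_generated_def in_closure_krull[OF GQ.generate_incl[OF commutators_subset]] by blast
 moreover have "g x = x" if "x \<in> Qab" for x
  by (rule stabilizer_closed_subgroup[OF commutators_subset])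
   (use that g commutator_fixes_Qab in \<open>simp_all add: comm_G_def\<close>)
 ultimately show "g \<in> {g\<in>carrier G_Q. \<forall>x\<in>Qab. g x = x}" by blast
next
 fix g assume g: "g \<in> {g\<in>carrier G_Q. \<forall>x\<in>Qab. g x = x}"
 show "g \<in> comm_G"
  unfolding comm_G_def closed_subgroup_generated_def in_closure_krull[OF GQ.generate_incl[OF commutators_subset]]
 proof (intro conjI allI impI)
  show gG: "g \<in> carrier G_Q" using g by blast
  fix Z assume Z: "finite Z" "Z \<subseteq> Qbar"
  obtain F where F: "F \<subseteq> {x\<in>Qbar. \<forall>n\<in>generate G_Q commutators. n x = x}"
   "\<forall>g\<in>carrier G_Q. (\<forall>x\<in>F. g x = x) \<longrightarrow> (\<exists>n\<in>generate G_Q commutators. \<forall>z\<in>Z. g z = n z)"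
   using subgroup_approx[OF GQ.generate_is_subgroup[OF commutators_subset] Z] by (elim exE conjE)
  have "F \<subseteq> Qab"
  proof
   fix x assume "x \<in> F"
   then have x: "x \<in> Qbar" "\<forall>n\<in>generate G_Q commutators. n x = x" using F(1) by blast+
   show "x \<in> Qab"
    by (rule Qab_commutator_fixed[OF x(1)], rule bspec[OF x(2)], rule generate.incl)
  qed
  have "\<exists>n\<in>generate G_Q commutators. \<forall>z\<in>Z. g z = n z"
   by (rule bspec[OF F(2) gG, THEN mp]) (use g \<open>F \<subseteq> Qab\<close> in blast)
  then obtain n where "n \<in> generate G_Q commutators" "\<forall>z\<in>Z. g z = n z" by (elim bexE)
  then show "\<exists>a\<in>generate G_Q commutators. \<forall>x\<in>Z. a x = g x" by (intro bexI[of _ n]) auto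
 qed
qed

lemma subgroup_comm_G: "subgroup comm_G G_Q"
 unfolding comm_G_def closed_subgroup_generated_def
 by (rule subgroup_closure[OF GQ.generate_is_subgroup[OF commutators_subset]])

lemma comm_G_fixed_Qab:
 assumes "x \<in> Qbar" "\<And>g. g \<in> comm_G ==> g x = x" shows "x \<in> Qab"
 using assms closed_subgroup_generated_subset[OF commutators_subset]
 by (intro Qab_commutator_fixed) (auto simp: comm_G_def)

lemma conj_mult:
 assumes "h \<in> carrier G_Q" "x \<in> carrier G_Q" "y \<in> carrier G_Q"
 shows "h \<cdot> (x \<cdot> y) \<cdot> ginv h =
  (h \<cdot> x \<cdot> ginv h) \<cdot> (h \<cdot> y \<cdot> ginv h)"
 by (rule gal_eqI[of _ Qbar]) (use assms in simp_all)

lemma conj_inv: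
 assumes "h \<in> carrier G_Q" "x \<in> carrier G_Q"
 shows "h \<cdot> ginv x \<cdot> ginv h = ginv (h \<cdot> x \<cdot> ginv h)"
 using assms by (simp add: GQ.inv_mult_group GQ.m_assoc)

lemma conj_commutator:
 assumes "h \<in> carrier G_Q" "x \<in> carrier G_Q" "y \<in> carrier G_Q"
 shows "h \<cdot> commutator G_Q x y \<cdot> ginv h =
  commutator G_Q (h \<cdot> x \<cdot> ginv h) (h \<cdot> y \<cdot> ginv h)"
proof -
 have "h \<cdot> (x \<cdot> y \<cdot> ginv x \<cdot> ginv y) \<cdot> ginv h =
  (h \<cdot> x \<cdot> ginv h) \<cdot> (h \<cdot> y \<cdot> ginv h) \<cdot>
  (h \<cdot> ginv x \<cdot> ginv h) \<cdot> (h \<cdot> ginv y \<cdot> ginv h)"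
  by (rule gal_eqI[of _ Qbar]) (use assms in simp_all)
 then show ?thesis unfolding commutator_def conj_inv[OF assms(1,2)] conj_inv[OF assms(1,3)] .
qed

text \<open>Conjugation is compatible with commutators and squares, so it maps each of the two
  families of generators into itself; normality then passes to the closure.\<close>

lemma normal_comm_G_eps: "comm_G_eps \<lhd> G_Q"
 unfolding comm_G_eps_def closed_subgroup_generated_def
proof (rule normal_closure, rule GQ.normal_generateI)
 show "eps_generators \<subseteq> carrier G_Q" by (rule eps_generators_subset)
 fix s h assume s: "s \<in> eps_generators" and h: "h \<in> carrier G_Q"
 have cl: "h \<cdot> x \<cdot> ginv h \<in> carrier G_Q" if "x \<in> carrier G_Q" for x using h that by simp
 consider (a) \<sigma> \<tau> where "\<sigma> \<in> carrier G_Q" "\<tau> \<in> carrier G_Q" "s = commutator G_Q \<sigma> \<tau> [^]\<^bsub>G_Q\<^esub> (2::nat)"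
  | (b) \<sigma> \<tau> \<eta> where "\<sigma> \<in> carrier G_Q" "\<tau> \<in> carrier G_Q" "\<eta> \<in> carrier G_Q" "s = commutator G_Q \<sigma> (commutator G_Q \<tau> \<eta>)"
  using s by blast
 then show "h \<cdot> s \<cdot> ginv h \<in> eps_generators"
 proof cases
  case a
  have "h \<cdot> s \<cdot> ginv h =
   commutator G_Q (h \<cdot> \<sigma> \<cdot> ginv h) (h \<cdot> \<tau> \<cdot> ginv h) [^]\<^bsub>G_Q\<^esub> (2::nat)"
   using a h by (simp add: numeral_2_eq_2 conj_mult flip: conj_commutator)
  then show ?thesis using cl a by blast
 next
  case b
  have "h \<cdot> s \<cdot> ginv h =
   commutator G_Q (h \<cdot> \<sigma> \<cdot> ginv h) (commutator G_Q (h \<cdot> \<tau> \<cdot> ginv h)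
    (h \<cdot> \<eta> \<cdot> ginv h))"
   using b h by (simp add: conj_commutator)
  then show ?thesis using cl b by blast
 qed
qed

lemma comm_G_eps_subset: "comm_G_eps \<subseteq> comm_G"
proof
 fix g assume g: "g \<in> comm_G_eps"
 then have "g \<in> carrier G_Q" using normal_imp_subgroup[OF normal_comm_G_eps] subgroup.subset by blast
 moreover have "g x = x" if x: "x \<in> Qab" for x
 proof (rule stabilizer_closed_subgroup[OF eps_generators_subset Qab_Qbar[OF x]])
  have c: "commutator G_Q \<sigma> \<tau> x = x" if "\<sigma> \<in> carrier G_Q" "\<tau> \<in> carrier G_Q" for \<sigma> \<tau>
   using commutator_fixes_Qab[OF x] that by blast
  show "s x = x" if "s \<in> eps_generators" for s
   using that x by (auto simp: c numeral_2_eq_2)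
  show "g \<in> closed_subgroup_generated eps_generators" using g by (simp add: comm_G_eps_def)
 qed
 ultimately show "g \<in> comm_G" by (simp add: comm_G_eq)
qed

section \<open>Square roots of invariant classes\<close>

text \<open>Invariance of the class of \<open>u = w ^ 2\<close>, expressed through \<open>w\<close>:
  from \<open>g w = a * w\<close> follows \<open>g u = a ^ 2 * u\<close>, and the content is that
  \<open>a\<close> lies in \<open>Qab\<close>.\<close>

definition semi_invariant :: "complex \<Rightarrow> bool" where
 "semi_invariant w \<longleftrightarrow> w \<in> Qbar \<and> w \<noteq> 0 \<and> w\<^sup>2 \<in> Qab \<and> (\<forall>g\<in>carrier G_Q. \<exists>a\<in>Qab. g w = a * w)"

text \<open>Meaningful when \<open>g w\<close> is \<open>w\<close> or \<open>- w\<close>, in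
  particular for \<open>g\<close> in \<open>comm_G\<close> and \<open>w ^ 2\<close> in
  \<open>Qab\<close>; for other \<open>g\<close> the value is a default.\<close>

definition sign_char :: "complex \<Rightarrow> (complex \<Rightarrow> complex) \<Rightarrow> bit" where
 "sign_char w g = (if g w = w then 0 else 1)"

lemma bit_sign_simps [simp]: "bit_sign 0 = 1" "bit_sign 1 = -1"
 by (simp_all add: bit_sign_def)

lemma bit_sign_add: "bit_sign (a + b) = bit_sign a * bit_sign b"
 by (cases a; cases b) simp_all

lemma bit_sign_square [simp]: "bit_sign a * bit_sign a = 1" "bit_sign a * (bit_sign a * x) = x"
 by (cases a; simp)+

lemma bit_sign_inject [simp]: "bit_sign a = bit_sign b \<longleftrightarrow> a = b"
 by (cases a; cases b) simp_all

lemma bit_sign_Qab [simp]: "bit_sign a \<in> Qab"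
 by (cases a) (simp_all add: subfieldD[OF Qab])

lemma gal_bit_sign:
 assumes "g \<in> carrier G_Q" "x \<in> Qbar"
 shows "g (bit_sign a * x) = bit_sign a * g x"
 using gal_minus[OF Qbar assms] by (cases a) simp_all

lemma comm_G_sign:
 assumes g: "g \<in> comm_G" and w: "w \<in> Qbar" "w\<^sup>2 \<in> Qab" "w \<noteq> 0"
 shows "g w = bit_sign (sign_char w g) * w"
proof -
 have gG: "g \<in> carrier G_Q" and fx: "g (w\<^sup>2) = w\<^sup>2" using g w(2) by (auto simp: comm_G_eq)
 have "(g w)\<^sup>2 = w\<^sup>2" using gal_power[OF Qbar gG w(1), of 2] fx by simp
 then have "g w = w \<or> g w = - w" by (simp add: power2_eq_iff)
 then show ?thesis by (auto simp: sign_char_def)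
qed

lemma commutator_comm_G: "\<sigma> \<in> carrier G_Q ==> \<tau> \<in> carrier G_Q ==> commutator G_Q \<sigma> \<tau> \<in> comm_G"
 using closed_subgroup_generated_subset[OF commutators_subset] by (auto simp: comm_G_def)

text \<open>Commutators act on \<open>w\<close> by signs, so their squares act trivially. A
  commutator \<open>k\<close> fixes the factor \<open>a\<close> in
  \<open>(ginv \<sigma>) w = a * w\<close>, hence multiplies this number by the same sign as
  \<open>w\<close>, and the two signs cancel in the commutator of \<open>\<sigma>\<close> and
  \<open>k\<close>.\<close>

lemma comm_G_eps_fixes:
 assumes g: "g \<in> comm_G_eps" and w: "semi_invariant w"
 shows "g w = w"
proof -
 have wQ: "w \<in> Qbar" "w\<^sup>2 \<in> Qab" "w \<noteq> 0" using w by (auto simp: semi_invariant_def)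
 have c: "\<exists>b. commutator G_Q \<sigma> \<tau> w = bit_sign b * w" if "\<sigma> \<in> carrier G_Q" "\<tau> \<in> carrier G_Q" for \<sigma> \<tau>
  using comm_G_sign[OF commutator_comm_G[OF that] wQ] by blast
 have "s w = w" if s: "s \<in> eps_generators" for s
 proof -
  consider (a) \<sigma> \<tau> where "\<sigma> \<in> carrier G_Q" "\<tau> \<in> carrier G_Q" "s = commutator G_Q \<sigma> \<tau> [^]\<^bsub>G_Q\<^esub> (2::nat)"
   | (b) \<sigma> \<tau> \<eta> where "\<sigma> \<in> carrier G_Q" "\<tau> \<in> carrier G_Q" "\<eta> \<in> carrier G_Q" "s = commutator G_Q \<sigma> (commutator G_Q \<tau> \<eta>)"
   using s by blast
  then show ?thesis
  proof cases
   case a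
   obtain b where b: "commutator G_Q \<sigma> \<tau> w = bit_sign b * w" using c a by blast
   have "s w = commutator G_Q \<sigma> \<tau> (bit_sign b * w)" using a wQ b by (simp add: numeral_2_eq_2)
   also have "\<dots> = w" using gal_bit_sign[OF commutator_closed[OF a(1,2)] wQ(1), of b] b by simp
   finally show ?thesis .
  next
   case b
   define k where "k = commutator G_Q \<tau> \<eta>"
   have k: "k \<in> carrier G_Q" "k \<in> comm_G" using b commutator_comm_G by (auto simp: k_def)
   obtain e where e: "k w = bit_sign e * w" using c b unfolding k_def by blast
   have "w = (ginv k) (bit_sign e * w)" using e GQ_inv_apply(1)[OF k(1) wQ(1)] by simp
   also have "\<dots> = bit_sign e * (ginv k) w" using gal_bit_sign[OF GQ.inv_closed[OF k(1)] wQ(1)] .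
   finally have ki: "(ginv k) w = bit_sign e * w" by (metis bit_sign_square(2))
   have si: "ginv \<sigma> \<in> carrier G_Q" using b by simp
   obtain a where a: "a \<in> Qab" "(ginv \<sigma>) w = a * w" using w si unfolding semi_invariant_def by blast
   have aQ: "a \<in> Qbar" using a by simp
   have ka: "k a = a" using k a by (simp add: comm_G_eq)
   have "s w = \<sigma> (k ((ginv \<sigma>) (bit_sign e * w)))"
    using b k(1) wQ ki by (simp add: commutator_apply k_def)
   also have "(ginv \<sigma>) (bit_sign e * w) = bit_sign e * (a * w)" using gal_bit_sign[OF si wQ(1)] a by simp
   also have "k (bit_sign e * (a * w)) = bit_sign e * (a * (bit_sign e * w))"
    using gal_bit_sign[OF k(1)] gal_times[OF k(1) aQ wQ(1)] ka e subfieldD(4)[OF Qbar aQ wQ(1)] by simp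
   also have "\<dots> = (ginv \<sigma>) w" using a by (simp add: mult.left_commute)
   also have "\<sigma> \<dots> = w" using b wQ by simp
   finally show ?thesis .
  qed
 qed
 then show ?thesis
  using stabilizer_closed_subgroup[OF eps_generators_subset wQ(1)] g unfolding comm_G_eps_def by blast
qed

section \<open>A continuous section\<close>

lemma countable_Qbar: "countable Qbar"
proof -
 have "countable (UNIV :: int poly set)"
  by (rule countableI'[of coeffs]) (simp add: inj_on_def coeffs_eq_iff)
 then have "countable (\<Union>p\<in>{p::int poly. p \<noteq> 0}. {x::complex. poly (map_poly of_int p) x = 0})"
  by (intro countable_UN) (auto intro: countable_subset countable_finite poly_roots_finite simp: map_poly_eq_0_iff)
 moreover have "Qbar \<subseteq> (\<Union>p\<in>{p::int poly. p \<noteq> 0}. {x::complex. poly (map_poly of_int p) x = 0})"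
  by (auto elim: Qbar_int_root)
 ultimately show ?thesis by (rule countable_subset[rotated])
qed

text \<open>Enumerating \<open>Qbar\<close>, every automorphism of \<open>Qab\<close> has a lexicographically least extension;
 by \<open>subgroup_approx\<close>, each value of this extension is a locally constant function of the
 automorphism.\<close>

fun least_ext_stage :: "nat \<Rightarrow> (complex \<Rightarrow> complex) \<Rightarrow> (complex \<Rightarrow> complex) set" where
 "least_ext_stage 0 \<sigma> = {g\<in>carrier G_Q. restrict g Qab = \<sigma>}"
| "least_ext_stage (Suc n) \<sigma> = {g\<in>least_ext_stage n \<sigma>. \<forall>h\<in>least_ext_stage n \<sigma>.
  to_nat_on Qbar (g (from_nat_into Qbar n)) \<le> to_nat_on Qbar (h (from_nat_into Qbar n))}"

text \<open>The value at \<open>x\<close> is read off at the first stage past the index of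
  \<open>x\<close>. All members of that stage agree at \<open>x\<close>: the stage minimises the
  index of the image of \<open>x\<close>, and indices are injective.\<close>

definition least_ext :: "(complex \<Rightarrow> complex) \<Rightarrow> complex \<Rightarrow> complex" where
 "least_ext \<sigma> = (\<lambda>x\<in>Qbar. (SOME g. g \<in> least_ext_stage (Suc (to_nat_on Qbar x)) \<sigma>) x)"

lemma least_ext_stage_antimono: "m \<le> n ==> least_ext_stage n \<sigma> \<subseteq> least_ext_stage m \<sigma>"
 by (induction n rule: dec_induct) auto

lemma least_ext_stage_carrier: "g \<in> least_ext_stage n \<sigma> ==> g \<in> carrier G_Q \<and> restrict g Qab = \<sigma>"
 using least_ext_stage_antimono[of 0 n \<sigma>] by auto

lemma least_ext_stage_nonempty:
 assumes "\<sigma> \<in> carrier Gab" shows "least_ext_stage n \<sigma> \<noteq> {}"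
proof (induction n)
 case 0
 then show ?case using Gab_lift[OF assms] by auto
next
 case (Suc n)
 then obtain g0 where "g0 \<in> least_ext_stage n \<sigma>" by blast
 from ex_has_least_nat[of "\<lambda>g. g \<in> least_ext_stage n \<sigma>", OF this, of "\<lambda>g. to_nat_on Qbar (g (from_nat_into Qbar n))"]
 show ?case by auto
qed

lemma least_ext_eq:
 assumes \<sigma>: "\<sigma> \<in> carrier Gab" and x: "x \<in> Qbar" and g: "g \<in> least_ext_stage m \<sigma>" "to_nat_on Qbar x < m"
 shows "least_ext \<sigma> x = g x"
proof -
 define n where "n = to_nat_on Qbar x"
 have xn: "from_nat_into Qbar n = x" using x by (simp add: n_def countable_Qbar)
 define h where "h = (SOME g. g \<in> least_ext_stage (Suc n) \<sigma>)"
 have h: "h \<in> least_ext_stage (Suc n) \<sigma>"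
  unfolding h_def some_in_eq by (rule least_ext_stage_nonempty[OF \<sigma>])
 have g': "g \<in> least_ext_stage (Suc n) \<sigma>"
  using least_ext_stage_antimono[of "Suc n" m \<sigma>] g by (auto simp: n_def)
 have "to_nat_on Qbar (g x) = to_nat_on Qbar (h x)" using g' h by (auto simp: xn intro: antisym)
 moreover have "g x \<in> Qbar" "h x \<in> Qbar" using least_ext_stage_carrier[OF h] least_ext_stage_carrier[OF g(1)] x by auto
 ultimately have "g x = h x" using countable_Qbar by simp
 then show ?thesis using x by (simp add: least_ext_def h_def n_def)
qed

lemma least_ext_agree:
 assumes \<sigma>: "\<sigma> \<in> carrier Gab" and F: "finite F" "F \<subseteq> Qbar"
 shows "\<exists>g\<in>carrier G_Q. restrict g Qab = \<sigma> \<and> (\<forall>x\<in>F. least_ext \<sigma> x = g x)"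
proof -
 define m where "m = Suc (Max (insert 0 (to_nat_on Qbar ` F)))"
 have m: "to_nat_on Qbar x < m" if "x \<in> F" for x
  using that F by (auto simp: m_def less_Suc_eq_le intro: Max_ge)
 obtain g where g: "g \<in> least_ext_stage m \<sigma>" using least_ext_stage_nonempty[OF \<sigma>] by blast
 show ?thesis
  using least_ext_stage_carrier[OF g] least_ext_eq[OF \<sigma> _ g m] F(2) by (intro bexI[of _ g]) auto
qed

lemma least_ext_lift:
 assumes \<sigma>: "\<sigma> \<in> carrier Gab"
 shows "least_ext \<sigma> \<in> carrier G_Q" "restrict (least_ext \<sigma>) Qab = \<sigma>"
proof -
 have "restrict (least_ext \<sigma>) Qbar \<in> carrier G_Q"
 proof (rule gal_QbarI)
  have sub: "finite {1::complex}" "{1} \<subseteq> Qbar" by (simp_all add: subfieldD[OF Qbar])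
  obtain g where "g \<in> carrier G_Q" "\<forall>x\<in>{1}. least_ext \<sigma> x = g x"
   using least_ext_agree[OF \<sigma> sub] by blast
  then show "least_ext \<sigma> 1 = 1" using gal_1[OF Qbar] by simp
  fix x y assume xy: "x \<in> Qbar" "y \<in> Qbar"
  then have sub: "finite {x, y, x + y, x * y}" "{x, y, x + y, x * y} \<subseteq> Qbar" by (simp_all add: subfieldD[OF Qbar])
  obtain g where g: "g \<in> carrier G_Q" "\<forall>z\<in>{x, y, x + y, x * y}. least_ext \<sigma> z = g z"
   using least_ext_agree[OF \<sigma> sub] by blast
  then show "least_ext \<sigma> (x + y) = least_ext \<sigma> x + least_ext \<sigma> y" "least_ext \<sigma> (x * y) = least_ext \<sigma> x * least_ext \<sigma> y"
   using gal_add[OF g(1) xy] gal_times[OF g(1) xy] by simp_all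
 qed
 then show 1: "least_ext \<sigma> \<in> carrier G_Q" by (simp add: least_ext_def)
 show "restrict (least_ext \<sigma>) Qab = \<sigma>"
 proof (rule gal_eqI[OF restrict_Qab[OF 1] \<sigma>])
  fix x assume x: "x \<in> Qab"
  then have sub: "finite {x}" "{x} \<subseteq> Qbar" by simp_all
  obtain g where g: "restrict g Qab = \<sigma>" "\<forall>z\<in>{x}. least_ext \<sigma> z = g z"
   using least_ext_agree[OF \<sigma> sub] by blast
  then show "restrict (least_ext \<sigma>) Qab x = \<sigma> x" using x by auto
 qed
qed

text \<open>Up to the index of \<open>x\<close> the stages depend only on the restrictions to the
  finite set \<open>Z\<close> of the extensions of \<open>\<sigma>\<close>. By approximation, this
  set of restrictions is the same for all automorphisms that agree with \<open>\<sigma>\<close> on a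
  suitable finite subset of \<open>Qab\<close>.\<close>

lemma least_ext_locally_constant:
 assumes \<sigma>: "\<sigma> \<in> carrier Gab" and x: "x \<in> Qbar"
 shows "\<exists>F. finite F \<and> F \<subseteq> Qab \<and> (\<forall>\<sigma>'\<in>carrier Gab. (\<forall>y\<in>F. \<sigma>' y = \<sigma> y) \<longrightarrow> least_ext \<sigma>' x = least_ext \<sigma> x)"
proof -
 define M where "M = Suc (to_nat_on Qbar x)"
 define Z where "Z = from_nat_into Qbar ` {..<M}"
 have "Qbar \<noteq> {}" using subfieldD(1)[OF Qbar] by blast
 then have Z: "finite Z" "Z \<subseteq> Qbar" by (auto simp: Z_def intro: from_nat_into)
 obtain F where F: "finite F" "F \<subseteq> {x\<in>Qbar. \<forall>n\<in>comm_G. n x = x}"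
  "\<forall>g\<in>carrier G_Q. (\<forall>x\<in>F. g x = x) \<longrightarrow> (\<exists>n\<in>comm_G. \<forall>z\<in>Z. g z = n z)"
  using subgroup_approx[OF subgroup_comm_G Z] by (elim exE conjE)
 have FQ: "F \<subseteq> Qab" using F(2) by (auto intro: comm_G_fixed_Qab)
 \<comment> \<open>Any extension \<open>h\<close> of \<open>\<sigma>'\<close> is corrected by an
   element \<open>n\<close> of \<open>comm_G\<close> that agrees with
   \<open>ginv h \<cdot> g\<close> on \<open>Z\<close>; the restriction to \<open>Qab\<close> stays
   the same.\<close>
 have half: "\<exists>g'\<in>least_ext_stage 0 \<sigma>'. \<forall>z\<in>Z. g' z = g z"
  if s: "\<sigma> \<in> carrier Gab" "\<sigma>' \<in> carrier Gab" "\<forall>y\<in>F. \<sigma>' y = \<sigma> y" and g: "g \<in> least_ext_stage 0 \<sigma>" for \<sigma> \<sigma>' g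
 proof -
  obtain h where h: "h \<in> carrier G_Q" "restrict h Qab = \<sigma>'" using Gab_lift[OF s(2)] .
  have gG: "g \<in> carrier G_Q" "restrict g Qab = \<sigma>" using g by auto
  have fixF: "(ginv h \<cdot> g) y = y" if y: "y \<in> F" for y
  proof -
   have yq: "y \<in> Qab" "y \<in> Qbar" using y FQ by auto
   have "g y = \<sigma> y" "h y = \<sigma>' y" using gG(2) h(2) yq by auto
   then have "g y = h y" using s(3) y by simp
   then show ?thesis using gG(1) h(1) yq by simp
  qed
  have "\<exists>n\<in>comm_G. \<forall>z\<in>Z. (ginv h \<cdot> g) z = n z"
   by (rule bspec[OF F(3), THEN mp]) (use gG(1) h(1) fixF in blast)+
  then obtain n where n: "n \<in> comm_G" "\<forall>z\<in>Z. (ginv h \<cdot> g) z = n z" by (elim bexE)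
  have nG: "n \<in> carrier G_Q" using n by (simp add: comm_G_eq)
  have "restrict (h \<cdot> n) Qab = restrict h Qab"
   using h(1) nG n(1) by (intro restrict_ext) (simp add: comm_G_eq)
  then have "h \<cdot> n \<in> least_ext_stage 0 \<sigma>'" using h nG by simp
  moreover have "(h \<cdot> n) z = g z" if z: "z \<in> Z" for z
  proof -
   have zQ: "z \<in> Qbar" using z Z by blast
   have "n z = (ginv h) (g z)" using bspec[OF n(2) z] zQ gG(1) h(1) by simp
   then show ?thesis using h(1) nG zQ gG(1) by simp
  qed
  ultimately show ?thesis by blast
 qed
 define R where "R m \<sigma> = (\<lambda>g. restrict g Z) ` least_ext_stage m \<sigma>" for m \<sigma>
 \<comment> \<open>The minimisation at stage \<open>m\<close> looks at values at a single point of
   \<open>Z\<close>, so it can be carried out on restrictions.\<close>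
 have RSuc: "R (Suc m) \<sigma> = {r\<in>R m \<sigma>. \<forall>r'\<in>R m \<sigma>.
   to_nat_on Qbar (r (from_nat_into Qbar m)) \<le> to_nat_on Qbar (r' (from_nat_into Qbar m))}" if "m < M" for m \<sigma>
 proof -
  have "from_nat_into Qbar m \<in> Z" using that by (simp add: Z_def)
  then show ?thesis unfolding R_def by auto
 qed
 have "least_ext \<sigma>' x = least_ext \<sigma> x" if s': "\<sigma>' \<in> carrier Gab" "\<forall>y\<in>F. \<sigma>' y = \<sigma> y" for \<sigma>'
 proof -
  have "R 0 \<sigma>' = R 0 \<sigma>"
  proof (intro equalityI subsetI)
   fix r assume "r \<in> R 0 \<sigma>'"
   then obtain g where g: "g \<in> least_ext_stage 0 \<sigma>'" "r = restrict g Z" unfolding R_def by blast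
   obtain g' where g': "g' \<in> least_ext_stage 0 \<sigma>" "\<forall>z\<in>Z. g' z = g z"
    using half[OF s'(1) \<sigma> _ g(1)] s'(2) by auto
   have "restrict g' Z = r" unfolding g(2) using g'(2) by (intro restrict_ext) simp
   then show "r \<in> R 0 \<sigma>" unfolding R_def using g'(1) by blast
  next
   fix r assume "r \<in> R 0 \<sigma>"
   then obtain g where g: "g \<in> least_ext_stage 0 \<sigma>" "r = restrict g Z" unfolding R_def by blast
   obtain g' where g': "g' \<in> least_ext_stage 0 \<sigma>'" "\<forall>z\<in>Z. g' z = g z"
    using half[OF \<sigma> s'(1) s'(2) g(1)] by auto
   have "restrict g' Z = r" unfolding g(2) using g'(2) by (intro restrict_ext) simp
   then show "r \<in> R 0 \<sigma>'" unfolding R_def using g'(1) by blast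
  qed
  then have R: "m \<le> M ==> R m \<sigma>' = R m \<sigma>" for m
   by (induction m) (simp_all add: RSuc)
  obtain g' where g': "g' \<in> least_ext_stage M \<sigma>'" using least_ext_stage_nonempty[OF s'(1)] by blast
  then have "restrict g' Z \<in> R M \<sigma>" using R[of M] unfolding R_def by blast
  then obtain g where g: "g \<in> least_ext_stage M \<sigma>" "restrict g' Z = restrict g Z" unfolding R_def by blast
  have "x = from_nat_into Qbar (to_nat_on Qbar x)" using x by (simp add: countable_Qbar)
  then have xZ: "x \<in> Z" unfolding Z_def M_def by blast
  have "g' x = g x" using fun_cong[OF g(2), of x] xZ by simp
  moreover have "least_ext \<sigma>' x = g' x" by (rule least_ext_eq[OF s'(1) x g']) (simp add: M_def)
  moreover have "least_ext \<sigma> x = g x" by (rule least_ext_eq[OF \<sigma> x g(1)]) (simp add: M_def)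
  ultimately show ?thesis by simp
 qed
 then show ?thesis using F(1) FQ by blast
qed

lemma topspace_quotient: "topspace (quotient_topology T q) = q ` topspace T"
proof -
 have "openin (quotient_topology T q) (q ` topspace T)"
 proof -
  have "{x \<in> topspace T. q x \<in> q ` topspace T} = topspace T" by blast
  then show ?thesis unfolding openin_quotient_topology by simp
 qed
 then have "q ` topspace T \<subseteq> topspace (quotient_topology T q)" by (rule openin_subset)
 moreover have "topspace (quotient_topology T q) \<subseteq> q ` topspace T"
  using openin_topspace[of "quotient_topology T q"] unfolding openin_quotient_topology by blast
 ultimately show ?thesis by blast
qed

abbreviation eps_coset :: "(complex \<Rightarrow> complex) \<Rightarrow> (complex \<Rightarrow> complex) set" where
 "eps_coset g \<equiv> comm_G_eps #>\<^bsub>G_Q\<^esub> g"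

lemma topspace_Gab_eps: "topspace topGab_eps = eps_coset ` carrier G_Q"
 by (simp add: topGab_eps_def topspace_quotient)

lemma in_eps_coset: "h \<in> eps_coset g \<longleftrightarrow> (\<exists>k\<in>comm_G_eps. h = k \<cdot> g)"
 by (auto simp: r_coset_def)

lemma eps_coset_restrict:
 assumes "g \<in> carrier G_Q" "h \<in> eps_coset g"
 shows "h \<in> carrier G_Q" "restrict h Qab = restrict g Qab"
proof -
 obtain k where k: "k \<in> comm_G_eps" "h = k \<cdot> g" using assms in_eps_coset by blast
 then have "k \<in> comm_G" using comm_G_eps_subset by blast
 then have kG: "k \<in> carrier G_Q" "\<And>x. x \<in> Qab ==> k x = x" by (auto simp: comm_G_eq)
 show "h \<in> carrier G_Q" using k kG assms by simp
 show "restrict h Qab = restrict g Qab"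
  unfolding k(2) using kG assms(1) by (intro restrict_ext) simp
qed

theorem continuous_section_exists: "\<exists>\<theta>. continuous_section \<theta>"
proof
 let ?\<theta> = "\<lambda>\<sigma>. eps_coset (least_ext \<sigma>)"
 show "continuous_section ?\<theta>"
  unfolding continuous_section_def
 proof (intro conjI ballI)
  show "continuous_map topGab topGab_eps ?\<theta>"
   unfolding continuous_map_def
  proof (intro conjI allI impI)
   show "?\<theta> \<in> topspace topGab \<rightarrow> topspace topGab_eps"
    using least_ext_lift by (auto simp: topspace_Gab_eps)
   fix U assume "openin topGab_eps U"
   then have V: "openin (krull Qbar) {g \<in> carrier G_Q. eps_coset g \<in> U}"
    by (simp add: topGab_eps_def openin_quotient_topology)
   show "openin topGab {\<sigma> \<in> topspace topGab. ?\<theta> \<sigma> \<in> U}"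
    unfolding openin_krull topspace_krull
   proof (intro conjI ballI)
    fix \<sigma> assume "\<sigma> \<in> {\<sigma> \<in> carrier Gab. ?\<theta> \<sigma> \<in> U}"
    then have \<sigma>: "\<sigma> \<in> carrier Gab" and "least_ext \<sigma> \<in> {g \<in> carrier G_Q. eps_coset g \<in> U}"
     using least_ext_lift by auto
    then obtain E where E: "finite E" "E \<subseteq> Qbar"
     "\<forall>g\<in>carrier G_Q. (\<forall>x\<in>E. g x = least_ext \<sigma> x) \<longrightarrow> g \<in> {g \<in> carrier G_Q. eps_coset g \<in> U}"
     using V unfolding openin_krull by meson
    have "\<forall>x\<in>E. \<exists>F. finite F \<and> F \<subseteq> Qab \<and> (\<forall>\<sigma>'\<in>carrier Gab. (\<forall>y\<in>F. \<sigma>' y = \<sigma> y) \<longrightarrow> least_ext \<sigma>' x = least_ext \<sigma> x)"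
     using least_ext_locally_constant[OF \<sigma>] E(2) by blast
    then obtain F where F: "\<And>x. x \<in> E ==> finite (F x) \<and> F x \<subseteq> Qab \<and>
      (\<forall>\<sigma>'\<in>carrier Gab. (\<forall>y\<in>F x. \<sigma>' y = \<sigma> y) \<longrightarrow> least_ext \<sigma>' x = least_ext \<sigma> x)" by metis
    have "\<sigma>' \<in> {\<sigma> \<in> carrier Gab. ?\<theta> \<sigma> \<in> U}" if s': "\<sigma>' \<in> carrier Gab" "\<forall>y\<in>(\<Union>x\<in>E. F x). \<sigma>' y = \<sigma> y" for \<sigma>'
    proof -
     have "\<forall>x\<in>E. least_ext \<sigma>' x = least_ext \<sigma> x" using F s' by simp
     then have "least_ext \<sigma>' \<in> {g \<in> carrier G_Q. eps_coset g \<in> U}" using E(3) least_ext_lift(1)[OF s'(1)] by blast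
     then show ?thesis using s'(1) by simp
    qed
    moreover have "finite (\<Union>x\<in>E. F x)" "(\<Union>x\<in>E. F x) \<subseteq> Qab" using E(1) F by auto
    ultimately show "\<exists>F. finite F \<and> F \<subseteq> Qab \<and> (\<forall>\<tau>\<in>carrier Gab. (\<forall>x\<in>F. \<tau> x = \<sigma> x) \<longrightarrow> \<tau> \<in> {\<sigma> \<in> carrier Gab. ?\<theta> \<sigma> \<in> U})"
     by blast
   qed blast
  qed
  fix \<sigma> g assume "\<sigma> \<in> carrier Gab" "g \<in> ?\<theta> \<sigma>"
  then show "restrict g Qab = \<sigma>" using eps_coset_restrict(2) least_ext_lift by metis
 qed
qed

section \<open>Second cohomology modulo abelian extensions\<close>

lemma bit_add_self [simp]: "(a::bit) + a = 0" "a + (a + b) = b"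
 by (cases a; cases b; simp)+

lemma bit_eq_iff_add: "a = b \<longleftrightarrow> a + b = (0::bit)"
 by (cases a; cases b; simp)

lemma comm_group_additive_group:
 assumes "0 \<in> S" "\<And>x y. x \<in> S ==> y \<in> S ==> x + y \<in> S" "\<And>x. x \<in> S ==> - x \<in> S"
 shows "comm_group (additive_group (S :: 'a::ab_group_add set))"
proof (rule comm_groupI)
 show "\<exists>y\<in>carrier (additive_group S). y \<otimes>\<^bsub>additive_group S\<^esub> x = \<one>\<^bsub>additive_group S\<^esub>"
  if "x \<in> carrier (additive_group S)" for x
  using assms(3)[of x] that by (auto simp: additive_group_def intro!: bexI[of _ "- x"])
qed (use assms in \<open>auto simp: additive_group_def algebra_simps\<close>)

lemma additive_group_simps [simp]:
 "carrier (additive_group S) = S" "x \<otimes>\<^bsub>additive_group S\<^esub> y = x + y" "\<one>\<^bsub>additive_group S\<^esub> = 0"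
 by (simp_all add: additive_group_def)

text \<open>Preimages decompose over the pairs of values of \<open>f\<close> and \<open>g\<close>,
  and each pair contributes an intersection of two open sets.\<close>

lemma continuous_discrete_combine:
 assumes f: "continuous_map X (discrete_topology UNIV) f" and g: "continuous_map X (discrete_topology UNIV) g"
 shows "continuous_map X (discrete_topology UNIV) (\<lambda>x. F (f x) (g x))"
proof -
 have "openin X {x \<in> topspace X. F (f x) (g x) \<in> U}" for U
 proof -
  have fo: "openin X {x \<in> topspace X. f x \<in> A}" for A
   using openin_continuous_map_preimage[OF f, of A] by simp
  have go: "openin X {x \<in> topspace X. g x \<in> A}" for A
   using openin_continuous_map_preimage[OF g, of A] by simp
  have "{x \<in> topspace X. F (f x) (g x) \<in> U} =
   (\<Union>(a, b)\<in>{(a, b). F a b \<in> U}. {x \<in> topspace X. f x \<in> {a}} \<inter> {x \<in> topspace X. g x \<in> {b}})"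
   by auto
  moreover have "openin X (\<Union>(a, b)\<in>{(a, b). F a b \<in> U}. {x \<in> topspace X. f x \<in> {a}} \<inter> {x \<in> topspace X. g x \<in> {b}})"
  proof (rule openin_Union)
   fix S assume "S \<in> (\<lambda>(a, b). {x \<in> topspace X. f x \<in> {a}} \<inter> {x \<in> topspace X. g x \<in> {b}}) ` {(a, b). F a b \<in> U}"
   then show "openin X S" by (elim imageE) (simp only: case_prod_beta openin_Int fo go)
  qed
  ultimately show ?thesis by simp
 qed
 then show ?thesis by (simp add: continuous_map_def)
qed

lemma uminus_bit_fun [simp]: "- f = (f :: 'x \<Rightarrow> bit)"
 by (rule ext) simp

lemma bit_fun_add_self [simp]: "f + f = (0 :: 'x \<Rightarrow> bit)" "f + (f + g) = (g :: 'x \<Rightarrow> bit)"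
 by (rule ext, simp)+

locale topological_comm_group = comm_group \<Gamma> for \<Gamma> :: "'g monoid" (structure) +
 fixes T :: "'g topology"
 assumes top: "topspace T = carrier \<Gamma>"
  and cont_mult: "continuous_map (prod_topology T T) T (\<lambda>(x, y). x \<otimes> y)"
begin

lemma cochains1_0: "0 \<in> cochains1 \<Gamma> T"
 by (simp add: cochains1_def zero_fun_def)

lemma cochains1_add: "f \<in> cochains1 \<Gamma> T ==> g \<in> cochains1 \<Gamma> T ==> f + g \<in> cochains1 \<Gamma> T"
 using continuous_discrete_combine[of T f g "(+)"] by (auto simp: cochains1_def plus_fun_def)

lemma cocycles2_0: "0 \<in> cocycles2 \<Gamma> T"
 by (simp add: cocycles2_def cochains2_def zero_fun_def)

lemma cocycles2_add:
 assumes "f \<in> cocycles2 \<Gamma> T" "g \<in> cocycles2 \<Gamma> T" shows "f + g \<in> cocycles2 \<Gamma> T"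
proof -
 have "continuous_map (prod_topology T T) (discrete_topology UNIV) (f + g)"
  using assms continuous_discrete_combine[of "prod_topology T T" f g "(+)"]
  by (auto simp: cocycles2_def cochains2_def plus_fun_def)
 moreover have "(f + g) (y, z) - (f + g) (x \<otimes> y, z) + (f + g) (x, y \<otimes> z) - (f + g) (x, y) = 0"
  if "x \<in> carrier \<Gamma>" "y \<in> carrier \<Gamma>" "z \<in> carrier \<Gamma>" for x y z
 proof -
  have "f (y, z) - f (x \<otimes> y, z) + f (x, y \<otimes> z) - f (x, y) = 0"
   "g (y, z) - g (x \<otimes> y, z) + g (x, y \<otimes> z) - g (x, y) = 0"
   using assms that by (auto simp: cocycles2_def)
  then have "(f (y, z) - f (x \<otimes> y, z) + f (x, y \<otimes> z) - f (x, y)) +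
   (g (y, z) - g (x \<otimes> y, z) + g (x, y \<otimes> z) - g (x, y)) = 0" by (simp only: add_0)
  then show ?thesis by (simp only: plus_fun_apply minus_bit_def ac_simps)
 qed
 ultimately show ?thesis using assms by (auto simp: cocycles2_def cochains2_def)
qed



sublocale Z: comm_group "additive_group (cocycles2 \<Gamma> T)"
 by (rule comm_group_additive_group) (simp_all add: cocycles2_0 cocycles2_add)

lemma Z_inv: "f \<in> cocycles2 \<Gamma> T ==> inv\<^bsub>additive_group (cocycles2 \<Gamma> T)\<^esub> f = f"
 by (rule Z.inv_equality) simp_all

lemma coboundary2_add: "coboundary2 \<Gamma> (f + g) = coboundary2 \<Gamma> f + coboundary2 \<Gamma> g"
proof (rule ext)
 fix z :: "'g \<times> 'g"
 obtain x y where z: "z = (x, y)" by (cases z)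
 show "coboundary2 \<Gamma> (f + g) z = (coboundary2 \<Gamma> f + coboundary2 \<Gamma> g) z"
 proof (cases "x \<in> carrier \<Gamma> \<and> y \<in> carrier \<Gamma>")
  case True
  then show ?thesis
   by (simp only: z coboundary2_def prod.case plus_fun_apply if_True simp_thms minus_bit_def ac_simps)
 next
  case False
  then show ?thesis
   by (simp only: z coboundary2_def prod.case plus_fun_apply if_False add_0_left)
 qed
qed

lemma coboundary2_sym: "coboundary2 \<Gamma> f (x, y) = coboundary2 \<Gamma> f (y, x)"
proof (cases "x \<in> carrier \<Gamma> \<and> y \<in> carrier \<Gamma>")
 case True
 then show ?thesis
  by (simp only: coboundary2_def prod.case if_True simp_thms minus_bit_def m_comm[of x y] ac_simps)
qed (auto simp: coboundary2_def)

lemma coboundary2_cocycle: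
 assumes f: "f \<in> cochains1 \<Gamma> T" shows "coboundary2 \<Gamma> f \<in> cocycles2 \<Gamma> T"
proof -
 let ?X = "prod_topology T T"
 have cf: "continuous_map T (discrete_topology UNIV) f" using f by (simp add: cochains1_def)
 have c1: "continuous_map ?X (discrete_topology UNIV) (\<lambda>z. f (fst z))"
  using continuous_map_compose[OF continuous_map_fst cf, of T] by (simp add: o_def)
 have c2: "continuous_map ?X (discrete_topology UNIV) (\<lambda>z. f (snd z))"
  using continuous_map_compose[OF continuous_map_snd cf, of T] by (simp add: o_def)
 have c3: "continuous_map ?X (discrete_topology UNIV) (\<lambda>z. f (fst z \<otimes> snd z))"
  using continuous_map_compose[OF cont_mult cf] by (simp add: o_def case_prod_beta)
 have "continuous_map ?X (discrete_topology UNIV) (\<lambda>z. f (snd z) + f (fst z \<otimes> snd z) + f (fst z))"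
  using continuous_discrete_combine[OF continuous_discrete_combine[OF c2 c3, of "(+)"] c1, of "(+)"] .
 then have "continuous_map ?X (discrete_topology UNIV) (coboundary2 \<Gamma> f)"
  by (rule continuous_map_eq) (auto simp: coboundary2_def top)
 moreover have "coboundary2 \<Gamma> f (y, z) - coboundary2 \<Gamma> f (x \<otimes> y, z) + coboundary2 \<Gamma> f (x, y \<otimes> z) -
   coboundary2 \<Gamma> f (x, y) = 0"
  if xyz: "x \<in> carrier \<Gamma>" "y \<in> carrier \<Gamma>" "z \<in> carrier \<Gamma>" for x y z
 proof -
  have e: "coboundary2 \<Gamma> f (u, v) = f v + f (u \<otimes> v) + f u" if "u \<in> carrier \<Gamma>" "v \<in> carrier \<Gamma>" for u v
   using that by (simp add: coboundary2_def)
  show ?thesis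
   by (simp only: e xyz m_closed m_assoc minus_bit_def ac_simps bit_add_self add_0_left add_0_right)
 qed
 ultimately show ?thesis
  unfolding cocycles2_def cochains2_def by (auto simp: coboundary2_def)
qed

abbreviation B2 :: "('g \<times> 'g \<Rightarrow> bit) set" where
 "B2 \<equiv> coboundary2 \<Gamma> ` cochains1 \<Gamma> T"

lemma B2_subgroup: "subgroup B2 (additive_group (cocycles2 \<Gamma> T))"
proof (rule Z.subgroupI)
 show "B2 \<subseteq> carrier (additive_group (cocycles2 \<Gamma> T))" using coboundary2_cocycle by auto
 show "B2 \<noteq> {}" using cochains1_0 by auto
 show "inv\<^bsub>additive_group (cocycles2 \<Gamma> T)\<^esub> b \<in> B2" if "b \<in> B2" for b
  using that coboundary2_cocycle Z_inv by auto
 show "b \<otimes>\<^bsub>additive_group (cocycles2 \<Gamma> T)\<^esub> c \<in> B2" if bc: "b \<in> B2" "c \<in> B2" for b c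
 proof -
  obtain f g where fg: "f \<in> cochains1 \<Gamma> T" "g \<in> cochains1 \<Gamma> T" "b = coboundary2 \<Gamma> f" "c = coboundary2 \<Gamma> g"
   using bc by blast
  have "b + c = coboundary2 \<Gamma> (f + g)" by (simp only: fg coboundary2_add)
  then show ?thesis using cochains1_add[OF fg(1,2)] by simp
 qed
qed

lemma B2_normal: "B2 \<lhd> additive_group (cocycles2 \<Gamma> T)"
 by (rule Z.subgroup_imp_normal[OF B2_subgroup])

sublocale H2: comm_group "H2 \<Gamma> T"
 unfolding H2_def by (rule Z.abelian_FactGroup[OF B2_subgroup])

lemma in_H2_class: "g \<in> H2_class \<Gamma> T f \<longleftrightarrow> (\<exists>b\<in>B2. g = b + f)"
 by (auto simp: H2_class_def r_coset_def)

lemma H2_class_carrier: "f \<in> cocycles2 \<Gamma> T ==> H2_class \<Gamma> T f \<in> carrier (H2 \<Gamma> T)"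
 by (auto simp: H2_def FactGroup_def RCOSETS_def H2_class_def)

lemma H2_carrierE: "X \<in> carrier (H2 \<Gamma> T) ==> \<exists>f\<in>cocycles2 \<Gamma> T. X = H2_class \<Gamma> T f"
 by (auto simp: H2_def FactGroup_def RCOSETS_def H2_class_def)

lemma H2_class_add:
 "f \<in> cocycles2 \<Gamma> T ==> g \<in> cocycles2 \<Gamma> T ==> H2_class \<Gamma> T f \<otimes>\<^bsub>H2 \<Gamma> T\<^esub> H2_class \<Gamma> T g = H2_class \<Gamma> T (f + g)"
 using normal.rcos_sum[OF B2_normal, of f g] by (simp add: H2_def H2_class_def)

lemma H2_one: "\<one>\<^bsub>H2 \<Gamma> T\<^esub> = H2_class \<Gamma> T 0"
proof -
 have "\<one>\<^bsub>H2 \<Gamma> T\<^esub> = B2" by (simp add: H2_def)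
 also have "\<dots> = H2_class \<Gamma> T 0" using in_H2_class[of _ 0] by auto
 finally show ?thesis .
qed

lemma H2_inv: "f \<in> cocycles2 \<Gamma> T ==> inv\<^bsub>H2 \<Gamma> T\<^esub> (H2_class \<Gamma> T f) = H2_class \<Gamma> T f"
 by (rule H2.inv_equality) (simp_all add: H2_class_carrier H2_class_add H2_one)

definition sym_cocycle :: "('g \<times> 'g \<Rightarrow> bit) \<Rightarrow> bool" where
 "sym_cocycle f \<longleftrightarrow> (\<forall>x\<in>carrier \<Gamma>. \<forall>y\<in>carrier \<Gamma>. f (x, y) = f (y, x))"

text \<open>The products of the lifts \<open>(0, x)\<close> and \<open>(0, y)\<close> in the two
  orders differ by \<open>f (x, y) + f (y, x)\<close>.\<close>

lemma comm_group_extension_iff: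
 assumes f: "f \<in> cocycles2 \<Gamma> T"
 shows "comm_group (extension_group \<Gamma> f) \<longleftrightarrow> sym_cocycle f"
proof
 assume c: "comm_group (extension_group \<Gamma> f)"
 interpret E: comm_group "extension_group \<Gamma> f" by (fact c)
 show "sym_cocycle f"
  unfolding sym_cocycle_def
 proof (intro ballI)
  fix x y assume "x \<in> carrier \<Gamma>" "y \<in> carrier \<Gamma>"
  then show "f (x, y) = f (y, x)"
   using E.m_comm[of "(0, x)" "(0, y)"]
   by (cases "f (x, y)"; cases "f (y, x)") (simp_all add: extension_group_def)
 qed
next
 assume s: "sym_cocycle f"
 have co: "f (y, z) + f (x \<otimes> y, z) + f (x, y \<otimes> z) + f (x, y) = 0"
  if "x \<in> carrier \<Gamma>" "y \<in> carrier \<Gamma>" "z \<in> carrier \<Gamma>" for x y z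
  using f that by (auto simp: cocycles2_def)
 \<comment> \<open>Cocycles need not be normalised. That \<open>f\<close> is constant on pairs whose
   first entry is the unit makes the \<open>one\<close> of \<open>extension_group\<close> a left
   unit.\<close>
 have one: "f (\<one>, z) = f (\<one>, \<one>)" if "z \<in> carrier \<Gamma>" for z
  using co[of \<one> \<one> z] that by (cases "f (\<one>, z)"; cases "f (\<one>, \<one>)") simp_all
 show "comm_group (extension_group \<Gamma> f)"
 proof (rule comm_groupI)
  fix u v w assume "u \<in> carrier (extension_group \<Gamma> f)" "v \<in> carrier (extension_group \<Gamma> f)" "w \<in> carrier (extension_group \<Gamma> f)"
  then obtain a x b y c z where uvw: "u = (a, x)" "v = (b, y)" "w = (c, z)"
   and xyz: "x \<in> carrier \<Gamma>" "y \<in> carrier \<Gamma>" "z \<in> carrier \<Gamma>"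
   by (cases u; cases v; cases w) (auto simp: extension_group_def)
  have "f (x, y) + f (x \<otimes> y, z) = f (y, z) + f (x, y \<otimes> z)"
   using co[OF xyz]
   by (cases "f (x, y)"; cases "f (x \<otimes> y, z)"; cases "f (y, z)"; cases "f (x, y \<otimes> z)") simp_all
  then have "a + b + f (x, y) + c + f (x \<otimes> y, z) = a + (b + c + f (y, z)) + f (x, y \<otimes> z)"
   by (metis (no_types, lifting) add.assoc add.commute add.left_commute)
  then show "u \<otimes>\<^bsub>extension_group \<Gamma> f\<^esub> v \<otimes>\<^bsub>extension_group \<Gamma> f\<^esub> w =
    u \<otimes>\<^bsub>extension_group \<Gamma> f\<^esub> (v \<otimes>\<^bsub>extension_group \<Gamma> f\<^esub> w)"
   using xyz by (simp add: uvw extension_group_def m_assoc)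
 next
  fix u v assume "u \<in> carrier (extension_group \<Gamma> f)" "v \<in> carrier (extension_group \<Gamma> f)"
  then show "u \<otimes>\<^bsub>extension_group \<Gamma> f\<^esub> v = v \<otimes>\<^bsub>extension_group \<Gamma> f\<^esub> u"
   using s by (auto simp: extension_group_def m_comm sym_cocycle_def add.commute)
 next
  fix u assume "u \<in> carrier (extension_group \<Gamma> f)"
  then obtain a x where u: "u = (a, x)" "x \<in> carrier \<Gamma>" by (cases u) (auto simp: extension_group_def)
  show "\<one>\<^bsub>extension_group \<Gamma> f\<^esub> \<otimes>\<^bsub>extension_group \<Gamma> f\<^esub> u = u"
   using u one[OF u(2)] by (cases a; cases "f (\<one>, \<one>)") (simp_all add: extension_group_def)
  show "\<exists>v\<in>carrier (extension_group \<Gamma> f). v \<otimes>\<^bsub>extension_group \<Gamma> f\<^esub> u = \<one>\<^bsub>extension_group \<Gamma> f\<^esub>"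
   using u
   by (intro bexI[of _ "(a + f (inv x, x) + f (\<one>, \<one>), inv x)"])
    (cases a; cases "f (inv x, x)"; cases "f (\<one>, \<one>)"; simp add: extension_group_def)+
 qed (auto simp: extension_group_def)
qed

text \<open>Coboundaries on a commutative group are symmetric, so symmetry is independent of the
  representative of the class.\<close>

lemma H2_class_abelian_iff:
 assumes f: "f \<in> cocycles2 \<Gamma> T"
 shows "H2_class \<Gamma> T f \<in> abelian_classes \<Gamma> T \<longleftrightarrow> sym_cocycle f"
proof -
 have "comm_group (extension_group \<Gamma> (b + f)) \<longleftrightarrow> sym_cocycle f" if "b \<in> B2" for b
 proof -
  have b: "b \<in> cocycles2 \<Gamma> T" "b (x, y) = b (y, x)" for x y
   using that coboundary2_cocycle coboundary2_sym by auto
  have "sym_cocycle (b + f) \<longleftrightarrow> sym_cocycle f"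
   unfolding sym_cocycle_def plus_fun_apply by (intro ball_cong refl) (metis add_left_cancel b(2))
  then show ?thesis using comm_group_extension_iff[OF cocycles2_add[OF b(1) f]] by simp
 qed
 moreover have "B2 \<noteq> {}" using cochains1_0 by auto
 ultimately show ?thesis
  using H2_class_carrier[OF f] unfolding abelian_classes_def mem_Collect_eq Bex_def in_H2_class by blast
qed

lemma sym_cocycle_add: "sym_cocycle f ==> sym_cocycle g ==> sym_cocycle (f + g)"
 by (simp add: sym_cocycle_def)

lemma abelian_classes_subgroup: "subgroup (abelian_classes \<Gamma> T) (H2 \<Gamma> T)"
proof (rule H2.subgroupI)
 show sub: "abelian_classes \<Gamma> T \<subseteq> carrier (H2 \<Gamma> T)" by (auto simp: abelian_classes_def)
 have "H2_class \<Gamma> T 0 \<in> abelian_classes \<Gamma> T"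
  unfolding H2_class_abelian_iff[OF cocycles2_0] by (simp add: sym_cocycle_def)
 then show "abelian_classes \<Gamma> T \<noteq> {}" by blast
 fix X assume X: "X \<in> abelian_classes \<Gamma> T"
 then obtain f where f: "f \<in> cocycles2 \<Gamma> T" "X = H2_class \<Gamma> T f" using sub H2_carrierE by blast
 show "inv\<^bsub>H2 \<Gamma> T\<^esub> X \<in> abelian_classes \<Gamma> T" using X H2_inv f by simp
 fix Y assume Y: "Y \<in> abelian_classes \<Gamma> T"
 then obtain g where g: "g \<in> cocycles2 \<Gamma> T" "Y = H2_class \<Gamma> T g" using sub H2_carrierE by blast
 show "X \<otimes>\<^bsub>H2 \<Gamma> T\<^esub> Y \<in> abelian_classes \<Gamma> T"
  using X Y unfolding f(2) g(2) H2_class_add[OF f(1) g(1)] H2_class_abelian_iff[OF f(1)]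
   H2_class_abelian_iff[OF g(1)] H2_class_abelian_iff[OF cocycles2_add[OF f(1) g(1)]]
  by (rule sym_cocycle_add)
qed

lemma abelian_classes_normal: "abelian_classes \<Gamma> T \<lhd> H2 \<Gamma> T"
 by (rule H2.subgroup_imp_normal[OF abelian_classes_subgroup])

sublocale H2m: comm_group "H2_minus \<Gamma> T"
 unfolding H2_minus_def by (rule H2.abelian_FactGroup[OF abelian_classes_subgroup])

lemma H2_minus_class_carrier: "f \<in> cocycles2 \<Gamma> T ==> H2_minus_class \<Gamma> T f \<in> carrier (H2_minus \<Gamma> T)"
 using H2_class_carrier by (auto simp: H2_minus_def FactGroup_def RCOSETS_def H2_minus_class_def)

lemma H2_minus_class_add:
 "f \<in> cocycles2 \<Gamma> T ==> g \<in> cocycles2 \<Gamma> T ==>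
  H2_minus_class \<Gamma> T f \<otimes>\<^bsub>H2_minus \<Gamma> T\<^esub> H2_minus_class \<Gamma> T g = H2_minus_class \<Gamma> T (f + g)"
 using normal.rcos_sum[OF abelian_classes_normal H2_class_carrier H2_class_carrier, of f g]
 by (simp add: H2_minus_def H2_minus_class_def H2_class_add)

lemma H2_minus_class_one_iff:
 assumes f: "f \<in> cocycles2 \<Gamma> T"
 shows "H2_minus_class \<Gamma> T f = \<one>\<^bsub>H2_minus \<Gamma> T\<^esub> \<longleftrightarrow> sym_cocycle f"
proof -
 have "H2_minus_class \<Gamma> T f = \<one>\<^bsub>H2_minus \<Gamma> T\<^esub> \<longleftrightarrow> H2_class \<Gamma> T f \<in> abelian_classes \<Gamma> T"
  unfolding H2_minus_class_def H2_minus_def one_FactGroup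
  by (metis H2.coset_join1 H2.coset_join2 H2_class_carrier[OF f] abelian_classes_subgroup)
 then show ?thesis by (simp add: H2_class_abelian_iff[OF f])
qed

text \<open>In characteristic 2, equal antisymmetrisations make \<open>f + g\<close> symmetric, so
  the product of the two classes is trivial; every class is its own inverse.\<close>

lemma H2_minus_class_eqI:
 assumes f: "f \<in> cocycles2 \<Gamma> T" and g: "g \<in> cocycles2 \<Gamma> T"
  and fg: "\<And>x y. x \<in> carrier \<Gamma> ==> y \<in> carrier \<Gamma> ==> f (x, y) + f (y, x) = g (x, y) + g (y, x)"
 shows "H2_minus_class \<Gamma> T f = H2_minus_class \<Gamma> T g"
proof -
 have "sym_cocycle (f + g)"
  unfolding sym_cocycle_def
 proof (intro ballI)
  fix x y assume "x \<in> carrier \<Gamma>" "y \<in> carrier \<Gamma>"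
  from fg[OF this] show "(f + g) (x, y) = (f + g) (y, x)"
   by (cases "f (x, y)"; cases "f (y, x)"; cases "g (x, y)"; cases "g (y, x)") simp_all
 qed
 then have "H2_minus_class \<Gamma> T f \<otimes>\<^bsub>H2_minus \<Gamma> T\<^esub> H2_minus_class \<Gamma> T g = \<one>\<^bsub>H2_minus \<Gamma> T\<^esub>"
  using H2_minus_class_add[OF f g] H2_minus_class_one_iff[OF cocycles2_add[OF f g]] by simp
 moreover have "H2_minus_class \<Gamma> T g \<otimes>\<^bsub>H2_minus \<Gamma> T\<^esub> H2_minus_class \<Gamma> T g = \<one>\<^bsub>H2_minus \<Gamma> T\<^esub>"
  using H2_minus_class_add[OF g g] H2_minus_class_one_iff[OF cocycles2_0] by (simp add: sym_cocycle_def)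
 ultimately show ?thesis
  using H2_minus_class_carrier[OF f] H2_minus_class_carrier[OF g] by (metis H2m.right_cancel)
qed

lemma cup_cocycle:
 assumes x: "x \<in> H1 \<Gamma> T" and y: "y \<in> H1 \<Gamma> T"
 shows "cup x y \<in> cocycles2 \<Gamma> T"
proof -
 let ?X = "prod_topology T T"
 have cx: "continuous_map T (discrete_topology UNIV) x" and cy: "continuous_map T (discrete_topology UNIV) y"
  using x y by (auto simp: H1_def cochains1_def)
 have c1: "continuous_map ?X (discrete_topology UNIV) (\<lambda>z. x (fst z))"
  using continuous_map_compose[OF continuous_map_fst cx, of T] by (simp add: o_def)
 have c2: "continuous_map ?X (discrete_topology UNIV) (\<lambda>z. y (snd z))"
  using continuous_map_compose[OF continuous_map_snd cy, of T] by (simp add: o_def)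
 have "continuous_map ?X (discrete_topology UNIV) (cup x y)"
  using continuous_discrete_combine[OF c1 c2, of "(*)"] by (simp add: cup_def case_prod_beta')
 moreover have "x a = 0" "y a = 0" if "a \<notin> carrier \<Gamma>" for a
  using x y that by (auto simp: H1_def cochains1_def)

 moreover have "cup x y (b, c) - cup x y (a \<otimes> b, c) + cup x y (a, b \<otimes> c) - cup x y (a, b) = 0"
  if "a \<in> carrier \<Gamma>" "b \<in> carrier \<Gamma>" "c \<in> carrier \<Gamma>" for a b c
 proof -
  have "x (a \<otimes> b) = x a + x b" "y (b \<otimes> c) = y b + y c" using x y that by (auto simp: H1_def)
  then show ?thesis
   by (cases "x a"; cases "x b"; cases "y b"; cases "y c") (simp_all add: cup_def)
 qed
 ultimately show ?thesis
  unfolding cocycles2_def cochains2_def by (auto simp: cup_def)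
qed

end

section \<open>The exterior square\<close>

lemma sum_fun_apply: "sum f A x = (\<Sum>k\<in>A. f k x)"
 for f :: "'k \<Rightarrow> 'x \<Rightarrow> 'y::comm_monoid_add"
 by (induction A rule: infinite_finite_induct) auto

locale bit_function_space =
 fixes V :: "('g \<Rightarrow> bit) set"
 assumes V0: "0 \<in> V" and Vadd: "x \<in> V ==> y \<in> V ==> x + y \<in> V"
begin

abbreviation s :: "('g \<Rightarrow> bit) \<Rightarrow> ('g \<Rightarrow> bit) \<Rightarrow> (('g \<Rightarrow> bit) \<times> ('g \<Rightarrow> bit) \<Rightarrow>\<^sub>0 bit)" where
 "s x y \<equiv> Poly_Mapping.single (x, y) 1"

abbreviation F :: "(('g \<Rightarrow> bit) \<times> ('g \<Rightarrow> bit) \<Rightarrow>\<^sub>0 bit) set" where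
 "F \<equiv> {r. Poly_Mapping.keys r \<subseteq> V \<times> V}"

lemma pm_uminus [simp]: "- r = (r :: 'a \<Rightarrow>\<^sub>0 bit)"
 by (rule poly_mapping_eqI) simp

lemma pm_diff [simp]: "r - r' = (r + r' :: 'a \<Rightarrow>\<^sub>0 bit)"
 by (rule poly_mapping_eqI) (simp only: lookup_add lookup_minus minus_bit_def)

lemma pm_add_self [simp]: "r + r = (0 :: 'a \<Rightarrow>\<^sub>0 bit)" "r + (r + r') = (r' :: 'a \<Rightarrow>\<^sub>0 bit)"
 by (rule poly_mapping_eqI, simp only: lookup_add bit_add_self lookup_zero)+

lemma F_add: "r \<in> F ==> r' \<in> F ==> r + r' \<in> F"
 using Poly_Mapping.keys_add[of r r'] by auto

sublocale P: comm_group "free_on_pairs V"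
 unfolding free_on_pairs_def by (rule comm_group_additive_group) (use F_add in simp_all)

lemma P_simps [simp]: "carrier (free_on_pairs V) = F" "x \<otimes>\<^bsub>free_on_pairs V\<^esub> y = x + y" "\<one>\<^bsub>free_on_pairs V\<^esub> = 0"
 by (simp_all add: free_on_pairs_def)

abbreviation gens :: "(('g \<Rightarrow> bit) \<times> ('g \<Rightarrow> bit) \<Rightarrow>\<^sub>0 bit) set" where
 "gens \<equiv> {Poly_Mapping.single (u + v, w) 1 - Poly_Mapping.single (u, w) 1 -
    Poly_Mapping.single (v, w) 1 |u v w. u \<in> V \<and> v \<in> V \<and> w \<in> V} \<union>
   {Poly_Mapping.single (u, v + w) 1 - Poly_Mapping.single (u, v) 1 -
    Poly_Mapping.single (u, w) 1 |u v w. u \<in> V \<and> v \<in> V \<and> w \<in> V} \<union>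
   {Poly_Mapping.single (v, v) 1 |v. v \<in> V}"

abbreviation R :: "(('g \<Rightarrow> bit) \<times> ('g \<Rightarrow> bit) \<Rightarrow>\<^sub>0 bit) set" where
 "R \<equiv> ext_relations V"

lemma s_F: "x \<in> V ==> y \<in> V ==> s x y \<in> F"
 by simp

lemma gens_F: "gens \<subseteq> carrier (free_on_pairs V)"
proof
 fix r assume "r \<in> gens"
 then consider (a) u v w where "u \<in> V" "v \<in> V" "w \<in> V" "r = s (u + v) w + s u w + s v w"
  | (b) u v w where "u \<in> V" "v \<in> V" "w \<in> V" "r = s u (v + w) + s u v + s u w"
  | (c) v where "v \<in> V" "r = s v v" by auto
 then show "r \<in> carrier (free_on_pairs V)"
 proof cases
  case a
  then show ?thesis unfolding P_simps a(4) by (intro F_add s_F Vadd)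
 next
  case b
  then show ?thesis unfolding P_simps b(4) by (intro F_add s_F Vadd)
 qed simp
qed

lemma R_subgroup: "subgroup R (free_on_pairs V)"
 unfolding ext_relations_def by (rule P.generate_is_subgroup[OF gens_F])

lemma R_F: "R \<subseteq> F" using subgroup.subset[OF R_subgroup] by simp

lemma R_add: "r \<in> R ==> r' \<in> R ==> r + r' \<in> R"
 using subgroup.m_closed[OF R_subgroup, of r r'] by simp

lemma R_0: "0 \<in> R" using subgroup.one_closed[OF R_subgroup] by simp

lemma R_add_cancel: "r + r' \<in> R ==> r' \<in> R ==> r \<in> R"
 using R_add[of "r + r'" r'] by (simp add: add.assoc)

lemma R_left: "u \<in> V ==> v \<in> V ==> w \<in> V ==> s (u + v) w + (s u w + s v w) \<in> R"
 using generate.incl[of "s (u + v) w - s u w - s v w" gens "free_on_pairs V"]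
 unfolding ext_relations_def pm_diff add.assoc by blast

lemma R_right: "u \<in> V ==> v \<in> V ==> w \<in> V ==> s u (v + w) + (s u v + s u w) \<in> R"
 using generate.incl[of "s u (v + w) - s u v - s u w" gens "free_on_pairs V"]
 unfolding ext_relations_def pm_diff add.assoc by blast

lemma R_alt: "v \<in> V ==> s v v \<in> R"
 unfolding ext_relations_def by (rule generate.incl) blast

lemma R_zero_left: "w \<in> V ==> s 0 w \<in> R"
 using R_left[OF V0 V0, of w] by simp

lemma R_zero_right: "w \<in> V ==> s w 0 \<in> R"
 using R_right[OF _ V0 V0, of w] by simp

lemma R_swap:
 assumes "u \<in> V" "v \<in> V" shows "s u v + s v u \<in> R"
proof -
 have uv: "u + v \<in> V" by (intro Vadd assms)
 have "s (u + v) (u + v) + (s (u + v) (u + v) + (s u (u + v) + s v (u + v))) +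
  (s u (u + v) + (s u u + s u v)) + (s v (u + v) + (s v u + s v v)) + s u u + s v v \<in> R"
  by (intro R_add R_alt R_left R_right assms uv)
 then show ?thesis by (simp add: ac_simps)
qed

text \<open>Coefficients are bits, so \<open>r\<close> is the sum of its keys. The value is the
  alternating form that has to be compared with the commutator pairing of an extension.\<close>

definition asym :: "(('g \<Rightarrow> bit) \<times> ('g \<Rightarrow> bit) \<Rightarrow>\<^sub>0 bit) \<Rightarrow> 'g \<Rightarrow> 'g \<Rightarrow> bit" where
 "asym r \<sigma> \<tau> = (\<Sum>k\<in>Poly_Mapping.keys r. fst k \<sigma> * snd k \<tau> + fst k \<tau> * snd k \<sigma>)"

definition cup_sum :: "(('g \<Rightarrow> bit) \<times> ('g \<Rightarrow> bit) \<Rightarrow>\<^sub>0 bit) \<Rightarrow> 'g \<times> 'g \<Rightarrow> bit" where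
 "cup_sum r = (\<Sum>k\<in>Poly_Mapping.keys r. cup (fst k) (snd k))"

lemma cup_sum_apply: "cup_sum r (\<sigma>, \<tau>) = (\<Sum>k\<in>Poly_Mapping.keys r. fst k \<sigma> * snd k \<tau>)"
 by (simp only: cup_sum_def cup_def sum_fun_apply prod.case)

lemma asym_cup_sum: "asym r \<sigma> \<tau> = cup_sum r (\<sigma>, \<tau>) + cup_sum r (\<tau>, \<sigma>)"
 by (simp only: asym_def cup_sum_apply sum.distrib)

text \<open>The support of a sum of bit-valued functions is the symmetric difference of the
  supports; common keys count twice on the right and cancel.\<close>

lemma sum_keys_add:
 fixes f :: "'k \<Rightarrow> 'b::ab_group_add"
 assumes "\<And>b. b + b = (0::'b)"
 shows "sum f (Poly_Mapping.keys (r + r' :: 'k \<Rightarrow>\<^sub>0 bit)) = sum f (Poly_Mapping.keys r) + sum f (Poly_Mapping.keys r')"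
proof -
 define A where "A = Poly_Mapping.keys r \<union> Poly_Mapping.keys r'"
 have fin: "finite A" by (simp add: A_def)
 have *: "sum f (Poly_Mapping.keys q) = (\<Sum>k\<in>A. if Poly_Mapping.lookup q k = 1 then f k else 0)"
  if "Poly_Mapping.keys q \<subseteq> A" for q :: "'k \<Rightarrow>\<^sub>0 bit"
 proof -
  have "(\<Sum>k\<in>A. if Poly_Mapping.lookup q k = 1 then f k else 0) = sum f {k\<in>A. Poly_Mapping.lookup q k = 1}"
   using fin by (simp add: sum.inter_filter)
  also have "{k\<in>A. Poly_Mapping.lookup q k = 1} = Poly_Mapping.keys q" using that by (auto simp: in_keys_iff)
  finally show ?thesis by simp
 qed
 have "(if Poly_Mapping.lookup (r + r') k = 1 then f k else 0) = (if Poly_Mapping.lookup r k = 1 then f k else 0) + (if Poly_Mapping.lookup r' k = 1 then f k else 0)" for k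
  using assms[of "f k"] by (cases "Poly_Mapping.lookup r k"; cases "Poly_Mapping.lookup r' k") (simp_all add: lookup_add)
 then show ?thesis
  using *[of "r + r'"] *[of r] *[of r'] Poly_Mapping.keys_add[of r r'] by (simp add: A_def sum.distrib)
qed

lemma asym_add: "asym (r + r') \<sigma> \<tau> = asym r \<sigma> \<tau> + asym r' \<sigma> \<tau>"
 unfolding asym_def by (rule sum_keys_add) (rule bit_add_self)

lemma cup_sum_add: "cup_sum (r + r') = cup_sum r + cup_sum r'"
 unfolding cup_sum_def by (rule sum_keys_add) (rule bit_fun_add_self)

lemma asym_s: "asym (s x y) \<sigma> \<tau> = x \<sigma> * y \<tau> + x \<tau> * y \<sigma>"
 by (simp add: asym_def)

lemma asym_0: "asym 0 \<sigma> \<tau> = 0"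
 by (simp add: asym_def)

lemma asym_R:
 assumes "r \<in> R" shows "asym r \<sigma> \<tau> = 0"
proof -
 have "subgroup {r\<in>F. asym r \<sigma> \<tau> = 0} (free_on_pairs V)"
 proof (rule P.subgroupI)
  show "inv\<^bsub>free_on_pairs V\<^esub> r \<in> {r\<in>F. asym r \<sigma> \<tau> = 0}" if "r \<in> {r\<in>F. asym r \<sigma> \<tau> = 0}" for r
  proof -
   have "inv\<^bsub>free_on_pairs V\<^esub> r = r" using that by (intro P.inv_equality) auto
   then show ?thesis using that by simp
  qed
 qed (use F_add in \<open>auto simp: asym_add asym_0 intro!: exI[of _ 0]\<close>)
 moreover have "gens \<subseteq> {r\<in>F. asym r \<sigma> \<tau> = 0}"
 proof
  fix r assume r: "r \<in> gens"
  consider (a) u v w where "r = s (u + v) w + s u w + s v w"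
   | (b) u v w where "r = s u (v + w) + s u v + s u w" | (c) v where "r = s v v"
   using r by auto
  then have "asym r \<sigma> \<tau> = 0"
   by cases (simp_all only: asym_add asym_s plus_fun_apply distrib_left distrib_right ac_simps
     bit_add_self add_0_left add_0_right)
  moreover have "r \<in> F" using subsetD[OF gens_F r] unfolding P_simps .
  ultimately show "r \<in> {r\<in>F. asym r \<sigma> \<tau> = 0}" by blast
 qed
 ultimately have "R \<subseteq> {r\<in>F. asym r \<sigma> \<tau> = 0}"
  unfolding ext_relations_def by (intro P.generate_subgroup_incl)
 then show ?thesis using assms by blast
qed

definition sum_pairs :: "(('g \<Rightarrow> bit) \<times> ('g \<Rightarrow> bit)) list \<Rightarrow> (('g \<Rightarrow> bit) \<times> ('g \<Rightarrow> bit) \<Rightarrow>\<^sub>0 bit)" where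
 "sum_pairs L = (\<Sum>(x, y)\<leftarrow>L. s x y)"

lemma sum_pairs_simps [simp]: "sum_pairs [] = 0" "sum_pairs ((x, y) # L) = s x y + sum_pairs L"
 by (simp_all add: sum_pairs_def)

lemma sum_pairs_exists: "r \<in> F ==> \<exists>L. set L \<subseteq> V \<times> V \<and> r = sum_pairs L"
proof (induction "card (Poly_Mapping.keys r)" arbitrary: r)
 case 0
 then have "r = 0" by simp
 then show ?case by (intro exI[of _ "[]"]) simp
next
 case (Suc n)
 have "Poly_Mapping.keys r \<noteq> {}" using Suc(2) by (metis card.empty nat.distinct(1))
 then obtain k where k: "k \<in> Poly_Mapping.keys r" by blast
 obtain x y where xy: "k = (x, y)" by (cases k)
 have lk: "Poly_Mapping.lookup r k = 1" using k by (simp add: in_keys_iff)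
 have keys: "Poly_Mapping.keys (r + s x y) = Poly_Mapping.keys r - {k}"
 proof (rule Set.set_eqI)
  fix j show "j \<in> Poly_Mapping.keys (r + s x y) \<longleftrightarrow> j \<in> Poly_Mapping.keys r - {k}"
   using lk by (cases "j = k") (auto simp: in_keys_iff lookup_add lookup_single xy when_def)
 qed
 then have "n = card (Poly_Mapping.keys (r + s x y))" "r + s x y \<in> F" using Suc k by auto
 then obtain L where L: "set L \<subseteq> V \<times> V" "r + s x y = sum_pairs L" using Suc(1) by blast
 have "r = sum_pairs ((x, y) # L)" using L(2)[symmetric] by (simp add: ac_simps)
 moreover have "(x, y) \<in> V \<times> V" using Suc(3) k xy by blast
 ultimately show ?case using L(1) by (intro exI[of _ "(x, y) # L"]) simp
qed

text \<open>If \<open>x \<sigma>\<^sub>0 = 1\<close>, then the vanishing of the antisymmetrisation of \<open>x \<wedge> y + \<Sum> x\<^sub>i \<wedge> y\<^sub>i\<close> at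
 \<open>\<sigma>\<^sub>0\<close> expresses \<open>y\<close> by \<open>x\<close>, the \<open>x\<^sub>i\<close> and the \<open>y\<^sub>i\<close>, and substituting this turns the sum into
 \<open>\<Sum> (x\<^sub>i + x\<^sub>i(\<sigma>\<^sub>0) x) \<wedge> (y\<^sub>i + y\<^sub>i(\<sigma>\<^sub>0) x)\<close>, which has one term less.\<close>

lemma asym_zero_imp_R:
 assumes "set L \<subseteq> V \<times> V" "\<And>\<sigma> \<tau>. asym (sum_pairs L) \<sigma> \<tau> = 0"
 shows "sum_pairs L \<in> R"
 using assms
proof (induction "length L" arbitrary: L)
 case 0
 then show ?case using R_0 by simp
next
 case (Suc n)
 then obtain x y L' where L: "L = (x, y) # L'" by (metis Suc_length_conv surj_pair)
 have V: "x \<in> V" "y \<in> V" "set L' \<subseteq> V \<times> V" and len: "n = length L'" using Suc(2,3) L by auto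
 show ?case
 proof (cases "x = 0")
  case True
  have "asym (sum_pairs L') \<sigma> \<tau> = 0" for \<sigma> \<tau>
   using Suc(4)[of \<sigma> \<tau>] by (simp add: L True asym_add asym_s)
  then have "sum_pairs L' \<in> R" using Suc(1)[OF len V(3)] by blast
  then show ?thesis using R_add[OF R_zero_left[OF V(2)]] by (simp add: L True)
 next
  case False
  then obtain \<sigma> where \<sigma>: "x \<sigma> = 1" by (auto simp: fun_eq_iff)
  \<comment> \<open>\<open>c b z\<close> is the scalar multiple of \<open>z\<close> by
    \<open>b\<close>. The map \<open>t\<close> adds to each entry the multiple of \<open>x\<close>
    that makes it vanish at \<open>\<sigma>\<close>, and \<open>Z M\<close> is the contraction of
    \<open>M\<close> with \<open>\<sigma>\<close>, that is
    \<open>asym (sum_pairs M) \<sigma>\<close>.\<close>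
  define c :: "bit \<Rightarrow> ('g \<Rightarrow> bit) \<Rightarrow> ('g \<Rightarrow> bit)" where "c b z = (if b = 1 then z else 0)" for b z
  have cV: "c b z \<in> V" if "z \<in> V" for b z using that V0 by (simp add: c_def)
  define t where "t = (\<lambda>(u, v). (u + c (u \<sigma>) x, v + c (v \<sigma>) x))"
  define Z where "Z M = (\<Sum>(u, v)\<leftarrow>M. c (u \<sigma>) v + c (v \<sigma>) u)" for M
  have ZV: "Z M \<in> V" if "set M \<subseteq> V \<times> V" for M
   using that by (induction M) (auto simp: Z_def V0 intro!: Vadd cV)
  have tV: "set (map t M) \<subseteq> V \<times> V" if "set M \<subseteq> V \<times> V" for M
   using that V(1) by (auto simp: t_def intro!: Vadd cV)
  \<comment> \<open>Bilinear expansion of the wedge of the two corrected entries: the cross terms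
    combine to the wedge of \<open>x\<close> with the contraction of the pair, and \<open>x\<close>
    wedge \<open>x\<close> vanishes. The cases are the values of \<open>u\<close> and
    \<open>v\<close> at \<open>\<sigma>\<close>.\<close>
  have one: "s (u + c (u \<sigma>) x) (v + c (v \<sigma>) x) + (s u v + s x (c (u \<sigma>) v + c (v \<sigma>) u)) \<in> R"
   if uv: "u \<in> V" "v \<in> V" for u v
  proof -
   have r0: "s x 0 \<in> R" by (rule R_zero_right[OF V(1)])
   show ?thesis
   proof (cases "u \<sigma>"; cases "v \<sigma>")
    assume "u \<sigma> = 0" "v \<sigma> = 0"
    then show ?thesis using r0 r0[unfolded zero_fun_def] by (simp add: c_def)
   next
    assume a: "u \<sigma> = 0" "v \<sigma> = 1"
    have "(s u (v + x) + (s u v + s u x)) + (s u x + s x u) \<in> R"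
     by (intro R_add R_right R_swap uv V(1))
    then show ?thesis using a by (simp add: c_def ac_simps)
   next
    assume a: "u \<sigma> = 1" "v \<sigma> = 0"
    have "s (u + x) v + (s u v + s x v) \<in> R" by (intro R_left uv V(1))
    then show ?thesis using a by (simp add: c_def)
   next
    assume a: "u \<sigma> = 1" "v \<sigma> = 1"
    have "(s (u + x) (v + x) + (s u (v + x) + s x (v + x))) + (s u (v + x) + (s u v + s u x)) +
     (s x (v + x) + (s x v + s x x)) + s x x + (s u x + s x u) + (s x (v + u) + (s x v + s x u)) \<in> R"
     by (intro R_add R_left R_right R_alt R_swap uv V(1) Vadd)
    then show ?thesis using a by (simp add: c_def ac_simps)
   qed
  qed
  have all: "sum_pairs (map t M) + (sum_pairs M + s x (Z M)) \<in> R" if "set M \<subseteq> V \<times> V" for M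
   using that
  proof (induction M)
   case Nil
   then show ?case
    using R_zero_right[OF V(1)] R_zero_right[OF V(1), unfolded zero_fun_def] by (simp add: Z_def)
  next
   case (Cons p M)
   obtain u v where p: "p = (u, v)" by (cases p)
   have uv: "u \<in> V" "v \<in> V" and M: "set M \<subseteq> V \<times> V" using Cons(2) p by auto
   define z where "z = c (u \<sigma>) v + c (v \<sigma>) u"
   have zV: "z \<in> V" unfolding z_def by (intro Vadd cV uv)
   define N where "N = Z (p # M)"
   have ZC: "N = z + Z M" by (simp add: Z_def p z_def N_def)
   have e1: "s x N + (s x z + s x (Z M)) \<in> R" unfolding ZC by (intro R_right V(1) zV ZV M)
   have e2: "s (u + c (u \<sigma>) x) (v + c (v \<sigma>) x) + (s u v + s x z) \<in> R"
    unfolding z_def by (rule one[OF uv])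
   have "(sum_pairs (map t M) + (sum_pairs M + s x (Z M))) +
    (s (u + c (u \<sigma>) x) (v + c (v \<sigma>) x) + (s u v + s x z)) + (s x N + (s x z + s x (Z M))) \<in> R"
    by (rule R_add[OF R_add[OF Cons(1)[OF M] e2] e1])
   moreover have "Z ((u, v) # M) = N" by (simp add: N_def p)
   ultimately show ?case by (simp add: p t_def ac_simps)
  qed
  have asymM: "asym (sum_pairs M) \<sigma> \<tau> = Z M \<tau>" for M \<tau>
  proof (induction M)
   case (Cons p M)
   obtain u v where p: "p = (u, v)" by (cases p)
   have "(c (u \<sigma>) v + c (v \<sigma>) u) \<tau> = u \<sigma> * v \<tau> + u \<tau> * v \<sigma>"
    by (cases "u \<sigma>"; cases "v \<sigma>") (simp_all add: c_def)
   with Cons show ?case by (simp add: p asym_add asym_s Z_def)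
  qed (simp add: asym_0 Z_def)
  have sxc: "s x (c b x) \<in> R" for b
   using R_alt[OF V(1)] R_zero_right[OF V(1)] by (simp add: c_def)
  \<comment> \<open>Vanishing of \<open>asym\<close> at \<open>\<sigma>\<close> solves for
    \<open>y\<close>; the multiple of \<open>x\<close> in the solution disappears in the wedge with
    \<open>x\<close>.\<close>
  have y: "c (y \<sigma>) x + Z L' = y"
  proof
   fix \<tau>
   have e: "y \<tau> + x \<tau> * y \<sigma> + Z L' \<tau> = 0"
    using Suc(4)[of \<sigma> \<tau>] \<sigma> by (simp add: L asym_add asym_s asymM)
   have "c (y \<sigma>) x \<tau> = x \<tau> * y \<sigma>" by (cases "y \<sigma>") (simp_all add: c_def)
   with e show "(c (y \<sigma>) x + Z L') \<tau> = y \<tau>"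
    by (cases "y \<tau>"; cases "Z L' \<tau>") simp_all
  qed
  define b where "b = y \<sigma>"
  have yb: "c b x + Z L' = y" unfolding b_def by (rule y)
  have "s x (c b x + Z L') + (s x (c b x) + s x (Z L')) \<in> R"
   by (intro R_right V(1) cV ZV V(3))
  then have "(s x y + (s x (c b x) + s x (Z L'))) + s x (c b x) \<in> R"
   unfolding yb by (rule R_add[OF _ sxc])
  then have "s x y + s x (Z L') \<in> R" by (simp add: ac_simps)
  from R_add[OF this all[OF V(3)]] have tot: "sum_pairs L + sum_pairs (map t L') \<in> R"
   by (simp add: L ac_simps)
  have "asym (sum_pairs (map t L')) \<sigma>' \<tau> = 0" for \<sigma>' \<tau>
   using asym_R[OF tot, of \<sigma>' \<tau>] Suc(4)[of \<sigma>' \<tau>] by (simp add: asym_add)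
  then have "sum_pairs (map t L') \<in> R" using Suc(1)[of "map t L'"] len tV[OF V(3)] by simp
  then show ?thesis using R_add_cancel[OF tot] by blast
 qed
qed

lemma R_iff: "r \<in> R \<longleftrightarrow> r \<in> F \<and> (\<forall>\<sigma> \<tau>. asym r \<sigma> \<tau> = 0)"
 using asym_R R_F sum_pairs_exists asym_zero_imp_R by blast

end


section \<open>Injectivity of the cup product on the exterior square\<close>

context topological_comm_group
begin

lemma H1_bit_function_space: "bit_function_space (H1 \<Gamma> T)"
proof
 show "0 \<in> H1 \<Gamma> T" using cochains1_0 by (simp add: H1_def)
 fix x y assume xy: "x \<in> H1 \<Gamma> T" "y \<in> H1 \<Gamma> T"
 have "x + y \<in> cochains1 \<Gamma> T" using xy cochains1_add by (simp add: H1_def)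
 moreover have "(x + y) (a \<otimes> b) = (x + y) a + (x + y) b" if "a \<in> carrier \<Gamma>" "b \<in> carrier \<Gamma>" for a b
 proof -
  have "x (a \<otimes> b) = x a + x b" "y (a \<otimes> b) = y a + y b" using xy that by (auto simp: H1_def)
  then show ?thesis by (simp only: plus_fun_apply ac_simps)
 qed
 ultimately show "x + y \<in> H1 \<Gamma> T" by (simp add: H1_def)
qed

sublocale V: bit_function_space "H1 \<Gamma> T" by (rule H1_bit_function_space)

lemma cup_sum_cocycle:
 assumes "r \<in> V.F" shows "V.cup_sum r \<in> cocycles2 \<Gamma> T"
proof -
 have sumZ: "sum f A \<in> cocycles2 \<Gamma> T" if "finite A" "\<And>k. k \<in> A ==> f k \<in> cocycles2 \<Gamma> T" for A :: "(('g \<Rightarrow> bit) \<times> ('g \<Rightarrow> bit)) set" and f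
  using that by (induction A rule: finite_induct) (simp_all add: cocycles2_0 cocycles2_add)
 show ?thesis
  unfolding V.cup_sum_def
 proof (rule sumZ)
  fix k assume "k \<in> Poly_Mapping.keys r"
  then have "k \<in> H1 \<Gamma> T \<times> H1 \<Gamma> T" using assms by blast
  then show "cup (fst k) (snd k) \<in> cocycles2 \<Gamma> T" by (intro cup_cocycle) (auto simp: mem_Times_iff)
 qed simp
qed

lemma cup_sum_hom: "(\<lambda>r. H2_minus_class \<Gamma> T (V.cup_sum r)) \<in> hom (free_on_pairs (H1 \<Gamma> T)) (H2_minus \<Gamma> T)"
proof (rule homI)
 fix r r' assume "r \<in> carrier (free_on_pairs (H1 \<Gamma> T))" "r' \<in> carrier (free_on_pairs (H1 \<Gamma> T))"
 then have r: "r \<in> V.F" "r' \<in> V.F" by simp_all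
 show "H2_minus_class \<Gamma> T (V.cup_sum r) \<in> carrier (H2_minus \<Gamma> T)"
  by (intro H2_minus_class_carrier cup_sum_cocycle r)
 show "H2_minus_class \<Gamma> T (V.cup_sum (r \<otimes>\<^bsub>free_on_pairs (H1 \<Gamma> T)\<^esub> r')) =
   H2_minus_class \<Gamma> T (V.cup_sum r) \<otimes>\<^bsub>H2_minus \<Gamma> T\<^esub> H2_minus_class \<Gamma> T (V.cup_sum r')"
  using H2_minus_class_add[OF cup_sum_cocycle[OF r(1)] cup_sum_cocycle[OF r(2)]] by (simp add: V.cup_sum_add)
qed

lemma cup_sum_outside:
 assumes "r \<in> V.F" "\<sigma> \<notin> carrier \<Gamma> \<or> \<tau> \<notin> carrier \<Gamma>" shows "V.cup_sum r (\<sigma>, \<tau>) = 0"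
 using cup_sum_cocycle[OF assms(1)] assms(2) by (auto simp: cocycles2_def cochains2_def)

text \<open>Symmetry of the cocycle \<open>cup_sum r\<close> is the vanishing of
  \<open>asym r\<close>, which by \<open>V.R_iff\<close> makes \<open>r\<close> a relation. This is
  the injectivity of the map induced by cup product.\<close>

lemma cup_sum_kernel:
 "kernel (free_on_pairs (H1 \<Gamma> T)) (H2_minus \<Gamma> T) (\<lambda>r. H2_minus_class \<Gamma> T (V.cup_sum r)) = ext_relations (H1 \<Gamma> T)"
proof (intro equalityI subsetI)
 fix r assume "r \<in> kernel (free_on_pairs (H1 \<Gamma> T)) (H2_minus \<Gamma> T) (\<lambda>r. H2_minus_class \<Gamma> T (V.cup_sum r))"
 then have r: "r \<in> V.F" and "H2_minus_class \<Gamma> T (V.cup_sum r) = \<one>\<^bsub>H2_minus \<Gamma> T\<^esub>" by (auto simp: kernel_def)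
 then have sym: "sym_cocycle (V.cup_sum r)" using H2_minus_class_one_iff[OF cup_sum_cocycle[OF r]] by simp
 have "V.asym r \<sigma> \<tau> = 0" for \<sigma> \<tau>
 proof (cases "\<sigma> \<in> carrier \<Gamma> \<and> \<tau> \<in> carrier \<Gamma>")
  case True
  then have "V.cup_sum r (\<sigma>, \<tau>) = V.cup_sum r (\<tau>, \<sigma>)" using sym by (simp add: sym_cocycle_def)
  then show ?thesis by (simp only: V.asym_cup_sum bit_add_self)
 next
  case False
  then show ?thesis using cup_sum_outside[OF r, of \<sigma> \<tau>] cup_sum_outside[OF r, of \<tau> \<sigma>] by (auto simp: V.asym_cup_sum)
 qed
 then show "r \<in> ext_relations (H1 \<Gamma> T)" using r V.R_iff by blast
next
 fix r assume r: "r \<in> ext_relations (H1 \<Gamma> T)"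
 then have rF: "r \<in> V.F" and a: "\<And>\<sigma> \<tau>. V.asym r \<sigma> \<tau> = 0" using V.R_iff by blast+
 have "sym_cocycle (V.cup_sum r)"
  unfolding sym_cocycle_def
 proof (intro ballI)
  fix x y
  show "V.cup_sum r (x, y) = V.cup_sum r (y, x)"
   using a[of x y] unfolding V.asym_cup_sum bit_eq_iff_add[of "V.cup_sum r (x, y)"] .
 qed
 then have "H2_minus_class \<Gamma> T (V.cup_sum r) = \<one>\<^bsub>H2_minus \<Gamma> T\<^esub>"
  using H2_minus_class_one_iff[OF cup_sum_cocycle[OF rF]] by simp
 then show "r \<in> kernel (free_on_pairs (H1 \<Gamma> T)) (H2_minus \<Gamma> T) (\<lambda>r. H2_minus_class \<Gamma> T (V.cup_sum r))"
  using rF by (simp add: kernel_def)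
qed

lemma ext_relations_normal: "ext_relations (H1 \<Gamma> T) \<lhd> free_on_pairs (H1 \<Gamma> T)"
 by (rule V.P.subgroup_imp_normal[OF V.R_subgroup])

text \<open>By \<open>V.sum_pairs_exists\<close> every element of the exterior square is a sum of
  wedges.\<close>

lemma ext_square_hom_unique:
 assumes h: "h \<in> hom (ext_square (H1 \<Gamma> T)) (H2_minus \<Gamma> T)" and k: "k \<in> hom (ext_square (H1 \<Gamma> T)) (H2_minus \<Gamma> T)"
  and hk: "\<And>x y. x \<in> H1 \<Gamma> T ==> y \<in> H1 \<Gamma> T ==> h (wedge (H1 \<Gamma> T) x y) = k (wedge (H1 \<Gamma> T) x y)"
  and X: "X \<in> carrier (ext_square (H1 \<Gamma> T))"
 shows "h X = k X"
proof -
 let ?P = "free_on_pairs (H1 \<Gamma> T)" and ?E = "ext_square (H1 \<Gamma> T)"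
 let ?c = "\<lambda>r. ext_relations (H1 \<Gamma> T) #>\<^bsub>?P\<^esub> r"
 interpret E: group ?E unfolding ext_square_def by (rule normal.factorgroup_is_group[OF ext_relations_normal])
 interpret h: group_hom ?E "H2_minus \<Gamma> T" h by unfold_locales (rule h)
 interpret k: group_hom ?E "H2_minus \<Gamma> T" k by unfold_locales (rule k)
 have cE: "?c r \<in> carrier ?E" if "r \<in> V.F" for r
  using that by (auto simp: ext_square_def FactGroup_def RCOSETS_def)
 have cadd: "?c (r + r') = ?c r \<otimes>\<^bsub>?E\<^esub> ?c r'" if "r \<in> V.F" "r' \<in> V.F" for r r'
  using normal.rcos_sum[OF ext_relations_normal, of r r'] that by (simp add: ext_square_def)
 have c0: "?c 0 = \<one>\<^bsub>?E\<^esub>"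
  using V.P.coset_join2[OF _ V.R_subgroup, of 0] V.R_0 by (simp add: ext_square_def)
 have "set L \<subseteq> H1 \<Gamma> T \<times> H1 \<Gamma> T ==> V.sum_pairs L \<in> V.F \<and> h (?c (V.sum_pairs L)) = k (?c (V.sum_pairs L))" for L
 proof (induction L)
  case Nil
  then show ?case by (simp add: c0)
 next
  case (Cons p L)
  obtain x y where p: "p = (x, y)" by (cases p)
  have xy: "x \<in> H1 \<Gamma> T" "y \<in> H1 \<Gamma> T" using Cons(2) p by auto
  have IH: "V.sum_pairs L \<in> V.F" "h (?c (V.sum_pairs L)) = k (?c (V.sum_pairs L))" using Cons by auto
  have s: "V.s x y \<in> V.F" by (rule V.s_F[OF xy])
  have "h (?c (V.s x y)) = k (?c (V.s x y))" using hk[OF xy] by (simp add: wedge_def)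
  then have "h (?c (V.s x y + V.sum_pairs L)) = k (?c (V.s x y + V.sum_pairs L))"
   using IH(2) cE[OF s] cE[OF IH(1)] by (simp only: cadd[OF s IH(1)] h.hom_mult k.hom_mult)
  then show ?case using V.F_add[OF s IH(1)] by (simp add: p)
 qed
 moreover obtain r where "r \<in> V.F" "X = ?c r" using X by (auto simp: ext_square_def FactGroup_def RCOSETS_def)
 ultimately show ?thesis using V.sum_pairs_exists by metis
qed

text \<open>The description of \<open>h\<close> is a hypothesis so that the result applies verbatim
  to \<open>cup_iso\<close>. It determines \<open>h\<close> because wedges generate the exterior
  square, and \<open>inv_into\<close> recovers the wedge because the induced map is
  injective.\<close>

theorem ext_square_cup_iso:
 fixes h assumes h_def: "h = (THE h. h \<in> hom (ext_square (H1 \<Gamma> T)) (H2_minus \<Gamma> T) \<and>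
  h \<in> extensional (carrier (ext_square (H1 \<Gamma> T))) \<and>
  (\<forall>x\<in>H1 \<Gamma> T. \<forall>y\<in>H1 \<Gamma> T. h (wedge (H1 \<Gamma> T) x y) = H2_minus_class \<Gamma> T (cup x y)))"
 assumes xy: "x \<in> H1 \<Gamma> T" "y \<in> H1 \<Gamma> T"
 shows "inv_into (carrier (ext_square (H1 \<Gamma> T))) h (H2_minus_class \<Gamma> T (cup x y)) = wedge (H1 \<Gamma> T) x y"
proof -
 let ?P = "free_on_pairs (H1 \<Gamma> T)" and ?E = "ext_square (H1 \<Gamma> T)" and ?H = "H2_minus \<Gamma> T"
 let ?\<Phi> = "\<lambda>r. H2_minus_class \<Gamma> T (V.cup_sum r)"
 interpret \<Phi>: group_hom ?P ?H ?\<Phi> by unfold_locales (rule cup_sum_hom)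
 define k where "k = restrict (\<lambda>X. the_elem (?\<Phi> ` X)) (carrier ?E)"
 have E: "?E = ?P Mod kernel ?P ?H ?\<Phi>" by (simp add: ext_square_def cup_sum_kernel)
 interpret E: group ?E unfolding ext_square_def by (rule normal.factorgroup_is_group[OF ext_relations_normal])
 have "(\<lambda>X. the_elem (?\<Phi> ` X)) \<in> hom ?E ?H" unfolding E by (rule \<Phi>.FactGroup_hom)
 then have k_hom: "k \<in> hom ?E ?H" by (simp add: k_def hom_def E.m_closed Pi_iff)
 have "inj_on (\<lambda>X. the_elem (?\<Phi> ` X)) (carrier ?E)" unfolding E by (rule \<Phi>.FactGroup_inj_on)
 then have k_inj: "inj_on k (carrier ?E)" by (simp add: k_def inj_on_def)
 have wE: "wedge (H1 \<Gamma> T) u v \<in> carrier ?E" if "u \<in> H1 \<Gamma> T" "v \<in> H1 \<Gamma> T" for u v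
  using V.s_F[OF that]
  unfolding wedge_def ext_square_def FactGroup_def RCOSETS_def partial_object.simps V.P_simps by blast
 have kw: "k (wedge (H1 \<Gamma> T) u v) = H2_minus_class \<Gamma> T (cup u v)" if uv: "u \<in> H1 \<Gamma> T" "v \<in> H1 \<Gamma> T" for u v
 proof -
  have s: "V.s u v \<in> V.F" by (rule V.s_F[OF uv])
  have "?\<Phi> ` (wedge (H1 \<Gamma> T) u v) = {?\<Phi> (V.s u v)}"
  proof (intro equalityI subsetI)
   fix z assume "z \<in> ?\<Phi> ` (wedge (H1 \<Gamma> T) u v)"
   then obtain r where r: "r \<in> ext_relations (H1 \<Gamma> T)" "z = ?\<Phi> (r + V.s u v)"
    by (auto simp: wedge_def r_coset_def)
   have rF: "r \<in> V.F" using r V.R_F by blast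
   have "?\<Phi> r = \<one>\<^bsub>?H\<^esub>" using r cup_sum_kernel by (auto simp: kernel_def)
   then have "z = ?\<Phi> (V.s u v)" using \<Phi>.hom_mult[of r "V.s u v"] rF s r(2)
     H2_minus_class_carrier[OF cup_sum_cocycle[OF s]] by simp
   then show "z \<in> {?\<Phi> (V.s u v)}" by simp
  next
   fix z assume "z \<in> {?\<Phi> (V.s u v)}"
   moreover have "V.s u v \<in> wedge (H1 \<Gamma> T) u v"
    using V.R_0 by (auto simp: wedge_def r_coset_def intro!: bexI[of _ 0])
   ultimately show "z \<in> ?\<Phi> ` (wedge (H1 \<Gamma> T) u v)" by blast
  qed
  moreover have "V.cup_sum (V.s u v) = cup u v" by (simp add: V.cup_sum_def)
  ultimately show ?thesis using wE[OF uv] by (simp add: k_def)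
 qed
 have "h = k"
  unfolding h_def
 proof (rule the_equality)
  show "k \<in> hom ?E ?H \<and> k \<in> extensional (carrier ?E) \<and>
   (\<forall>x\<in>H1 \<Gamma> T. \<forall>y\<in>H1 \<Gamma> T. k (wedge (H1 \<Gamma> T) x y) = H2_minus_class \<Gamma> T (cup x y))"
   using k_hom kw by (auto simp: k_def)
  fix g assume g: "g \<in> hom ?E ?H \<and> g \<in> extensional (carrier ?E) \<and>
   (\<forall>x\<in>H1 \<Gamma> T. \<forall>y\<in>H1 \<Gamma> T. g (wedge (H1 \<Gamma> T) x y) = H2_minus_class \<Gamma> T (cup x y))"
  show "g = k"
  proof (rule extensionalityI[of _ "carrier ?E"])
   show "g \<in> extensional (carrier ?E)" using g by blast
   show "k \<in> extensional (carrier ?E)" by (simp add: k_def)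
   fix X assume "X \<in> carrier ?E"
   then show "g X = k X" using ext_square_hom_unique[OF _ k_hom, of g X] g kw by auto
  qed
 qed
 then show ?thesis using kw[OF xy] inv_into_f_f[OF k_inj wE[OF xy]] by simp
qed

end

section \<open>The class attached to a square root\<close>

lemma openin_prod_krull:
 assumes "U \<subseteq> carrier (gal K) \<times> carrier (gal K)"
  and "\<And>\<sigma> \<tau>. (\<sigma>, \<tau>) \<in> U ==> \<exists>F. finite F \<and> F \<subseteq> K \<and> (\<forall>\<sigma>'\<in>carrier (gal K). \<forall>\<tau>'\<in>carrier (gal K).
   (\<forall>x\<in>F. \<sigma>' x = \<sigma> x \<and> \<tau>' x = \<tau> x) \<longrightarrow> (\<sigma>', \<tau>') \<in> U)"
 shows "openin (prod_topology (krull K) (krull K)) U"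
 unfolding openin_prod_topology_alt
proof (intro allI impI)
 fix \<sigma> \<tau> assume st: "(\<sigma>, \<tau>) \<in> U"
 obtain F where F: "finite F" "F \<subseteq> K" and FU: "\<forall>\<sigma>'\<in>carrier (gal K). \<forall>\<tau>'\<in>carrier (gal K).
   (\<forall>x\<in>F. \<sigma>' x = \<sigma> x \<and> \<tau>' x = \<tau> x) \<longrightarrow> (\<sigma>', \<tau>') \<in> U"
  using assms(2)[OF st] by (elim exE conjE)
 define A where "A \<rho> = {\<rho>'\<in>carrier (gal K). \<forall>x\<in>F. \<rho>' x = \<rho> x}" for \<rho> :: "complex \<Rightarrow> complex"
 have "openin (krull K) (A \<rho>)" for \<rho> unfolding A_def by (rule openin_krull_agree[OF F(2,1)])
 moreover have "\<sigma> \<in> A \<sigma>" "\<tau> \<in> A \<tau>" using st assms(1) by (auto simp: A_def)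
 moreover have "A \<sigma> \<times> A \<tau> \<subseteq> U" using FU by (auto simp: A_def)
 ultimately show "\<exists>U' V'. openin (krull K) U' \<and> openin (krull K) V' \<and> \<sigma> \<in> U' \<and> \<tau> \<in> V' \<and> U' \<times> V' \<subseteq> U"
  by blast
qed

lemma topological_comm_group_Gab: "topological_comm_group Gab topGab"
proof -
 interpret comm_group Gab by (rule comm_group_Gab)
 show ?thesis
 proof
  show "topspace topGab = carrier Gab" by simp
  show "continuous_map (prod_topology topGab topGab) topGab (\<lambda>(x, y). x \<otimes>\<^bsub>Gab\<^esub> y)"
   unfolding continuous_map_def
  proof (intro conjI allI impI)
   show "(\<lambda>(x, y). x \<otimes>\<^bsub>Gab\<^esub> y) \<in> topspace (prod_topology topGab topGab) \<rightarrow> topspace topGab"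
    by auto
   fix U assume U: "openin topGab U"
   show "openin (prod_topology topGab topGab) {z \<in> topspace (prod_topology topGab topGab). (case z of (x, y) \<Rightarrow> x \<otimes>\<^bsub>Gab\<^esub> y) \<in> U}"
   proof (rule openin_prod_krull)
    fix \<sigma> \<tau> assume "(\<sigma>, \<tau>) \<in> {z \<in> topspace (prod_topology topGab topGab). (case z of (x, y) \<Rightarrow> x \<otimes>\<^bsub>Gab\<^esub> y) \<in> U}"
    then have st: "\<sigma> \<in> carrier Gab" "\<tau> \<in> carrier Gab" "\<sigma> \<otimes>\<^bsub>Gab\<^esub> \<tau> \<in> U" by auto
    obtain F where F: "finite F" "F \<subseteq> Qab"
     and FU: "\<forall>\<rho>\<in>carrier Gab. (\<forall>x\<in>F. \<rho> x = (\<sigma> \<otimes>\<^bsub>Gab\<^esub> \<tau>) x) \<longrightarrow> \<rho> \<in> U"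
     using U st(3) unfolding openin_krull by meson
    have "\<sigma>' \<otimes>\<^bsub>Gab\<^esub> \<tau>' \<in> U" if s': "\<sigma>' \<in> carrier Gab" "\<tau>' \<in> carrier Gab"
     and ag: "\<forall>x\<in>F \<union> \<tau> ` F. \<sigma>' x = \<sigma> x \<and> \<tau>' x = \<tau> x" for \<sigma>' \<tau>'
    proof -
     have "(\<sigma>' \<otimes>\<^bsub>Gab\<^esub> \<tau>') x = (\<sigma> \<otimes>\<^bsub>Gab\<^esub> \<tau>) x" if x: "x \<in> F" for x
     proof -
      have "x \<in> Qab" using x F by blast
      moreover have "\<tau>' x = \<tau> x" "\<sigma>' (\<tau> x) = \<sigma> (\<tau> x)" using ag x by auto
      ultimately show ?thesis using s' st by simp
     qed
     then show ?thesis using FU m_closed[OF s'] by blast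
    qed
    moreover have "finite (F \<union> \<tau> ` F)" "F \<union> \<tau> ` F \<subseteq> Qab" using F st(2) by auto
    ultimately show "\<exists>F. finite F \<and> F \<subseteq> Qab \<and> (\<forall>\<sigma>'\<in>carrier Gab. \<forall>\<tau>'\<in>carrier Gab.
      (\<forall>x\<in>F. \<sigma>' x = \<sigma> x \<and> \<tau>' x = \<tau> x) \<longrightarrow>
      (\<sigma>', \<tau>') \<in> {z \<in> topspace (prod_topology topGab topGab). (case z of (x, y) \<Rightarrow> x \<otimes>\<^bsub>Gab\<^esub> y) \<in> U})"
     by (intro exI[of _ "F \<union> \<tau> ` F"]) simp
   qed auto
  qed
 qed
qed

lemma mod_squares_eq: "mod_squares u = {t\<^sup>2 * u |t. t \<in> Qab - {0}}"
 by (auto simp: mod_squares_def r_coset_def Qab_squares_def Qab_units_def)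

text \<open>A lift \<open>g\<close> of \<open>\<sigma>\<close> with \<open>g w = a * w\<close>
  multiplies \<open>w ^ 2\<close> by the square of an element of \<open>Qab\<close>. This gives one
  inclusion; the other follows by applying it to the inverse of \<open>\<sigma>\<close>.\<close>

lemma mod_squares_H0:
 assumes w: "semi_invariant w" shows "mod_squares (w\<^sup>2) \<in> H0"
 unfolding H0_def
proof (intro CollectI conjI ballI)
 have u: "w\<^sup>2 \<in> Qab - {0}" using w by (auto simp: semi_invariant_def)
 then show "mod_squares (w\<^sup>2) \<in> carrier (Qab_units Mod Qab_squares)"
  by (auto simp: FactGroup_def RCOSETS_def mod_squares_def Qab_units_def)
 have sub: "\<sigma> ` mod_squares (w\<^sup>2) \<subseteq> mod_squares (w\<^sup>2)" if s: "\<sigma> \<in> carrier Gab" for \<sigma>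
 proof
  fix z assume "z \<in> \<sigma> ` mod_squares (w\<^sup>2)"
  then obtain t where t: "t \<in> Qab" "t \<noteq> 0" "z = \<sigma> (t\<^sup>2 * w\<^sup>2)" unfolding mod_squares_eq by blast
  obtain g where g: "g \<in> carrier G_Q" "restrict g Qab = \<sigma>" using Gab_lift[OF s] .
  obtain a where a: "a \<in> Qab" "g w = a * w" using w g by (auto simp: semi_invariant_def)
  have wQ: "w \<in> Qbar" "w \<noteq> 0" using w by (auto simp: semi_invariant_def)
  have a0: "a \<noteq> 0" using a gal_eq_0_iff[OF Qbar g(1) wQ(1)] wQ(2) by auto
  have t2: "t\<^sup>2 * w\<^sup>2 \<in> Qab" by (rule subfieldD(4)[OF Qab subfield_power[OF Qab t(1)]]) (use u in blast)
  have "z = g (t\<^sup>2 * w\<^sup>2)" using t(3) t2 g(2) by auto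
  also have "\<dots> = (g t)\<^sup>2 * (g w)\<^sup>2"
   using t(1) wQ by (simp add: gal_times[OF g(1)] gal_power[OF Qbar g(1)] subfield_power[OF Qbar])
  also have "\<dots> = (g t * a)\<^sup>2 * w\<^sup>2" by (simp add: a power_mult_distrib mult_ac)
  finally have "z = (g t * a)\<^sup>2 * w\<^sup>2" .
  moreover have "g t * a \<in> Qab - {0}"
   using t a(1) a0 g(1) gal_eq_0_iff[OF Qbar g(1), of t] by (auto intro: subfieldD(4)[OF Qab])
  ultimately show "z \<in> mod_squares (w\<^sup>2)" unfolding mod_squares_eq by blast
 qed
 fix \<sigma> assume s: "\<sigma> \<in> carrier Gab"
 interpret group Gab by (rule group_gal[OF Qab])
 show "\<sigma> ` mod_squares (w\<^sup>2) = mod_squares (w\<^sup>2)"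
 proof (rule equalityI[OF sub[OF s]], rule subsetI)
  fix z assume z: "z \<in> mod_squares (w\<^sup>2)"
  then have zQ: "z \<in> Qab"
   using u by (auto simp: mod_squares_eq intro!: subfieldD(4)[OF Qab] subfield_power[OF Qab])
  have "(inv\<^bsub>Gab\<^esub> \<sigma>) z \<in> mod_squares (w\<^sup>2)" using sub[OF inv_closed[OF s]] z by blast
  moreover have "z = \<sigma> ((inv\<^bsub>Gab\<^esub> \<sigma>) z)" using gal_inv_apply(2)[OF Qab s zQ] by simp
  ultimately show "z \<in> \<sigma> ` mod_squares (w\<^sup>2)" by blast
 qed
qed

lemma semi_invariantD:
 assumes "semi_invariant w"
 shows "w \<in> Qbar" "w\<^sup>2 \<in> Qab" "w \<noteq> 0" "g \<in> carrier G_Q ==> \<exists>a\<in>Qab. g w = a * w"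
 using assms by (auto simp: semi_invariant_def)

lemma comm_G_sub: "g \<in> comm_G ==> g \<in> carrier G_Q"
 by (simp add: comm_G_eq)

lemma comm_G_eps_comm_G: "g \<in> comm_G_eps ==> g \<in> comm_G"
 using comm_G_eps_subset by blast

lemma eps_coset_apply:
 assumes w: "semi_invariant w" and g: "g \<in> carrier G_Q" and h: "h \<in> eps_coset g"
 shows "h w = g w"
proof -
 obtain k where k: "k \<in> comm_G_eps" "h = k \<cdot> g" using h in_eps_coset by blast
 obtain a where a: "a \<in> Qab" "g w = a * w" using semi_invariantD(4)[OF w g] by blast
 have kc: "k \<in> comm_G" using k by (simp add: comm_G_eps_comm_G)
 have kG: "k \<in> carrier G_Q" "k a = a" using kc a by (auto simp: comm_G_eq)
 show ?thesis
  using kG g a semi_invariantD(1)[OF w] comm_G_eps_fixes[OF k(1) w]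
  by (simp add: k(2) gal_times[OF kG(1)])
qed

lemma carrier_G_eps: "carrier G_eps = eps_coset ` comm_G"
 by (auto simp: G_eps_def FactGroup_def RCOSETS_def r_coset_def)

lemma G_eps_mult:
 assumes "g \<in> comm_G" "h \<in> comm_G"
 shows "eps_coset g \<otimes>\<^bsub>G_eps\<^esub> eps_coset h = eps_coset (g \<cdot> h)"
proof -
 have "eps_coset g \<otimes>\<^bsub>G_eps\<^esub> eps_coset h = eps_coset g <#>\<^bsub>G_Q\<^esub> eps_coset h"
  by (simp add: G_eps_def FactGroup_def set_mult_def)
 then show ?thesis using normal.rcos_sum[OF normal_comm_G_eps] assms comm_G_sub by simp
qed

lemma self_in_eps_coset: "g \<in> carrier G_Q ==> g \<in> eps_coset g"
 using subgroup.one_closed[OF normal_imp_subgroup[OF normal_comm_G_eps]]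
 by (auto simp: in_eps_coset intro!: bexI[of _ "\<one>\<^bsub>G_Q\<^esub>"])

lemma sign_char_mult:
 assumes w: "semi_invariant w" and gh: "g \<in> comm_G" "h \<in> comm_G"
 shows "sign_char w (g \<cdot> h) = sign_char w g + sign_char w h"
proof -
 note wD = semi_invariantD[OF w]
 have gG: "g \<in> carrier G_Q" "h \<in> carrier G_Q" using gh comm_G_sub by auto
 have "g \<cdot> h \<in> comm_G" using gh subgroup.m_closed[OF subgroup_comm_G] by blast
 then have "bit_sign (sign_char w (g \<cdot> h)) * w = (g \<cdot> h) w"
  using comm_G_sign wD(1,2,3) by simp
 also have "\<dots> = g (bit_sign (sign_char w h) * w)"
  using gG wD(1) comm_G_sign[OF gh(2) wD(1,2,3)] by simp
 also have "\<dots> = bit_sign (sign_char w h) * (bit_sign (sign_char w g) * w)"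
  unfolding gal_bit_sign[OF gG(1) wD(1)] using comm_G_sign[OF gh(1) wD(1,2,3)] by simp
 finally have "bit_sign (sign_char w (g \<cdot> h)) * w = bit_sign (sign_char w g + sign_char w h) * w"
  by (simp only: bit_sign_add mult_ac)
 then show ?thesis using wD(3) by (metis mult_right_cancel bit_sign_inject)
qed

lemma kummer_mod_squares:
 assumes w: "semi_invariant w" and g: "g \<in> comm_G"
 shows "kummer (mod_squares (w\<^sup>2)) (eps_coset g) = sign_char w g"
proof -
 note wD = semi_invariantD[OF w]
 \<comment> \<open>The choice of a representative is harmless: all members of a coset of
   \<open>comm_G_eps\<close> act alike on \<open>w\<close>.\<close>
 define c where "c s = (if s \<in> carrier G_eps then sign_char w (SOME h. h \<in> s) else 0)" for s
 have elems: "h \<in> comm_G \<and> sign_char w h = sign_char w g" if g: "g \<in> comm_G" and h: "h \<in> eps_coset g" for g h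
 proof -
  have gG: "g \<in> carrier G_Q" using g comm_G_sub by blast
  have "h \<in> carrier G_Q" "restrict h Qab = restrict g Qab" using eps_coset_restrict[OF gG h] by auto
  moreover have "h x = g x" if "x \<in> Qab" for x using fun_cong[OF calculation(2), of x] that by simp
  ultimately have "h \<in> comm_G" using g by (simp add: comm_G_eq)
  then show ?thesis using eps_coset_apply[OF w gG h] by (simp add: sign_char_def)
 qed
 have c: "c (eps_coset g) = sign_char w g" if g: "g \<in> comm_G" for g
 proof -
  have "(SOME h. h \<in> eps_coset g) \<in> eps_coset g"
   using self_in_eps_coset[OF comm_G_sub[OF g]] some_in_eq by blast
  then show ?thesis using elems[OF g] g by (auto simp: c_def carrier_G_eps)
 qed
 \<comment> \<open>Square roots of the other representatives differ from \<open>w\<close> by factors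
   in \<open>Qab\<close>, which \<open>comm_G\<close> fixes, so one sign serves all of them.\<close>
 have roots: "\<exists>t\<in>Qab. w' = t * w" if "w'\<^sup>2 \<in> mod_squares (w\<^sup>2)" for w'
 proof -
  obtain t where t: "t \<in> Qab" "w'\<^sup>2 = t\<^sup>2 * w\<^sup>2" using \<open>w'\<^sup>2 \<in> _\<close> unfolding mod_squares_eq by blast
  then have "w'\<^sup>2 = (t * w)\<^sup>2" by (simp add: power_mult_distrib)
  then have "w' = t * w \<or> w' = (- t) * w" by (simp add: power2_eq_iff)
  then show ?thesis using t subfieldD(5)[OF Qab] by blast
 qed
 have w_in: "w\<^sup>2 \<in> mod_squares (w\<^sup>2)"
  unfolding mod_squares_eq using subfieldD(2)[OF Qab] by (auto intro!: exI[of _ 1])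
 have "kummer (mod_squares (w\<^sup>2)) = c"
  unfolding kummer_def
 proof (rule the_equality)
  have "c \<in> H1 G_eps topG_eps"
   unfolding H1_def cochains1_def
  proof (intro CollectI conjI allI impI ballI)
   show "c s = 0" if "s \<notin> carrier G_eps" for s using that by (simp add: c_def)
   have top: "topspace topG_eps = carrier G_eps"
    by (auto simp: topG_eps_def topspace_Gab_eps carrier_G_eps comm_G_sub)
   have "openin topG_eps {s \<in> carrier G_eps. c s = b}" for b
   proof -
    \<comment> \<open>The action on \<open>w\<close> factors through the cosets, so the preimage of
      \<open>U\<close> in \<open>G_Q\<close> is the set of all \<open>g\<close> with the prescribed
      value at \<open>w\<close>, which is open.\<close>
    define U where "U = {eps_coset g |g. g \<in> carrier G_Q \<and> g w = bit_sign b * w}"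
    have "openin topGab_eps U"
     unfolding topGab_eps_def openin_quotient_topology
    proof
     show "U \<subseteq> eps_coset ` topspace (krull Qbar)" by (auto simp: U_def)
     have "{g \<in> topspace (krull Qbar). eps_coset g \<in> U} = {g \<in> carrier G_Q. \<forall>x\<in>{w}. g x = (\<lambda>_. bit_sign b * w) x}"
     proof (intro equalityI subsetI)
      fix g assume "g \<in> {g \<in> topspace (krull Qbar). eps_coset g \<in> U}"
      then obtain h where h: "h \<in> carrier G_Q" "h w = bit_sign b * w" "eps_coset g = eps_coset h" and gG: "g \<in> carrier G_Q"
       by (auto simp: U_def)
      have "g \<in> eps_coset h" using self_in_eps_coset[OF gG] h(3) by simp
      then have "g w = h w" by (rule eps_coset_apply[OF w h(1)])
      then show "g \<in> {g \<in> carrier G_Q. \<forall>x\<in>{w}. g x = (\<lambda>_. bit_sign b * w) x}" using gG h by simp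
     qed (auto simp: U_def)
     then show "openin (krull Qbar) {g \<in> topspace (krull Qbar). eps_coset g \<in> U}"
      using openin_krull_agree[of "{w}" Qbar "\<lambda>_. bit_sign b * w"] wD(1) by simp
    qed
    moreover have "{s \<in> carrier G_eps. c s = b} = U \<inter> carrier G_eps"
    proof (intro equalityI subsetI)
     fix s assume "s \<in> {s \<in> carrier G_eps. c s = b}"
     then obtain g where g: "g \<in> comm_G" "s = eps_coset g" "sign_char w g = b" using c by (auto simp: carrier_G_eps)
     then show "s \<in> U \<inter> carrier G_eps"
      using comm_G_sign[OF g(1) wD(1,2,3)] comm_G_sub by (auto simp: U_def carrier_G_eps)
    next
     fix s assume "s \<in> U \<inter> carrier G_eps"
     then obtain g h where g: "g \<in> comm_G" "s = eps_coset g" and h: "h \<in> carrier G_Q" "s = eps_coset h" "h w = bit_sign b * w"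
      by (auto simp: U_def carrier_G_eps)
     have "g \<in> eps_coset h" using self_in_eps_coset[OF comm_G_sub[OF g(1)]] g(2) h(2) by simp
     then have "g w = bit_sign b * w" using eps_coset_apply[OF w h(1)] h(3) by simp
     then have "bit_sign (sign_char w g) = bit_sign b"
      using comm_G_sign[OF g(1) wD(1,2,3)] wD(3) by (metis mult_right_cancel)
     then show "s \<in> {s \<in> carrier G_eps. c s = b}" using c g by (auto simp: carrier_G_eps)
    qed
    ultimately show ?thesis unfolding topG_eps_def openin_subtopology by blast
   qed
   then have "openin topG_eps (\<Union>b\<in>B. {s \<in> carrier G_eps. c s = b})" for B by blast
   moreover have "{s \<in> carrier G_eps. c s \<in> B} = (\<Union>b\<in>B. {s \<in> carrier G_eps. c s = b})" for B by blast
   ultimately show "continuous_map topG_eps (discrete_topology UNIV) c"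
    by (simp add: continuous_map_def top)
   fix s s' assume "s \<in> carrier G_eps" "s' \<in> carrier G_eps"
   then obtain g h where gh: "g \<in> comm_G" "h \<in> comm_G" "s = eps_coset g" "s' = eps_coset h" by (auto simp: carrier_G_eps)
   show "c (s \<otimes>\<^bsub>G_eps\<^esub> s') = c s + c s'"
    using gh sign_char_mult[OF w gh(1,2)] subgroup.m_closed[OF subgroup_comm_G gh(1,2)]
    by (simp only: G_eps_mult c)
  qed
  moreover have "\<sigma> w' = bit_sign (c s) * w'"
   if w': "w'\<^sup>2 \<in> mod_squares (w\<^sup>2)" and s: "s \<in> carrier G_eps" "\<sigma> \<in> s" for w' s \<sigma>
  proof -
   obtain g where g: "g \<in> comm_G" "s = eps_coset g" using s by (auto simp: carrier_G_eps)
   have \<sigma>: "\<sigma> \<in> comm_G" "sign_char w \<sigma> = c s" using elems[OF g(1), of \<sigma>] s(2) g(2) c[OF g(1)] by auto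
   obtain t where t: "t \<in> Qab" "w' = t * w" using roots[OF w'] by blast
   have "\<sigma> t = t" "\<sigma> \<in> carrier G_Q" using \<sigma> t by (auto simp: comm_G_eq)
   then show ?thesis
    using gal_times[of \<sigma> Qbar t w] t wD(1) comm_G_sign[OF \<sigma>(1) wD(1,2,3)] \<sigma>(2) by (simp add: mult_ac)
  qed
  ultimately show "c \<in> H1 G_eps topG_eps \<and> (\<forall>w'. w'\<^sup>2 \<in> mod_squares (w\<^sup>2) \<longrightarrow>
    (\<forall>s\<in>carrier G_eps. \<forall>\<sigma>\<in>s. \<sigma> w' = bit_sign (c s) * w'))" by blast
  fix d assume d: "d \<in> H1 G_eps topG_eps \<and> (\<forall>w'. w'\<^sup>2 \<in> mod_squares (w\<^sup>2) \<longrightarrow>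
    (\<forall>s\<in>carrier G_eps. \<forall>\<sigma>\<in>s. \<sigma> w' = bit_sign (d s) * w'))"
  show "d = c"
  proof
   fix s
   show "d s = c s"
   proof (cases "s \<in> carrier G_eps")
    case True
    then obtain g where g: "g \<in> comm_G" "s = eps_coset g" by (auto simp: carrier_G_eps)
    have "g \<in> s" using self_in_eps_coset[OF comm_G_sub[OF g(1)]] g(2) by simp
    then have "g w = bit_sign (d s) * w" using d w_in True by blast
    then have "bit_sign (sign_char w g) = bit_sign (d s)"
     using comm_G_sign[OF g(1) wD(1,2,3)] wD(3) by (metis mult_right_cancel)
    then show ?thesis using c[OF g(1)] g(2) by simp
   next
    case False
    then show ?thesis using d by (simp add: c_def H1_def cochains1_def)
   qed
  qed
 qed
 then show ?thesis using c[OF g] by simp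
qed

lemma Gab_eps_mult:
 assumes "g \<in> carrier G_Q" "h \<in> carrier G_Q"
 shows "eps_coset g \<otimes>\<^bsub>Gab_eps\<^esub> eps_coset h = eps_coset (g \<cdot> h)"
 using normal.rcos_sum[OF normal_comm_G_eps assms] by (simp add: Gab_eps_def)

lemma Gab_eps_inv:
 assumes "g \<in> carrier G_Q" shows "inv\<^bsub>Gab_eps\<^esub> (eps_coset g) = eps_coset (ginv g)"
proof -
 have "eps_coset g \<in> carrier (G_Q Mod comm_G_eps)" using assms by (auto simp: FactGroup_def RCOSETS_def)
 then show ?thesis
  using normal.inv_FactGroup[OF normal_comm_G_eps] normal.rcos_inv[OF normal_comm_G_eps assms] by (simp add: Gab_eps_def)
qed

text \<open>The section cocycle is the sign by which \<open>G \<sigma> (G \<tau> w)\<close> differs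
  from the value at \<open>w\<close> of the lift of the product. Exchanging \<open>\<sigma>\<close>
  and \<open>\<tau>\<close> does not change that value, so the antisymmetrised cocycle is the
  commutation sign, which by hypothesis is that of \<open>cup x y\<close>.\<close>

theorem D_map_mod_squares:
 assumes w: "semi_invariant w" and xy: "x \<in> H1ab" "y \<in> H1ab"
  and comm: "\<And>g h. g \<in> carrier G_Q ==> h \<in> carrier G_Q ==>
   g (h w) = bit_sign (x (restrict g Qab) * y (restrict h Qab) + x (restrict h Qab) * y (restrict g Qab)) * h (g w)"
 shows "D_map (mod_squares (w\<^sup>2)) = wedge H1ab x y"
proof -
 interpret A: topological_comm_group Gab topGab by (rule topological_comm_group_Gab)
 note wD = semi_invariantD[OF w]
 define \<theta> where "\<theta> = (SOME \<theta>. continuous_section \<theta>)"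
 define c where "c = kummer (mod_squares (w\<^sup>2))"
 have \<theta>: "continuous_section \<theta>" unfolding \<theta>_def using continuous_section_exists by (rule someI_ex)
 have cont: "continuous_map topGab topGab_eps \<theta>"
  and res: "\<And>\<sigma> g. \<sigma> \<in> carrier Gab ==> g \<in> \<theta> \<sigma> ==> restrict g Qab = \<sigma>"
  using \<theta> by (auto simp: continuous_section_def)
 have "\<exists>g\<in>carrier G_Q. \<theta> \<sigma> = eps_coset g" if "\<sigma> \<in> carrier Gab" for \<sigma>
  using continuous_map_image_subset_topspace[OF cont] that by (auto simp: topspace_Gab_eps)
 then obtain G where G: "\<And>\<sigma>. \<sigma> \<in> carrier Gab ==> G \<sigma> \<in> carrier G_Q"
  and \<theta>G: "\<And>\<sigma>. \<sigma> \<in> carrier Gab ==> \<theta> \<sigma> = eps_coset (G \<sigma>)" by metis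
 have Gres: "restrict (G \<sigma>) Qab = \<sigma>" if "\<sigma> \<in> carrier Gab" for \<sigma>
  using res[OF that] self_in_eps_coset[OF G[OF that]] \<theta>G[OF that] by simp
 have Gapp: "G \<sigma> z = \<sigma> z" if "\<sigma> \<in> carrier Gab" "z \<in> Qab" for \<sigma> z
  using fun_cong[OF Gres[OF that(1)], of z] that(2) by simp
 define f where "f = section_cocycle \<theta> c"
 have f0: "f (\<sigma>, \<tau>) = 0" if "\<sigma> \<notin> carrier Gab \<or> \<tau> \<notin> carrier Gab" for \<sigma> \<tau>
  using that by (auto simp: f_def section_cocycle_def)
 have f: "G \<sigma> (G \<tau> w) = bit_sign (f (\<sigma>, \<tau>)) * G (\<sigma> \<otimes>\<^bsub>Gab\<^esub> \<tau>) w"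
  if s: "\<sigma> \<in> carrier Gab" "\<tau> \<in> carrier Gab" for \<sigma> \<tau>
 proof -
  let ?m = "G (\<sigma> \<otimes>\<^bsub>Gab\<^esub> \<tau>)"
  have m: "\<sigma> \<otimes>\<^bsub>Gab\<^esub> \<tau> \<in> carrier Gab" using s by simp
  note GG = G[OF s(1)] G[OF s(2)] G[OF m]
  define k where "k = G \<sigma> \<cdot> G \<tau> \<cdot> ginv ?m"
  have kG: "k \<in> carrier G_Q" using GG by (simp add: k_def)
  have "k z = z" if z: "z \<in> Qab" for z
  proof -
   have i: "(ginv ?m) z \<in> Qab" using GG(3) z by simp
   have "k z = G \<sigma> (G \<tau> ((ginv ?m) z))" using GG z by (simp add: k_def)
   also have "\<dots> = \<sigma> (\<tau> ((ginv ?m) z))" using Gapp[OF s(1)] Gapp[OF s(2) i] s(2) i by simp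
   also have "\<dots> = ?m ((ginv ?m) z)" using Gapp[OF m i] s i by simp
   also have "\<dots> = z" using GG(3) z by simp
   finally show ?thesis .
  qed
  then have kc: "k \<in> comm_G" using kG by (simp add: comm_G_eq)
  have "f (\<sigma>, \<tau>) = c (eps_coset k)"
   using s GG m by (simp add: f_def section_cocycle_def \<theta>G Gab_eps_mult Gab_eps_inv k_def)
  then have fk: "f (\<sigma>, \<tau>) = sign_char w k" using kummer_mod_squares[OF w kc] by (simp add: c_def)
  obtain a where a: "a \<in> Qab" "?m w = a * w" using wD(4)[OF GG(3)] by blast
  have "k (?m w) = k a * k w" using a gal_times[OF kG, of a w] wD(1) by simp
  also have "k a = a" using kc a by (simp add: comm_G_eq)
  also have "k w = bit_sign (f (\<sigma>, \<tau>)) * w" using comm_G_sign[OF kc wD(1,2,3)] fk by simp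
  finally have "k (?m w) = bit_sign (f (\<sigma>, \<tau>)) * ?m w" using a by (simp add: mult_ac)
  moreover have "k (?m w) = G \<sigma> (G \<tau> w)" using GG wD(1) by (simp add: k_def)
  ultimately show ?thesis by simp
 qed
 have nz: "G \<sigma> w \<noteq> 0" if "\<sigma> \<in> carrier Gab" for \<sigma>
  using gal_eq_0_iff[OF Qbar G[OF that] wD(1)] wD(3) by simp
 \<comment> \<open>The composite of three lifts, applied to \<open>w\<close>, is compared with the
   lift of the triple product in two ways, and the total signs agree.\<close>
 have cocycle: "f (\<tau>, \<eta>) - f (\<sigma> \<otimes>\<^bsub>Gab\<^esub> \<tau>, \<eta>) + f (\<sigma>, \<tau> \<otimes>\<^bsub>Gab\<^esub> \<eta>) - f (\<sigma>, \<tau>) = 0"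
  if s: "\<sigma> \<in> carrier Gab" "\<tau> \<in> carrier Gab" "\<eta> \<in> carrier Gab" for \<sigma> \<tau> \<eta>
 proof -
  let ?st = "\<sigma> \<otimes>\<^bsub>Gab\<^esub> \<tau>" and ?te = "\<tau> \<otimes>\<^bsub>Gab\<^esub> \<eta>"
  have m: "?st \<in> carrier Gab" "?te \<in> carrier Gab" using s by simp_all
  have wG: "G \<rho> w \<in> Qbar" if "\<rho> \<in> carrier Gab" for \<rho> using G[OF that] wD(1) by simp
  have "G \<sigma> (G \<tau> (G \<eta> w)) = bit_sign (f (\<tau>, \<eta>)) * G \<sigma> (G ?te w)"
   using f[OF s(2,3)] gal_bit_sign[OF G[OF s(1)] wG[OF m(2)]] by simp
  also have "\<dots> = bit_sign (f (\<tau>, \<eta>)) * (bit_sign (f (\<sigma>, ?te)) * G (\<sigma> \<otimes>\<^bsub>Gab\<^esub> ?te) w)"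
   using f[OF s(1) m(2)] by simp
  finally have 1: "G \<sigma> (G \<tau> (G \<eta> w)) = bit_sign (f (\<tau>, \<eta>) + f (\<sigma>, ?te)) * G (\<sigma> \<otimes>\<^bsub>Gab\<^esub> ?te) w"
   by (simp only: bit_sign_add mult_ac)
  obtain b where b: "b \<in> Qab" "G \<eta> w = b * w" using wD(4)[OF G[OF s(3)]] by blast
  have b2: "\<tau> b \<in> Qab" using b s by simp
  have "G \<sigma> (G \<tau> (G \<eta> w)) = G \<sigma> (G \<tau> b) * G \<sigma> (G \<tau> w)"
   using b wD(1) G[OF s(1)] G[OF s(2)] by (simp add: gal_times)
  also have "G \<sigma> (G \<tau> b) = G ?st b" using Gapp[OF s(2) b(1)] Gapp[OF s(1) b2] Gapp[OF m(1) b(1)] s b by simp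
  also have "G ?st b * G \<sigma> (G \<tau> w) = bit_sign (f (\<sigma>, \<tau>)) * G ?st (G \<eta> w)"
   using f[OF s(1,2)] b wD(1) gal_times[OF G[OF m(1)], of b w] by (simp add: mult_ac)
  also have "\<dots> = bit_sign (f (\<sigma>, \<tau>)) * (bit_sign (f (?st, \<eta>)) * G (?st \<otimes>\<^bsub>Gab\<^esub> \<eta>) w)"
   using f[OF m(1) s(3)] by simp
  also have "?st \<otimes>\<^bsub>Gab\<^esub> \<eta> = \<sigma> \<otimes>\<^bsub>Gab\<^esub> ?te" using s by (simp add: A.m_assoc)
  finally have "bit_sign (f (\<tau>, \<eta>) + f (\<sigma>, ?te)) * G (\<sigma> \<otimes>\<^bsub>Gab\<^esub> ?te) w =
    bit_sign (f (\<sigma>, \<tau>) + f (?st, \<eta>)) * G (\<sigma> \<otimes>\<^bsub>Gab\<^esub> ?te) w"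
   using 1 by (simp only: bit_sign_add mult_ac)
  moreover have "G (\<sigma> \<otimes>\<^bsub>Gab\<^esub> ?te) w \<noteq> 0" using s by (intro nz) simp
  ultimately have "f (\<tau>, \<eta>) + f (\<sigma>, ?te) = f (\<sigma>, \<tau>) + f (?st, \<eta>)" by (metis mult_right_cancel bit_sign_inject)
  then show ?thesis
   by (cases "f (\<tau>, \<eta>)"; cases "f (\<sigma>, ?te)"; cases "f (\<sigma>, \<tau>)"; cases "f (?st, \<eta>)") simp_all
 qed
 \<comment> \<open>The sign \<open>f\<close> involves the lifts only through their action on
   \<open>w\<close> and on \<open>Qab\<close>. The value at \<open>w\<close> is constant on cosets
   of \<open>comm_G_eps\<close>, so continuity of \<open>\<theta>\<close> makes it locally
   constant.\<close>
 have locally: "\<exists>F. finite F \<and> F \<subseteq> Qab \<and> (\<forall>\<sigma>'\<in>carrier Gab. (\<forall>z\<in>F. \<sigma>' z = \<sigma> z) \<longrightarrow> G \<sigma>' w = G \<sigma> w)"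
  if s: "\<sigma> \<in> carrier Gab" for \<sigma>
 proof -
  define U where "U = {eps_coset g |g. g \<in> carrier G_Q \<and> g w = G \<sigma> w}"
  have "openin topGab_eps U"
   unfolding topGab_eps_def openin_quotient_topology
  proof
   show "U \<subseteq> eps_coset ` topspace (krull Qbar)" by (auto simp: U_def)
   have "{g \<in> topspace (krull Qbar). eps_coset g \<in> U} = {g \<in> carrier G_Q. \<forall>x\<in>{w}. g x = G \<sigma> x}"
   proof (intro equalityI subsetI)
    fix g assume "g \<in> {g \<in> topspace (krull Qbar). eps_coset g \<in> U}"
    then obtain h where h: "h \<in> carrier G_Q" "h w = G \<sigma> w" "eps_coset g = eps_coset h" and gG: "g \<in> carrier G_Q"
     by (auto simp: U_def)
    have "g \<in> eps_coset h" using self_in_eps_coset[OF gG] h(3) by simp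
    then have "g w = h w" by (rule eps_coset_apply[OF w h(1)])
    then show "g \<in> {g \<in> carrier G_Q. \<forall>x\<in>{w}. g x = G \<sigma> x}" using gG h by simp
   qed (auto simp: U_def)
   then show "openin (krull Qbar) {g \<in> topspace (krull Qbar). eps_coset g \<in> U}"
    using openin_krull_agree[of "{w}" Qbar "G \<sigma>"] wD(1) by simp
  qed
  then have "openin topGab {\<sigma>' \<in> topspace topGab. \<theta> \<sigma>' \<in> U}" by (rule openin_continuous_map_preimage[OF cont])
  moreover have "\<sigma> \<in> {\<sigma>' \<in> topspace topGab. \<theta> \<sigma>' \<in> U}" using s \<theta>G[OF s] G[OF s] by (auto simp: U_def)
  ultimately obtain F where F: "finite F" "F \<subseteq> Qab"
   and FU: "\<forall>\<tau>\<in>carrier Gab. (\<forall>x\<in>F. \<tau> x = \<sigma> x) \<longrightarrow> \<tau> \<in> {\<sigma>' \<in> topspace topGab. \<theta> \<sigma>' \<in> U}"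
   unfolding openin_krull by meson
  have "G \<sigma>' w = G \<sigma> w" if s': "\<sigma>' \<in> carrier Gab" "\<forall>z\<in>F. \<sigma>' z = \<sigma> z" for \<sigma>'
  proof -
   have "\<theta> \<sigma>' \<in> U" using FU s' by blast
   then obtain h where h: "h \<in> carrier G_Q" "h w = G \<sigma> w" "eps_coset (G \<sigma>') = eps_coset h"
    using \<theta>G[OF s'(1)] by (auto simp: U_def)
   have "G \<sigma>' \<in> eps_coset h" using self_in_eps_coset[OF G[OF s'(1)]] h(3) by simp
   from eps_coset_apply[OF w h(1) this] h(2) show ?thesis by simp
  qed
  then show ?thesis using F by blast
 qed
 have loc2: "\<exists>F. finite F \<and> F \<subseteq> Qab \<and> (\<forall>\<sigma>'\<in>carrier Gab. \<forall>\<tau>'\<in>carrier Gab.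
   (\<forall>x\<in>F. \<sigma>' x = \<sigma> x \<and> \<tau>' x = \<tau> x) \<longrightarrow> f (\<sigma>', \<tau>') = f (\<sigma>, \<tau>))"
  if s: "\<sigma> \<in> carrier Gab" "\<tau> \<in> carrier Gab" for \<sigma> \<tau>
 proof -
  let ?m = "\<sigma> \<otimes>\<^bsub>Gab\<^esub> \<tau>"
  have m: "?m \<in> carrier Gab" using s by simp
  obtain F1 where F1: "finite F1" "F1 \<subseteq> Qab" "\<forall>\<sigma>'\<in>carrier Gab. (\<forall>z\<in>F1. \<sigma>' z = \<sigma> z) \<longrightarrow> G \<sigma>' w = G \<sigma> w"
   using locally[OF s(1)] by (elim exE conjE)
  obtain F2 where F2: "finite F2" "F2 \<subseteq> Qab" "\<forall>\<sigma>'\<in>carrier Gab. (\<forall>z\<in>F2. \<sigma>' z = \<tau> z) \<longrightarrow> G \<sigma>' w = G \<tau> w"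
   using locally[OF s(2)] by (elim exE conjE)
  obtain F3 where F3: "finite F3" "F3 \<subseteq> Qab" "\<forall>\<sigma>'\<in>carrier Gab. (\<forall>z\<in>F3. \<sigma>' z = ?m z) \<longrightarrow> G \<sigma>' w = G ?m w"
   using locally[OF m] by (elim exE conjE)
  \<comment> \<open>\<open>b\<close> joins the test set because \<open>G \<sigma>'\<close> acts on
    \<open>G \<tau> w = b * w\<close> through its values at \<open>b\<close> and at
    \<open>w\<close>.\<close>
  obtain b where b: "b \<in> Qab" "G \<tau> w = b * w" using wD(4)[OF G[OF s(2)]] by blast
  define E where "E = F1 \<union> F2 \<union> F3 \<union> \<tau> ` F3 \<union> {b}"
  have E: "finite E" "E \<subseteq> Qab" using F1(1,2) F2(1,2) F3(1,2) b s(2) by (auto simp: E_def)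
  have "f (\<sigma>', \<tau>') = f (\<sigma>, \<tau>)" if s': "\<sigma>' \<in> carrier Gab" "\<tau>' \<in> carrier Gab"
   and ag: "\<forall>x\<in>E. \<sigma>' x = \<sigma> x \<and> \<tau>' x = \<tau> x" for \<sigma>' \<tau>'
  proof -
   have g1: "G \<sigma>' w = G \<sigma> w" using F1(3) s'(1) ag by (simp add: E_def)
   have g2: "G \<tau>' w = G \<tau> w" using F2(3) s'(2) ag by (simp add: E_def)
   have "(\<sigma>' \<otimes>\<^bsub>Gab\<^esub> \<tau>') z = ?m z" if z: "z \<in> F3" for z
   proof -
    have "z \<in> Qab" using z F3 by blast
    moreover have "\<tau>' z = \<tau> z" "\<sigma>' (\<tau> z) = \<sigma> (\<tau> z)" using ag z by (auto simp: E_def)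
    ultimately show ?thesis using s s' by simp
   qed
   then have g3: "G (\<sigma>' \<otimes>\<^bsub>Gab\<^esub> \<tau>') w = G ?m w" using F3(3) A.m_closed[OF s'] by blast
   have "\<sigma>' b = \<sigma> b" using ag by (simp add: E_def)
   then have "G \<sigma>' (b * w) = G \<sigma> (b * w)"
    using gal_times[OF G[OF s'(1)], of b w] gal_times[OF G[OF s(1)], of b w] b(1) wD(1) g1
     Gapp[OF s'(1) b(1)] Gapp[OF s(1) b(1)] by simp
   then have "G \<sigma>' (G \<tau>' w) = G \<sigma> (G \<tau> w)" by (simp only: g2 b(2))
   then have "bit_sign (f (\<sigma>', \<tau>')) * G ?m w = bit_sign (f (\<sigma>, \<tau>)) * G ?m w"
    using f[OF s'] f[OF s] g3 by simp
   then show ?thesis using nz[OF m] by simp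
  qed
  then show ?thesis using E by blast
 qed
 have "continuous_map (prod_topology topGab topGab) (discrete_topology UNIV) f"
  unfolding continuous_map_def
 proof (intro conjI allI impI)
  fix U :: "bit set"
  show "openin (prod_topology topGab topGab) {z \<in> topspace (prod_topology topGab topGab). f z \<in> U}"
  proof (rule openin_prod_krull)
   fix \<sigma> \<tau> assume "(\<sigma>, \<tau>) \<in> {z \<in> topspace (prod_topology topGab topGab). f z \<in> U}"
   then have st: "\<sigma> \<in> carrier Gab" "\<tau> \<in> carrier Gab" "f (\<sigma>, \<tau>) \<in> U" by auto
   obtain F where F: "finite F" "F \<subseteq> Qab" "\<forall>\<sigma>'\<in>carrier Gab. \<forall>\<tau>'\<in>carrier Gab.
     (\<forall>x\<in>F. \<sigma>' x = \<sigma> x \<and> \<tau>' x = \<tau> x) \<longrightarrow> f (\<sigma>', \<tau>') = f (\<sigma>, \<tau>)"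
    using loc2[OF st(1,2)] by (elim exE conjE)
   show "\<exists>F. finite F \<and> F \<subseteq> Qab \<and> (\<forall>\<sigma>'\<in>carrier Gab. \<forall>\<tau>'\<in>carrier Gab.
     (\<forall>x\<in>F. \<sigma>' x = \<sigma> x \<and> \<tau>' x = \<tau> x) \<longrightarrow> (\<sigma>', \<tau>') \<in> {z \<in> topspace (prod_topology topGab topGab). f z \<in> U})"
    using F st(3) by (intro exI[of _ F]) simp
  qed auto
 qed auto
 then have fZ: "f \<in> cocycles2 Gab topGab"
  unfolding cocycles2_def cochains2_def
 proof (intro CollectI conjI allI impI ballI)
  fix z :: "(complex \<Rightarrow> complex) \<times> (complex \<Rightarrow> complex)"
  assume "z \<notin> carrier Gab \<times> carrier Gab"
  then show "f z = 0" using f0[of "fst z" "snd z"] by (cases z) simp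
 qed (use cocycle in simp_all)
 have "f (\<sigma>, \<tau>) + f (\<tau>, \<sigma>) = cup x y (\<sigma>, \<tau>) + cup x y (\<tau>, \<sigma>)"
  if s: "\<sigma> \<in> carrier Gab" "\<tau> \<in> carrier Gab" for \<sigma> \<tau>
 proof -
  let ?m = "\<sigma> \<otimes>\<^bsub>Gab\<^esub> \<tau>"
  have m: "?m \<in> carrier Gab" "\<tau> \<otimes>\<^bsub>Gab\<^esub> \<sigma> = ?m" using s by (simp_all add: A.m_comm)
  have "bit_sign (f (\<sigma>, \<tau>)) * G ?m w = G \<sigma> (G \<tau> w)" using f[OF s] by simp
  also have "\<dots> = bit_sign (x \<sigma> * y \<tau> + x \<tau> * y \<sigma>) * G \<tau> (G \<sigma> w)"
   using comm[OF G[OF s(1)] G[OF s(2)]] Gres[OF s(1)] Gres[OF s(2)] by simp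
  also have "\<dots> = bit_sign (x \<sigma> * y \<tau> + x \<tau> * y \<sigma> + f (\<tau>, \<sigma>)) * G ?m w"
   using f[OF s(2,1)] m(2) by (simp add: bit_sign_add)
  finally have "f (\<sigma>, \<tau>) = x \<sigma> * y \<tau> + x \<tau> * y \<sigma> + f (\<tau>, \<sigma>)" using nz[OF m(1)] by (metis mult_right_cancel bit_sign_inject)
  then show ?thesis
   by (cases "f (\<sigma>, \<tau>)"; cases "f (\<tau>, \<sigma>)") (simp_all add: cup_def)
 qed
 then have "H2_minus_class Gab topGab f = H2_minus_class Gab topGab (cup x y)"
  by (intro A.H2_minus_class_eqI fZ A.cup_cocycle xy)
 then have "push_extension (kummer (mod_squares (w\<^sup>2))) = H2_minus_class Gab topGab (cup x y)"
  by (simp add: push_extension_def f_def \<theta>_def c_def)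
 then show ?thesis
  using mod_squares_H0[OF w] A.ext_square_cup_iso[OF cup_iso_def xy] by (simp add: D_map_def)
qed

section \<open>Conjugates of roots of unity\<close>

lemma algebraic_int_diff: "algebraic_int x ==> algebraic_int y ==> algebraic_int (x - y)" for x y :: complex
 using algebraic_int_add[of x "- y"] by auto

lemma algebraic_int_of_nat': "algebraic_int (of_nat n :: complex)"
 by (rule int_imp_algebraic_int) simp

lemma algebraic_int_power: "algebraic_int x ==> algebraic_int (x ^ n)" for x :: complex
 by (induction n) (auto intro: algebraic_int_mult)

lemma algebraic_int_sum: "(\<And>i. i \<in> A ==> algebraic_int (f i)) ==> algebraic_int (sum f A)"
 for f :: "'a \<Rightarrow> complex"
 by (induction A rule: infinite_finite_induct) (auto intro: algebraic_int_add)

lemma algebraic_int_poly: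
 fixes p :: "complex poly"
 assumes "\<And>i. algebraic_int (coeff p i)" "algebraic_int x"
 shows "algebraic_int (poly p x)"
 unfolding poly_altdef using assms by (intro algebraic_int_sum algebraic_int_mult algebraic_int_power)

lemma algebraic_int_root_of_unity: "z ^ n = 1 ==> n > 0 ==> algebraic_int (z::complex)"
 by (rule algebraic_int_root[of 1 "Polynomial.monom 1 n" z])
  (auto simp: poly_monom degree_monom_eq coeff_monom)

lemma algebraic_int_coeff_of_roots:
 fixes p :: "complex poly"
 assumes p: "lead_coeff p = 1" and roots: "\<And>z. poly p z = 0 ==> algebraic_int z"
 shows "algebraic_int (coeff p i)"
proof -
 obtain as where as: "Polynomial.smult (coeff p (degree p)) (\<Prod>a\<leftarrow>as. [:- a, 1:]) = p"
  using fundamental_theorem_algebra_factorized[of p] by blast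
 then have p_eq: "p = (\<Prod>a\<leftarrow>as. [:- a, 1:])" using p by simp
 have "\<forall>a\<in>set as. algebraic_int a"
 proof
  fix a assume "a \<in> set as"
  then have "[:- a, 1:] dvd p" unfolding p_eq by (intro prod_list_dvd) auto
  then show "algebraic_int a" using roots by (simp add: poly_eq_0_iff_dvd)
 qed
 then have "\<forall>i. algebraic_int (coeff (\<Prod>a\<leftarrow>as. [:- a, 1:]) i)"
 proof (induction as)
  case Nil
  then show ?case by (auto simp: coeff_1)
 next
  case (Cons a as)
  have c: "coeff ([:-a, 1:] * q) i = (if i = 0 then 0 else coeff q (i - 1)) - a * coeff q i" for q and i
   by (cases i) auto
  have "algebraic_int ((if i = 0 then 0 else coeff (\<Prod>a\<leftarrow>as. [:- a, 1:]) (i - 1)) - a * coeff (\<Prod>a\<leftarrow>as. [:- a, 1:]) i)" for i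
   using Cons by (intro algebraic_int_diff algebraic_int_mult) auto
  then show ?case unfolding list.map prod_list.Cons c by blast
 qed
 then show ?thesis unfolding p_eq by blast
qed

text \<open>The inner binomial coefficients are divisible by \<open>l\<close>.\<close>

lemma frobenius_add:
 fixes a b :: complex
 assumes l: "prime l" and ab: "algebraic_int a" "algebraic_int b"
 shows "algebraic_int (((a + b) ^ l - a ^ l - b ^ l) / of_nat l)"
proof -
 have l0: "l > 0" using l by (simp add: prime_gt_0_nat)
 have ex: "\<exists>m. l choose k = l * m" if "k \<in> {1..<l}" for k
  using dvd_choose_prime[OF _ _ _ l, of k] that by (auto simp: dvd_def)
 define m where "m k = (l choose k) div l" for k
 have m: "of_nat (l choose k) / of_nat l = (of_nat (m k) :: complex)" if "k \<in> {1..<l}" for k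
  using ex[OF that] l0 by (auto simp: m_def)
 have "(a + b) ^ l = (\<Sum>k\<le>l. of_nat (l choose k) * a ^ k * b ^ (l - k))" by (rule binomial_ring)
 also have "{..l} = insert 0 (insert l {1..<l})" using l0 by auto
 also have "(\<Sum>k\<in>\<dots>. of_nat (l choose k) * a ^ k * b ^ (l - k)) =
   b ^ l + a ^ l + (\<Sum>k\<in>{1..<l}. of_nat (l choose k) * a ^ k * b ^ (l - k))"
  using l0 by (subst sum.insert, simp, simp, subst sum.insert) auto
 finally have "((a + b) ^ l - a ^ l - b ^ l) / of_nat l =
   (\<Sum>k\<in>{1..<l}. of_nat (l choose k) / of_nat l * (a ^ k * b ^ (l - k)))"
  by (simp add: sum_divide_distrib mult_ac)
 also have "\<dots> = (\<Sum>k\<in>{1..<l}. of_nat (m k) * (a ^ k * b ^ (l - k)))"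
  by (intro sum.cong refl) (simp only: m)
 finally show ?thesis
  by (simp only: algebraic_int_sum algebraic_int_mult algebraic_int_power algebraic_int_of_nat' ab)
qed

text \<open>The congruence of \<open>p(X^l)\<close> and \<open>p(X)^l\<close> modulo
  \<open>l\<close>, evaluated at an algebraic integer. The induction splits off the constant term by
  \<open>frobenius_add\<close> and treats it by Fermat's theorem.\<close>

lemma frobenius_poly:
 fixes p :: "complex poly" and z :: complex
 assumes l: "prime l" and p: "\<And>i. coeff p i \<in> \<int>" and z: "algebraic_int z"
 shows "algebraic_int ((poly p (z ^ l) - poly p z ^ l) / of_nat l)"
 using p
proof (induction p)
 case 0
 then show ?case using l by (simp add: prime_gt_0_nat zero_power)
next
 case (pCons c p)
 have l0: "l > 0" using l by (simp add: prime_gt_0_nat)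
 have cZ: "c \<in> \<int>" using pCons(3)[of 0] by simp
 have pZ: "coeff p i \<in> \<int>" for i using pCons(3)[of "Suc i"] by simp
 have IH: "algebraic_int ((poly p (z ^ l) - poly p z ^ l) / of_nat l)" using pCons pZ by blast
 have "algebraic_int (poly p z)" by (rule algebraic_int_poly[OF int_imp_algebraic_int[OF pZ] z])
 then have 1: "algebraic_int (((c + z * poly p z) ^ l - c ^ l - (z * poly p z) ^ l) / of_nat l)"
  by (intro frobenius_add[OF l int_imp_algebraic_int[OF cZ]] algebraic_int_mult z)
 obtain n where n: "c = of_int n" using cZ by (auto elim: Ints_cases)
 \<comment> \<open>Fermat's theorem for integers of either sign, by passing to the residue
   \<open>m\<close>.\<close>
 have "[n ^ l = n] (mod int l)"
 proof (cases "int l dvd n")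
  case True
  then have "int l dvd n ^ l" using l0 by (meson dvd_power dvd_trans)
  with True show ?thesis by (simp add: cong_iff_dvd_diff)
 next
  case False
  have "prime (int l)" using l by simp
  define m where "m = nat (n mod int l)"
  have m: "int m = n mod int l" using l0 by (simp add: m_def)
  then have nm: "[n = int m] (mod int l)" by (simp add: cong_iff_dvd_diff minus_mod_eq_div_mult)
  have "\<not> l dvd m" using False m by (metis dvd_mod_iff dvd_refl of_nat_dvd_iff)
  then have "coprime m l" using l by (metis coprime_commute prime_imp_coprime)
  then have "[m ^ totient l = 1] (mod l)" by (rule euler_theorem)
  then have "[int (m ^ totient l) = int 1] (mod int l)" by (simp only: cong_int_iff)
  then have "[int m ^ totient l = 1] (mod int l)" by simp
  then have "[n ^ totient l = 1] (mod int l)" using cong_trans[OF cong_pow[OF nm]] by blast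
  then have "[n * n ^ (l - 1) = n * 1] (mod int l)" using totient_prime[OF l] by (intro cong_mult) simp_all
  then show ?thesis using l0 by (simp flip: power_Suc)
 qed
 then obtain k where k: "n - n ^ l = int l * k" by (metis cong_iff_dvd_diff cong_sym dvd_def)
 have "(c - c ^ l) / of_nat l = of_int k"
 proof -
  have "c - c ^ l = of_int (n - n ^ l)" by (simp add: n)
  then show ?thesis using l0 by (simp add: k)
 qed
 then have 2: "algebraic_int ((c - c ^ l) / of_nat l)" by simp
 have 3: "algebraic_int (z ^ l * ((poly p (z ^ l) - poly p z ^ l) / of_nat l))"
  by (intro algebraic_int_mult algebraic_int_power z IH)
 have "(poly (pCons c p) (z ^ l) - poly (pCons c p) z ^ l) / of_nat l =
  (c - c ^ l) / of_nat l - ((c + z * poly p z) ^ l - c ^ l - (z * poly p z) ^ l) / of_nat l +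
  z ^ l * ((poly p (z ^ l) - poly p z ^ l) / of_nat l)"
  using l0 by (simp add: field_simps power_mult_distrib)
 then show ?case using 1 2 3 by (simp only: algebraic_int_add algebraic_int_diff)
qed

text \<open>If \<open>f\<close> is the minimal polynomial of \<open>z\<close> and \<open>z\<^sup>l\<close> is not a root of \<open>f\<close>, then \<open>f(z\<^sup>l)\<close> is
 divisible by \<open>l\<close> because of \<open>f(X\<^sup>l) \<equiv> f(X)\<^sup>l\<close>, and divides the derivative of \<open>X\<^sup>N - 1\<close>
 at \<open>z\<^sup>l\<close>, so \<open>l\<close> divides \<open>N\<close>.\<close>

lemma cyclotomic_conjugate_prime:
 fixes z :: complex
 assumes z: "z ^ N = 1" and N: "N > 0" and l: "prime l" "\<not> l dvd N"
 shows "\<exists>g\<in>carrier G_Q. g z = z ^ l"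
proof -
 have zQ: "z \<in> Qbar" using root_of_unity_Qab[OF z N] by simp
 obtain f0 :: "rat poly" where f0: "Factorial_Ring.irreducible f0" "poly (map_poly of_rat f0) z = 0"
  by (rule Qbar_rat_root[OF zQ])
 have dvd: "f0 dvd Polynomial.monom 1 N - 1"
 proof (rule irreducible_common_root_dvd[OF f0])
  have "map_poly of_rat (Polynomial.monom 1 N - 1) = (Polynomial.monom 1 N - 1 :: complex poly)"
   by (intro poly_eqI) (simp add: coeff_map_poly coeff_1)
  then show "poly (map_poly of_rat (Polynomial.monom 1 N - 1)) z = 0" using z by (simp add: poly_monom)
 qed
 have f0nz: "f0 \<noteq> 0" using f0 by auto
 define f where "f = Polynomial.smult (inverse (lead_coeff f0)) f0"
 have lcf: "lead_coeff f = 1" using f0nz by (simp add: f_def)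
 have "f dvd Polynomial.monom 1 N - 1" using dvd f0nz by (simp add: f_def smult_dvd_iff)
 then obtain h where h: "Polynomial.monom 1 N - 1 = f * h" by (auto simp: dvd_def)
 define F where "F = (map_poly of_rat f :: complex poly)"
 define H where "H = (map_poly of_rat h :: complex poly)"
 have FH: "Polynomial.monom 1 N - 1 = F * H"
 proof -
  have "map_poly of_rat (Polynomial.monom 1 N - 1) = (Polynomial.monom 1 N - 1 :: complex poly)"
   by (intro poly_eqI) (simp add: coeff_map_poly coeff_1)
  then show ?thesis unfolding h F_def H_def map_poly_of_rat_mult by simp
 qed
 have degF: "lead_coeff F = 1" using lcf by (simp add: F_def)
 have lcX: "lead_coeff (Polynomial.monom 1 N - 1 :: complex poly) = 1"
 proof -
  have "degree (Polynomial.monom 1 N - 1 :: complex poly) = N"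
   using N degree_add_eq_left[of "- 1" "Polynomial.monom 1 N :: complex poly"] by (simp add: degree_monom_eq)
  then show ?thesis using N by (simp add: coeff_1)
 qed
 then have degH: "lead_coeff H = 1" using degF by (simp add: FH lead_coeff_mult)
 have root1: "algebraic_int y" if "poly (F * H) y = 0" for y
 proof -
  have "y ^ N = 1" using that by (simp add: poly_monom flip: FH)
  then show ?thesis using N by (rule algebraic_int_root_of_unity)
 qed
 have Fint: "algebraic_int (coeff F i)" for i
  by (rule algebraic_int_coeff_of_roots[OF degF]) (use root1 in simp)
 have Hint: "algebraic_int (coeff H i)" for i
  by (rule algebraic_int_coeff_of_roots[OF degH]) (use root1 in simp)
 \<comment> \<open>This takes the place of Gauss' lemma on polynomials: the coefficients are
   rational and, since all roots are roots of unity, also algebraic integers.\<close>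
 have FZ: "coeff F i \<in> \<int>" for i
  using rational_algebraic_int_is_int[OF Fint] by (simp add: F_def coeff_map_poly)
 have zint: "algebraic_int z" using z N by (rule algebraic_int_root_of_unity)
 have fz: "poly F z = 0"
 proof -
  have "F = Polynomial.smult (of_rat (inverse (lead_coeff f0))) (map_poly of_rat f0)"
   unfolding F_def f_def by (intro poly_eqI) (simp add: coeff_map_poly of_rat_mult)
  then show ?thesis using f0 by simp
 qed
 have fzl: "poly F (z ^ l) = 0"
 proof (rule ccontr)
  assume nz: "poly F (z ^ l) \<noteq> 0"
  define y where "y = z ^ l"
  have y: "y ^ N = 1" using z by (simp add: y_def mult.commute flip: power_mult) (metis power_mult power_one)
  have "poly (F * H) y = 0" using y by (simp add: poly_monom flip: FH)
  then have Hy: "poly H y = 0" using nz by (simp add: y_def)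
  have "pderiv (Polynomial.monom 1 N - 1 :: complex poly) = F * pderiv H + H * pderiv F"
   by (simp add: FH pderiv_mult)
  then have "poly (pderiv (Polynomial.monom 1 N - 1)) y = poly F y * poly (pderiv H) y"
   using Hy by simp
  moreover have "poly (pderiv (Polynomial.monom 1 N - 1)) y = of_nat N * y ^ (N - 1)"
   by (simp add: pderiv_diff pderiv_monom poly_monom)
  ultimately have e: "of_nat N * y ^ (N - 1) = poly F y * poly (pderiv H) y" by simp
  have "y ^ (N - 1) * y = 1" using y N by (metis power_minus_mult)
  then have "of_nat N = of_nat N * (y ^ (N - 1) * y)" by simp
  also have "\<dots> = (of_nat N * y ^ (N - 1)) * y" by (simp only: mult.assoc)
  \<comment> \<open>In the derivative of \<open>F * H = X^N - 1\<close> at the root \<open>y\<close>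
    of \<open>H\<close> only the term \<open>F * pderiv H\<close> survives, so
    \<open>poly F y\<close> divides \<open>N\<close> among algebraic integers.\<close>
  finally have Neq: "of_nat N = poly F y * (poly (pderiv H) y * y)" by (simp only: e mult.assoc)
  have yint: "algebraic_int y" using y N by (rule algebraic_int_root_of_unity)
  have "algebraic_int (coeff (pderiv H) i)" for i
   unfolding coeff_pderiv by (intro algebraic_int_mult algebraic_int_of_nat' Hint)
  then have i1: "algebraic_int (poly (pderiv H) y * y)"
   by (intro algebraic_int_mult algebraic_int_poly yint)
  have "algebraic_int ((poly F (z ^ l) - poly F z ^ l) / of_nat l)"
   by (rule frobenius_poly[OF l(1) FZ zint])
  then have i2: "algebraic_int (poly F y / of_nat l)"
   using fz prime_gt_0_nat[OF l(1)] by (simp add: y_def zero_power)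
  have e: "of_nat N / of_nat l = poly F y / of_nat l * (poly (pderiv H) y * y)" by (simp add: Neq)
  have "algebraic_int (of_nat N / of_nat l :: complex)" unfolding e by (rule algebraic_int_mult[OF i2 i1])
  then have "(of_nat N / of_nat l :: complex) \<in> \<int>" by (rule rational_algebraic_int_is_int) auto
  then obtain k where k: "of_nat N / of_nat l = (of_int k :: complex)" by (auto elim: Ints_cases)
  have "of_nat N = (of_int k * of_nat l :: complex)"
   using k prime_gt_0_nat[OF l(1)] by (simp add: field_simps)
  then have "(of_int (int N) :: complex) = of_int (k * int l)" by simp
  then have "int N = k * int l" by (simp only: of_int_eq_iff)
  then have "int l dvd int N" by simp
  then show False using l(2) by simp
 qed
 have "poly (map_poly of_rat f0) (z ^ l) = 0"
 proof -
  have "F = Polynomial.smult (of_rat (inverse (lead_coeff f0))) (map_poly of_rat f0)"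
   unfolding F_def f_def by (intro poly_eqI) (simp add: coeff_map_poly of_rat_mult)
  then show ?thesis using fzl f0nz by simp
 qed
 then show ?thesis using irreducible_conjugate[OF f0] by blast
qed

text \<open>The prime factors of \<open>t\<close> are split off one at a time; none of them divides
  \<open>N\<close>.\<close>

theorem cyclotomic_conjugate:
 fixes z :: complex
 assumes z: "z ^ N = 1" and N: "N > 0" and t: "coprime t N"
 shows "\<exists>g\<in>carrier G_Q. g z = z ^ t"
 using t
proof (induction t rule: less_induct)
 case (less t)
 have zQ: "z \<in> Qbar" using root_of_unity_Qab[OF z N] by simp
 have id: "\<exists>g\<in>carrier G_Q. g z = z" using zQ by (intro bexI[of _ "\<one>\<^bsub>G_Q\<^esub>"]) simp_all
 consider "t = 0" | "t = 1" | "t > 1" by linarith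
 then show ?case
 proof cases
  case 1
  \<comment> \<open>Coprimality of 0 and \<open>N\<close> forces \<open>N = 1\<close>.\<close>
  then have "z = 1" using less(2) z by simp
  then show ?thesis using id by simp
 next
  case 2
  then show ?thesis using id by simp
 next
  case 3
  then obtain l where l: "prime l" "l dvd t" using prime_factor_nat[of t] by auto
  then obtain m where m: "t = l * m" by (auto simp: dvd_def)
  have "\<not> l dvd N" using less(2) l by (metis coprime_common_divisor_nat not_prime_1 nat_dvd_1_iff_1)
  then obtain g where g: "g \<in> carrier G_Q" "g z = z ^ l" using cyclotomic_conjugate_prime[OF z N l(1)] by blast
  have "0 < m" using m 3 by (cases m) auto
  then have "m < t" using m prime_gt_1_nat[OF l(1)] by simp
  moreover have "coprime m N" using less(2) m by simp
  ultimately obtain h where h: "h \<in> carrier G_Q" "h z = z ^ m" using less(1) by blast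
  have "(g \<cdot> h) z = z ^ t" using g h zQ gal_power[OF Qbar g(1) zQ] by (simp add: m power_mult)
  then show ?thesis using GQ.m_closed[OF g(1) h(1)] by blast
 qed
qed

section \<open>Commutation signs\<close>

text \<open>Products grow by one generator in front, so a property of all of \<open>G_Q\<close>
  reduces to the unit and to one left multiplication by a generator.\<close>

inductive_set mult_closure :: "(complex \<Rightarrow> complex) set \<Rightarrow> (complex \<Rightarrow> complex) set" for S where
 one: "\<one>\<^bsub>G_Q\<^esub> \<in> mult_closure S"
| step: "s \<in> S ==> g \<in> mult_closure S ==> s \<cdot> g \<in> mult_closure S"

lemma mult_closure_carrier:
 assumes S: "S \<subseteq> carrier G_Q" and g: "g \<in> mult_closure S" shows "g \<in> carrier G_Q"
 using g by induction (use S in auto)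

lemma mult_closure_power:
 "S \<subseteq> carrier G_Q ==> s \<in> S ==> g \<in> mult_closure S ==> s [^]\<^bsub>G_Q\<^esub> (n::nat) \<cdot> g \<in> mult_closure S"
proof (induction n arbitrary: g)
 case 0
 then show ?case using mult_closure_carrier by simp
next
 case (Suc n)
 have "s [^]\<^bsub>G_Q\<^esub> Suc n \<cdot> g = s [^]\<^bsub>G_Q\<^esub> n \<cdot> (s \<cdot> g)"
  using Suc mult_closure_carrier by (simp add: GQ.m_assoc subset_iff)
 then show ?case using Suc mult_closure.step[of s S g] by simp
qed

text \<open>The commutation sign is bimultiplicative, because the factors \<open>a\<close> with \<open>g w = a w\<close> lie in
 \<open>Qab\<close>, on which the automorphisms commute.\<close>

lemma comm_sign_generated:
 fixes b :: "(complex \<Rightarrow> complex) \<Rightarrow> (complex \<Rightarrow> complex) \<Rightarrow> bit"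
 assumes w: "w \<in> Qbar" "w \<noteq> 0" "w\<^sup>2 \<in> Qab"
  and S: "S \<subseteq> carrier G_Q" "carrier G_Q \<subseteq> mult_closure S"
  and Sw: "\<And>s. s \<in> S ==> \<exists>a\<in>Qab. s w = a * w"
  and b_mult: "\<And>g h k. g \<in> carrier G_Q ==> h \<in> carrier G_Q ==> k \<in> carrier G_Q ==>
   b (g \<cdot> h) k = b g k + b h k"
  and b_sym: "\<And>g h. g \<in> carrier G_Q ==> h \<in> carrier G_Q ==> b g h = b h g"
  and comm: "\<And>s t. s \<in> S ==> t \<in> S ==> s (t w) = bit_sign (b s t) * t (s w)"
 shows "semi_invariant w"
  and "\<And>g h. g \<in> carrier G_Q ==> h \<in> carrier G_Q ==> g (h w) = bit_sign (b g h) * h (g w)"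
proof -
 have semi: "\<exists>a\<in>Qab. g w = a * w" if "g \<in> mult_closure S" for g
  using that
 proof induction
  case one
  then show ?case using w subfieldD(2)[OF Qab] by (intro bexI[of _ 1]) simp_all
 next
  case (step s g)
  have sG: "s \<in> carrier G_Q" and gG: "g \<in> carrier G_Q" using step S mult_closure_carrier by auto
  obtain a where a: "a \<in> Qab" "g w = a * w" using step by blast
  obtain c where c: "c \<in> Qab" "s w = c * w" using Sw step by blast
  have "(s \<cdot> g) w = (s a * c) * w" using sG gG w a c by (simp add: gal_times)
  moreover have "s a * c \<in> Qab" using sG a c by (intro subfieldD(4)[OF Qab]) simp_all
  ultimately show ?case by blast
 qed
 then show inv: "semi_invariant w" using w S unfolding semi_invariant_def by blast
 have b0: "b \<one>\<^bsub>G_Q\<^esub> k = 0" if "k \<in> carrier G_Q" for k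
  using b_mult[of "\<one>\<^bsub>G_Q\<^esub>" "\<one>\<^bsub>G_Q\<^esub>" k] that by (cases "b \<one>\<^bsub>G_Q\<^esub> k") simp_all
 have left: "(s \<cdot> g) (h w) = bit_sign (b (s \<cdot> g) h) * h ((s \<cdot> g) w)"
  if c: "s \<in> carrier G_Q" "g \<in> carrier G_Q" "h \<in> carrier G_Q"
   and sh: "s (h w) = bit_sign (b s h) * h (s w)" and gh: "g (h w) = bit_sign (b g h) * h (g w)" for s g h
 proof -
  obtain a where a: "a \<in> Qab" "g w = a * w" using inv c(2) by (auto simp: semi_invariant_def)
  have "(s \<cdot> g) (h w) = s (bit_sign (b g h) * h (g w))" using c w gh by simp
  also have "\<dots> = bit_sign (b g h) * s (h (a * w))"
   using gal_bit_sign[OF c(1) gal_closed[OF c(3) subfieldD(4)[OF Qbar Qab_Qbar[OF a(1)] w(1)]]] a(2) by simp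
  also have "s (h (a * w)) = s (h a) * s (h w)" using c w a by (simp add: gal_times)
  also have "\<dots> = bit_sign (b s h) * (h (s a) * h (s w))" using Qab_comm[OF a(1) c(1,3)] sh by (simp add: mult_ac)
  also have "h (s a) * h (s w) = h ((s \<cdot> g) w)" using c w a by (simp add: gal_times)
  finally show ?thesis by (simp only: b_mult c bit_sign_add mult_ac)
 qed
 have one_comm: "\<one>\<^bsub>G_Q\<^esub> (h w) = bit_sign (b \<one>\<^bsub>G_Q\<^esub> h) * h (\<one>\<^bsub>G_Q\<^esub> w)" if "h \<in> carrier G_Q" for h
  using that w b0 by simp
 have swap: "h (g w) = bit_sign (b h g) * g (h w)"
  if "g \<in> carrier G_Q" "h \<in> carrier G_Q" "g (h w) = bit_sign (b g h) * h (g w)" for g h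
  using that b_sym[OF that(1,2)] by simp
 \<comment> \<open>Two inductions: the first extends the relation in one argument while the other is
   a generator; the second, with the roles exchanged by symmetry of \<open>b\<close>, extends it
   while the other is an arbitrary automorphism.\<close>
 have 1: "g (t w) = bit_sign (b g t) * t (g w)" if "g \<in> mult_closure S" "t \<in> S" for g t
  using that
 proof induction
  case one
  then show ?case using one_comm S by blast
 next
  case (step s g)
  have c: "s \<in> carrier G_Q" "g \<in> carrier G_Q" "t \<in> carrier G_Q" using step S mult_closure_carrier by auto
  show ?case by (rule left[OF c comm[OF step(1,4)] step(3)[OF step(4)]])
 qed
 have 2: "h (g w) = bit_sign (b h g) * g (h w)" if "h \<in> mult_closure S" "g \<in> carrier G_Q" for g h
  using that
 proof induction
  case one
  then show ?case by (rule one_comm)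
 next
  case (step s h)
  have c: "s \<in> carrier G_Q" "h \<in> carrier G_Q" using step S mult_closure_carrier by auto
  have "g \<in> mult_closure S" using step(4) S by blast
  from swap[OF step(4) c(1) 1[OF this step(1)]]
  show ?case by (rule left[OF c step(4) _ step(3)[OF step(4)]])
 qed
 show "g (h w) = bit_sign (b g h) * h (g w)" if "g \<in> carrier G_Q" "h \<in> carrier G_Q" for g h
  using 2 S that by blast
qed

section \<open>Quadratic characters\<close>

lemma e_char:
 assumes r: "complex_of_real (sqrt p) \<in> Qab" and p: "p > 0"
 shows "e_char p \<in> H1ab"
  and "g \<in> carrier G_Q ==> g (of_real (sqrt p)) = bit_sign (e_char p (restrict g Qab)) * of_real (sqrt p)"
proof -
 let ?r = "complex_of_real (sqrt p)"
 have r0: "?r \<noteq> 0" using p by simp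
 have r2: "?r\<^sup>2 = of_nat p" by (simp flip: of_real_power)
 define c where "c \<sigma> = (if \<sigma> \<in> carrier Gab \<and> \<sigma> ?r \<noteq> ?r then 1 else 0 :: bit)" for \<sigma>
 have c: "\<sigma> ?r = bit_sign (c \<sigma>) * ?r" if s: "\<sigma> \<in> carrier Gab" for \<sigma>
 proof -
  have "(\<sigma> ?r)\<^sup>2 = ?r\<^sup>2" using gal_power[OF Qab s r, of 2] r2 gal_of_nat[OF Qab s] by simp
  then have "\<sigma> ?r = ?r \<or> \<sigma> ?r = - ?r" by (simp add: power2_eq_iff)
  then show ?thesis using s by (auto simp: c_def)
 qed
 have cH: "c \<in> H1ab"
  unfolding H1_def cochains1_def
 proof (intro CollectI conjI allI impI ballI)
  show "c \<sigma> = 0" if "\<sigma> \<notin> carrier Gab" for \<sigma> using that by (simp add: c_def)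
  have "openin topGab {\<sigma> \<in> carrier Gab. c \<sigma> \<in> U}" for U
   unfolding openin_krull by (auto simp: c_def intro!: exI[of _ "{?r}"] r)
  then show "continuous_map topGab (discrete_topology UNIV) c" by (simp add: continuous_map_def)
  fix \<sigma> \<tau> assume s: "\<sigma> \<in> carrier Gab" "\<tau> \<in> carrier Gab"
  interpret group Gab by (rule group_gal[OF Qab])
  have m: "\<sigma> \<otimes>\<^bsub>Gab\<^esub> \<tau> \<in> carrier Gab" using s by simp
  have "bit_sign (c (\<sigma> \<otimes>\<^bsub>Gab\<^esub> \<tau>)) * ?r = \<sigma> (\<tau> ?r)" using c[OF m] s r by simp
  also have "\<dots> = \<sigma> (bit_sign (c \<tau>)) * \<sigma> ?r" using c[OF s(2)] gal_times[OF s(1) bit_sign_Qab r] by simp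
  also have "\<sigma> (bit_sign (c \<tau>)) = bit_sign (c \<tau>)"
   using gal_1[OF Qab s(1)] gal_minus[OF Qab s(1) subfieldD(2)[OF Qab]] by (cases "c \<tau>") simp_all
  also have "\<sigma> ?r = bit_sign (c \<sigma>) * ?r" by (rule c[OF s(1)])
  finally have "bit_sign (c (\<sigma> \<otimes>\<^bsub>Gab\<^esub> \<tau>)) * ?r = bit_sign (c \<sigma> + c \<tau>) * ?r" by (simp only: bit_sign_add mult_ac)
  then show "c (\<sigma> \<otimes>\<^bsub>Gab\<^esub> \<tau>) = c \<sigma> + c \<tau>" using r0 by (metis mult_right_cancel bit_sign_inject)
 qed
 have "e_char p = c"
  unfolding e_char_def
 proof (rule the_equality)
  show "c \<in> H1ab \<and> (\<forall>\<sigma>\<in>carrier Gab. \<sigma> ?r = bit_sign (c \<sigma>) * ?r)" using cH c by blast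
  fix d assume d: "d \<in> H1ab \<and> (\<forall>\<sigma>\<in>carrier Gab. \<sigma> ?r = bit_sign (d \<sigma>) * ?r)"
  show "d = c"
  proof
   fix \<sigma>
   show "d \<sigma> = c \<sigma>"
   proof (cases "\<sigma> \<in> carrier Gab")
    case True
    then have "bit_sign (d \<sigma>) * ?r = bit_sign (c \<sigma>) * ?r" using d c by metis
    then show ?thesis using r0 by (metis mult_right_cancel bit_sign_inject)
   next
    case False
    then show ?thesis using d by (simp add: H1_def cochains1_def c_def)
   qed
  qed
 qed
 then show "e_char p \<in> H1ab" using cH by simp
 show "g ?r = bit_sign (e_char p (restrict g Qab)) * ?r" if g: "g \<in> carrier G_Q"
  using c[OF restrict_Qab[OF g]] r \<open>e_char p = c\<close> by simp
qed

lemma e_char_mult: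
 assumes r: "complex_of_real (sqrt p) \<in> Qab" and p: "p > 0" and gh: "g \<in> carrier G_Q" "h \<in> carrier G_Q"
 shows "e_char p (restrict (g \<cdot> h) Qab) = e_char p (restrict g Qab) + e_char p (restrict h Qab)"
 using e_char(1)[OF r p] restrict_Qab[OF gh(1)] restrict_Qab[OF gh(2)]
 by (simp add: restrict_Qab_mult[OF gh] H1_def)

theorem D_map_of_generators:
 assumes w: "w \<in> Qbar" "w \<noteq> 0" "w\<^sup>2 \<in> Qab"
  and pq: "p > 0" "q > 0" "complex_of_real (sqrt p) \<in> Qab" "complex_of_real (sqrt q) \<in> Qab"
  and S: "S \<subseteq> carrier G_Q" "carrier G_Q \<subseteq> mult_closure S"
  and Sw: "\<And>s. s \<in> S ==> \<exists>a\<in>Qab. s w = a * w"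
  and comm: "\<And>s t. s \<in> S ==> t \<in> S ==> s (t w) = bit_sign (
   e_char p (restrict s Qab) * e_char q (restrict t Qab) + e_char p (restrict t Qab) * e_char q (restrict s Qab)) * t (s w)"
 shows "D_map (mod_squares (w\<^sup>2)) = wedge H1ab (e_char p) (e_char q)"
proof -
 define b where "b s t = e_char p (restrict s Qab) * e_char q (restrict t Qab) +
  e_char p (restrict t Qab) * e_char q (restrict s Qab)" for s t
 have bm: "b (g \<cdot> h) k = b g k + b h k" if "g \<in> carrier G_Q" "h \<in> carrier G_Q" "k \<in> carrier G_Q" for g h k
  unfolding b_def e_char_mult[OF pq(3,1) that(1,2)] e_char_mult[OF pq(4,2) that(1,2)]
  by (simp only: distrib_left distrib_right ac_simps)
 have bs: "b g h = b h g" for g h by (simp only: b_def ac_simps)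
 note comm' = comm[folded b_def]
 have gen1: "semi_invariant w"
  by (rule comm_sign_generated(1)[where w = w and S = S and b = b]) (fact w S Sw bm comm' | rule bs)+
 have gen2: "g (h w) = bit_sign (b g h) * h (g w)" if "g \<in> carrier G_Q" "h \<in> carrier G_Q" for g h
  by (rule comm_sign_generated(2)[where w = w and S = S and b = b]) (fact w S Sw bm comm' that | rule bs)+
 show ?thesis
 proof (rule D_map_mod_squares)
  show "semi_invariant w" by (rule gen1)
  show "e_char p \<in> H1ab" "e_char q \<in> H1ab" using e_char(1) pq by auto
  fix g h assume "g \<in> carrier G_Q" "h \<in> carrier G_Q"
  from gen2[OF this] show "g (h w) = bit_sign (e_char p (restrict g Qab) * e_char q (restrict h Qab) +
   e_char p (restrict h Qab) * e_char q (restrict g Qab)) * h (g w)" by (simp only: b_def)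
 qed
qed

section \<open>Equality modulo squares\<close>

text \<open>Membership in \<open>Qab\<close> and nonvanishing are part of the relation, so that
  chains of equivalences carry them along.\<close>

definition sq_eq :: "complex \<Rightarrow> complex \<Rightarrow> bool" where
 "sq_eq u v \<longleftrightarrow> u \<in> Qab - {0} \<and> v \<in> Qab - {0} \<and> (\<exists>t\<in>Qab. u = t\<^sup>2 * v)"

lemma sq_eqD: "sq_eq u v ==> u \<in> Qab \<and> u \<noteq> 0 \<and> v \<in> Qab \<and> v \<noteq> 0"
 by (auto simp: sq_eq_def)

lemma sq_eq_refl: "u \<in> Qab ==> u \<noteq> 0 ==> sq_eq u u"
 using subfieldD(2)[OF Qab] by (auto simp: sq_eq_def intro!: bexI[of _ 1])

lemma sq_eq_sym: assumes "sq_eq u v" shows "sq_eq v u"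
proof -
 obtain t where t: "t \<in> Qab" "u = t\<^sup>2 * v" using assms by (auto simp: sq_eq_def)
 have "t \<noteq> 0" using t sq_eqD[OF assms] by auto
 then have "v = (inverse t)\<^sup>2 * u" using t(2) by (simp add: field_simps power2_eq_square)
 then show ?thesis using sq_eqD[OF assms] subfieldD(6)[OF Qab t(1)] by (auto simp: sq_eq_def)
qed

lemma sq_eq_trans [trans]: assumes "sq_eq u v" "sq_eq v w" shows "sq_eq u w"
proof -
 obtain s t where st: "s \<in> Qab" "u = s\<^sup>2 * v" "t \<in> Qab" "v = t\<^sup>2 * w" using assms by (auto simp: sq_eq_def)
 have "u = (s * t)\<^sup>2 * w" by (simp add: st(2,4) power_mult_distrib mult_ac)
 then show ?thesis using sq_eqD[OF assms(1)] sq_eqD[OF assms(2)] subfieldD(4)[OF Qab st(1,3)] by (auto simp: sq_eq_def)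
qed

lemma sq_eq_mult: assumes "sq_eq u v" "sq_eq u' v'" shows "sq_eq (u * u') (v * v')"
proof -
 obtain s t where st: "s \<in> Qab" "u = s\<^sup>2 * v" "t \<in> Qab" "u' = t\<^sup>2 * v'" using assms by (auto simp: sq_eq_def)
 have eq: "u * u' = (s * t)\<^sup>2 * (v * v')" by (simp add: st(2,4) power_mult_distrib mult_ac)
 have "u * u' \<in> Qab" "v * v' \<in> Qab" "u * u' \<noteq> 0" "v * v' \<noteq> 0" "s * t \<in> Qab"
  using sq_eqD[OF assms(1)] sq_eqD[OF assms(2)] subfieldD(4)[OF Qab] st(1,3) by simp_all
 then show ?thesis unfolding sq_eq_def using eq by blast
qed

text \<open>An element and its inverse differ by a square, so quotients may be replaced by
  products.\<close>

lemma sq_eq_inverse: assumes "sq_eq u v" shows "sq_eq (inverse u) v"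
proof -
 have u: "u \<in> Qab" "u \<noteq> 0" using sq_eqD[OF assms] by auto
 then have "inverse u = (inverse u)\<^sup>2 * u" by (simp add: power2_eq_square)
 then have "sq_eq (inverse u) u" using u subfieldD(6)[OF Qab] by (auto simp: sq_eq_def)
 then show ?thesis using assms by (rule sq_eq_trans)
qed

lemma sq_eq_divide: "sq_eq u v ==> sq_eq u' v' ==> sq_eq (u / u') (v * v')"
 unfolding divide_inverse by (intro sq_eq_mult sq_eq_inverse)

lemma sq_eq_prod: "(\<And>i. i \<in> A ==> sq_eq (f i) (g i)) ==> sq_eq (prod f A) (prod g A)"
 by (induction A rule: infinite_finite_induct) (auto intro: sq_eq_mult sq_eq_refl subfieldD(2)[OF Qab])

lemma sq_eq_1: "sq_eq 1 1"
 by (rule sq_eq_refl) (simp_all add: subfieldD[OF Qab])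

lemma sq_eq_mult_self: assumes "u \<in> Qab" "u \<noteq> 0" shows "sq_eq (u * u) 1"
 using assms subfieldD(2,4)[OF Qab] by (auto simp: sq_eq_def power2_eq_square)

lemma sq_eq_cancel_left: assumes "u \<in> Qab" "u \<noteq> 0" "sq_eq v w" shows "sq_eq (u * (u * v)) w"
 using sq_eq_mult[OF sq_eq_mult_self[OF assms(1,2)] assms(3)] by (simp add: mult.assoc)

lemma mod_squares_cong: assumes "sq_eq u v" shows "mod_squares u = mod_squares v"
proof -
 have sub: "mod_squares u \<subseteq> mod_squares v" if "sq_eq u v" for u v
 proof
  fix z assume "z \<in> mod_squares u"
  then obtain s where s: "s \<in> Qab" "s \<noteq> 0" "z = s\<^sup>2 * u" unfolding mod_squares_eq by blast
  obtain t where t: "t \<in> Qab" "u = t\<^sup>2 * v" using \<open>sq_eq u v\<close> by (auto simp: sq_eq_def)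
  have "t \<noteq> 0" using t sq_eqD[OF \<open>sq_eq u v\<close>] by auto
  moreover have "z = (s * t)\<^sup>2 * v" by (simp add: s(3) t(2) power_mult_distrib mult_ac)
  ultimately show "z \<in> mod_squares v" unfolding mod_squares_eq using s t subfieldD(4)[OF Qab] by auto
 qed
 show ?thesis using sub[OF assms] sub[OF sq_eq_sym[OF assms]] by blast
qed

definition root_of_unity :: "complex \<Rightarrow> bool" where
 "root_of_unity z \<longleftrightarrow> (\<exists>n>0. z ^ n = 1)"

lemma root_of_unityD: assumes "root_of_unity z" shows "z \<in> Qab" "z \<noteq> 0"
proof -
 obtain n where n: "n > 0" "z ^ n = 1" using assms by (auto simp: root_of_unity_def)
 then show "z \<in> Qab" by (intro root_of_unity_Qab)
 show "z \<noteq> 0" using n by (auto simp: power_0_left)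
qed

lemma root_of_unity_1: "root_of_unity 1"
 by (auto simp: root_of_unity_def)

lemma root_of_unity_mult: assumes "root_of_unity z" "root_of_unity w" shows "root_of_unity (z * w)"
proof -
 obtain m n where mn: "m > 0" "z ^ m = 1" "n > 0" "w ^ n = 1" using assms by (auto simp: root_of_unity_def)
 have "(z * w) ^ (m * n) = (z ^ m) ^ n * (w ^ n) ^ m"
  by (simp add: power_mult_distrib mult.commute flip: power_mult)
 then have "(z * w) ^ (m * n) = 1" using mn by simp
 then show ?thesis using mn unfolding root_of_unity_def by (intro exI[of _ "m * n"]) simp
qed

lemma root_of_unity_inverse: "root_of_unity z ==> root_of_unity (inverse z)"
 by (auto simp: root_of_unity_def power_inverse)

lemma root_of_unity_minus_1: "root_of_unity (- 1)"
 unfolding root_of_unity_def by (intro exI[of _ 2]) simp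

lemma root_of_unity_minus: "root_of_unity z ==> root_of_unity (- z)"
 using root_of_unity_mult[OF root_of_unity_minus_1, of z] by simp

lemma root_of_unity_power: "root_of_unity z ==> root_of_unity (z ^ n)"
 by (induction n) (auto intro: root_of_unity_mult root_of_unity_1)

lemma root_of_unity_power_int: "root_of_unity z ==> root_of_unity (z powi n)"
 by (auto simp: power_int_def intro: root_of_unity_power root_of_unity_inverse)

text \<open>A square root of a root of unity is again a root of unity and therefore lies in
  \<open>Qab\<close>.\<close>

lemma sq_eq_root_of_unity: assumes z: "root_of_unity z" and uv: "sq_eq u v" shows "sq_eq (z * u) v"
proof -
 obtain n where n: "n > 0" "z ^ n = 1" using z by (auto simp: root_of_unity_def)
 have "csqrt z ^ (2 * n) = 1" using n by (simp add: power_mult)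
 then have "csqrt z \<in> Qab" using n by (intro root_of_unity_Qab[of _ "2 * n"]) simp_all
 then have "sq_eq z 1" using root_of_unityD[OF z] subfieldD(2)[OF Qab] by (auto simp: sq_eq_def intro!: bexI[of _ "csqrt z"])
 from sq_eq_mult[OF this uv] show ?thesis by simp
qed

lemma sq_eq_minus: "sq_eq u v ==> sq_eq (- u) v"
 using sq_eq_root_of_unity[OF root_of_unity_minus_1, of u v] by simp

lemma sq_eq_one_minus:
 assumes "root_of_unity z" "z \<noteq> 1" shows "sq_eq (1 - z) (1 - z)"
 using assms root_of_unityD[OF assms(1)] by (intro sq_eq_refl subfield_diff[OF Qab] subfieldD(2)[OF Qab]) simp_all

lemma sq_eq_one_minus_inverse:
 assumes "root_of_unity z" "z \<noteq> 1" shows "sq_eq (1 - inverse z) (1 - z)"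
proof -
 have "1 - inverse z = (- inverse z) * (1 - z)" using root_of_unityD[OF assms(1)] by (simp add: field_simps)
 then show ?thesis
  using sq_eq_root_of_unity[OF root_of_unity_minus[OF root_of_unity_inverse[OF assms(1)]] sq_eq_one_minus[OF assms]] by simp
qed

section \<open>Values of the sine homomorphism\<close>

definition ee :: "rat \<Rightarrow> complex" where
 "ee a = cis (2 * pi * of_rat a)"

lemma ee_add: "ee (a + b) = ee a * ee b"
 by (simp add: ee_def of_rat_add cis_mult algebra_simps)

lemma ee_of_int [simp]: "ee (of_int n) = 1"
 using cis_multiple_2pi[of "of_int n"] by (simp add: ee_def)

lemma ee_minus: "ee (- a) = inverse (ee a)"
 by (simp add: ee_def of_rat_minus cis_inverse)

lemma ee_diff: "ee (a - b) = ee a * inverse (ee b)"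
 using ee_add[of a "- b"] by (simp add: ee_minus)

lemma ee_power: "ee a ^ n = ee (of_nat n * a)"
 by (simp add: ee_def Complex.DeMoivre of_rat_mult mult_ac)

lemma ee_power_int: "ee a powi n = ee (of_int n * a)"
 by (cases "n \<ge> 0") (auto simp: power_int_def ee_power ee_minus[symmetric] simp flip: of_rat_minus)

lemma ee_nonzero [simp]: "ee a \<noteq> 0"
 by (simp add: ee_def)

lemma ee_eq_1_iff: "ee a = 1 \<longleftrightarrow> a \<in> \<int>"
proof
 assume "ee a = 1"
 then have "cos (2 * pi * of_rat a) = 1" by (simp add: ee_def complex_eq_iff)
 then obtain n :: int where "2 * pi * real_of_rat a = of_int n * 2 * pi" using cos_one_2pi_int by blast
 then have "real_of_rat a = real_of_rat (of_int n)" by simp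
 then have "a = of_int n" by (simp only: of_rat_eq_iff)
 then show "a \<in> \<int>" by simp
qed (auto elim: Ints_cases)

lemma root_of_unity_ee: "root_of_unity (ee a)"
proof -
 obtain m n where a: "a = of_int m / of_int n" "n > 0" by (metis Fract_of_int_quotient Rat_cases)
 have "ee a ^ nat n = ee (of_int m)" using a by (simp add: ee_power)
 then show ?thesis using a(2) unfolding root_of_unity_def by (intro exI[of _ "nat n"]) simp
qed

text \<open>The value of the sine homomorphism on a generator: the argument is reduced modulo 1, and
  integers take the exceptional value 1 of the generator of 0.\<close>

definition sin1 :: "rat \<Rightarrow> complex" where
 "sin1 a = (if a \<in> \<int> then 1 else of_real (2 * sin (pi * of_rat (frac a))))"

text \<open>For the fractional part \<open>b\<close> of \<open>a\<close>, the number
  \<open>2 sin (pi b)\<close> is \<open>1 - exp (2 pi \<i> b)\<close> times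
  \<open>\<i> exp (- pi \<i> b)\<close>, and the latter is the root of unity
  \<open>z\<close>.\<close>

lemma sin1_sq_eq: assumes a: "a \<notin> \<int>" shows "sq_eq (sin1 a) (1 - ee a)"
proof -
 define b where "b = frac a"
 have eb: "ee a = ee b"
  using ee_add[of "of_int \<lfloor>a\<rfloor>" b] by (simp add: b_def frac_def)
 define z where "z = ee (1 / 4 - b / 2)"
 have "sin1 a = z * (1 - ee a)"
 proof -
  define x where "x = pi * real_of_rat b"
  have z: "z = \<i> * cis (- x)"
   unfolding z_def ee_diff by (simp add: ee_def x_def of_rat_divide cis_inverse mult_ac)
  have eb2: "ee b = cis x * cis x" by (simp add: ee_def x_def cis_mult mult_ac)
  have "z * (1 - ee b) = \<i> * (cis (- x) - cis x)"
   by (simp add: z eb2 algebra_simps) (simp add: cis_mult flip: mult.assoc)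
  also have "\<dots> = of_real (2 * sin x)" by (simp add: complex_eq_iff)
  finally show ?thesis using a by (simp add: sin1_def x_def b_def eb)
 qed
 moreover have "ee a \<noteq> 1" using a ee_eq_1_iff by blast
 ultimately show ?thesis
  using sq_eq_root_of_unity[OF root_of_unity_ee[of "1 / 4 - b / 2"] sq_eq_one_minus[OF root_of_unity_ee[of a]]] by (simp add: z_def)
qed

lemma sin1_Qab: "sin1 a \<in> Qab" "sin1 a \<noteq> 0"
 using sq_eqD[OF sin1_sq_eq[of a]] subfieldD(2)[OF Qab] by (cases "a \<in> \<int>"; simp add: sin1_def)+

lemma sin1_cong: assumes "a - b \<in> \<int>" shows "sin1 a = sin1 b"
proof -
 have "a \<in> \<int> \<longleftrightarrow> b \<in> \<int>" using assms Ints_diff Ints_add by (metis add_diff_cancel_left' diff_add_cancel)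
 moreover have "frac a = frac b"
 proof -
  obtain n where "a = b + of_int n" using assms by (auto elim!: Ints_cases simp: algebra_simps)
  then show ?thesis by (simp add: frac_def)
 qed
 ultimately show ?thesis by (simp add: sin1_def)
qed

lemma comm_group_Qab_units: "comm_group Qab_units"
proof (rule comm_groupI)
 show "\<exists>y\<in>carrier Qab_units. y \<otimes>\<^bsub>Qab_units\<^esub> x = \<one>\<^bsub>Qab_units\<^esub>" if "x \<in> carrier Qab_units" for x
  using that subfieldD(6)[OF Qab, of x] by (auto simp: Qab_units_def intro!: bexI[of _ "inverse x"])
qed (auto simp: Qab_units_def subfieldD[OF Qab])

lemma A_relations_normal: "A_relations \<lhd> free_Abelian_group UNIV"
proof -
 interpret comm_group "free_Abelian_group (UNIV :: rat set)" by (rule abelian_free_Abelian_group)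
 show ?thesis unfolding A_relations_def by (intro subgroup_imp_normal generate_is_subgroup) auto
qed

text \<open>\<open>sin1\<close> agrees on generators that differ by integers, so the homomorphism
  from the free group factors through \<open>A_group\<close>. It is the only one with the prescribed
  values because each generator is congruent to one whose argument is 0 or lies strictly between 0
  and 1.\<close>

theorem sin_A_hom:
 obtains h where "h \<in> hom (free_Abelian_group UNIV) Qab_units" "\<And>a. h (frag_of a) = sin1 a"
  "\<And>x. sin_A (A_class x) = h x"
proof -
 interpret U: comm_group Qab_units by (rule comm_group_Qab_units)
 let ?F = "free_Abelian_group (UNIV :: rat set)"
 interpret F: comm_group ?F by (rule abelian_free_Abelian_group)
 have "sin1 ` UNIV \<subseteq> carrier Qab_units" using sin1_Qab by (auto simp: Qab_units_def)
 then obtain h where h: "h \<in> hom ?F Qab_units" and hs: "\<And>a. h (frag_of a) = sin1 a"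
  using U.free_Abelian_group_universal[of sin1 UNIV] by auto
 interpret h: group_hom ?F Qab_units h by unfold_locales (rule h)
 have rel: "A_relations \<subseteq> kernel ?F Qab_units h"
  unfolding A_relations_def
 proof (rule F.generate_subgroup_incl[OF _ h.subgroup_kernel])
  show "{frag_of a - frag_of b |a b. a - b \<in> \<int>} \<subseteq> kernel ?F Qab_units h"
  proof clarify
   fix a b :: rat assume ab: "a - b \<in> \<int>"
   have "h (frag_of a) = h ((frag_of a - frag_of b) \<otimes>\<^bsub>?F\<^esub> frag_of b)" by simp
   also have "\<dots> = h (frag_of a - frag_of b) * h (frag_of b)"
    by (subst h.hom_mult) (simp_all add: Qab_units_def)
   finally have "h (frag_of a - frag_of b) = 1" using sin1_cong[OF ab] sin1_Qab(2)[of b] by (simp add: hs)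
   then show "frag_of a - frag_of b \<in> kernel ?F Qab_units h" by (simp add: kernel_def Qab_units_def)
  qed
 qed
 have eq: "h x = h y" if "A_class x = A_class y" for x y
 proof -
  have "x \<in> A_class y"
   using that F.rcos_self[OF _ normal_imp_subgroup[OF A_relations_normal], of x] by (simp add: A_class_def)
  then obtain r where r: "r \<in> A_relations" "x = r + y" by (auto simp: A_class_def r_coset_def)
  have "h r = 1" using rel r by (auto simp: kernel_def Qab_units_def)
  then show ?thesis using h.hom_mult[of r y] by (simp add: r(2) Qab_units_def)
 qed
 obtain g where g: "g \<in> hom (?F Mod A_relations) Qab_units" "\<And>x. x \<in> carrier ?F ==> g (A_relations #>\<^bsub>?F\<^esub> x) = h x"
  by (rule FactGroup_universal[OF h A_relations_normal]) (auto intro: eq simp: A_class_def)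
 have gA: "g (A_class x) = h x" for x using g(2) by (simp add: A_class_def)
 have carr: "carrier A_group = range A_class"
  by (auto simp: A_group_def FactGroup_def RCOSETS_def A_class_def)
 interpret A: group A_group unfolding A_group_def by (rule normal.factorgroup_is_group[OF A_relations_normal])
 define k where "k = restrict g (carrier A_group)"
 have k: "k \<in> hom A_group Qab_units" using g(1) by (simp add: k_def hom_def A_group_def[symmetric] Pi_iff)
 have kA: "k (A_class x) = h x" for x using gA by (simp add: k_def carr)
 have A_add: "A_class (x + y) = A_class x \<otimes>\<^bsub>A_group\<^esub> A_class y" for x y
  using normal.rcos_sum[OF A_relations_normal, of x y] by (simp add: A_class_def A_group_def)
 have "sin_A = k"
  unfolding sin_A_def
 proof (rule the_equality)
  have "h (frag_of a) = of_real (2 * sin (pi * of_rat a))" if "0 < a" "a < 1" for a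
  proof -
   have "a \<notin> \<int>" using that by (auto elim!: Ints_cases)
   moreover have "frac a = a" using that by (simp add: frac_eq)
   ultimately show ?thesis by (simp add: hs sin1_def)
  qed
  then have "\<forall>a. 0 < a \<and> a < 1 \<longrightarrow> k (A_class (frag_of a)) = of_real (2 * sin (pi * of_rat a))"
   unfolding kA by blast
  moreover have "k (A_class (frag_of 0)) = 1" unfolding kA hs by (simp add: sin1_def)
  moreover have "k \<in> extensional (carrier A_group)" by (simp add: k_def)
  ultimately show "k \<in> hom A_group Qab_units \<and> k \<in> extensional (carrier A_group) \<and>
   (\<forall>a. 0 < a \<and> a < 1 \<longrightarrow> k (A_class (frag_of a)) = of_real (2 * sin (pi * of_rat a))) \<and> k (A_class (frag_of 0)) = 1"
   using k by blast
  fix k' assume k': "k' \<in> hom A_group Qab_units \<and> k' \<in> extensional (carrier A_group) \<and>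
   (\<forall>a. 0 < a \<and> a < 1 \<longrightarrow> k' (A_class (frag_of a)) = of_real (2 * sin (pi * of_rat a))) \<and> k' (A_class (frag_of 0)) = 1"
  interpret k': group_hom A_group Qab_units k' by unfold_locales (use k' in blast)
  have frag: "k' (A_class (frag_of a)) = sin1 a" for a
  proof -
   have "frag_of a - frag_of (frac a) \<in> A_relations"
   proof -
    have "a - frac a \<in> \<int>" by (simp add: frac_def)
    then show ?thesis unfolding A_relations_def by (blast intro: generate.incl)
   qed
   note d = this
   have "A_class (frag_of a) = A_class (frag_of (frac a))"
   proof -
    have "frag_of a = (frag_of a - frag_of (frac a)) \<otimes>\<^bsub>?F\<^esub> frag_of (frac a)" by simp
    with d have "frag_of a \<in> A_relations #>\<^bsub>?F\<^esub> frag_of (frac a)" unfolding r_coset_def by blast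
    from F.repr_independence[OF this _ normal_imp_subgroup[OF A_relations_normal]] show ?thesis
     by (simp add: A_class_def)
   qed
   then have eq: "k' (A_class (frag_of a)) = k' (A_class (frag_of (frac a)))" by (rule arg_cong)
   show ?thesis
   proof (cases "a \<in> \<int>")
    case True
    then have "frac a = 0" by simp
    moreover have "k' (A_class (frag_of 0)) = 1" using k' by (elim conjE)
    ultimately have "k' (A_class (frag_of (frac a))) = 1" by (simp only:)
    then show ?thesis unfolding eq sin1_def by (simp only: True if_True)
   next
    case False
    then have "0 < frac a" "frac a < 1" by (simp_all add: frac_lt_1)
    then have "k' (A_class (frag_of (frac a))) = of_real (2 * sin (pi * of_rat (frac a)))"
     using k' by blast
    then show ?thesis unfolding eq sin1_def by (simp only: False if_False)
   qed
  qed
  have "k' (A_class x) = h x" for x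
  proof (induction x rule: free_Abelian_group_induct[where S = UNIV])
   case 1
   then show ?case by simp
  next
   case 2
   have "A_class 0 = \<one>\<^bsub>A_group\<^esub>"
    using F.coset_join2[OF _ normal_imp_subgroup[OF A_relations_normal], of 0] subgroup.one_closed[OF normal_imp_subgroup[OF A_relations_normal]]
    by (simp add: A_class_def A_group_def)
   then show ?case using h.hom_one k'.hom_one by simp
  next
   case (3 x y)
   have "k' (A_class (x - y)) * k' (A_class y) = k' (A_class x)"
    using k'.hom_mult[of "A_class (x - y)" "A_class y"] by (simp add: carr Qab_units_def flip: A_add)
   moreover have "h (x - y) * h y = h x" using h.hom_mult[of "x - y" y] by (simp add: Qab_units_def)
   moreover have "h y \<noteq> 0" using h.hom_closed[of y] by (simp add: Qab_units_def)
   ultimately show ?case using 3 by (metis mult_right_cancel)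
  next
   case (4 a)
   then show ?case by (simp add: frag hs)
  qed
  note k'h = this
  show "k' = k"
  proof (rule extensionalityI[of _ "carrier A_group"])
   show "k' \<in> extensional (carrier A_group)" using k' by blast
   show "k \<in> extensional (carrier A_group)" by (simp add: k_def)
   show "k' x = k x" if "x \<in> carrier A_group" for x using that unfolding carr by (auto simp: k'h kA)
  qed
 qed
 then show thesis using that[OF h hs] kA by simp
qed

lemma hom_Qab_units:
 assumes h: "h \<in> hom (free_Abelian_group UNIV) Qab_units"
 shows "h (x - y) = h x / h y" "h (x + y) = h x * h y" "h (sum f A) = (\<Prod>i\<in>A. h (f i))"
proof -
 interpret U: comm_group Qab_units by (rule comm_group_Qab_units)
 interpret F: comm_group "free_Abelian_group (UNIV :: 'a set)" by (rule abelian_free_Abelian_group)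
 interpret h: group_hom "free_Abelian_group UNIV" Qab_units h by unfold_locales (rule h)
 have add: "h (x + y) = h x * h y" for x y using h.hom_mult[of x y] by (simp add: Qab_units_def)
 have nz: "h y \<noteq> 0" for y using h.hom_closed[of y] by (simp add: Qab_units_def)
 show "h (x + y) = h x * h y" by (rule add)
 show "h (x - y) = h x / h y" using add[of "x - y" y] nz[of y] by (simp add: field_simps)
 have "h 0 = 1" using h.hom_one by (simp add: Qab_units_def)
 then show "h (sum f A) = (\<Prod>i\<in>A. h (f i))"
  by (induction A rule: infinite_finite_induct) (simp_all add: add)
qed

section \<open>Sine products and products over powers of a root of unity\<close>

lemma sin_A_odd:
 assumes "p \<noteq> 2"
 shows "sin_A (a_elem p q) =
  (\<Prod>i = 1..(p - 1) div 2. sin1 (of_nat i / of_nat p)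
    / (\<Prod>k = 0..(q - 1) div 2. sin1 (of_nat i / of_nat (p * q) + of_nat k / of_nat q)))
  / (\<Prod>j = 1..(q - 1) div 2. sin1 (of_nat j / of_nat q)
    / (\<Prod>l = 0..(p - 1) div 2. sin1 (of_nat j / of_nat (p * q) + of_nat l / of_nat p)))"
proof -
 obtain h where h: "h \<in> hom (free_Abelian_group UNIV) Qab_units" "\<And>a. h (frag_of a) = sin1 a"
  "\<And>x. sin_A (A_class x) = h x" by (rule sin_A_hom) blast
 show ?thesis using assms by (simp only: a_elem_def a_odd_def if_False h hom_Qab_units[OF h(1)])
qed

lemma sin_A_two:
 "sin_A (a_elem 2 q) =
  (sin1 (1 / 4) / (\<Prod>k = 0..(q - 1) div 2. sin1 (1 / of_nat (4 * q) + of_nat k / of_nat q)))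
 / (\<Prod>j = 1..(q - 1) div 2.
    sin1 (of_nat j / of_nat q) * sin1 (- 1 / of_nat (2 * q) + of_nat j / of_nat q)
    / sin1 (of_nat j / of_nat (2 * q))
    / sin1 (- 1 / of_nat (4 * q) + of_nat j / of_nat (2 * q)))"
proof -
 obtain h where h: "h \<in> hom (free_Abelian_group UNIV) Qab_units" "\<And>a. h (frag_of a) = sin1 a"
  "\<And>x. sin_A (A_class x) = h x" by (rule sin_A_hom) blast
 show ?thesis by (simp only: a_elem_def a_two_def simp_thms if_True h hom_Qab_units[OF h(1)])
qed

text \<open>Both sides have degree at most \<open>n\<close> and agree at the \<open>n + 1\<close>
  points of \<open>A\<close>: both are 1 at 0, and both vanish at the inverses of the powers of
  \<open>\<omega>\<close>.\<close>

lemma prod_linear_factors: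
 fixes \<omega> :: complex
 assumes \<omega>: "\<omega> ^ n = 1" "n > 0" and inj: "inj_on (\<lambda>k. \<omega> ^ k) {..<n}"
 shows "(\<Prod>k<n. [:1, - (\<omega> ^ k):]) = 1 - Polynomial.monom 1 n"
proof -
 define p where "p = (\<Prod>k<n. [:1, - (\<omega> ^ k):])"
 define q where "q = 1 - Polynomial.monom (1::complex) n"
 define A where "A = insert 0 ((\<lambda>j. inverse (\<omega> ^ j)) ` {..<n})"
 have nz: "\<omega> \<noteq> 0" using \<omega> by (auto simp: power_0_left)
 have "inj_on (\<lambda>j. inverse (\<omega> ^ j)) {..<n}" using inj by (simp add: inj_on_def)
 then have card: "card A = Suc n" using nz by (subst A_def, subst card_insert_disjoint) (auto simp: card_image)
 have "p = q"
 proof (rule poly_eqI_degree)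
  fix x assume "x \<in> A"
  then consider "x = 0" | j where "j < n" "x = inverse (\<omega> ^ j)" by (auto simp: A_def)
  then show "poly p x = poly q x"
  proof cases
   case 1
   then show ?thesis using \<omega>(2) by (simp add: p_def q_def poly_prod poly_monom)
  next
   case 2
   have "poly p x = 0" using 2 nz by (auto simp: p_def poly_prod prod_zero_iff intro!: bexI[of _ j])
   moreover have "(\<omega> ^ j) ^ n = 1" using \<omega>(1) by (metis mult.commute power_mult power_one)
   then have "x ^ n = 1" by (simp add: 2 power_inverse)
   ultimately show ?thesis by (simp add: q_def poly_monom)
  qed
 next
  have "degree p \<le> (\<Sum>k<n. degree [:1, - (\<omega> ^ k):])"
   unfolding p_def using degree_prod_sum_le[of "{..<n}" "\<lambda>k. [:1, - (\<omega> ^ k):]"] by (simp add: o_def)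
  also have "\<dots> \<le> (\<Sum>k<n. 1)" by (rule sum_mono) simp
  finally show "degree p < card A" using card by simp
  have "degree q \<le> n" unfolding q_def by (rule degree_diff_le) (simp_all add: degree_monom_le)
  then show "degree q < card A" using card by simp
 qed
 then show ?thesis by (simp add: p_def q_def)
qed

lemma prod_one_minus_powers:
 fixes \<omega> :: complex
 assumes \<omega>: "\<omega> ^ n = 1" "n > 0" and inj: "inj_on (\<lambda>k. \<omega> ^ k) {..<n}"
 shows "(\<Prod>k<n. 1 - z * \<omega> ^ k) = 1 - z ^ n"
 using arg_cong[OF prod_linear_factors[OF assms], of "\<lambda>f. poly f z"] by (simp add: poly_prod poly_monom mult_ac)

text \<open>The factor \<open>1 - X\<close> for \<open>k = 0\<close> divides
  \<open>1 - X ^ n\<close> with the geometric sum as quotient; evaluation of that sum at 1 gives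
  \<open>n\<close>.\<close>

lemma prod_one_minus_nontrivial_powers:
 fixes \<omega> :: complex
 assumes \<omega>: "\<omega> ^ n = 1" "n > 0" and inj: "inj_on (\<lambda>k. \<omega> ^ k) {..<n}"
 shows "(\<Prod>k = 1..<n. 1 - \<omega> ^ k) = of_nat n"
proof -
 have "{..<n} = insert 0 {1..<n}" using \<omega>(2) by auto
 then have "[:1, - 1:] * (\<Prod>k = 1..<n. [:1, - (\<omega> ^ k):]) = 1 - Polynomial.monom 1 n"
  using prod_linear_factors[OF assms] by simp
 also have "\<dots> = [:1, - 1:] * (\<Sum>k<n. Polynomial.monom 1 k)"
 proof -
  have "Polynomial.monom (1::complex) k = [:0, 1:] ^ k" for k by (simp add: monom_altdef)
  moreover have "[:1, - 1 :: complex:] = 1 - [:0, 1:]" by (simp add: one_pCons)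
  ultimately show ?thesis by (simp only: one_diff_power_eq)
 qed
 finally have "(\<Prod>k = 1..<n. [:1, - (\<omega> ^ k):]) = (\<Sum>k<n. Polynomial.monom 1 k)"
  by (rule mult_left_cancel[THEN iffD1, rotated]) simp
 then have "poly (\<Prod>k = 1..<n. [:1, - (\<omega> ^ k):]) 1 = poly (\<Sum>k<n. Polynomial.monom 1 k) 1" by simp
 then show ?thesis by (simp add: poly_prod poly_sum poly_monom)
qed

lemma ee_powers_inj: assumes n: "n > 0" shows "inj_on (\<lambda>k. ee (1 / of_nat n) ^ k) {..<n}"
proof (rule inj_onI)
 fix i j assume ij: "i \<in> {..<n}" "j \<in> {..<n}" "ee (1 / of_nat n) ^ i = ee (1 / of_nat n) ^ j"
 then have "ee (of_nat i / of_nat n - of_nat j / of_nat n) = 1" by (simp add: ee_diff ee_power)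
 then obtain m where m: "of_nat i / of_nat n - of_nat j / of_nat n = (of_int m :: rat)"
  unfolding ee_eq_1_iff by (auto elim: Ints_cases)
 have "of_nat i - of_nat j = (of_int m * of_nat n :: rat)" using m n by (simp add: field_simps)
 then have "(of_int (int i - int j) :: rat) = of_int (m * int n)" by simp
 then have eq: "int i - int j = m * int n" by (simp only: of_int_eq_iff)
 moreover have "\<bar>int i - int j\<bar> < int n" using ij by auto
 ultimately have "m = 0" using n dvd_imp_le_int[of "int i - int j" "int n"] by force
 then show "i = j" using eq by simp
qed

lemma prod_one_minus_ee:
 assumes n: "n > 0"
 shows "(\<Prod>k<n. 1 - z * ee (of_nat k / of_nat n)) = 1 - z ^ n"
proof -
 have "ee (1 / of_nat n) ^ n = ee (of_int 1)" using n by (simp add: ee_power)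
 then have "ee (1 / of_nat n) ^ n = 1" by (simp only: ee_of_int)
 from prod_one_minus_powers[OF this n ee_powers_inj[OF n], of z] show ?thesis by (simp add: ee_power)
qed

section \<open>Half systems modulo an odd prime\<close>

text \<open>Representatives of the nonzero residues up to sign; the modulus may be any odd number,
  such as \<open>p * q\<close> below.\<close>

definition half :: "int \<Rightarrow> int set" where
 "half p = {1..(p - 1) div 2}"

definition upper :: "int \<Rightarrow> int \<Rightarrow> bool" where
 "upper p a \<longleftrightarrow> p < 2 * (a mod p)"

text \<open>The elements of the half system that multiplication by \<open>g\<close> carries to the
  other half: the sign changes counted in Gauss' lemma.\<close>

definition uppers :: "int \<Rightarrow> int \<Rightarrow> int set" where
 "uppers p g = {a \<in> half p. upper p (g * a)}"

definition periodic :: "int \<Rightarrow> (int \<Rightarrow> 'a) \<Rightarrow> bool" where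
 "periodic p F \<longleftrightarrow> (\<forall>a b. [a = b] (mod p) \<longrightarrow> F a = F b)"

lemma periodicD: "periodic p F ==> [a = b] (mod p) ==> F a = F b"
 by (simp add: periodic_def)

lemma half_iff: "a \<in> half p \<longleftrightarrow> 0 < a \<and> 2 * a < p"
 by (auto simp: half_def)

lemma finite_half [simp]: "finite (half p)" by (simp add: half_def)

lemma finite_uppers [simp]: "finite (uppers p g)" by (simp add: uppers_def)

lemma card_half: "card (half p) = nat ((p - 1) div 2)" by (simp add: half_def)

lemma upper_periodic: "periodic p (upper p)"
 by (simp add: periodic_def upper_def unique_euclidean_semiring_class.cong_def)

lemma upper_cong: "[a = b] (mod p) ==> upper p a = upper p b"
 by (rule periodicD[OF upper_periodic])

lemma periodic_mult: assumes "periodic p F" shows "periodic p (\<lambda>a. F (n * a))"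
 unfolding periodic_def by (intro allI impI periodicD[OF assms] cong_mult) auto

locale odd_prime =
 fixes p :: int
 assumes prime_p: "prime p" and p_gt_2: "2 < p"
begin

lemma odd_p: "odd p" using prime_odd_int[OF prime_p] p_gt_2 by simp

lemma double_neq: "2 * a \<noteq> p" using odd_p by auto

lemma half_not_dvd: "a \<in> half p ==> \<not> p dvd a"
 using zdvd_not_zless[of a p] by (auto simp: half_iff)

lemma half_not_upper: assumes "a \<in> half p" shows "\<not> upper p a"
proof -
 have "a mod p = a" using assms by (intro mod_pos_pos_trivial) (auto simp: half_iff)
 then show ?thesis using assms by (simp add: upper_def half_iff)
qed

lemma mod_pos: "\<not> p dvd a ==> 0 < a mod p"
 using pos_mod_sign[of p a] p_gt_2 by (simp add: dvd_eq_mod_eq_0 order.strict_iff_order)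

lemma upper_minus: assumes "\<not> p dvd a" shows "upper p (- a) \<longleftrightarrow> \<not> upper p a"
proof -
 have "(- a) mod p = p - a mod p" using assms by (simp add: zmod_zminus1_eq_if dvd_eq_mod_eq_0)
 then show ?thesis using double_neq[of "a mod p"] by (auto simp: upper_def)
qed

text \<open>For \<open>a\<close> prime to \<open>p\<close>, the representative of the pair
  \<open>a\<close>, \<open>- a\<close> in the half system.\<close>

definition rep :: "int \<Rightarrow> int" where
 "rep a = (if upper p a then p - a mod p else a mod p)"

lemma rep_half: assumes "\<not> p dvd a" shows "rep a \<in> half p"
proof -
 have "a mod p < p" using p_gt_2 by simp
 then show ?thesis using mod_pos[OF assms] double_neq[of "a mod p"] by (auto simp: rep_def half_iff upper_def)
qed

lemma rep_cong: "[rep a = (if upper p a then - a else a)] (mod p)"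
proof (cases "upper p a")
 case True
 have "p dvd a - a mod p" by (rule dvd_minus_mod)
 then have "p dvd (p - a mod p) - (- a)" using dvd_add[of p p "a - a mod p"] by (simp add: algebra_simps)
 then show ?thesis using True by (simp add: rep_def cong_iff_dvd_diff)
next
 case False
 then show ?thesis by (simp add: rep_def unique_euclidean_semiring_class.cong_def)
qed

lemma not_dvd_mult: "\<not> p dvd a ==> \<not> p dvd b ==> \<not> p dvd a * b"
 using prime_dvd_mult_iff[OF prime_p] by blast

lemma half_eqI:
 assumes a: "a \<in> half p" and b: "b \<in> half p" and d: "p dvd a - b \<or> p dvd a + b" shows "a = b"
proof -
 have "\<bar>a - b\<bar> < p" "0 < a + b" "a + b < p" using a b by (auto simp: half_iff)
 then show ?thesis using d zdvd_not_zless[of "a + b" p] dvd_imp_le_int[of "a - b" p] by force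
qed

lemma bij_rep: assumes g: "\<not> p dvd g" shows "bij_betw (\<lambda>a. rep (g * a)) (half p) (half p)"
proof -
 have inj: "inj_on (\<lambda>a. rep (g * a)) (half p)"
 proof (rule inj_onI)
  fix a b assume ab: "a \<in> half p" "b \<in> half p" "rep (g * a) = rep (g * b)"
  have "[(if upper p (g * a) then - (g * a) else g * a) = (if upper p (g * b) then - (g * b) else g * b)] (mod p)"
   using rep_cong[of "g * a"] rep_cong[of "g * b"] ab(3) cong_trans cong_sym by metis
  then have "p dvd g * a - g * b \<or> p dvd g * a + g * b \<or> p dvd - (g * a - g * b) \<or> p dvd - (g * a + g * b)"
   by (auto simp: cong_iff_dvd_diff algebra_simps split: if_splits)
  then have "p dvd g * (a - b) \<or> p dvd g * (a + b)"
   unfolding dvd_minus_iff by (auto simp: algebra_simps)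
  then have "p dvd a - b \<or> p dvd a + b" using not_dvd_mult[OF g] by blast
  then show "a = b" by (rule half_eqI[OF ab(1,2)])
 qed
 moreover have "(\<lambda>a. rep (g * a)) ` half p \<subseteq> half p"
  using rep_half not_dvd_mult[OF g] half_not_dvd by blast
 ultimately show ?thesis by (simp add: bij_betw_def endo_inj_surj)
qed

lemma prod_half_rep:
 fixes F :: "int \<Rightarrow> 'a :: comm_monoid_mult"
 assumes F: "periodic p F" and g: "\<not> p dvd g"
 shows "(\<Prod>a\<in>half p. F (if upper p (g * a) then - (g * a) else g * a)) = prod F (half p)"
 using prod.reindex_bij_betw[OF bij_rep[OF g], of F] periodicD[OF F rep_cong] by simp

text \<open>Multiplication by \<open>g\<close> permutes the half system up to signs, so replacing
  \<open>F (g * a)\<close> by \<open>F (- (g * a))\<close> at the sign changes restores the product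
  of \<open>F\<close>. The cross-multiplied form avoids division.\<close>

lemma prod_half_scale:
 fixes F :: "int \<Rightarrow> 'a :: comm_monoid_mult"
 assumes F: "periodic p F" and g: "\<not> p dvd g"
 shows "(\<Prod>a\<in>half p. F (g * a)) * (\<Prod>a\<in>uppers p g. F (- (g * a)))
   = prod F (half p) * (\<Prod>a\<in>uppers p g. F (g * a))"
proof -
 have u: "(\<Prod>a\<in>uppers p g. H a) = (\<Prod>a\<in>half p. if upper p (g * a) then H a else 1)" for H :: "int \<Rightarrow> 'a"
  unfolding uppers_def by (rule prod.inter_filter) simp
 show ?thesis
  unfolding u prod_half_rep[OF F g, symmetric] prod.distrib[symmetric]
  by (rule prod.cong) (auto simp: mult_ac)
qed

text \<open>The factors at which multiplication of the half system by \<open>m\<close> changes the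
  sign, with \<open>F\<close> rescaled by \<open>n\<close>. The rescaling records the action of an
  automorphism.\<close>

definition upper_prod :: "(int \<Rightarrow> complex) \<Rightarrow> int \<Rightarrow> int \<Rightarrow> complex" where
 "upper_prod F n m = (\<Prod>a\<in>uppers p m. F (n * m * a))"

lemma upper_prod_alt: "upper_prod F n m = (\<Prod>a\<in>half p. if upper p (m * a) then F (n * m * a) else 1)"
 unfolding upper_prod_def uppers_def by (rule prod.inter_filter) simp

lemma upper_prod_1: "upper_prod F n 1 = 1"
 unfolding upper_prod_alt by (rule prod.neutral) (simp add: half_not_upper)

lemma upper_prod_cong:
 assumes F: "periodic p F" and m: "[m = m'] (mod p)" shows "upper_prod F n m = upper_prod F n m'"
 unfolding upper_prod_alt
proof (rule prod.cong)
 fix a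
 have "upper p (m * a) = upper p (m' * a)" by (intro upper_cong cong_mult m cong_refl)
 moreover have "F (n * m * a) = F (n * m' * a)" by (intro periodicD[OF F] cong_mult m cong_refl)
 ultimately show "(if upper p (m * a) then F (n * m * a) else 1) = (if upper p (m' * a) then F (n * m' * a) else 1)"
  by simp
qed simp

definition odd_periodic :: "(int \<Rightarrow> complex) \<Rightarrow> bool" where
 "odd_periodic F \<longleftrightarrow> periodic p F \<and> (\<forall>a. F (- a) = - F a) \<and> (\<forall>a. \<not> p dvd a \<longrightarrow> F a \<in> Qab \<and> F a \<noteq> 0)"

text \<open>A sign change of \<open>m * m'\<close> at \<open>a\<close> is the exclusive or of one of
  \<open>m'\<close> at \<open>a\<close> and one of \<open>m\<close> at the representative of
  \<open>m' * a\<close>. All of them contribute the factor \<open>F (n * m * m' * a)\<close> up to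
  sign, and modulo squares two equal factors cancel.\<close>

lemma upper_prod_mult:
 assumes F: "odd_periodic F" and n: "\<not> p dvd n" and m: "\<not> p dvd m" and m': "\<not> p dvd m'"
 shows "sq_eq (upper_prod F n (m * m')) (upper_prod F n m * upper_prod F (n * m) m')"
proof -
 have per: "periodic p F" and neg: "F (- a) = - F a" for a using F by (auto simp: odd_periodic_def)
 define H where "H b = (if upper p (m * b) then F (n * m * b) else 1)" for b
 define r where "r a = (if upper p (m' * a) then - (m' * a) else m' * a)" for a
 have "periodic p H"
  using periodicD[OF periodic_mult[OF per, of "n * m"]] periodicD[OF periodic_mult[OF upper_periodic, of p m]]
  unfolding periodic_def H_def by metis
 note H = prod_half_rep[OF this m', folded r_def]
 have "sq_eq (if upper p (m * m' * a) then F (n * (m * m') * a) else 1)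
  (H (r a) * (if upper p (m' * a) then F (n * m * m' * a) else 1))" if a: "a \<in> half p" for a
 proof -
  define f where "f = F (n * m * m' * a)"
  have nd: "\<not> p dvd m * m' * a" "\<not> p dvd n * m * m' * a"
   using half_not_dvd[OF a] n m m' not_dvd_mult by blast+
  have f: "f \<in> Qab" "f \<noteq> 0" using F nd(2) by (auto simp: f_def odd_periodic_def)
  have e1: "F (n * (m * m') * a) = f" "F (n * m * (m' * a)) = f" by (simp_all add: f_def mult_ac)
  have e2: "F (- (n * m * (m' * a))) = - f" using e1(2) neg by simp
  have up: "upper p (- (m * (m' * a))) \<longleftrightarrow> \<not> upper p (m * m' * a)" "upper p (m * (m' * a)) = upper p (m * m' * a)"
   using upper_minus[OF nd(1)] by (simp_all add: mult.assoc)
  have r: "sq_eq f f" "sq_eq 1 1" "sq_eq f (- f * - f * f)" "sq_eq 1 (- f * f)" "sq_eq 1 (f * f)"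
  proof -
   show ff: "sq_eq f f" using f by (rule sq_eq_refl)
   show "sq_eq 1 1" by (rule sq_eq_1)
   show "sq_eq 1 (f * f)" using sq_eq_sym[OF sq_eq_mult_self[OF f]] .
   then show "sq_eq 1 (- f * f)" using sq_eq_sym[OF sq_eq_minus[OF sq_eq_mult_self[OF f]]] by simp
   show "sq_eq f (- f * - f * f)" using sq_eq_sym[OF sq_eq_cancel_left[OF f ff]] by (simp add: mult_ac)
  qed
  show ?thesis
   using r by (auto simp: H_def r_def up e1 e2 f_def[symmetric])
 qed
 then have "sq_eq (upper_prod F n (m * m')) (\<Prod>a\<in>half p. H (r a) * (if upper p (m' * a) then F (n * m * m' * a) else 1))"
  unfolding upper_prod_alt by (rule sq_eq_prod)
 then show ?thesis unfolding prod.distrib H by (simp add: upper_prod_alt H_def)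
qed

text \<open>Iterating the cocycle relation replaces the sign changes of \<open>g ^ k\<close> by
  those of \<open>g\<close> alone at successive rescalings, a form on which the automorphism with
  exponent \<open>g\<close> acts by a shift.\<close>

lemma upper_prod_power:
 assumes F: "odd_periodic F" and n: "\<not> p dvd n" and g: "\<not> p dvd g"
 shows "sq_eq (upper_prod F n (g ^ k)) (\<Prod>j<k. upper_prod F (n * g ^ j) g)"
proof (induction k)
 case 0
 then show ?case by (simp add: upper_prod_1 sq_eq_1)
next
 case (Suc k)
 have gk: "\<not> p dvd g ^ k" using g prime_dvd_power[OF prime_p] by blast
 have "sq_eq (upper_prod F n (g ^ k * g)) (upper_prod F n (g ^ k) * upper_prod F (n * g ^ k) g)"
  by (rule upper_prod_mult[OF F n gk g])
 also have "sq_eq \<dots> ((\<Prod>j<k. upper_prod F (n * g ^ j) g) * upper_prod F (n * g ^ k) g)"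
 proof (rule sq_eq_mult[OF Suc sq_eq_refl])
  have "F (n * g ^ k * g * a) \<in> Qab \<and> F (n * g ^ k * g * a) \<noteq> 0" if "a \<in> uppers p g" for a
  proof -
   have "\<not> p dvd n * g ^ k * g * a"
    using that half_not_dvd n g gk not_dvd_mult unfolding uppers_def by blast
   then show ?thesis using F by (auto simp: odd_periodic_def)
  qed
  then show "upper_prod F (n * g ^ k) g \<in> Qab" "upper_prod F (n * g ^ k) g \<noteq> 0"
   unfolding upper_prod_def by (auto intro!: subfield_prod[OF Qab])
 qed
 finally show ?case by (simp add: mult.commute)
qed

lemma primitive_root:
 obtains g where "\<not> p dvd g" "\<And>a. \<not> p dvd a ==> \<exists>k. [a = g ^ k] (mod p)"
proof -
 have pn: "prime (nat p)" using prime_p by simp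
 moreover have "odd (nat p)" using odd_p p_gt_2 by (simp add: even_nat_iff)
 ultimately obtain g where "\<forall>k>0. residue_primroot (nat p ^ k) g" by (rule residue_primroot_odd_prime_power_exists)
 from spec[OF this, of 1] have g: "residue_primroot (nat p) g" by simp
 have cg: "coprime (nat p) g" using g by (simp add: residue_primroot_def)
 show thesis
 proof (rule that[of "int g"])
  have "\<not> nat p dvd g" using coprime_common_divisor[OF cg, of "nat p"] p_gt_2 by auto
  then have "\<not> int (nat p) dvd int g" by (simp only: int_dvd_int_iff not_False_eq_True)
  then show "\<not> p dvd int g" using p_gt_2 by simp
  fix a assume a: "\<not> p dvd a"
  have "nat (a mod p) \<in> totatives (nat p)"
  proof -
   have "0 < nat (a mod p)" "nat (a mod p) < nat p" using mod_pos[OF a] p_gt_2 by simp_all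
   then show ?thesis using pn by (simp add: totatives_prime)
  qed
  then obtain k where "nat (a mod p) = g ^ k mod nat p"
   using residue_primroot_is_generator[OF prime_gt_1_nat[OF pn] g] by (auto simp: bij_betw_def)
  then have "int (nat (a mod p)) = int (g ^ k mod nat p)" by simp
  then have "a mod p = int g ^ k mod p" using p_gt_2 by (simp add: zmod_int)
  then show "\<exists>k. [a = int g ^ k] (mod p)" by (auto simp: unique_euclidean_semiring_class.cong_def)
 qed
qed

end

section \<open>Commutation with generators over a radical tower\<close>

lemma fixed_subfield: assumes g: "g \<in> carrier G_Q" shows "is_subfield {z \<in> Qbar. g z = z}"
 unfolding is_subfield_def
 using subfieldD[OF Qbar] gal_add[OF g] gal_times[OF g] gal_0[OF Qbar g] gal_1[OF Qbar g]
  gal_minus[OF Qbar g] gal_inverse[OF Qbar g] by simp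

lemma mult_closure_mult:
 assumes S: "S \<subseteq> carrier G_Q" and g: "g \<in> mult_closure S" and h: "h \<in> mult_closure S"
 shows "g \<cdot> h \<in> mult_closure S"
 using g
proof induction
 case one
 then show ?case using h mult_closure_carrier[OF S h] by simp
next
 case (step s g)
 then show ?case
  using mult_closure_carrier[OF S] h S mult_closure.step[of s S "g \<cdot> h"] by (simp add: GQ.m_assoc subset_iff)
qed

lemma mult_closure_mono: assumes "S \<subseteq> T" "g \<in> mult_closure S" shows "g \<in> mult_closure T"
 using assms(2) by induction (use assms(1) in \<open>auto intro: mult_closure.intros\<close>)

text \<open>The automorphisms send \<open>w\<close> to \<open>A * w\<close> and \<open>B * w\<close>
  up to signs. Signs are fixed by automorphisms and enter both composites equally, so only
  \<open>t A * B\<close> and \<open>s B * A\<close> have to be compared.\<close>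

lemma commute_on_sqrt:
 assumes st: "s \<in> carrier G_Q" "t \<in> carrier G_Q" and w: "w \<in> Qbar" "w\<^sup>2 = v"
  and AB: "A \<in> Qbar" "B \<in> Qbar" and sv: "s v = A\<^sup>2 * v" and tv: "t v = B\<^sup>2 * v"
  and c: "t A * B = bit_sign \<epsilon> * (s B * A)"
 shows "s (t w) = bit_sign \<epsilon> * t (s w)"
proof -
 have sq: "g w = a * w \<or> g w = - a * w" if "g \<in> carrier G_Q" "g v = a\<^sup>2 * v" for g a
 proof -
  have "(g w)\<^sup>2 = (a * w)\<^sup>2" using that gal_power[OF Qbar that(1) w(1), of 2] by (simp add: w(2) power_mult_distrib)
  then show ?thesis unfolding power2_eq_iff by simp
 qed
 have e: "s (t w) = s (c * B) * (d * A) * w" "t (s w) = t (d * A) * (c * B) * w"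
  if "s w = d * A * w" "t w = c * B * w" "c \<in> Qbar" "d \<in> Qbar" for c d
  using that w AB gal_times[OF st(1), of "c * B" w] gal_times[OF st(2), of "d * A" w] subfieldD(4)[OF Qbar]
  by (simp_all add: mult_ac)
 have m: "g (- z) = - g z" if "g \<in> carrier G_Q" "z \<in> Qbar" for g z using gal_minus[OF Qbar that] .
 have cc: "t A * B * w = bit_sign \<epsilon> * (s B * A) * w" using c by simp
 have "bit_sign \<epsilon> * bit_sign \<epsilon> = 1" by (cases \<epsilon>) simp_all
 then have cc': "s B * A * w = bit_sign \<epsilon> * (t A * B * w)" unfolding cc by (simp flip: mult.assoc)
 have one: "(1::complex) \<in> Qbar" "(-1::complex) \<in> Qbar" using subfieldD(2,5)[OF Qbar] by auto
 show ?thesis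
  using sq[OF st(1) sv] sq[OF st(2) tv] e[of 1 1] e[of 1 "-1"] e[of "-1" 1] e[of "-1" "-1"] one cc'
  by (auto simp: m[OF st(1) AB(2)] m[OF st(2) AB(1)])
qed

text \<open>A tuple in \<open>R\<close> records an automorphism \<open>s\<close>, a square root
  \<open>A\<close> of \<open>s v / v\<close> and the values of the two quadratic characters at
  \<open>s\<close>. Quantification over all subfields \<open>K\<close> that contain \<open>X\<close>
  expresses membership in the field generated by \<open>X\<close>. Whatever lies there is fixed by
  the stabiliser \<open>N\<close> of \<open>X\<close>, whose elements join the generators with
  trivial data.\<close>

theorem D_map_of_tuples:
 fixes R :: "((complex \<Rightarrow> complex) \<times> complex \<times> bit \<times> bit) set"
 assumes v: "v \<noteq> 0" and pq: "p > 0" "q > 0" and X: "X \<subseteq> Qab"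
  and mem: "\<And>K. is_subfield K ==> X \<subseteq> K ==> v \<in> K \<and> complex_of_real (sqrt p) \<in> K \<and> complex_of_real (sqrt q) \<in> K"
  and memR: "\<And>K s A P Q. is_subfield K ==> X \<subseteq> K ==> (s, A, P, Q) \<in> R ==> A \<in> K"
  and R: "\<And>s A P Q. (s, A, P, Q) \<in> R ==> s \<in> carrier G_Q \<and> s v = A\<^sup>2 * v \<and>
   s (of_real (sqrt p)) = bit_sign P * of_real (sqrt p) \<and> s (of_real (sqrt q)) = bit_sign Q * of_real (sqrt q)"
  and comm: "\<And>s A P Q t B P' Q'. (s, A, P, Q) \<in> R ==> (t, B, P', Q') \<in> R ==>
   t A * B = bit_sign (P * Q' + P' * Q) * (s B * A)"
  and gen: "\<And>g. g \<in> carrier G_Q ==> \<exists>h\<in>mult_closure (fst ` R). \<forall>x\<in>X. g x = h x"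
 shows "D_map (mod_squares v) = wedge H1ab (e_char p) (e_char q)"
proof -
 have XQ: "X \<subseteq> Qbar" using X Qab_Qbar by blast
 note memQ = mem[OF Qab X]
 define N where "N = {\<nu> \<in> carrier G_Q. \<forall>x\<in>X. \<nu> x = x}"
 define R' where "R' = R \<union> (\<lambda>\<nu>. (\<nu>, 1, 0, 0)) ` N"
 have fx: "is_subfield {z \<in> Qbar. \<nu> z = z}" "X \<subseteq> {z \<in> Qbar. \<nu> z = z}" if "\<nu> \<in> N" for \<nu>
  using that fixed_subfield XQ by (auto simp: N_def)
 have R'1: "s \<in> carrier G_Q \<and> A \<in> Qab \<and> s v = A\<^sup>2 * v \<and>
   s (of_real (sqrt p)) = bit_sign P * of_real (sqrt p) \<and> s (of_real (sqrt q)) = bit_sign Q * of_real (sqrt q)"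
  if h: "(s, A, P, Q) \<in> R'" for s A P Q
 proof (cases "(s, A, P, Q) \<in> R")
  case True
  then show ?thesis using R memR[OF Qab X True] by blast
 next
  case False
  then have "s \<in> N" "A = 1" "P = 0" "Q = 0" using h by (auto simp: R'_def)
  then show ?thesis using mem[OF fx] subfieldD(2)[OF Qab] by (simp add: N_def)
 qed
 have R'2: "t A * B = bit_sign (P * Q' + P' * Q) * (s B * A)"
  if h: "(s, A, P, Q) \<in> R'" "(t, B, P', Q') \<in> R'" for s A P Q t B P' Q'
 proof -
  have c: "s \<in> carrier G_Q" "t \<in> carrier G_Q" using R'1 h by auto
  have n: "A = 1 \<and> P = 0 \<and> Q = 0 \<and> s \<in> N" if "(s, A, P, Q) \<notin> R" "(s, A, P, Q) \<in> R'" for s A P Q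
   using that by (auto simp: R'_def)
  have f: "\<nu> A = A" if "\<nu> \<in> N" "(s, A, P, Q) \<in> R'" for \<nu> s A P Q
  proof (cases "(s, A, P, Q) \<in> R")
   case True
   then show ?thesis using memR[OF fx[OF that(1)] True] by simp
  next
   case False
   then have "A = 1" using n that by blast
   then show ?thesis using gal_1[OF Qbar, of \<nu>] that(1) by (simp add: N_def)
  qed
  show ?thesis
  proof (cases "(s, A, P, Q) \<in> R \<and> (t, B, P', Q') \<in> R")
   case True
   then show ?thesis using comm by blast
  next
   case False
   then consider "A = 1 \<and> P = 0 \<and> Q = 0 \<and> s \<in> N" | "B = 1 \<and> P' = 0 \<and> Q' = 0 \<and> t \<in> N"
    using n h by blast
   then show ?thesis
   proof cases
    case 1
    then have "s B = B" using f[OF _ h(2)] by blast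
    then show ?thesis using 1 gal_1[OF Qbar c(2)] by simp
   next
    case 2
    then have "t A = A" using f[OF _ h(1)] by blast
    then show ?thesis using 2 gal_1[OF Qbar c(1)] by simp
   qed
  qed
 qed
 define S where "S = fst ` R'"
 have tuple: "\<exists>A P Q. (s, A, P, Q) \<in> R'" if "s \<in> S" for s using that by (force simp: S_def)
 have SG: "S \<subseteq> carrier G_Q" using tuple R'1 by blast
 have full: "carrier G_Q \<subseteq> mult_closure S"
 proof
  fix g assume g: "g \<in> carrier G_Q"
  obtain h where h: "h \<in> mult_closure (fst ` R)" and gh: "\<forall>x\<in>X. g x = h x" using gen[OF g] by blast
  have hS: "h \<in> mult_closure S" by (rule mult_closure_mono[OF _ h]) (auto simp: S_def R'_def)
  have hG: "h \<in> carrier G_Q" using mult_closure_carrier[OF SG hS] .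
  \<comment> \<open>Any automorphism is a product of one generated by \<open>R\<close> and one that
    fixes \<open>X\<close>.\<close>
  define \<nu> where "\<nu> = ginv h \<cdot> g"
  have \<nu>G: "\<nu> \<in> carrier G_Q" using g hG by (simp add: \<nu>_def)
  have "\<nu> x = x" if x: "x \<in> X" for x
  proof -
   have xQ: "x \<in> Qbar" using x XQ by blast
   then have "\<nu> x = (ginv h) (g x)" using g hG by (simp add: \<nu>_def)
   also have "\<dots> = (ginv h) (h x)" using gh x by simp
   finally show ?thesis using GQ_inv_apply(1)[OF hG xQ] by simp
  qed
  then have "\<nu> \<in> N" using \<nu>G by (simp add: N_def)
  then have "\<nu> \<in> S" unfolding S_def R'_def by force
  then have "\<nu> \<in> mult_closure S"
   using mult_closure.step[OF _ mult_closure.one, of \<nu> S] \<nu>G by simp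
  moreover have "g = h \<cdot> \<nu>" using g hG by (simp add: \<nu>_def flip: GQ.m_assoc)
  ultimately show "g \<in> mult_closure S" using mult_closure_mult[OF SG hS] by simp
 qed
 define w where "w = csqrt v"
 have w2: "w\<^sup>2 = v" by (simp add: w_def)
 have vQ: "v \<in> Qbar" using memQ Qab_Qbar by blast
 have wQ: "w \<in> Qbar" using vQ by (auto simp: w_def Qbar_def)
 have w0: "w \<noteq> 0" using w2 v by auto
 have ech: "e_char n (restrict s Qab) = P"
  if "complex_of_real (sqrt n) \<in> Qab" "n > 0" "s \<in> carrier G_Q" "s (of_real (sqrt n)) = bit_sign P * of_real (sqrt n)"
  for n :: nat and s P
 proof -
  have "bit_sign (e_char n (restrict s Qab)) * complex_of_real (sqrt n) = bit_sign P * of_real (sqrt n)"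
   by (rule trans[OF sym[OF e_char(2)[OF that(1,2,3)]] that(4)])
  moreover have "complex_of_real (sqrt n) \<noteq> 0" using that(2) by simp
  ultimately show ?thesis by (metis mult_right_cancel bit_sign_inject)
 qed
 have "D_map (mod_squares (w\<^sup>2)) = wedge H1ab (e_char p) (e_char q)"
 proof (rule D_map_of_generators[where S = S])
  show "w \<in> Qbar" "w \<noteq> 0" by (fact wQ w0)+
  show "w\<^sup>2 \<in> Qab" using memQ by (simp add: w2)
  show "p > 0" "q > 0" by (fact pq)+
  show "complex_of_real (sqrt p) \<in> Qab" "complex_of_real (sqrt q) \<in> Qab" using memQ by auto
  show "S \<subseteq> carrier G_Q" "carrier G_Q \<subseteq> mult_closure S" by (fact SG full)+
 next
  fix s assume "s \<in> S"
  then obtain A P Q where h: "(s, A, P, Q) \<in> R'" using tuple by blast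
  have "(s w)\<^sup>2 = (A * w)\<^sup>2"
   using gal_power[OF Qbar _ wQ, of s 2] R'1[OF h] by (simp add: w2 power_mult_distrib)
  then have "s w = A * w \<or> s w = (- A) * w" unfolding power2_eq_iff by simp
  then show "\<exists>a\<in>Qab. s w = a * w" using R'1[OF h] subfieldD(5)[OF Qab] by blast
 next
  fix s t assume "s \<in> S" "t \<in> S"
  then obtain A P Q B P' Q' where h: "(s, A, P, Q) \<in> R'" "(t, B, P', Q') \<in> R'" using tuple by meson
  note r = R'1[OF h(1)] R'1[OF h(2)]
  have e: "e_char p (restrict s Qab) = P" "e_char q (restrict s Qab) = Q"
   "e_char p (restrict t Qab) = P'" "e_char q (restrict t Qab) = Q'"
   using ech pq r memQ by blast+
  show "s (t w) = bit_sign (e_char p (restrict s Qab) * e_char q (restrict t Qab) +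
    e_char p (restrict t Qab) * e_char q (restrict s Qab)) * t (s w)"
   unfolding e using r Qab_Qbar by (intro commute_on_sqrt[where s = s and t = t and A = A and B = B and v = v, OF _ _ wQ w2 _ _ _ _ R'2[OF h]]) blast+
 qed
 then show ?thesis by (simp add: w2)
qed

lemma D_map_of_three_generators:
 assumes v: "v \<noteq> 0" and pq: "p > 0" "q > 0" and X: "X \<subseteq> Qab"
  and mem: "\<And>K. is_subfield K ==> X \<subseteq> K ==> v \<in> K \<and> complex_of_real (sqrt p) \<in> K \<and> complex_of_real (sqrt q) \<in> K \<and>
   A1 \<in> K \<and> A2 \<in> K \<and> A3 \<in> K"
  and s: "s1 \<in> carrier G_Q" "s2 \<in> carrier G_Q" "s3 \<in> carrier G_Q"
  and sv: "s1 v = A1\<^sup>2 * v" "s2 v = A2\<^sup>2 * v" "s3 v = A3\<^sup>2 * v"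
  and sp: "s1 (of_real (sqrt p)) = bit_sign P1 * of_real (sqrt p)"
   "s2 (of_real (sqrt p)) = bit_sign P2 * of_real (sqrt p)"
   "s3 (of_real (sqrt p)) = bit_sign P3 * of_real (sqrt p)"
  and sq: "s1 (of_real (sqrt q)) = bit_sign Q1 * of_real (sqrt q)"
   "s2 (of_real (sqrt q)) = bit_sign Q2 * of_real (sqrt q)"
   "s3 (of_real (sqrt q)) = bit_sign Q3 * of_real (sqrt q)"
  and comm: "s2 A1 * A2 = bit_sign (P1 * Q2 + P2 * Q1) * (s1 A2 * A1)"
   "s3 A1 * A3 = bit_sign (P1 * Q3 + P3 * Q1) * (s1 A3 * A1)"
   "s3 A2 * A3 = bit_sign (P2 * Q3 + P3 * Q2) * (s2 A3 * A2)"
  and gen: "\<And>g. g \<in> carrier G_Q ==>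
   \<exists>(a::nat) (b::nat) (c::nat). \<forall>x\<in>X. g x = (s1 [^]\<^bsub>G_Q\<^esub> a \<cdot> (s2 [^]\<^bsub>G_Q\<^esub> b \<cdot> s3 [^]\<^bsub>G_Q\<^esub> c)) x"
 shows "D_map (mod_squares v) = wedge H1ab (e_char p) (e_char q)"
proof -
 define R where "R = {(s1, A1, P1, Q1), (s2, A2, P2, Q2), (s3, A3, P3, Q3)}"
 \<comment> \<open>The exponent is symmetric in the two tuples, so each of the three relations also
   gives the reversed one; on the diagonal the exponent is \<open>P * Q + P * Q = 0\<close>.\<close>
 have flip: "u * B = bit_sign (P' * Q + P * Q') * u'" if "u' = bit_sign (P * Q' + P' * Q) * (u * B)" for u u' B P P' Q Q'
 proof -
  have "bit_sign (P' * Q + P * Q') * bit_sign (P * Q' + P' * Q) = (1 :: complex)"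
   by (cases P; cases P'; cases Q; cases Q'; simp)
  then show ?thesis unfolding that by (simp flip: mult.assoc)
 qed
 have diag: "u = bit_sign (P * Q + P * Q) * u" for u :: complex and P Q by simp
 show ?thesis
 proof (rule D_map_of_tuples[OF v pq X, where R = R])
  fix s A P Q t B P' Q' assume "(s, A, P, Q) \<in> R" "(t, B, P', Q') \<in> R"
  then show "t A * B = bit_sign (P * Q' + P' * Q) * (s B * A)"
   unfolding R_def insert_iff prod.inject empty_iff
   by (elim disjE conjE FalseE; hypsubst) (rule comm diag flip[OF comm(1)] flip[OF comm(2)] flip[OF comm(3)])+
 next
  fix g assume "g \<in> carrier G_Q"
  from gen[OF this] show "\<exists>h\<in>mult_closure (fst ` R). \<forall>x\<in>X. g x = h x"
  proof (elim exE)
  fix a b c :: nat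
  assume abc: "\<forall>x\<in>X. g x = (s1 [^]\<^bsub>G_Q\<^esub> a \<cdot> (s2 [^]\<^bsub>G_Q\<^esub> b \<cdot> s3 [^]\<^bsub>G_Q\<^esub> c)) x"
  have S: "fst ` R \<subseteq> carrier G_Q" and in_S: "s1 \<in> fst ` R" "s2 \<in> fst ` R" "s3 \<in> fst ` R"
   using s by (auto simp: R_def)
  have "s1 [^]\<^bsub>G_Q\<^esub> a \<cdot> (s2 [^]\<^bsub>G_Q\<^esub> b \<cdot> (s3 [^]\<^bsub>G_Q\<^esub> c \<cdot> \<one>\<^bsub>G_Q\<^esub>)) \<in> mult_closure (fst ` R)"
   by (intro mult_closure_power[OF S] in_S mult_closure.one)
  then have "s1 [^]\<^bsub>G_Q\<^esub> a \<cdot> (s2 [^]\<^bsub>G_Q\<^esub> b \<cdot> s3 [^]\<^bsub>G_Q\<^esub> c) \<in> mult_closure (fst ` R)"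
   using s by simp
  then show "\<exists>h\<in>mult_closure (fst ` R). \<forall>x\<in>X. g x = h x" using abc by blast
  qed
 next
  fix K s A P Q assume K: "is_subfield K" "X \<subseteq> K" and "(s, A, P, Q) \<in> R"
  then have "A = A1 \<or> A = A2 \<or> A = A3" by (auto simp: R_def)
  then show "A \<in> K" using mem[OF K] by blast
 next
  fix K assume "is_subfield K" "X \<subseteq> K"
  then show "v \<in> K \<and> complex_of_real (sqrt p) \<in> K \<and> complex_of_real (sqrt q) \<in> K" using mem by blast
 next
  fix s A P Q assume "(s, A, P, Q) \<in> R"
  then show "s \<in> carrier G_Q \<and> s v = A\<^sup>2 * v \<and>
   s (of_real (sqrt p)) = bit_sign P * of_real (sqrt p) \<and> s (of_real (sqrt q)) = bit_sign Q * of_real (sqrt q)"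
   unfolding R_def insert_iff prod.inject empty_iff
   by (elim disjE conjE FalseE; hypsubst) (intro conjI s sv sp sq)+
 qed
qed

section \<open>Roots of unity of odd prime order\<close>

text \<open>Odd in \<open>a\<close>, and equal to \<open>1 - x ^ (2 a)\<close> up to sign and a
  power of \<open>x\<close>.\<close>

definition od :: "complex \<Rightarrow> int \<Rightarrow> complex" where
 "od x a = x powi a - x powi (- a)"

lemma od_minus: "od x (- a) = - od x a"
 by (simp add: od_def)

lemma od_powi: "od (x powi g) a = od x (g * a)"
 using power_int_mult[of x g a] power_int_mult[of x g "- a"] by (simp add: od_def)

lemma gal_od: assumes "s \<in> carrier G_Q" "x \<in> Qbar" shows "s (od x a) = od (s x) a"
 unfolding od_def using assms subfield_power_int[OF Qbar]
 by (simp add: gal_diff[OF Qbar] gal_power_int[OF Qbar])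

lemma od_mem: "is_subfield K ==> x \<in> K ==> od x a \<in> K"
 unfolding od_def by (intro subfield_diff subfield_power_int)

lemma powi_cong:
 fixes x :: complex
 assumes x: "x powi n = 1" "x \<noteq> 0" and ab: "[a = b] (mod n)"
 shows "x powi a = x powi b"
proof -
 obtain m where m: "a = b + n * m"
 proof -
  obtain m where "a - b = n * m" using ab unfolding cong_iff_dvd_diff by blast
  then show thesis by (intro that[of m]) simp
 qed
 show ?thesis using x by (simp add: m power_int_add power_int_mult)
qed

lemma power_cong_nat:
 fixes x :: complex
 assumes x: "x ^ n = 1" and ab: "[a = b] (mod n)"
 shows "x ^ a = x ^ b"
proof -
 have "x ^ c = x ^ (c mod n)" for c
 proof -
  have "x ^ c = x ^ (n * (c div n) + c mod n)" by simp
  then show ?thesis using x by (simp only: power_add power_mult power_one mult_1)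
 qed
 from this[of a] this[of b] show ?thesis using ab by (simp add: unique_euclidean_semiring_class.cong_def)
qed

text \<open>A full residue system consists of 0, the half system and its negatives.\<close>

lemma prod_residues:
 fixes F :: "int \<Rightarrow> 'a :: comm_monoid_mult"
 assumes n: "odd n" "n > 0" and F: "periodic n F"
 shows "prod F {0..<n} = F 0 * (\<Prod>a\<in>half n. F a * F (- a))"
proof -
 define U where "U = {a \<in> {0..<n}. n < 2 * a}"
 have bij: "bij_betw (\<lambda>a. n - a) (half n) U"
  by (rule bij_betwI[of _ _ _ "\<lambda>a. n - a"]) (auto simp: half_iff U_def)
 have split: "{0..<n} = insert 0 (half n \<union> U)"
 proof -
  have "2 * a \<noteq> n" for a using n(1) by auto
  then show ?thesis using n(2) by (auto simp: half_iff U_def not_less order.strict_iff_order)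
 qed
 have "finite U" by (rule finite_subset[of _ "{0..<n}"]) (auto simp: U_def)
 moreover have "half n \<inter> U = {}" "0 \<notin> half n \<union> U" using n(2) by (auto simp: U_def half_iff)
 ultimately have U: "finite U" "half n \<inter> U = {}" "0 \<notin> half n \<union> U" by blast+
 have "prod F {0..<n} = F 0 * (prod F (half n) * prod F U)"
  using U by (subst split) (simp add: prod.union_disjoint)
 also have "prod F U = (\<Prod>a\<in>half n. F (n - a))"
  using prod.reindex_bij_betw[OF bij, of F] by simp
 also have "\<dots> = (\<Prod>a\<in>half n. F (- a))"
  by (rule prod.cong[OF refl], rule periodicD[OF F]) (simp add: cong_iff_dvd_diff)
 finally show ?thesis by (simp add: prod.distrib)
qed

locale prime_root = odd_prime +
 fixes x :: complex
 assumes powi_p: "x powi p = 1" and neq_1: "x \<noteq> 1"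
begin

lemma p_pos: "0 < p" using p_gt_2 by simp

lemma power_nat_p: "x ^ nat p = 1"
 using powi_p p_gt_2 by (simp add: power_int_def)

lemma nonzero: "x \<noteq> 0"
 using powi_p p_gt_2 by auto

lemma is_root_of_unity: "root_of_unity x"
 using power_nat_p p_gt_2 unfolding root_of_unity_def by (intro exI[of _ "nat p"]) simp

lemma in_Qab: "x \<in> Qab"
 using root_of_unityD[OF is_root_of_unity] by blast

lemma in_Qbar: "x \<in> Qbar"
 using in_Qab by simp

lemma powi_eq_1_iff: "x powi a = 1 \<longleftrightarrow> p dvd a"
proof
 assume "p dvd a"
 then have "[a = 0] (mod p)" by (simp add: cong_iff_dvd_diff)
 then show "x powi a = 1" using powi_cong[OF powi_p nonzero, of a 0] by simp
next
 assume a: "x powi a = 1"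
 show "p dvd a"
 proof (rule ccontr)
  assume "\<not> p dvd a"
  then have "coprime a p" using prime_imp_coprime[OF prime_p] by (simp add: coprime_commute)
  then obtain u where u: "[a * u = 1] (mod p)" using cong_solve_coprime_int by blast
  have "x powi (a * u) = 1" using a by (simp add: power_int_mult)
  then have "x = 1" using powi_cong[OF powi_p nonzero u] by simp
  then show False using neq_1 by simp
 qed
qed

lemma powi_eq_iff: "x powi a = x powi b \<longleftrightarrow> [a = b] (mod p)"
 using powi_eq_1_iff[of "a - b"] nonzero by (simp add: power_int_diff cong_iff_dvd_diff)

lemma od_eq_0_iff: "od x a = 0 \<longleftrightarrow> p dvd a"
proof -
 have "od x a = 0 \<longleftrightarrow> p dvd 2 * a" by (simp add: od_def powi_eq_iff cong_iff_dvd_diff)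
 moreover have "\<not> p dvd 2" using p_gt_2 zdvd_imp_le[of p 2] by auto
 ultimately show ?thesis using prime_dvd_mult_iff[OF prime_p] by blast
qed

lemma od_odd_periodic: "odd_periodic (od x)"
 unfolding odd_periodic_def periodic_def
proof (intro conjI allI impI)
 fix a b assume "[a = b] (mod p)"
 then have "x powi a = x powi b" "x powi (- a) = x powi (- b)"
  by (auto simp: powi_eq_iff cong_minus_minus_iff)
 then show "od x a = od x b" by (simp add: od_def)
qed (use od_mem[OF Qab in_Qab] in \<open>auto simp: od_minus od_eq_0_iff\<close>)

lemma od_periodic: "periodic p (od x)"
 using od_odd_periodic by (simp add: odd_periodic_def)

lemma powers_inj:
 assumes d: "\<not> p dvd d" shows "inj_on (\<lambda>k. (x powi d) ^ k) {..<nat p}"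
proof (rule inj_onI)
 fix i j assume ij: "i \<in> {..<nat p}" "j \<in> {..<nat p}" "(x powi d) ^ i = (x powi d) ^ j"
 then have "x powi (d * int i) = x powi (d * int j)" by (simp add: power_int_mult)
 then have "p dvd d * (int i - int j)" by (simp add: powi_eq_iff cong_iff_dvd_diff right_diff_distrib)
 then have "p dvd int i - int j" using d not_dvd_mult by blast
 moreover have "\<bar>int i - int j\<bar> < p" using ij by auto
 ultimately show "i = j" using dvd_imp_le_int[of "int i - int j" p] by force
qed

lemma powers_eq_1: "(x powi d) ^ nat p = 1"
proof -
 have "(x powi d) ^ nat p = x powi (d * p)" using p_gt_2 by (simp add: power_int_mult flip: power_int_of_nat)
 then show ?thesis by (simp add: powi_eq_1_iff)
qed

lemma prod_int_residues: "(\<Prod>k\<in>{0..<p}. H k) = (\<Prod>k<nat p. H (int k))"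
 by (rule prod.reindex_bij_witness[of _ int nat]) auto

lemma half_card_double: "int (2 * card (half p)) = p - 1"
 using odd_p p_gt_2 by (simp add: card_half)

text \<open>As \<open>p\<close> is odd, \<open>x ^ 2\<close> also generates the group of
  \<open>p\<close>-th roots of unity; the factors run over this group, with that of 1 written
  separately.\<close>

lemma prod_one_minus:
 "(1 - z) * (\<Prod>a\<in>half p. (1 - z * x powi (2 * a)) * (1 - z * x powi (- (2 * a)))) = 1 - z ^ nat p"
proof -
 have n2: "\<not> p dvd 2" using p_gt_2 zdvd_imp_le[of p 2] by auto
 have per: "periodic p (\<lambda>a. 1 - z * x powi (2 * a))"
  unfolding periodic_def by (simp add: powi_eq_iff cong_scalar_left)
 have "(1 - z) * (\<Prod>a\<in>half p. (1 - z * x powi (2 * a)) * (1 - z * x powi (- (2 * a)))) = (\<Prod>a\<in>{0..<p}. 1 - z * x powi (2 * a))"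
  using prod_residues[OF odd_p p_pos per] by simp
 also have "\<dots> = (\<Prod>k<nat p. 1 - z * (x powi 2) ^ k)"
  unfolding prod_int_residues by (simp add: power_int_mult)
 also have "\<dots> = 1 - z ^ nat p"
  using p_gt_2 by (intro prod_one_minus_powers powers_eq_1 powers_inj[OF n2]) simp
 finally show ?thesis .
qed

text \<open>Pairing \<open>a\<close> with \<open>- a\<close> turns the square, up to sign, into the
  product of \<open>1 - x ^ (2 a)\<close> over all nonzero residues, which is \<open>p\<close>. The
  product over the half system thus plays the part of the quadratic Gauss sum.\<close>

lemma prod_od_squared: "(\<Prod>a\<in>half p. od x a)\<^sup>2 = (- 1) ^ card (half p) * of_int p"
proof -
 have n2: "\<not> p dvd 2" using p_gt_2 zdvd_imp_le[of p 2] by auto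
 \<comment> \<open>The value 1 at multiples of \<open>p\<close> removes the vanishing factor and
   keeps \<open>F\<close> periodic.\<close>
 define F where "F a = (if p dvd a then 1 else 1 - x powi (2 * a))" for a
 have per: "periodic p F"
  unfolding periodic_def
 proof (intro allI impI)
  fix a b assume ab: "[a = b] (mod p)"
  then have "p dvd a \<longleftrightarrow> p dvd b"
   unfolding cong_iff_dvd_diff using dvd_add_right_iff[of p "a - b" b] by simp
  moreover have "x powi (2 * a) = x powi (2 * b)" using ab by (simp add: powi_eq_iff cong_scalar_left)
  ultimately show "F a = F b" by (simp add: F_def)
 qed
 have "(\<Prod>a\<in>half p. od x a * od x (- a)) = (\<Prod>a\<in>half p. F a * F (- a))"
 proof (rule prod.cong[OF refl])
  fix a assume "a \<in> half p"
  then have nd: "\<not> p dvd a" by (rule half_not_dvd)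
  have x2: "x powi (2 * a) = x powi a * x powi a" "x powi (- (2 * a)) = x powi (- a) * x powi (- a)"
   using nonzero by (simp_all flip: power_int_add)
  have "x powi a * x powi (- a) = 1" using nonzero by (simp add: power_int_minus)
  then have "(X * x powi a) * x powi (- a) = X" for X by (simp only: mult.assoc mult_1_right)
  then show "od x a * od x (- a) = F a * F (- a)"
   using nd x2 \<open>x powi a * x powi (- a) = 1\<close> by (simp add: F_def od_def algebra_simps)
 qed
 also have "\<dots> = prod F {0..<p}" using prod_residues[OF odd_p p_pos per] by (simp add: F_def)
 also have "\<dots> = (\<Prod>k<nat p. F (int k))" by (rule prod_int_residues)
 also have "{..<nat p} = insert 0 {1..<nat p}" using p_gt_2 by auto
 also have "(\<Prod>k\<in>\<dots>. F (int k)) = (\<Prod>k = 1..<nat p. F (int k))" by (simp add: F_def)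
 also have "\<dots> = (\<Prod>k = 1..<nat p. 1 - (x powi 2) ^ k)"
 proof (rule prod.cong[OF refl])
  fix k assume "k \<in> {1..<nat p}"
  then have "\<not> p dvd int k" using zdvd_not_zless[of "int k" p] by (auto simp: zless_nat_eq_int_zless)
  then show "F (int k) = 1 - (x powi 2) ^ k" by (simp add: F_def power_int_mult)
 qed
 also have "\<dots> = of_nat (nat p)"
  using p_gt_2 by (intro prod_one_minus_nontrivial_powers powers_eq_1 powers_inj[OF n2]) simp
 also have "\<dots> = of_int p" using p_gt_2 by simp
 finally have "(\<Prod>a\<in>half p. od x a * od x (- a)) = of_int p" .
 moreover have "(\<Prod>a\<in>half p. od x a * od x (- a)) = (- 1) ^ card (half p) * (\<Prod>a\<in>half p. od x a)\<^sup>2"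
  by (simp add: od_minus prod_uminus prod.distrib power2_eq_square)
 ultimately have "(- 1) ^ card (half p) * (\<Prod>a\<in>half p. od x a)\<^sup>2 = of_int p" by simp
 then have "(- 1) ^ card (half p) * ((- 1) ^ card (half p) * (\<Prod>a\<in>half p. od x a)\<^sup>2) = (- 1) ^ card (half p) * of_int p"
  by simp
 then show ?thesis by (simp flip: mult.assoc power_mult_distrib)
qed

text \<open>The sign \<open>\<delta>\<close> stays undetermined; being rational, it is invisible to
  automorphisms.\<close>

lemma sqrt_prod_od:
 obtains \<delta> :: complex where "\<delta> \<in> {1, -1}"
  "complex_of_real (sqrt (of_int p)) = \<delta> * (\<i> ^ card (half p) * (\<Prod>a\<in>half p. od x a))"
proof -
 let ?K = "\<i> ^ card (half p) * (\<Prod>a\<in>half p. od x a)"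
 have "?K\<^sup>2 = (\<i> ^ 2) ^ card (half p) * ((- 1) ^ card (half p) * of_int p)"
  unfolding power_mult_distrib prod_od_squared by (simp add: mult.commute flip: power_mult)
 also have "\<dots> = of_int p" by (simp flip: mult.assoc power_mult_distrib)
 also have "\<dots> = (complex_of_real (sqrt (of_int p)))\<^sup>2"
  using p_gt_2 by (simp flip: of_real_power)
 finally have "complex_of_real (sqrt (of_int p)) = ?K \<or> complex_of_real (sqrt (of_int p)) = - ?K"
  by (metis power2_eq_iff)
 then show thesis using that[of 1] that[of "-1"] by auto
qed

lemma sqrt_in_subfield:
 assumes "is_subfield K" "x \<in> K" "\<i> \<in> K" shows "complex_of_real (sqrt (of_int p)) \<in> K"
proof -
 obtain \<delta> where d: "\<delta> \<in> {1, -1 :: complex}"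
  "complex_of_real (sqrt (of_int p)) = \<delta> * (\<i> ^ card (half p) * (\<Prod>a\<in>half p. od x a))" by (rule sqrt_prod_od)
 have "\<delta> \<in> K" using d(1) subfieldD(2,5)[OF assms(1)] by auto
 then show ?thesis
  unfolding d(2) using assms by (intro subfieldD(4) subfield_power subfield_prod od_mem)
qed

text \<open>Gauss' lemma: the product over the half system contributes the sign changes of
  \<open>g\<close>, and the power of \<open>\<i>\<close> contributes the remaining exponent.\<close>

lemma gal_sqrt:
 assumes s: "s \<in> carrier G_Q" and sx: "s x = x powi g" and g: "\<not> p dvd g" and si: "s \<i> = (- 1) ^ e * \<i>"
 shows "s (of_real (sqrt (of_int p))) =
  (- 1) ^ (e * card (half p) + card (uppers p g)) * complex_of_real (sqrt (of_int p))"
proof -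
 obtain \<delta> where d: "\<delta> \<in> {1, -1 :: complex}"
  "complex_of_real (sqrt (of_int p)) = \<delta> * (\<i> ^ card (half p) * (\<Prod>a\<in>half p. od x a))" by (rule sqrt_prod_od)
 have iQ: "\<i> \<in> Qbar" by (simp add: Qbar_def)
 have od: "od x a \<in> Qbar" for a by (rule od_mem[OF Qbar in_Qbar])
 have "s \<delta> = \<delta>" using d(1) gal_1[OF Qbar s] gal_minus[OF Qbar s, of 1] subfieldD(2)[OF Qbar] by auto
 moreover have "s (\<i> ^ card (half p)) = (- 1) ^ (e * card (half p)) * \<i> ^ card (half p)"
  using gal_power[OF Qbar s iQ] by (simp add: si power_mult_distrib power_mult)
 moreover have "s (\<Prod>a\<in>half p. od x a) = (- 1) ^ card (uppers p g) * (\<Prod>a\<in>half p. od x a)"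
 proof -
  have "s (\<Prod>a\<in>half p. od x a) = (\<Prod>a\<in>half p. od x (g * a))"
   using gal_prod[OF Qbar s, of "half p" "od x"] od by (simp add: gal_od[OF s in_Qbar] sx od_powi)
  moreover have "(\<Prod>a\<in>uppers p g. od x (- (g * a))) = (- 1) ^ card (uppers p g) * (\<Prod>a\<in>uppers p g. od x (g * a))"
   by (simp add: od_minus prod_uminus)
  moreover have "(\<Prod>a\<in>uppers p g. od x (g * a)) \<noteq> 0"
   using half_not_dvd not_dvd_mult[OF g] by (auto simp: od_eq_0_iff uppers_def)
  ultimately have "s (\<Prod>a\<in>half p. od x a) * (- 1) ^ card (uppers p g) = (\<Prod>a\<in>half p. od x a)"
   using prod_half_scale[OF od_periodic g] by (simp add: mult_ac)
  moreover have "(- 1) ^ card (uppers p g) * (- 1) ^ card (uppers p g) = (1 :: complex)"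
   by (simp flip: power_mult_distrib)
  ultimately show ?thesis by (metis mult.commute mult.assoc mult_1_right)
 qed
 moreover have "s (\<delta> * (\<i> ^ card (half p) * (\<Prod>a\<in>half p. od x a))) =
  s \<delta> * (s (\<i> ^ card (half p)) * s (\<Prod>a\<in>half p. od x a))"
  using d(1) subfieldD(2,5)[OF Qbar]
  by (subst gal_times[OF s] ; (subst gal_times[OF s])?; (intro subfieldD(4)[OF Qbar] subfield_power[OF Qbar] subfield_prod[OF Qbar] od iQ)?) auto
 ultimately show ?thesis unfolding d(2) by (simp add: power_add mult_ac)
qed

lemma gal_root:
 assumes s: "s \<in> carrier G_Q" obtains g where "\<not> p dvd g" "s x = x powi g"
proof -
 define z where "z = s x"
 have z: "z ^ nat p = 1"
  using gal_power[OF Qbar s in_Qbar, of "nat p"] gal_1[OF Qbar s] by (simp add: power_nat_p z_def)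
 have z1: "z \<noteq> 1"
 proof
  assume "z = 1"
  then have "s (x - 1) = 0" using gal_diff[OF Qbar s in_Qbar, of 1] gal_1[OF Qbar s] subfieldD(2)[OF Qbar] by (simp add: z_def)
  then show False
   using gal_eq_0_iff[OF Qbar s, of "x - 1"] subfield_diff[OF Qbar in_Qbar subfieldD(2)[OF Qbar]] neq_1 by simp
 qed
 have z0: "z \<noteq> 0" using z p_gt_2 by (auto simp: power_0_left)
 have "\<not> p dvd 1" using p_gt_2 zdvd_imp_le[of p 1] by auto
 from powers_inj[OF this] have "(\<Prod>k<nat p. 1 - inverse z * x ^ k) = 1 - inverse z ^ nat p"
  using p_gt_2 by (intro prod_one_minus_powers power_nat_p) simp_all
 also have "\<dots> = 0" using z by (simp add: power_inverse)
 finally obtain k where "1 - inverse z * x ^ k = 0" by (auto simp: prod_zero_iff)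
 then have zk: "z = x ^ k" using z0 by (simp add: field_simps)
 then have "s x = x powi (int k)" by (simp add: z_def)
 moreover have "\<not> p dvd int k" using z1 zk powi_eq_1_iff[of "int k"] by simp
 ultimately show thesis using that by blast
qed

end

section \<open>Automorphisms with prescribed action on roots of unity\<close>

text \<open>By the Chinese remainder theorem \<open>a\<close>, \<open>b\<close> and \<open>c\<close>
  are powers of their product \<open>z\<close>, so one automorphism with a suitable exponent on
  \<open>z\<close> has the prescribed exponents on all three.\<close>

lemma galois_extend:
 assumes abc: "a ^ l = 1" "b ^ m = 1" "c ^ n = (1 :: complex)" and lmn: "l > 0" "m > 0" "n > 0"
  and cop: "coprime l m" "coprime l n" "coprime m n"
  and stu: "coprime s l" "coprime t m" "coprime u n"
 obtains g where "g \<in> carrier G_Q" "g a = a ^ s" "g b = b ^ t" "g c = c ^ u"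
proof -
 have clmn: "coprime (l * m) n" using cop by simp
 have crt: "\<exists>e::nat. [e = e1] (mod l) \<and> [e = e2] (mod m) \<and> [e = e3] (mod n)" for e1 e2 e3
 proof -
  obtain d where d: "[d = e1] (mod l)" "[d = e2] (mod m)" using binary_chinese_remainder_nat[OF cop(1)] by blast
  obtain e where e: "[e = d] (mod (l * m))" "[e = e3] (mod n)" using binary_chinese_remainder_nat[OF clmn] by blast
  have "[e = d] (mod l)" "[e = d] (mod m)" using e(1) cong_modulus_mult_nat[of e d l m] cong_modulus_mult_nat[of e d m l]
   by (simp_all add: mult.commute)
  then show ?thesis using d e(2) cong_trans by blast
 qed
 obtain T where T: "[T = s] (mod l)" "[T = t] (mod m)" "[T = u] (mod n)" using crt by blast
 have "coprime T (l * m * n)"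
  using stu T by (metis coprime_mult_right_iff cong_imp_coprime cong_sym)
 moreover define z where "z = a * b * c"
 moreover have zpow: "z ^ e = a ^ e1 * b ^ e2 * c ^ e3" if "[e = e1] (mod l)" "[e = e2] (mod m)" "[e = e3] (mod n)" for e e1 e2 e3
  using power_cong_nat[OF abc(1) that(1)] power_cong_nat[OF abc(2) that(2)] power_cong_nat[OF abc(3) that(3)]
  by (simp add: z_def power_mult_distrib)
 moreover have zN: "z ^ (l * m * n) = 1"
 proof -
  have "z ^ (l * m * n) = a ^ 0 * b ^ 0 * c ^ 0" by (intro zpow) (simp_all add: cong_iff_dvd_diff cong_0_iff)
  then show ?thesis by simp
 qed
 ultimately have "\<exists>g\<in>carrier G_Q. g z = z ^ T" using lmn by (intro cyclotomic_conjugate[OF zN]) simp_all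
 then obtain g where g: "g \<in> carrier G_Q" "g z = z ^ T" by blast
 have zQ: "z \<in> Qbar" using root_of_unity_Qab[OF zN] lmn by simp
 have act: "g (z ^ e) = z ^ (e * T)" for e
  using gal_power[OF Qbar g(1) zQ] g(2) by (simp add: mult.commute flip: power_mult)
 obtain e1 where e1: "[e1 = 1] (mod l)" "[e1 = 0] (mod m)" "[e1 = 0] (mod n)" using crt by blast
 obtain e2 where e2: "[e2 = 0] (mod l)" "[e2 = 1] (mod m)" "[e2 = 0] (mod n)" using crt by blast
 obtain e3 where e3: "[e3 = 0] (mod l)" "[e3 = 0] (mod m)" "[e3 = 1] (mod n)" using crt by blast
 show thesis
 proof (rule that[OF g(1)])
  have "z ^ (e1 * T) = a ^ (1 * s) * b ^ (0 * t) * c ^ (0 * u)" by (intro zpow cong_mult e1 T)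
  then show "g a = a ^ s" using act[of e1] zpow[OF e1] by simp
  have "z ^ (e2 * T) = a ^ (0 * s) * b ^ (1 * t) * c ^ (0 * u)" by (intro zpow cong_mult e2 T)
  then show "g b = b ^ t" using act[of e2] zpow[OF e2] by simp
  have "z ^ (e3 * T) = a ^ (0 * s) * b ^ (0 * t) * c ^ (1 * u)" by (intro zpow cong_mult e3 T)
  then show "g c = c ^ u" using act[of e3] zpow[OF e3] by simp
 qed
qed

lemma galois_extend_int:
 assumes abc: "a ^ nat l = 1" "b ^ nat m = 1" "c ^ nat n = (1 :: complex)" and lmn: "l > 0" "m > 0" "n > 0"
  and cop: "coprime l m" "coprime l n" "coprime m n"
  and stu: "coprime s l" "coprime t m" "coprime u n"
 obtains g where "g \<in> carrier G_Q" "g a = a powi s" "g b = b powi t" "g c = c powi u"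
proof -
 have red: "r powi e = r ^ nat (e mod k)" if r: "r ^ nat k = 1" "k > 0" for r :: complex and e k :: int
 proof -
  have "r powi k = 1" "r \<noteq> 0" using r by (auto simp: power_int_def power_0_left)
  moreover have "[e = e mod k] (mod k)" by (simp add: unique_euclidean_semiring_class.cong_def)
  ultimately have "r powi e = r powi (e mod k)" by (rule powi_cong)
  then show ?thesis using r(2) by (simp add: power_int_def)
 qed
 have cp: "coprime (nat (e mod k)) (nat k)" if "coprime e k" "k > 0" for e k :: int
 proof -
  have "coprime (int (nat (e mod k))) (int (nat k))" using that by (simp add: coprime_mod_left_iff)
  then show ?thesis by (simp only: coprime_int_iff)
 qed
 have cn: "coprime (nat e) (nat k)" if "coprime e k" "e > 0" "k > 0" for e k :: int
 proof -
  have "coprime (int (nat e)) (int (nat k))" using that by simp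
  then show ?thesis by (simp only: coprime_int_iff)
 qed
 obtain g where g: "g \<in> carrier G_Q" "g a = a ^ nat (s mod l)" "g b = b ^ nat (t mod m)" "g c = c ^ nat (u mod n)"
  by (rule galois_extend[OF abc, of "nat (s mod l)" "nat (t mod m)" "nat (u mod n)"])
   (use lmn cop stu cp cn in auto)
 show thesis
  using that[OF g(1)] unfolding red[OF abc(1) lmn(1)] red[OF abc(2) lmn(2)] red[OF abc(3) lmn(3)] using g by blast
qed

lemma gal_iterate:
 assumes s: "s \<in> carrier G_Q" and x: "x \<in> Qbar" "s x = x powi g" shows "(s [^]\<^bsub>G_Q\<^esub> (n::nat)) x = x powi (g ^ n)"
proof (induction n)
 case 0
 then show ?case using x by simp
next
 case (Suc n)
 have "(s [^]\<^bsub>G_Q\<^esub> Suc n) x = (s [^]\<^bsub>G_Q\<^esub> n) (s x)" using s x by simp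
 also have "\<dots> = ((s [^]\<^bsub>G_Q\<^esub> n) x) powi g" using s x by (simp add: gal_power_int[OF Qbar])
 finally show ?case using Suc by (simp add: mult.commute flip: power_int_mult)
qed

section \<open>The class attached to two odd primes\<close>

lemma bit_sign_of_nat: "bit_sign (of_nat n) = ((- 1) ^ n :: complex)"
proof (induction n)
 case (Suc n)
 have "bit_sign (of_nat (Suc n)) = (bit_sign 1 * bit_sign (of_nat n) :: complex)"
  unfolding of_nat_Suc bit_sign_add by (rule refl)
 then show ?case using Suc by simp
qed simp

text \<open>The analogue of \<open>od\<close> in two roots of unity, odd under a simultaneous change
  of sign of both exponents.\<close>

definition th :: "complex \<Rightarrow> complex \<Rightarrow> int \<Rightarrow> int \<Rightarrow> complex" where
 "th x y a b = x powi a * y powi b - x powi (- a) * y powi (- b)"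

lemma th_swap: "th y x b a = th x y a b"
 by (simp add: th_def mult.commute)

lemma th_minus: "th x y (- a) (- b) = - th x y a b"
 by (simp add: th_def)

lemma th_minus_right: "th x y a (- b) = - th x y (- a) b"
 using th_minus[of x y "- a" b] by simp

lemma th_powi_left: "th (x powi g) y a b = th x y (g * a) b"
 using power_int_mult[of x g a] power_int_mult[of x g "- a"] by (simp add: th_def)

lemma th_powi_right: "th x (y powi h) a b = th x y a (h * b)"
 by (metis th_powi_left th_swap)

lemma th_mem: "is_subfield K ==> x \<in> K ==> y \<in> K ==> th x y a b \<in> K"
 unfolding th_def by (intro subfield_diff subfieldD(4) subfield_power_int)

lemma gal_th: assumes "s \<in> carrier G_Q" "x \<in> Qbar" "y \<in> Qbar" shows "s (th x y a b) = th (s x) (s y) a b"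
 unfolding th_def using assms subfield_power_int[OF Qbar] subfieldD(4)[OF Qbar]
 by (simp add: gal_diff[OF Qbar] gal_power_int[OF Qbar] gal_times)

text \<open>The membership hypothesis is applied to the fixed field of \<open>s\<close>.\<close>

lemma gal_fixes:
 assumes s: "s \<in> carrier G_Q" and x: "x \<in> Qbar" "s x = x" and y: "y \<in> Qbar" "s y = y"
  and mem: "\<And>K. is_subfield K ==> x \<in> K ==> y \<in> K ==> z \<in> K"
 shows "s z = z"
 using mem[OF fixed_subfield[OF s]] x y by simp

context odd_prime
begin

lemma upper_prod_mem:
 assumes "is_subfield K" "\<And>a. F a \<in> K" shows "upper_prod F n m \<in> K"
 unfolding upper_prod_def using assms by (intro subfield_prod)

lemma upper_prod_cong_left:
 assumes F: "periodic p F" and n: "[n = n'] (mod p)" shows "upper_prod F n m = upper_prod F n' m"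
 unfolding upper_prod_def by (intro prod.cong refl periodicD[OF F] cong_mult n cong_refl)

lemma uppers_1: "uppers p 1 = {}"
 by (simp add: uppers_def half_not_upper)

end

context prime_root
begin

lemma upper_prod_nonzero: assumes "\<not> p dvd n" "\<not> p dvd m" shows "upper_prod (od x) n m \<noteq> 0"
 using assms half_not_dvd not_dvd_mult unfolding upper_prod_def uppers_def
 by (simp add: od_eq_0_iff prime_dvd_mult_iff[OF prime_p])

lemma gal_upper_prod:
 assumes s: "s \<in> carrier G_Q" and sx: "s x = x powi e"
 shows "s (upper_prod (od x) n m) = upper_prod (od x) (e * n) m"
 unfolding upper_prod_def
 using gal_prod[OF Qbar s, of "uppers p m" "\<lambda>a. od x (n * m * a)"] od_mem[OF Qbar in_Qbar]
 by (simp add: gal_od[OF s in_Qbar] sx od_powi mult.assoc)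

text \<open>The right side of \<open>upper_prod_power\<close> for \<open>od x\<close>: the
  multiplier \<open>g\<close> is the same in every factor.\<close>

definition tele :: "int \<Rightarrow> int \<Rightarrow> nat \<Rightarrow> complex" where
 "tele n g k = (\<Prod>j<k. upper_prod (od x) (n * g ^ j) g)"

lemma not_dvd_power: "\<not> p dvd g ==> \<not> p dvd g ^ k"
 using prime_dvd_power[OF prime_p] by blast

lemma tele_nonzero: "\<not> p dvd n ==> \<not> p dvd g ==> tele n g k \<noteq> 0"
 using upper_prod_nonzero not_dvd_power not_dvd_mult by (simp add: tele_def)

lemma tele_mem: "is_subfield K ==> x \<in> K ==> tele n g k \<in> K"
 unfolding tele_def by (intro subfield_prod upper_prod_mem od_mem)

text \<open>An automorphism with \<open>x\<close> going to \<open>x ^ g\<close> carries each factor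
  to the next, so only the first and the last remain in the quotient.\<close>

lemma gal_tele:
 assumes s: "s \<in> carrier G_Q" and sx: "s x = x powi g" and c: "[n * g ^ k = m] (mod p)"
 shows "s (tele n g k) * upper_prod (od x) n g = tele n g k * upper_prod (od x) m g"
proof -
 have "s (tele n g k) = (\<Prod>j<k. s (upper_prod (od x) (n * g ^ j) g))"
  unfolding tele_def by (intro gal_prod[OF Qbar s] upper_prod_mem[OF Qbar] od_mem[OF Qbar in_Qbar])
 also have "\<dots> = (\<Prod>j<k. upper_prod (od x) (n * g ^ Suc j) g)"
  by (simp add: gal_upper_prod[OF s sx] mult_ac)
 also have "\<dots> * upper_prod (od x) (n * g ^ 0) g = (\<Prod>j<Suc k. upper_prod (od x) (n * g ^ j) g)"
  by (subst prod.lessThan_Suc_shift) (simp add: mult.commute)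
 also have "\<dots> = tele n g k * upper_prod (od x) (n * g ^ k) g" by (simp add: tele_def)
 also have "upper_prod (od x) (n * g ^ k) g = upper_prod (od x) m g"
  by (rule upper_prod_cong_left[OF od_periodic c])
 finally show ?thesis by simp
qed

end

section \<open>Products in two roots of unity of distinct odd prime orders\<close>

locale two_prime_roots = P: prime_root p x + Q: prime_root q y for p x q y +
 assumes p_neq_q: "p \<noteq> q"
begin

lemma swap: "two_prime_roots q y p x"
 by unfold_locales (use p_neq_q in simp)

lemma p_not_dvd_q: "\<not> p dvd q"
 using primes_dvd_imp_eq[OF P.prime_p Q.prime_p] p_neq_q by blast

text \<open>Raising to the \<open>q\<close>-th power removes \<open>y\<close> and reduces to
  \<open>od x (a * q)\<close>.\<close>

lemma th_nonzero: assumes a: "\<not> p dvd a" shows "th x y a b \<noteq> 0"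
proof
 assume "th x y a b = 0"
 then have "(x powi a * y powi b) powi q = (x powi (- a) * y powi (- b)) powi q" by (simp add: th_def)
 moreover have "(x powi a * y powi b) powi q = x powi (a * q)" for a b
 proof -
  have "(y powi b) powi q = y powi (b * q)" by (rule power_int_mult[symmetric])
  also have "\<dots> = 1" using Q.powi_eq_1_iff by simp
  finally show ?thesis by (simp add: power_int_mult_distrib flip: power_int_mult)
 qed
 ultimately have "x powi (a * q) = x powi (- a * q)" by simp
 then have "od x (a * q) = 0" by (simp add: od_def)
 then show False using a p_not_dvd_q P.not_dvd_mult P.od_eq_0_iff by blast
qed

lemma th_periodic_left: "periodic p (\<lambda>a. th x y a b)"
 unfolding periodic_def
proof (intro allI impI)
 fix a a' assume "[a = a'] (mod p)"
 then have "x powi a = x powi a'" "x powi (- a) = x powi (- a')"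
  by (auto simp: P.powi_eq_iff cong_minus_minus_iff)
 then show "th x y a b = th x y a' b" by (simp add: th_def)
qed

lemma th_periodic_right: "periodic q (\<lambda>b. th x y a b)"
 using two_prime_roots.th_periodic_left[OF swap] by (simp add: th_swap)

definition row :: "int \<Rightarrow> complex" where
 "row a = (\<Prod>b\<in>half q. th x y a b)"

lemma row_periodic: "periodic p row"
 using periodicD[OF th_periodic_left] unfolding periodic_def row_def by (intro allI impI prod.cong) blast+

lemma row_nonzero: "\<not> p dvd a ==> row a \<noteq> 0"
 using th_nonzero by (simp add: row_def)

lemma row_mem: "is_subfield K ==> x \<in> K ==> y \<in> K ==> row a \<in> K"
 unfolding row_def by (intro subfield_prod th_mem)

text \<open>A distribution relation. Up to signs and powers of \<open>x\<close>, the product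
  \<open>row a * row (- a)\<close> consists of the factors
  \<open>1 - x ^ (- 2 a) * y ^ (2 b)\<close> for all nonzero \<open>b\<close> modulo
  \<open>q\<close>; \<open>od x a\<close> supplies the factor for \<open>b = 0\<close>, and the full
  product is \<open>1 - x ^ (- 2 a q)\<close>.\<close>

lemma row_reflection: "row a * row (- a) * od x a = (- 1) ^ card (half q) * od x (q * a)"
proof -
 define n where "n = card (half q)"
 define z where "z = x powi (- (2 * a))"
 have n: "2 * int n + 1 = q" using Q.half_card_double by (simp add: n_def)
 note nz = P.nonzero Q.nonzero
 have pair: "th x y a b * th x y (- a) b =
   - (x powi (2 * a)) * ((1 - z * y powi (2 * b)) * (1 - z * y powi (- (2 * b))))" for b
 proof -
  define X Y where "X = x powi a" and "Y = y powi b"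
  have XY: "X \<noteq> 0" "Y \<noteq> 0" using nz by (simp_all add: X_def Y_def)
  have e: "x powi (- a) = inverse X" "y powi (- b) = inverse Y" "x powi (2 * a) = X * X" "y powi (2 * b) = Y * Y"
   "z = inverse (X * X)" "y powi (- (2 * b)) = inverse (Y * Y)"
   using nz by (simp_all add: X_def Y_def z_def power_int_minus flip: power_int_add)
  show ?thesis using XY unfolding th_def e minus_minus X_def[symmetric] Y_def[symmetric] by (simp add: field_simps)
 qed
 have "row a * row (- a) = (\<Prod>b\<in>half q. - (x powi (2 * a)) * ((1 - z * y powi (2 * b)) * (1 - z * y powi (- (2 * b)))))"
  unfolding row_def prod.distrib[symmetric] pair by (rule refl)
 also have "\<dots> = (- (x powi (2 * a))) ^ n * (\<Prod>b\<in>half q. (1 - z * y powi (2 * b)) * (1 - z * y powi (- (2 * b))))"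
  unfolding prod.distrib[of "\<lambda>_. - (x powi (2 * a))"] by (simp add: n_def)
 finally have r: "row a * row (- a) = (- (x powi (2 * a))) ^ n * (\<Prod>b\<in>half q. (1 - z * y powi (2 * b)) * (1 - z * y powi (- (2 * b))))" .
 have o: "od x a = x powi a * (1 - z)"
  using nz by (simp add: od_def z_def right_diff_distrib flip: power_int_add)
 have "row a * row (- a) * od x a = (- (x powi (2 * a))) ^ n * x powi a * (1 - z ^ nat q)"
  unfolding r o Q.prod_one_minus[symmetric] by (simp only: mult_ac)
 also have "z ^ nat q = x powi (- (2 * a) * q)"
 proof -
  have "z ^ nat q = z powi q" using Q.p_gt_2 by (simp add: power_int_def)
  then show ?thesis by (simp only: z_def power_int_mult)
 qed
 also have "(- (x powi (2 * a))) ^ n = (- 1) ^ n * x powi (2 * a * int n)"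
  by (subst power_minus) (simp add: power_int_mult)
 also have "(- 1) ^ n * x powi (2 * a * int n) * x powi a * (1 - x powi (- (2 * a) * q)) =
  (- 1) ^ n * (x powi (2 * a * int n + a) - x powi (2 * a * int n + a + - (2 * a) * q))"
 proof -
  have "x powi (u + v) = x powi u * x powi v" for u v using nz by (simp add: power_int_add)
  then show ?thesis by (simp only: right_diff_distrib mult_1_right mult.assoc)
 qed
 also have "2 * a * int n + a = q * a" by (simp add: n[symmetric] algebra_simps)
 also have "q * a + - (2 * a) * q = - (q * a)" by simp
 finally show ?thesis by (simp add: n_def od_def)
qed

definition grid :: complex where
 "grid = (\<Prod>a\<in>half p. row a)"

lemma grid_nonzero: "grid \<noteq> 0"
 using row_nonzero P.half_not_dvd by (auto simp: grid_def)

lemma gal_row: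
 assumes s: "s \<in> carrier G_Q" shows "s (row a) = (\<Prod>b\<in>half q. th (s x) (s y) a b)"
 unfolding row_def using gal_prod[OF Qbar s, of "half q" "\<lambda>b. th x y a b"] th_mem[OF Qbar P.in_Qbar Q.in_Qbar]
 by (simp add: gal_th[OF s P.in_Qbar Q.in_Qbar])

end

lemma (in two_prime_roots) grid_swap: "two_prime_roots.grid q y p x = grid"
 unfolding grid_def two_prime_roots.grid_def[OF swap] row_def two_prime_roots.row_def[OF swap]
 by (subst prod.swap) (simp add: th_swap)

section \<open>The element V for two odd primes and the square roots of its Galois quotients\<close>

locale odd_pair = two_prime_roots +
 fixes g h :: int and k l :: nat
 assumes g: "\<not> p dvd g" "\<And>a. \<not> p dvd a ==> \<exists>k. [a = g ^ k] (mod p)"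
  and h: "\<not> q dvd h" "\<And>a. \<not> q dvd a ==> \<exists>k. [a = h ^ k] (mod q)"
  and gk: "[g ^ k = q] (mod p)" and hl: "[h ^ l = p] (mod q)"
begin

lemma swap_pair: "odd_pair q y p x h g l k"
 by unfold_locales (use p_neq_q g h gk hl in auto)

definition V :: complex where
 "V = grid * (P.tele 1 g k * Q.tele 1 h l)"

lemma p_not_dvd_1: "\<not> p dvd 1"
 using P.p_gt_2 zdvd_imp_le[of p 1] by auto

lemma q_not_dvd_1: "\<not> q dvd 1"
 using Q.p_gt_2 zdvd_imp_le[of q 1] by auto

lemma V_nonzero: "V \<noteq> 0"
 using grid_nonzero P.tele_nonzero[OF p_not_dvd_1 g(1)] Q.tele_nonzero[OF q_not_dvd_1 h(1)] by (simp add: V_def)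

lemma V_mem: "is_subfield K ==> x \<in> K ==> y \<in> K ==> V \<in> K"
 unfolding V_def grid_def by (intro subfieldD(4) subfield_prod row_mem P.tele_mem Q.tele_mem)

text \<open>The rows at the sign changes of \<open>g\<close>; the inverse of this product enters the
  square root of \<open>s V / V\<close>.\<close>

definition R :: complex where
 "R = (\<Prod>a\<in>uppers p g. row (- (g * a)))"

definition B :: complex where
 "B = P.upper_prod (od x) q g / (P.upper_prod (od x) 1 g * R)"

text \<open>The square root of \<open>s V / V\<close> when \<open>s\<close> raises \<open>x\<close>
  to the power \<open>g\<close> and fixes \<open>y\<close>. The power of \<open>\<i>\<close> squares
  to the sign left by the row reflections; \<open>B\<close> is the part that lies in the field
  generated by \<open>x\<close> and \<open>y\<close>.\<close>

definition A :: complex where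
 "A = \<i> ^ (card (half q) * card (uppers p g)) * B"

lemma ga_not_dvd: "a \<in> uppers p g ==> \<not> p dvd g * a"
 using P.half_not_dvd P.not_dvd_mult g(1) by (auto simp: uppers_def)

lemma R_nonzero: "R \<noteq> 0"
 using row_nonzero ga_not_dvd by (simp add: R_def)

lemma R_mem: "is_subfield K ==> x \<in> K ==> y \<in> K ==> R \<in> K"
 unfolding R_def by (intro subfield_prod row_mem)

lemma B_mem: "is_subfield K ==> x \<in> K ==> y \<in> K ==> B \<in> K"
 unfolding B_def by (intro subfield_divide subfieldD(4) P.upper_prod_mem od_mem R_mem)

text \<open>The grid contributes the quotients of \<open>row (g * a)\<close> by
  \<open>row (- (g * a))\<close> over the sign changes. Expanded by a further \<open>R\<close>,
  these become \<open>e * U q / (U 1 * R ^ 2)\<close> by \<open>row_reflection\<close>, and the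
  telescoping factor in \<open>x\<close> contributes the second \<open>U q / U 1\<close>.\<close>

lemma gal_V:
 assumes s: "s \<in> carrier G_Q" and sx: "s x = x powi g" and sy: "s y = y"
 shows "s V = A\<^sup>2 * V"
proof -
 define U where "U n = P.upper_prod (od x) n g" for n
 define e where "e = ((- 1) ^ (card (half q) * card (uppers p g)) :: complex)"
 have U0: "U 1 \<noteq> 0" using P.upper_prod_nonzero[OF p_not_dvd_1 g(1)] by (simp add: U_def)
 note mem = row_mem[OF Qbar P.in_Qbar Q.in_Qbar]
 have "s (row a) = row (g * a)" for a
  unfolding gal_row[OF s] sx sy th_powi_left by (simp add: row_def)
 then have "s grid = (\<Prod>a\<in>half p. row (g * a))"
  unfolding grid_def using gal_prod[OF Qbar s, of "half p" row] mem by simp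
 then have 1: "s grid * R = grid * (\<Prod>a\<in>uppers p g. row (g * a))"
  unfolding R_def grid_def by (simp add: P.prod_half_scale[OF row_periodic g(1)])
 have "(\<Prod>a\<in>uppers p g. row (g * a) * row (- (g * a)) * od x (g * a)) =
   (\<Prod>a\<in>uppers p g. (- 1) ^ card (half q) * od x (q * g * a))"
  by (simp only: row_reflection mult.assoc[of q])
 then have 2: "(\<Prod>a\<in>uppers p g. row (g * a)) * R * U 1 = e * U q"
  by (simp add: prod.distrib R_def U_def P.upper_prod_def e_def power_mult)
 have 3: "s (P.tele 1 g k) * U 1 = P.tele 1 g k * U q"
  unfolding U_def using gk by (intro P.gal_tele[OF s sx]) simp
 have 4: "s (Q.tele 1 h l) = Q.tele 1 h l"
  by (rule gal_fixes[OF s Q.in_Qbar sy Q.in_Qbar sy]) (rule Q.tele_mem)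
 have "s V = s grid * (s (P.tele 1 g k) * s (Q.tele 1 h l))"
 proof -
  have "grid \<in> Qbar" "P.tele 1 g k \<in> Qbar" "Q.tele 1 h l \<in> Qbar"
   unfolding grid_def by (intro subfield_prod[OF Qbar] mem P.tele_mem[OF Qbar P.in_Qbar] Q.tele_mem[OF Qbar Q.in_Qbar])+
  then show ?thesis unfolding V_def using subfieldD(4)[OF Qbar] by (simp add: gal_times[OF s])
 qed
 then have "s V * (R * R * U 1 * U 1) = (s grid * R) * (s (P.tele 1 g k) * U 1) * (R * U 1) * Q.tele 1 h l"
  by (simp add: 4 mult_ac)
 also have "\<dots> = grid * ((\<Prod>a\<in>uppers p g. row (g * a)) * R * U 1) * P.tele 1 g k * U q * Q.tele 1 h l"
  unfolding 1 3 by (simp only: mult_ac)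
 also have "\<dots> = e * U q * U q * V" unfolding 2 V_def by (simp only: mult_ac)
 finally have "s V = e * (U q * U q) / (R * R * U 1 * U 1) * V" using R_nonzero U0 by (simp add: field_simps)
 moreover have "A\<^sup>2 = e * (U q * U q) / (R * R * U 1 * U 1)"
 proof -
  have "(\<i> ^ n)\<^sup>2 = (- 1) ^ n" for n by (metis i_squared mult.commute power_mult power2_i)
  then show ?thesis by (simp add: A_def B_def e_def U_def power_mult_distrib power_divide) (simp add: power2_eq_square mult_ac)
 qed
 ultimately show ?thesis by simp
qed

text \<open>In \<open>A\<close> only \<open>R\<close> involves \<open>y\<close>, and
  \<open>t\<close> permutes the entries of each row up to signs. The quotient is a double product
  over the sign changes of both generators, and up to sign it is the same when \<open>x\<close> and
  \<open>y\<close> exchange roles.\<close>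

lemma gal_A:
 assumes t: "t \<in> carrier G_Q" and tx: "t x = x" and ty: "t y = y powi h" and ti: "t \<i> = \<i>"
 shows "t A * (\<Prod>a\<in>uppers p g. \<Prod>b\<in>uppers q h. th x y (- (g * a)) (h * b)) =
  A * (\<Prod>a\<in>uppers p g. \<Prod>b\<in>uppers q h. th x y (- (g * a)) (- (h * b)))"
proof -
 define M1 where "M1 = (\<Prod>a\<in>uppers p g. \<Prod>b\<in>uppers q h. th x y (- (g * a)) (- (h * b)))"
 define M2 where "M2 = (\<Prod>a\<in>uppers p g. \<Prod>b\<in>uppers q h. th x y (- (g * a)) (h * b))"
 have "t R = (\<Prod>a\<in>uppers p g. \<Prod>b\<in>half q. th x y (- (g * a)) (h * b))"
  using gal_prod[OF Qbar t, of "uppers p g" "\<lambda>a. row (- (g * a))"] row_mem[OF Qbar P.in_Qbar Q.in_Qbar]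
  by (simp add: R_def gal_row[OF t] tx ty th_powi_right)
 then have "t R * M1 = (\<Prod>a\<in>uppers p g. (\<Prod>b\<in>half q. th x y (- (g * a)) (h * b)) *
   (\<Prod>b\<in>uppers q h. th x y (- (g * a)) (- (h * b))))"
  by (simp add: M1_def prod.distrib)
 also have "\<dots> = R * M2"
  unfolding Q.prod_half_scale[OF th_periodic_right h(1)] by (simp add: prod.distrib M2_def R_def row_def)
 finally have RM: "t R * M1 = R * M2" .
 have RQ: "R \<in> Qbar" by (rule R_mem[OF Qbar P.in_Qbar Q.in_Qbar])
 have tR: "t R \<noteq> 0" using gal_eq_0_iff[OF Qbar t RQ] R_nonzero by simp
 define c where "c = \<i> ^ (card (half q) * card (uppers p g)) * P.upper_prod (od x) q g / P.upper_prod (od x) 1 g"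
 have A: "A = c / R" by (simp add: A_def B_def c_def)
 have iQ: "\<i> \<in> Qbar" by (simp add: Qbar_def)
 have cmem: "c \<in> K" if "is_subfield K" "x \<in> K" "\<i> \<in> K" for K
  unfolding c_def using that by (intro subfield_divide subfieldD(4) subfield_power P.upper_prod_mem od_mem)
 have "t c = c" by (rule gal_fixes[OF t P.in_Qbar tx iQ ti cmem])
 then have "t A = c / t R" unfolding A using gal_divide[OF Qbar t cmem[OF Qbar P.in_Qbar iQ] RQ] by simp
 then have "t A * M2 = c / t R * M2" by (rule arg_cong)
 also have "\<dots> = A * M1" using RM tR R_nonzero by (simp add: A field_simps)
 finally show ?thesis by (simp only: M1_def M2_def)
qed

theorem D_map_V: "D_map (mod_squares V) = wedge H1ab (e_char (nat p)) (e_char (nat q))"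
proof -
 \<comment> \<open>The mirror image with \<open>x\<close> and \<open>y\<close> exchanged. It has the
   same \<open>V\<close>, and \<open>S.A\<close> is the square root that belongs to the generator
   acting on \<open>y\<close>.\<close>
 interpret S: odd_pair q y p x h g l k by (rule swap_pair)
 have VS: "S.V = V" by (simp add: V_def S.V_def grid_swap mult_ac)
 define m n where "m = card (uppers p g)" and "n = card (uppers q h)"
 have pos: "p > 0" "q > 0" using P.p_gt_2 Q.p_gt_2 by auto
 have i4: "\<i> ^ nat 4 = 1" using power4_eq_xxxx[of \<i>] by simp
 have iQ: "\<i> \<in> Qbar" by (simp add: Qbar_def)
 have cop: "coprime p q" "coprime p 4" "coprime q 4"
 proof -
  show "coprime p q" using prime_imp_coprime[OF P.prime_p p_not_dvd_q] .
  have "coprime r (2 ^ 2)" if "odd r" for r :: int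
   using that unfolding coprime_power_right_iff by simp
  from this[OF P.odd_p] this[OF Q.odd_p] show "coprime p 4" "coprime q 4" by simp_all
 qed
 have cg: "coprime g p" "coprime h q"
  using prime_imp_coprime[OF P.prime_p g(1)] prime_imp_coprime[OF Q.prime_p h(1)] by (simp_all add: coprime_commute)
 note ext = galois_extend_int[OF P.power_nat_p Q.power_nat_p i4 pos _ cop]
 \<comment> \<open>The three generators are a primitive root on \<open>x\<close>, one on
   \<open>y\<close>, and the negation of \<open>\<i>\<close>. Their products realise every action on
   \<open>x\<close>, \<open>y\<close> and \<open>\<i>\<close>.\<close>
 obtain s where s: "s \<in> carrier G_Q" "s x = x powi g" "s y = y powi 1" "s \<i> = \<i> powi 1"
  by (rule ext[of g 1 1]) (use cg in auto)
 obtain t where t: "t \<in> carrier G_Q" "t x = x powi 1" "t y = y powi h" "t \<i> = \<i> powi 1"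
  by (rule ext[of 1 h 1]) (use cg in auto)
 obtain c where c: "c \<in> carrier G_Q" "c x = x powi 1" "c y = y powi 1" "c \<i> = \<i> powi (- 1)"
  by (rule ext[of 1 1 "- 1"]) auto
 have ci: "c \<i> = - \<i>" using c(4) by (simp add: power_int_minus)
 have sqrt: "complex_of_real (sqrt (real (nat p))) = of_real (sqrt (of_int p))"
  "complex_of_real (sqrt (real (nat q))) = of_real (sqrt (of_int q))" using pos by simp_all
 have fixes_: "u z = z" if "u \<in> carrier G_Q" "u x = x" "u y = y" "\<And>K. is_subfield K ==> x \<in> K ==> y \<in> K ==> z \<in> K" for u z
  by (rule gal_fixes[OF that(1) P.in_Qbar that(2) Q.in_Qbar that(3,4)])
 show ?thesis
 proof (rule D_map_of_three_generators[where X = "{x, y, \<i>}" and ?A1.0 = A and ?A2.0 = S.A and ?A3.0 = 1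
    and ?s1.0 = s and ?s2.0 = t and ?s3.0 = c
    and ?P1.0 = "of_nat m" and ?P2.0 = 0 and ?P3.0 = "of_nat (card (half p))"
    and ?Q1.0 = 0 and ?Q2.0 = "of_nat n" and ?Q3.0 = "of_nat (card (half q))"])
  show "V \<noteq> 0" by (rule V_nonzero)
  show "nat p > 0" "nat q > 0" using pos by simp_all
  have "\<i> \<in> Qab" using i4 by (intro root_of_unity_Qab[of _ "nat 4"]) simp_all
  then show "{x, y, \<i>} \<subseteq> Qab" using P.in_Qab Q.in_Qab by simp
  show "V \<in> K \<and> complex_of_real (sqrt (real (nat p))) \<in> K \<and> complex_of_real (sqrt (real (nat q))) \<in> K \<and>
    A \<in> K \<and> S.A \<in> K \<and> 1 \<in> K" if K: "is_subfield K" "{x, y, \<i>} \<subseteq> K" for K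
  proof -
   have m: "x \<in> K" "y \<in> K" "\<i> \<in> K" using K(2) by auto
   have "A \<in> K" "S.A \<in> K" unfolding A_def S.A_def
    by (intro subfieldD(4)[OF K(1)] subfield_power[OF K(1)] B_mem[OF K(1)] S.B_mem[OF K(1)] m)+
   then show ?thesis unfolding sqrt
    using V_mem P.sqrt_in_subfield Q.sqrt_in_subfield subfieldD(2) m K(1) by blast
  qed
  show "s \<in> carrier G_Q" "t \<in> carrier G_Q" "c \<in> carrier G_Q" by (fact s t c)+
  show "s V = A\<^sup>2 * V" using gal_V s by simp
  show "t V = S.A\<^sup>2 * V" using S.gal_V t by (simp add: VS)
  have "c V = V" by (rule fixes_[OF c(1)]) (use c V_mem in auto)
  then show "c V = 1\<^sup>2 * V" by simp
  show "s (of_real (sqrt (real (nat p)))) = bit_sign (of_nat m) * of_real (sqrt (real (nat p)))"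
   unfolding sqrt bit_sign_of_nat using P.gal_sqrt[OF s(1,2) g(1), of 0] s(4) by (simp add: m_def)
  show "t (of_real (sqrt (real (nat p)))) = bit_sign 0 * of_real (sqrt (real (nat p)))"
   unfolding sqrt using P.gal_sqrt[OF t(1,2) p_not_dvd_1, of 0] t(4) by (simp add: P.uppers_1)
  show "c (of_real (sqrt (real (nat p)))) = bit_sign (of_nat (card (half p))) * of_real (sqrt (real (nat p)))"
   unfolding sqrt bit_sign_of_nat using P.gal_sqrt[OF c(1,2) p_not_dvd_1, of 1] ci by (simp add: P.uppers_1)
  show "s (of_real (sqrt (real (nat q)))) = bit_sign 0 * of_real (sqrt (real (nat q)))"
   unfolding sqrt using Q.gal_sqrt[OF s(1,3) q_not_dvd_1, of 0] s(4) by (simp add: Q.uppers_1)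
  show "t (of_real (sqrt (real (nat q)))) = bit_sign (of_nat n) * of_real (sqrt (real (nat q)))"
   unfolding sqrt bit_sign_of_nat using Q.gal_sqrt[OF t(1,3) h(1), of 0] t(4) by (simp add: n_def)
  show "c (of_real (sqrt (real (nat q)))) = bit_sign (of_nat (card (half q))) * of_real (sqrt (real (nat q)))"
   unfolding sqrt bit_sign_of_nat using Q.gal_sqrt[OF c(1,3) q_not_dvd_1, of 1] ci by (simp add: Q.uppers_1)
  \<comment> \<open>\<open>t A / A\<close> is \<open>M1 / M2\<close>, and \<open>s S.A / S.A\<close>
    is the same up to the sign that arises from moving the minus sign to the other exponent in each
    of the \<open>m * n\<close> factors. This is the sign demanded by the characters, as
    \<open>s\<close> negates the root of \<open>p\<close> with exponent \<open>m\<close> and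
    \<open>t\<close> that of \<open>q\<close> with exponent \<open>n\<close>.\<close>
  show "t A * S.A = bit_sign (of_nat m * of_nat n + 0 * 0) * (s S.A * A)"
  proof -
   define M1 where "M1 = (\<Prod>a\<in>uppers p g. \<Prod>b\<in>uppers q h. th x y (- (g * a)) (- (h * b)))"
   define M2 where "M2 = (\<Prod>a\<in>uppers p g. \<Prod>b\<in>uppers q h. th x y (- (g * a)) (h * b))"
   have 1: "t A * M2 = A * M1" using gal_A t by (simp add: M1_def M2_def)
   have "s S.A * (\<Prod>b\<in>uppers q h. \<Prod>a\<in>uppers p g. th y x (- (h * b)) (g * a)) =
    S.A * (\<Prod>b\<in>uppers q h. \<Prod>a\<in>uppers p g. th y x (- (h * b)) (- (g * a)))"
    using S.gal_A s by simp
   moreover have "(\<Prod>b\<in>uppers q h. \<Prod>a\<in>uppers p g. th y x (- (h * b)) (- (g * a))) = M1"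
    unfolding M1_def th_swap[of y x] by (rule prod.swap)
   moreover have "(\<Prod>b\<in>uppers q h. \<Prod>a\<in>uppers p g. th y x (- (h * b)) (g * a)) = (- 1) ^ (m * n) * M2"
   proof -
    have "(\<Prod>b\<in>uppers q h. \<Prod>a\<in>uppers p g. th y x (- (h * b)) (g * a)) =
      (\<Prod>a\<in>uppers p g. \<Prod>b\<in>uppers q h. th x y (g * a) (- (h * b)))"
     unfolding th_swap[of y x] by (rule prod.swap)
    also have "\<dots> = (\<Prod>a\<in>uppers p g. \<Prod>b\<in>uppers q h. - th x y (- (g * a)) (h * b))"
     by (simp only: th_minus_right)
    also have "\<dots> = (- 1) ^ (m * n) * M2"
     by (simp add: prod_uminus prod.distrib M2_def m_def n_def mult.commute[of "card (uppers p g)"] power_mult)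
    finally show ?thesis .
   qed
   ultimately have 2: "s S.A * ((- 1) ^ (m * n) * M2) = S.A * M1" by simp
   have M2: "M2 \<noteq> 0" using th_nonzero ga_not_dvd by (simp add: M2_def)
   have "(t A * S.A) * M2 = (t A * M2) * S.A" by (simp only: mult_ac)
   also have "\<dots> = (S.A * M1) * A" unfolding 1 by (simp only: mult_ac)
   also have "\<dots> = ((- 1) ^ (m * n) * (s S.A * A)) * M2" unfolding 2[symmetric] by (simp only: mult_ac)
   finally have "t A * S.A = (- 1) ^ (m * n) * (s S.A * A)" using M2 by simp
   moreover have "of_nat m * of_nat n + 0 * 0 = (of_nat (m * n) :: bit)"
    unfolding of_nat_mult mult_zero_left add_0_right by (rule refl)
   ultimately show ?thesis by (simp only: bit_sign_of_nat)
  qed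
  have one: "u 1 = 1" if "u \<in> carrier G_Q" for u using gal_1[OF Qbar that] .
  have ip: "c (\<i> ^ r) = (- 1) ^ r * \<i> ^ r" for r
   using gal_power[OF Qbar c(1) iQ] by (simp add: ci power_minus[of \<i>])
  have cA: "c (\<i> ^ r * D) = (- 1) ^ r * (\<i> ^ r * D)" if "\<And>K. is_subfield K ==> x \<in> K ==> y \<in> K ==> D \<in> K" for r D
  proof -
   have "c D = D" by (rule fixes_[OF c(1) _ _ that]) (use c in auto)
   moreover have "D \<in> Qbar" using that[OF Qbar P.in_Qbar Q.in_Qbar] .
   ultimately show ?thesis using gal_times[OF c(1), of "\<i> ^ r" D] subfield_power[OF Qbar iQ] by (simp add: ip)
  qed
  \<comment> \<open>\<open>c\<close> fixes \<open>V\<close> and acts on \<open>A\<close> only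
    through the power of \<open>\<i>\<close>. The exponent of that power is the exponent of
    \<open>s\<close> at the root of \<open>p\<close> times that of \<open>c\<close> at the root of
    \<open>q\<close>.\<close>
  show "c A * 1 = bit_sign (of_nat m * of_nat (card (half q)) + of_nat (card (half p)) * 0) * (s 1 * A)"
  proof -
   have "of_nat m * of_nat (card (half q)) + of_nat (card (half p)) * 0 = (of_nat (card (half q) * m) :: bit)"
    unfolding of_nat_mult mult_zero_right add_0_right by (rule mult.commute)
   then show ?thesis using cA[OF B_mem] one[OF s(1)] by (simp only: bit_sign_of_nat A_def m_def mult_1_right mult_1_left)
  qed
  show "c S.A * 1 = bit_sign (0 * of_nat (card (half q)) + of_nat (card (half p)) * of_nat n) * (t 1 * S.A)"
  proof -
   have "0 * of_nat (card (half q)) + of_nat (card (half p)) * of_nat n = (of_nat (card (half p) * n) :: bit)"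
    unfolding of_nat_mult mult_zero_left add_0_left by (rule refl)
   then show ?thesis using cA[OF S.B_mem] one[OF t(1)] by (simp only: bit_sign_of_nat S.A_def n_def mult_1_right mult_1_left)
  qed
  fix u assume u: "u \<in> carrier G_Q"
  obtain a' where a': "\<not> p dvd a'" "u x = x powi a'" by (rule P.gal_root[OF u])
  obtain b' where b': "\<not> q dvd b'" "u y = y powi b'" by (rule Q.gal_root[OF u])
  obtain a where a: "[a' = g ^ a] (mod p)" using g(2)[OF a'(1)] by blast
  obtain b where b: "[b' = h ^ b] (mod q)" using h(2)[OF b'(1)] by blast
  have "(u \<i>)\<^sup>2 = \<i>\<^sup>2"
   using gal_power[OF Qbar u iQ, of 2] gal_minus[OF Qbar u subfieldD(2)[OF Qbar]] one[OF u] by simp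
  then have "u \<i> = \<i> \<or> u \<i> = - \<i>" unfolding power2_eq_iff .
  then obtain r :: nat where r: "u \<i> = \<i> powi ((- 1) ^ r)"
  proof (elim disjE)
   assume "u \<i> = \<i>" then show thesis using that[of 0] by simp
  next
   assume "u \<i> = - \<i>" then show thesis using that[of 1] by (simp add: power_int_minus)
  qed
  have "\<forall>z\<in>{x, y, \<i>}. u z = (s [^]\<^bsub>G_Q\<^esub> a \<cdot> (t [^]\<^bsub>G_Q\<^esub> b \<cdot> c [^]\<^bsub>G_Q\<^esub> r)) z"
  proof -
   note it = gal_iterate[OF s(1) P.in_Qbar s(2)] gal_iterate[OF s(1) Q.in_Qbar s(3)] gal_iterate[OF s(1) iQ s(4)]
    gal_iterate[OF t(1) P.in_Qbar t(2)] gal_iterate[OF t(1) Q.in_Qbar t(3)] gal_iterate[OF t(1) iQ t(4)]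
    gal_iterate[OF c(1) P.in_Qbar c(2)] gal_iterate[OF c(1) Q.in_Qbar c(3)] gal_iterate[OF c(1) iQ c(4)]
   note it' = it[unfolded power_one power_int_1_right]
   have pw: "x powi a' = x powi (g ^ a)" "y powi b' = y powi (h ^ b)"
    using a b by (simp_all add: P.powi_eq_iff Q.powi_eq_iff)
   have mem: "w powi e \<in> Qbar" if "w \<in> Qbar" for w e using subfield_power_int[OF Qbar that] .
   have "t [^]\<^bsub>G_Q\<^esub> b \<in> carrier G_Q" "s [^]\<^bsub>G_Q\<^esub> a \<in> carrier G_Q" "c [^]\<^bsub>G_Q\<^esub> r \<in> carrier G_Q" using s t c by simp_all
   note G = this
   have "(t [^]\<^bsub>G_Q\<^esub> b) (\<i> powi e) = \<i> powi e" "(s [^]\<^bsub>G_Q\<^esub> a) (\<i> powi e) = \<i> powi e"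
    "(s [^]\<^bsub>G_Q\<^esub> a) (y powi e) = y powi e" for e
    using gal_power_int[OF Qbar G(1) iQ] gal_power_int[OF Qbar G(2) iQ] gal_power_int[OF Qbar G(2) Q.in_Qbar] by (simp_all add: it')
   then show ?thesis
    using G P.in_Qbar Q.in_Qbar iQ mem by (simp add: it' pw a'(2) b'(2) r)
  qed
  then show "\<exists>(a::nat) (b::nat) (c'::nat). \<forall>z\<in>{x, y, \<i>}.
    u z = (s [^]\<^bsub>G_Q\<^esub> a \<cdot> (t [^]\<^bsub>G_Q\<^esub> b \<cdot> c [^]\<^bsub>G_Q\<^esub> c')) z" by blast
 qed
qed

end

section \<open>Reduction of the sine products for odd primes\<close>

definition uu :: "rat \<Rightarrow> complex" where
 "uu a = 1 - ee a"

lemma uu_mem: assumes "a \<notin> \<int>" shows "uu a \<in> Qab" "uu a \<noteq> 0"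
 using sq_eqD[OF sin1_sq_eq[OF assms]] by (simp_all add: uu_def)

lemma sin1_uu: "a \<notin> \<int> ==> sq_eq (sin1 a) (uu a)"
 unfolding uu_def by (rule sin1_sq_eq)

lemma uu_minus: assumes "a \<notin> \<int>" shows "sq_eq (uu (- a)) (uu a)"
 unfolding uu_def ee_minus using assms root_of_unity_ee ee_eq_1_iff by (intro sq_eq_one_minus_inverse) auto

lemma uu_add_int: "uu (a + of_int n) = uu a"
 by (simp add: uu_def ee_add)

lemma uu_prod: assumes "n > 0" shows "(\<Prod>k<n. uu (a + of_nat k / of_nat n)) = uu (of_nat n * a)"
 using prod_one_minus_ee[OF assms, of "ee a"] by (simp add: uu_def ee_add ee_power)

lemma of_int_div_Ints: assumes "n > 0" shows "(of_int m / of_int n :: rat) \<in> \<int> \<longleftrightarrow> n dvd m"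
proof
 assume "(of_int m / of_int n :: rat) \<in> \<int>"
 then obtain d where "of_int m / of_int n = (of_int d :: rat)" by (auto elim: Ints_cases)
 then have "(of_int m :: rat) = of_int (d * n)" using assms by (simp add: field_simps)
 then show "n dvd m" by (simp only: of_int_eq_iff) simp
next
 assume "n dvd m"
 then show "(of_int m / of_int n :: rat) \<in> \<int>" using assms by (auto elim!: dvdE)
qed

lemma prod_half_nat: "(\<Prod>i = 1..(p - 1) div 2. F (int i)) = prod F (half (int p))" if "odd p"
 by (rule prod.reindex_bij_witness[of _ nat int]) (use that in \<open>auto simp: half_iff elim!: oddE\<close>)

text \<open>By the distribution relation the product of \<open>uu (a + k / q)\<close> over all
  \<open>k < q\<close> is \<open>uu (i / p)\<close>. Modulo squares, division by the lower half
  \<open>L\<close> is multiplication by it, which squares \<open>L\<close> and leaves the upper half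
  \<open>M\<close>; the reflection \<open>k -> q - k\<close> brings \<open>M\<close> to the stated
  form. The number \<open>p\<close> may be composite, and 4 will occur in its place.\<close>

lemma sine_quotient:
 fixes p q i :: nat
 assumes p: "p > 0" and q: "odd q" and i: "\<not> p dvd i"
 shows "sq_eq (sin1 (of_nat i / of_nat p) / (\<Prod>k = 0..(q - 1) div 2. sin1 (of_nat i / of_nat (p * q) + of_nat k / of_nat q)))
  (\<Prod>k\<in>half (int q). uu (of_int (k * int p - int i) / of_int (int p * int q)))"
proof -
 have q0: "q > 0" using q by (auto elim: oddE)
 define a :: rat where "a = of_nat i / of_nat (p * q)"
 have ak: "a + of_nat k / of_nat q \<notin> \<int>" for k
 proof -
  have "a + of_nat k / of_nat q = of_int (int (i + k * p)) / of_int (int (p * q))"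
   using p q0 by (simp add: a_def field_simps)
  moreover have "\<not> int (p * q) dvd int (i + k * p)"
  proof
   assume "int (p * q) dvd int (i + k * p)"
   then have "p dvd i + k * p" unfolding int_dvd_int_iff by (rule dvd_mult_left)
   then show False using i by (simp add: dvd_add_left_iff)
  qed
  ultimately show ?thesis using of_int_div_Ints[of "int (p * q)" "int (i + k * p)"] p q0 by simp
 qed
 have qa: "of_nat q * a = of_nat i / of_nat p" using q0 by (simp add: a_def)
 have ip: "(of_nat i / of_nat p :: rat) \<notin> \<int>"
  using of_int_div_Ints[of "int p" "int i"] p i by (simp add: int_dvd_int_iff)
 define L where "L = (\<Prod>k = 0..(q - 1) div 2. uu (a + of_nat k / of_nat q))"
 define M where "M = (\<Prod>k = (q + 1) div 2..<q. uu (a + of_nat k / of_nat q))"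
 have LM: "uu (of_nat i / of_nat p) = L * M"
 proof -
  have "{..<q} = {0..(q - 1) div 2} \<union> {(q + 1) div 2..<q}" using q by (auto elim!: oddE)
  moreover have "{0..(q - 1) div 2} \<inter> {(q + 1) div 2..<q} = {}" using q by (auto elim!: oddE)
  ultimately show ?thesis
   using uu_prod[OF q0, of a] unfolding qa L_def M_def by (simp add: prod.union_disjoint)
 qed
 have L: "L \<in> Qab" "L \<noteq> 0" unfolding L_def using uu_mem[OF ak] by (auto intro: subfield_prod[OF Qab])
 have M: "sq_eq M M" unfolding M_def using uu_mem[OF ak] by (intro sq_eq_prod sq_eq_refl)
 have "sq_eq (sin1 (of_nat i / of_nat p) / (\<Prod>k = 0..(q - 1) div 2. sin1 (a + of_nat k / of_nat q)))
  (uu (of_nat i / of_nat p) * L)"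
  unfolding L_def by (intro sq_eq_divide sq_eq_prod sin1_uu ak ip)
 also have "\<dots> = L * (L * M)" unfolding LM by (simp only: mult_ac)
 also have "sq_eq (L * (L * M)) M" by (rule sq_eq_cancel_left[OF L M])
 also have "sq_eq M (\<Prod>k = (q + 1) div 2..<q. uu (of_int ((int q - int k) * int p - int i) / of_int (int p * int q)))"
  unfolding M_def
 proof (rule sq_eq_prod)
  fix k
  have "of_int ((int q - int k) * int p - int i) / of_int (int p * int q) = - (a + of_nat k / of_nat q) + of_int 1"
   using p q0 by (simp add: a_def field_simps)
  then have "uu (of_int ((int q - int k) * int p - int i) / of_int (int p * int q)) = uu (- (a + of_nat k / of_nat q))"
   by (simp only: uu_add_int)
  then show "sq_eq (uu (a + of_nat k / of_nat q)) (uu (of_int ((int q - int k) * int p - int i) / of_int (int p * int q)))"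
   using sq_eq_sym[OF uu_minus[OF ak]] by simp
 qed
 also have "(\<Prod>k = (q + 1) div 2..<q. uu (of_int ((int q - int k) * int p - int i) / of_int (int p * int q))) =
   (\<Prod>k\<in>half (int q). uu (of_int (k * int p - int i) / of_int (int p * int q)))"
  by (rule prod.reindex_bij_witness[of _ "\<lambda>k. q - nat k" "\<lambda>k. int q - int k"])
   (use q in \<open>auto simp: half_iff of_nat_diff elim!: oddE\<close>)
 finally show ?thesis by (simp add: a_def)
qed

text \<open>Division with remainder: \<open>n = k * p - i\<close> has remainder \<open>p - i\<close>
  in the upper half and quotient \<open>k - 1\<close>, and the range of \<open>k\<close> corresponds
  to \<open>2 * n < p * q\<close>.\<close>

lemma (in odd_prime) prod_upper_grid:
 fixes F :: "int \<Rightarrow> 'a :: comm_monoid_mult" and q :: int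
 assumes q: "odd q" "q > 0"
 shows "(\<Prod>i\<in>half p. \<Prod>k\<in>half q. F (k * p - i)) = (\<Prod>n\<in>half (p * q). if upper p n then F n else 1)"
proof -
 have "(\<Prod>i\<in>half p. \<Prod>k\<in>half q. F (k * p - i)) = (\<Prod>(i, k)\<in>half p \<times> half q. F (k * p - i))"
  by (rule prod.cartesian_product)
 also have "\<dots> = (\<Prod>n\<in>{n \<in> half (p * q). upper p n}. F n)"
 proof (rule prod.reindex_bij_witness[of _ "\<lambda>n. (p - n mod p, n div p + 1)" "\<lambda>(i, k). k * p - i"])
  fix z assume z: "z \<in> half p \<times> half q"
  obtain i k where ik: "z = (i, k)" by (cases z)
  have i: "0 < i" "2 * i < p" and k: "0 < k" "2 * k < q" using z by (auto simp: ik half_iff)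
  have e: "k * p - i = (p - i) + (k - 1) * p" by (simp add: algebra_simps)
  have m: "(k * p - i) mod p = p - i" "(k * p - i) div p = k - 1"
  proof -
   show "(k * p - i) mod p = p - i" unfolding e mod_mult_self1 using i by (intro mod_pos_pos_trivial) auto
   show "(k * p - i) div p = k - 1" unfolding e using i by (subst div_mult_self1) (auto simp: div_pos_pos_trivial)
  qed
  show "(\<lambda>n. (p - n mod p, n div p + 1)) (case z of (i, k) \<Rightarrow> k * p - i) = z" by (simp add: ik m)
  have "p \<le> k * p" using k p_gt_2 by (simp add: mult_le_cancel_right1)
  moreover have "2 * (k * p) \<le> p * (q - 1)"
  proof -
   have "2 * k \<le> q - 1" using k by simp
   then have "2 * k * p \<le> (q - 1) * p" using p_gt_2 by (intro mult_right_mono) simp_all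
   then show ?thesis by (simp add: mult_ac)
  qed
  moreover have "i < k * p" using \<open>p \<le> k * p\<close> i by linarith
  ultimately show "(case z of (i, k) \<Rightarrow> k * p - i) \<in> {n \<in> half (p * q). upper p n}"
   using i by (simp add: ik half_iff upper_def m algebra_simps)
  show "F (case z of (i, k) \<Rightarrow> k * p - i) = (case z of (i, k) \<Rightarrow> F (k * p - i))" by (simp add: ik)
 next
  fix n assume n: "n \<in> {n \<in> half (p * q). upper p n}"
  have e: "n = n div p * p + n mod p" by simp
  show "(case (p - n mod p, n div p + 1) of (i, k) \<Rightarrow> k * p - i) = n" using e by (simp add: algebra_simps)
  have r: "p < 2 * (n mod p)" "n mod p < p" "0 < n" "2 * n < p * q" using n p_gt_2 by (simp_all add: upper_def half_iff)
  have "0 \<le> n div p" using r p_gt_2 by (simp add: pos_imp_zdiv_nonneg_iff)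
  moreover have "2 * (n div p + 1) < q"
  proof -
   have "2 * (n div p * p) + 2 * (n mod p) = 2 * n" using e by (metis distrib_left)
   then have "2 * (n div p * p) + p < p * q" using r by linarith
   then have "p * (2 * (n div p) + 1) < p * q" by (simp add: algebra_simps)
   then have "2 * (n div p) + 1 < q" using p_gt_2 by (simp add: mult_less_cancel_left_pos)
   \<comment> \<open>Oddness of \<open>q\<close> improves \<open>2 * (n div p) + 1 < q\<close> to
     \<open>2 * (n div p + 1) < q\<close>.\<close>
   moreover obtain b where b: "q = 2 * b + 1" using q(1) by (elim oddE)
   ultimately have "n div p < b" by linarith
   then have "n div p + 1 \<le> b" by (rule zless_imp_add1_zle)
   then have "2 * (n div p + 1) \<le> 2 * b" by (rule mult_left_mono) simp
   then show ?thesis using b by (simp only: less_add_one order_le_less_trans)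
  qed
  ultimately show "(p - n mod p, n div p + 1) \<in> half p \<times> half q" using r by (simp add: half_iff)
 qed
 also have "\<dots> = (\<Prod>n\<in>half (p * q). if upper p n then F n else 1)" by (rule prod.inter_filter) simp
 finally show ?thesis .
qed

lemma (in odd_prime) prod_multiples:
 fixes F :: "int \<Rightarrow> 'a :: comm_monoid_mult" and q :: int
 assumes q: "q > 0"
 shows "(\<Prod>n\<in>half (p * q). if upper p n \<and> q dvd n then F n else 1) = (\<Prod>m\<in>uppers p q. F (q * m))"
proof -
 have "(\<Prod>n\<in>half (p * q). if upper p n \<and> q dvd n then F n else 1) = (\<Prod>n\<in>{n \<in> half (p * q). upper p n \<and> q dvd n}. F n)"
  by (rule prod.inter_filter[symmetric]) simp
 also have "\<dots> = (\<Prod>m\<in>uppers p q. F (q * m))"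
 proof (rule prod.reindex_bij_witness[of _ "\<lambda>m. q * m" "\<lambda>n. n div q"])
  fix m assume "m \<in> uppers p q"
  then show "q * m \<in> {n \<in> half (p * q). upper p n \<and> q dvd n}"
   using q by (simp add: uppers_def half_iff mult.commute[of p])
 next
  fix n assume n: "n \<in> {n \<in> half (p * q). upper p n \<and> q dvd n}"
  then have "q * (n div q) = n" by simp
  moreover have "0 < n div q" "2 * (n div q) < p"
  proof -
   have "2 * (q * (n div q)) < p * q" unfolding \<open>q * (n div q) = n\<close> using n by (simp add: half_iff)
   then have "q * (2 * (n div q)) < q * p" by (simp only: mult_ac)
   moreover have "0 < q * (n div q)" unfolding \<open>q * (n div q) = n\<close> using n by (simp add: half_iff)
   ultimately
   show "0 < n div q" "2 * (n div q) < p" using q by (simp_all add: zero_less_mult_iff mult_less_cancel_left_pos)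
  qed
  ultimately show "n div q \<in> uppers p q" using n by (simp add: uppers_def half_iff)
  show "F (q * (n div q)) = F n" using \<open>q * (n div q) = n\<close> by simp
 qed (use q in simp_all)
 finally show ?thesis .
qed

lemma (in prime_root) upper_prod_tele:
 assumes n: "\<not> p dvd n" and g: "\<not> p dvd g" and c: "[g ^ k = m] (mod p)"
 shows "sq_eq (upper_prod (od x) n m) (tele n g k)"
 using upper_prod_power[OF od_odd_periodic n g, of k]
 unfolding tele_def upper_prod_cong[OF od_periodic c] .

section \<open>Sorting the residues modulo p q by their halves modulo p and q\<close>

context two_prime_roots
begin

lemma pq_not_dvd: "\<not> p dvd n \<or> \<not> q dvd n ==> \<not> p * q dvd n"
 by (meson dvd_mult_left dvd_mult_right)

context
 fixes S :: "int \<Rightarrow> complex"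
 assumes S: "\<And>n. \<not> p * q dvd n ==> sq_eq (S n) (th x y (- n) n)" and Sper: "periodic (p * q) S"
begin

lemma S_minus: assumes "\<not> p * q dvd n" shows "sq_eq (S (- n)) (S n)"
proof -
 have "sq_eq (S (- n)) (- th x y (- n) n)" using S[of "- n"] assms th_minus[of x y "- n" n] by simp
 also have "sq_eq (- th x y (- n) n) (th x y (- n) n)"
  using sq_eqD[OF S[OF assms]] by (intro sq_eq_minus sq_eq_refl) auto
 also have "sq_eq (th x y (- n) n) (S n)" by (rule sq_eq_sym[OF S[OF assms]])
 finally show ?thesis .
qed

text \<open>An \<open>n\<close> in both upper halves contributes a square. An \<open>n\<close> in
  exactly one of them can be brought by \<open>n -> - n\<close> to the upper half modulo
  \<open>p\<close> and the lower one modulo \<open>q\<close>, unless the other prime divides it;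
  such multiples are collected in \<open>H\<close> and \<open>H'\<close> and give the factors in one
  variable. The others correspond to pairs \<open>(a, b)\<close> from the two half systems with
  \<open>n = - a\<close> modulo \<open>p\<close> and \<open>n = b\<close> modulo \<open>q\<close>,
  which make up the grid.\<close>

lemma prod_halves:
 "sq_eq ((\<Prod>n\<in>half (p * q). if upper p n then S n else 1) * (\<Prod>n\<in>half (p * q). if upper q n then S n else 1))
  (grid * (P.upper_prod (od x) 1 q * Q.upper_prod (od y) 1 p))"
proof -
 define G where "G n = (if upper p n \<and> \<not> upper q n \<and> \<not> q dvd n then S n else 1)" for n
 define H where "H n = (if upper p n \<and> q dvd n then S n else 1)" for n
 define H' where "H' n = (if upper q n \<and> p dvd n then S n else 1)" for n
 have up: "\<not> p dvd n" if "upper p n" for n using that P.p_gt_2 by (auto simp: upper_def)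
 have uq: "\<not> q dvd n" if "upper q n" for n using that Q.p_gt_2 by (auto simp: upper_def)
 have neg: "upper p (- n) \<longleftrightarrow> \<not> p dvd n \<and> \<not> upper p n" "upper q (- n) \<longleftrightarrow> \<not> q dvd n \<and> \<not> upper q n" for n
  using up[of "- n"] uq[of "- n"] P.upper_minus[of n] Q.upper_minus[of n] by auto
 have pt: "sq_eq ((if upper p n then S n else 1) * (if upper q n then S n else 1)) (G n * G (- n) * (H n * H' n))" for n
 proof (cases "p * q dvd n")
  case True
  then have "p dvd n" "q dvd n" using pq_not_dvd by blast+
  then show ?thesis using up[of n] uq[of n] by (auto simp: G_def H_def H'_def neg sq_eq_1)
 next
  case False
  have SS: "S n \<in> Qab" "S n \<noteq> 0" using sq_eqD[OF S[OF False]] by auto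
  have r: "sq_eq (S n) (S n)" "sq_eq (S n * S n) 1" "sq_eq (S n) (S (- n))" "sq_eq 1 1"
   using SS sq_eq_sym[OF S_minus[OF False]] by (auto intro: sq_eq_refl sq_eq_mult_self sq_eq_1)
  show ?thesis
   using up[of n] uq[of n] r by (cases "upper p n"; cases "upper q n"; cases "p dvd n"; cases "q dvd n") (simp_all add: G_def H_def H'_def neg)
 qed
 have "sq_eq ((\<Prod>n\<in>half (p * q). if upper p n then S n else 1) * (\<Prod>n\<in>half (p * q). if upper q n then S n else 1))
   (\<Prod>n\<in>half (p * q). G n * G (- n) * (H n * H' n))"
  unfolding prod.distrib[symmetric] by (rule sq_eq_prod) (rule pt)
 also have "\<dots> = (\<Prod>n\<in>half (p * q). G n * G (- n)) * ((\<Prod>n\<in>half (p * q). H n) * (\<Prod>n\<in>half (p * q). H' n))"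
  by (simp only: prod.distrib)
 also have "sq_eq \<dots> (grid * (P.upper_prod (od x) 1 q * Q.upper_prod (od y) 1 p))"
 proof (intro sq_eq_mult)
  have pos: "p > 0" "q > 0" using P.p_gt_2 Q.p_gt_2 by auto
  have nd: "\<not> p dvd q * m \<and> upper p (q * m)" if "m \<in> uppers p q" for m
   using that up by (auto simp: uppers_def)
  have nd': "\<not> q dvd p * m \<and> upper q (p * m)" if "m \<in> uppers q p" for m
   using that uq by (auto simp: uppers_def)
  have 1: "sq_eq (S (q * m)) (od x (1 * q * m))" if "m \<in> uppers p q" for m
  proof -
   have "th x y (- (q * m)) (q * m) = th x y (- (q * m)) 0"
    by (rule periodicD[OF th_periodic_right]) (simp add: cong_iff_dvd_diff)
   also have "\<dots> = - od x (q * m)" by (simp add: th_def od_def)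
   finally have e: "th x y (- (q * m)) (q * m) = - od x (q * m)" .
   have o: "od x (q * m) \<in> Qab" "od x (q * m) \<noteq> 0" using nd[OF that] od_mem[OF Qab P.in_Qab] P.od_eq_0_iff by auto
   have "sq_eq (S (q * m)) (- od x (q * m))" using S[of "q * m"] pq_not_dvd nd[OF that] unfolding e by blast
   also have "sq_eq (- od x (q * m)) (od x (q * m))" using o by (intro sq_eq_minus sq_eq_refl)
   finally show ?thesis by simp
  qed
  have 2: "sq_eq (S (p * m)) (od y (1 * p * m))" if "m \<in> uppers q p" for m
  proof -
   have "th x y (- (p * m)) (p * m) = th x y 0 (p * m)"
    by (rule periodicD[OF th_periodic_left]) (simp add: cong_iff_dvd_diff)
   also have "\<dots> = od y (p * m)" by (simp add: th_def od_def)
   finally have e: "th x y (- (p * m)) (p * m) = od y (p * m)" .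
   have "\<not> p * q dvd p * m" using pq_not_dvd nd'[OF that] by blast
   from S[OF this] show ?thesis unfolding e by simp
  qed
  have "prod H (half (p * q)) = (\<Prod>m\<in>uppers p q. S (q * m))"
   unfolding H_def by (rule P.prod_multiples[OF pos(2)])
  then show "sq_eq (prod H (half (p * q))) (P.upper_prod (od x) 1 q)"
   unfolding P.upper_prod_def using sq_eq_prod[OF 1] by simp
  have "prod H' (half (p * q)) = (\<Prod>m\<in>uppers q p. S (p * m))"
   unfolding H'_def using Q.prod_multiples[OF pos(1), of S] by (simp add: mult.commute)
  then show "sq_eq (prod H' (half (p * q))) (Q.upper_prod (od y) 1 p)"
   unfolding Q.upper_prod_def using sq_eq_prod[OF 2] by simp
  obtain u v where uv: "u * q + v * p = 1"
  proof -
   have "coprime q p" using prime_imp_coprime[OF P.prime_p p_not_dvd_q] by (simp add: coprime_commute)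
   then show thesis using bezout_int[of q p] that by (auto simp: coprime_iff_gcd_eq_1)
  qed
  \<comment> \<open>The residue \<open>- a\<close> lies in the upper half modulo \<open>p\<close>
    and \<open>b\<close> in the lower half modulo \<open>q\<close>, as the condition in
    \<open>G\<close> demands.\<close>
  define crt where "crt a b = (- a * (u * q) + b * (v * p)) mod (p * q)" for a b
  have crt: "[crt a b = - a] (mod p)" "[crt a b = b] (mod q)" for a b
  proof -
   let ?n = "- a * (u * q) + b * (v * p)"
   have "p * q dvd crt a b - ?n" unfolding crt_def by (metis dvd_minus_mod dvd_diff_commute)
   then have "p dvd crt a b - ?n" "q dvd crt a b - ?n" by (auto dest: dvd_mult_left dvd_mult_right)
   moreover have "?n - (- a) = p * ((a + b) * v)" "?n - b = q * (- (a + b) * u)"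
   proof -
    have "u * q = 1 - v * p" using uv by simp
    then show "?n - (- a) = p * ((a + b) * v)" by (simp only:) (simp add: algebra_simps)
    have "v * p = 1 - u * q" using uv by simp
    then show "?n - b = q * (- (a + b) * u)" by (simp only:) (simp add: algebra_simps)
   qed
   then have "p dvd ?n - (- a)" "q dvd ?n - b" by (auto intro: dvdI)
   ultimately have "[crt a b = ?n] (mod p)" "[?n = - a] (mod p)" "[crt a b = ?n] (mod q)" "[?n = b] (mod q)"
    unfolding cong_iff_dvd_diff by blast+
   then show "[crt a b = - a] (mod p)" "[crt a b = b] (mod q)" by (blast intro: cong_trans)+
  qed
  define T where "T = {n \<in> {0..<p * q}. upper p n \<and> \<not> upper q n \<and> \<not> q dvd n}"
  have Gper: "periodic (p * q) G"
   unfolding periodic_def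
  proof (intro allI impI)
   fix m n assume mn: "[m = n] (mod p * q)"
   then have c: "[m = n] (mod p)" "[m = n] (mod q)"
    unfolding cong_iff_dvd_diff by (auto dest: dvd_mult_left dvd_mult_right)
   have "q dvd m \<longleftrightarrow> q dvd n"
    using c(2) unfolding cong_iff_dvd_diff using dvd_add_right_iff[of q "m - n" n] by simp
   then show "G m = G n" using upper_cong[OF c(1)] upper_cong[OF c(2)] periodicD[OF Sper mn] by (simp add: G_def)
  qed
  have "odd (p * q)" "0 < p * q" using P.odd_p Q.odd_p pos by simp_all
  \<comment> \<open>The two signs of the half system modulo \<open>p * q\<close> together run over
    all nonzero residues, and \<open>G 0 = 1\<close>.\<close>
  from prod_residues[OF this Gper] have "(\<Prod>n\<in>half (p * q). G n * G (- n)) = prod G {0..<p * q}"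
   using pos by (simp add: G_def upper_def)
  also have "\<dots> = prod S T"
   unfolding T_def G_def by (rule prod.inter_filter[symmetric]) simp
  also have "\<dots> = (\<Prod>(a, b)\<in>half p \<times> half q. S (crt a b))"
  proof (rule prod.reindex_bij_witness[of _ "\<lambda>(a, b). crt a b" "\<lambda>n. (P.rep n, Q.rep n)"])
   fix n assume n: "n \<in> T"
   then have nn: "upper p n" "\<not> upper q n" "\<not> p dvd n" "\<not> q dvd n" "0 \<le> n" "n < p * q"
    using up by (auto simp: T_def)
   have "[crt (P.rep n) (Q.rep n) = n] (mod p)"
   proof -
    have "[- P.rep n = - (- n)] (mod p)" using P.rep_cong[of n] nn(1) by (simp only: cong_minus_minus_iff if_True)
    then show ?thesis using cong_trans[OF crt(1)] by simp
   qed
   moreover have "[crt (P.rep n) (Q.rep n) = n] (mod q)"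
    using cong_trans[OF crt(2)] Q.rep_cong[of n] nn(2) by simp
   moreover have "coprime p q" using prime_imp_coprime[OF P.prime_p p_not_dvd_q] .
   ultimately have "p * q dvd crt (P.rep n) (Q.rep n) - n"
    unfolding cong_iff_dvd_diff by (intro divides_mult)
   moreover have "0 \<le> crt (P.rep n) (Q.rep n)" "crt (P.rep n) (Q.rep n) < p * q" using pos by (simp_all add: crt_def)
   ultimately have "crt (P.rep n) (Q.rep n) = n" using nn(5,6) dvd_imp_le_int[of "crt (P.rep n) (Q.rep n) - n" "p * q"] by force
   then show "(\<lambda>(a, b). crt a b) (P.rep n, Q.rep n) = n" "(case (P.rep n, Q.rep n) of (a, b) \<Rightarrow> S (crt a b)) = S n" by simp_all
   show "(P.rep n, Q.rep n) \<in> half p \<times> half q" using P.rep_half Q.rep_half nn by simp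
  next
   fix z assume z: "z \<in> half p \<times> half q"
   obtain a b where ab: "z = (a, b)" by (cases z)
   have m: "a \<in> half p" "b \<in> half q" using z by (auto simp: ab)
   have u: "upper p (crt a b)" "\<not> upper q (crt a b)"
    using upper_cong[OF crt(1)[of a b]] upper_cong[OF crt(2)[of a b]] P.half_not_upper[OF m(1)] Q.half_not_upper[OF m(2)]
     P.upper_minus[OF P.half_not_dvd[OF m(1)]] by simp_all
   have d: "\<not> q dvd crt a b"
    using crt(2)[of a b] Q.half_not_dvd[OF m(2)] dvd_add_right_iff[of q "crt a b - b" b] by (simp add: cong_iff_dvd_diff)
   show "(\<lambda>(a, b). crt a b) z \<in> T" using u d pos by (simp add: T_def ab crt_def)
   have "[P.rep (crt a b) = a] (mod p)"
   proof -
    have "[P.rep (crt a b) = - crt a b] (mod p)" using P.rep_cong[of "crt a b"] u by simp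
    moreover have "[- crt a b = - (- a)] (mod p)" unfolding cong_minus_minus_iff by (rule crt(1))
    ultimately show ?thesis using cong_trans by fastforce
   qed
   moreover have "[Q.rep (crt a b) = b] (mod q)" using cong_trans[OF _ crt(2)] Q.rep_cong[of "crt a b"] u by simp
   ultimately have "P.rep (crt a b) = a" "Q.rep (crt a b) = b"
    using P.half_eqI[OF P.rep_half m(1)] Q.half_eqI[OF Q.rep_half m(2)] up[OF u(1)] d by (auto simp: cong_iff_dvd_diff)
   then show "(\<lambda>n. (P.rep n, Q.rep n)) ((\<lambda>(a, b). crt a b) z) = z" by (simp add: ab)
  qed
  also have "sq_eq \<dots> (\<Prod>(a, b)\<in>half p \<times> half q. th x y a b)"
  proof (rule sq_eq_prod, clarify)
   fix a b assume m: "a \<in> half p" "b \<in> half q"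
   have "\<not> q dvd crt a b"
    using crt(2)[of a b] Q.half_not_dvd[OF m(2)] dvd_add_right_iff[of q "crt a b - b" b] by (simp add: cong_iff_dvd_diff)
   then have "sq_eq (S (crt a b)) (th x y (- crt a b) (crt a b))" using S pq_not_dvd by blast
   also have "th x y (- crt a b) (crt a b) = th x y a (crt a b)"
   proof (rule periodicD[OF th_periodic_left])
    have "[- crt a b = - (- a)] (mod p)" unfolding cong_minus_minus_iff by (rule crt(1))
    then show "[- crt a b = a] (mod p)" by simp
   qed
   also have "\<dots> = th x y a b" by (rule periodicD[OF th_periodic_right crt(2)])
   finally show "sq_eq (S (crt a b)) (th x y a b)" .
  qed
  also have "(\<Prod>(a, b)\<in>half p \<times> half q. th x y a b) = grid"
   unfolding grid_def row_def by (rule prod.cartesian_product[symmetric])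
  finally show "sq_eq (\<Prod>n\<in>half (p * q). G n * G (- n)) grid" .
 qed
 finally show ?thesis .
qed

end

end

theorem sin_A_sq_eq_V:
 fixes p q :: nat
 assumes p: "prime p" "2 < p" and q: "prime q" "p < q"
 obtains x y g h k l where "odd_pair (int p) x (int q) y g h k l"
  "sq_eq (sin_A (a_elem p q)) (odd_pair.V (int p) x (int q) y g h k l)"
proof -
 have pq: "odd p" "odd q" "p \<noteq> 2" "p > 0" "q > 0" using p q prime_odd_nat by auto
 interpret P: odd_prime "int p" by unfold_locales (use p in simp_all)
 interpret Q: odd_prime "int q" by unfold_locales (use p q in simp_all)
 have cop: "coprime (int q) (int p)"
  using p q by (metis primes_coprime coprime_int_iff less_not_refl)
 obtain u v where uv: "u * int q + v * int p = 1"
  using bezout_int[of "int q" "int p"] cop by (auto simp: coprime_iff_gcd_eq_1)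
 have np: "\<not> int p dvd u" and nq: "\<not> int q dvd v"
 proof -
  have "int p dvd 1" if "int p dvd u" using that uv by (metis dvd_add dvd_mult2 dvd_mult dvd_refl)
  moreover have "int q dvd 1" if "int q dvd v" using that uv by (metis dvd_add dvd_mult2 dvd_mult dvd_refl)
  ultimately show "\<not> int p dvd u" "\<not> int q dvd v" using p q by auto
 qed
 \<comment> \<open>\<open>e r\<close> represents one half modulo the odd number \<open>r\<close>, so
   square roots are taken without leaving the \<open>r\<close>-th roots of unity.\<close>
 define e where "e r = int ((r + 1) div 2)" for r
 have e: "2 * e p = int p + 1" "2 * e q = int q + 1" using pq by (auto simp: e_def elim!: oddE)
 \<comment> \<open>Chosen so that \<open>x ^ (- 2)\<close> is \<open>ee (u / p)\<close> and
   \<open>y ^ 2\<close> is \<open>ee (v / q)\<close>. As \<open>u q + v p = 1\<close>, their product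
   is \<open>ee (1 / (p q))\<close>, and \<open>1 - ee (n / (p q))\<close> becomes
   \<open>th x y (- n) n\<close> up to a root of unity.\<close>
 define x where "x = ee (of_int (- u * e p) / of_int (int p))"
 define y where "y = ee (of_int (v * e q) / of_int (int q))"
 have root: "prime_root r (ee (of_int (w * f) / of_int r))" if "odd_prime r" "\<not> r dvd w" "2 * f = r + 1" for r w f
 proof -
  interpret odd_prime r by fact
  have "\<not> r dvd f"
  proof
   assume "r dvd f"
   then have "r dvd 2 * f - r" by (intro dvd_diff dvd_mult dvd_refl)
   then show False using that(3) p_gt_2 by simp
  qed
  then have "\<not> r dvd w * f" using not_dvd_mult that(2) by blast
  then have "ee (of_int (w * f) / of_int r) \<noteq> 1" using p_gt_2 by (simp only: ee_eq_1_iff of_int_div_Ints) (simp add: of_int_div_Ints del: of_int_mult)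
  moreover have "ee (of_int (w * f) / of_int r) powi r = ee (of_int (w * f))" using p_gt_2 by (simp add: ee_power_int)
  then have "ee (of_int (w * f) / of_int r) powi r = 1" by (simp only: ee_of_int)
  ultimately show ?thesis by unfold_locales
 qed
 have "prime_root (int p) x" unfolding x_def by (rule root[OF P.odd_prime_axioms _ e(1)]) (use np in simp)
 moreover have "prime_root (int q) y" unfolding y_def by (rule root[OF Q.odd_prime_axioms nq e(2)])
 ultimately interpret two_prime_roots "int p" x "int q" y
  using q by (simp add: two_prime_roots_def two_prime_roots_axioms_def)
 obtain g where g: "\<not> int p dvd g" "\<And>a. \<not> int p dvd a ==> \<exists>k. [a = g ^ k] (mod int p)"
 proof (rule P.primitive_root)
  fix g assume "\<not> int p dvd g" "\<And>a. \<not> int p dvd a ==> \<exists>k. [a = g ^ k] (mod int p)"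
  then show thesis by (rule that)
 qed
 obtain h where h: "\<not> int q dvd h" "\<And>a. \<not> int q dvd a ==> \<exists>k. [a = h ^ k] (mod int q)"
 proof (rule Q.primitive_root)
  fix h assume "\<not> int q dvd h" "\<And>a. \<not> int q dvd a ==> \<exists>k. [a = h ^ k] (mod int q)"
  then show thesis by (rule that)
 qed
 obtain k where k: "[int q = g ^ k] (mod int p)" using g(2)[OF p_not_dvd_q] by blast
 obtain l where l: "[int p = h ^ l] (mod int q)" using h(2)[OF two_prime_roots.p_not_dvd_q[OF swap]] by blast
 interpret odd_pair "int p" x "int q" y g h k l
  by unfold_locales (use g h k l in \<open>auto intro: cong_sym\<close>)
 define S where "S n = uu (of_int n / of_int (int p * int q))" for n
 have Sper: "periodic (int p * int q) S"
  unfolding periodic_def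
 proof (intro allI impI)
  fix a b assume "[a = b] (mod int p * int q)"
  then obtain m where m: "a - b = int p * int q * m" unfolding cong_iff_dvd_diff by blast
  have "of_int a / of_int (int p * int q) = of_int b / of_int (int p * int q) + (of_int m :: rat)"
  proof -
   have "a = b + int p * int q * m" using m by simp
   then show ?thesis using pq by (simp add: field_simps)
  qed
  then show "S a = S b" by (simp only: S_def uu_add_int)
 qed
 have Sth: "sq_eq (S n) (th x y (- n) n)" if nd: "\<not> int p * int q dvd n" for n
 proof -
  have nz: "x \<noteq> 0" "y \<noteq> 0" by (simp_all add: x_def y_def)
  have "ee (of_int n / of_int (int p * int q)) = x powi (- 2 * n) * y powi (2 * n)"
  proof -
   have "x powi (- 2 * n) * y powi (2 * n) = ee (of_int (- 2 * n) * (of_int (- u * e p) / of_int (int p)) + of_int (2 * n) * (of_int (v * e q) / of_int (int q)))"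
    unfolding x_def y_def ee_power_int ee_add by (rule refl)
   also have "of_int (- 2 * n) * (of_int (- u * e p) / of_int (int p)) + of_int (2 * n) * (of_int (v * e q) / of_int (int q))
     = of_int (n * u * (2 * e p)) / of_int (int p) + (of_int (n * v * (2 * e q)) / of_int (int q) :: rat)"
    by (simp add: mult_ac)
   also have "\<dots> = of_int (n * (u * int q + v * int p)) / of_int (int p * int q) + of_int (n * u + n * v)"
    unfolding e using pq by (simp add: field_simps)
   also have "ee \<dots> = ee (of_int n / of_int (int p * int q))" unfolding uv ee_add ee_of_int by simp
   finally show ?thesis by simp
  qed
  moreover have "1 - x powi (- 2 * n) * y powi (2 * n) = (- (x powi (- n) * y powi n)) * th x y (- n) n"
  proof -
   define X Y where "X = x powi n" and "Y = y powi n"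
   have XY: "X \<noteq> 0" "Y \<noteq> 0" using nz by (simp_all add: X_def Y_def)
   have n2: "- 2 * n = - (n + n)" "2 * n = n + n" by simp_all
   have add: "x powi (n + n) = X * X" "y powi (n + n) = Y * Y"         using nz power_int_add[of x n n] power_int_add[of y n n] by (simp_all add: X_def Y_def)
   show ?thesis
    unfolding th_def minus_minus n2 power_int_minus add X_def[symmetric] Y_def[symmetric]
    using XY by (simp add: field_simps)
  qed
  ultimately have Se: "S n = (- (x powi (- n) * y powi n)) * th x y (- n) n" by (simp add: S_def uu_def)
  have "(of_int n / of_int (int p * int q) :: rat) \<notin> \<int>" using of_int_div_Ints[of "int p * int q" n] nd pq by simp
  then have "S n \<noteq> 0" using uu_mem(2) by (simp add: S_def)
  then have "th x y (- n) n \<noteq> 0" unfolding Se by simp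
  then have "sq_eq (th x y (- n) n) (th x y (- n) n)" by (intro sq_eq_refl th_mem[OF Qab P.in_Qab Q.in_Qab])
  then show ?thesis unfolding Se
   by (intro sq_eq_root_of_unity root_of_unity_minus root_of_unity_mult root_of_unity_power_int P.is_root_of_unity Q.is_root_of_unity)
 qed
 \<comment> \<open>Applied twice, with the two primes in either order.\<close>
 have blk: "sq_eq (\<Prod>i = 1..(p - 1) div 2. sin1 (of_nat i / of_nat p)
    / (\<Prod>k = 0..(q - 1) div 2. sin1 (of_nat i / of_nat (p * q) + of_nat k / of_nat q)))
   (\<Prod>n\<in>half (int p * int q). if upper (int p) n then uu (of_int n / of_int (int p * int q)) else 1)"
  if "odd_prime (int p)" "odd q" for p q
 proof -
  interpret odd_prime "int p" by fact
  have op: "odd p" using odd_p by simp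
  have "sq_eq (\<Prod>i = 1..(p - 1) div 2. sin1 (of_nat i / of_nat p)
    / (\<Prod>k = 0..(q - 1) div 2. sin1 (of_nat i / of_nat (p * q) + of_nat k / of_nat q)))
   (\<Prod>i = 1..(p - 1) div 2. \<Prod>k\<in>half (int q). uu (of_int (k * int p - int i) / of_int (int p * int q)))"
  proof (rule sq_eq_prod, rule sine_quotient)
   fix i assume "i \<in> {1..(p - 1) div 2}"
   then show "\<not> p dvd i" using op by (auto dest!: dvd_imp_le elim!: oddE)
  qed (use op that(2) in \<open>auto elim: oddE\<close>)
  also have "\<dots> = (\<Prod>i\<in>half (int p). \<Prod>k\<in>half (int q). uu (of_int (k * int p - i) / of_int (int p * int q)))"
   by (rule prod_half_nat[OF op])
  also have "\<dots> = (\<Prod>n\<in>half (int p * int q). if upper (int p) n then uu (of_int n / of_int (int p * int q)) else 1)"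
   by (rule prod_upper_grid) (use that(2) in \<open>auto elim: oddE\<close>)
  finally show ?thesis .
 qed
 have "sq_eq (sin_A (a_elem p q))
   ((\<Prod>n\<in>half (int p * int q). if upper (int p) n then S n else 1) * (\<Prod>n\<in>half (int p * int q). if upper (int q) n then S n else 1))"
  unfolding sin_A_odd[OF pq(3)] S_def
  using sq_eq_divide[OF blk[OF P.odd_prime_axioms pq(2)] blk[OF Q.odd_prime_axioms pq(1)]]
  by (simp only: mult.commute[of "int q"] mult.commute[of q])
 also have "sq_eq \<dots> (grid * (P.upper_prod (od x) 1 (int q) * Q.upper_prod (od y) 1 (int p)))"
  by (rule prod_halves[OF Sth Sper])
 also have "sq_eq \<dots> (grid * (P.tele 1 g k * Q.tele 1 h l))"
 proof (intro sq_eq_mult P.upper_prod_tele Q.upper_prod_tele p_not_dvd_1 q_not_dvd_1 g h gk hl sq_eq_refl grid_nonzero)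
  show "grid \<in> Qab" unfolding grid_def by (intro subfield_prod[OF Qab] row_mem[OF Qab] P.in_Qab Q.in_Qab)
 qed
 finally have "sq_eq (sin_A (a_elem p q)) V" by (simp only: V_def)
 then show thesis by (rule that[OF odd_pair_axioms])
qed

section \<open>The class attached to 2 and an odd prime\<close>

locale two_pair = prime_root q y for q y +
 fixes h :: int and k :: nat
 assumes h: "\<not> q dvd h" "\<And>a. \<not> q dvd a ==> \<exists>k. [a = h ^ k] (mod q)"
  and hk: "[h ^ k = 2] (mod q)"
begin

text \<open>The eighth roots of unity supply both \<open>\<i>\<close>, as a square, and the square
  root of 2.\<close>

definition z :: complex where "z = ee (1 / 8)"

lemma z8: "z ^ nat 8 = 1"
 using ee_of_int[of 1] by (simp add: z_def ee_power)

lemma z_square: "z\<^sup>2 = \<i>"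
proof -
 have "z\<^sup>2 = ee (1 / 4)" by (simp add: z_def ee_power)
 also have "\<dots> = cis (pi / 2)" by (simp add: ee_def of_rat_divide)
 finally show ?thesis by simp
qed

lemma z_nonzero: "z \<noteq> 0" by (simp add: z_def)

lemma z_inverse_square: "(inverse z)\<^sup>2 = - \<i>"
 by (simp add: power_inverse z_square)

lemma z_powi_5: "z powi 5 = - z"
proof -
 have "z ^ 5 = (z\<^sup>2)\<^sup>2 * z" by (simp add: eval_nat_numeral)
 then show ?thesis by (simp add: z_square)
qed

lemma z_powi_minus_5: "z powi (- 5) = - inverse z"
 unfolding power_int_minus z_powi_5 by (rule inverse_minus_eq)

lemma z_Qab: "z \<in> Qab" using root_of_unity_Qab[OF z8] by simp

lemma z_Qbar: "z \<in> Qbar" using z_Qab by simp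

lemma sqrt_2: "complex_of_real (sqrt (real 2)) = z + inverse z"
proof -
 have z: "z = cis (pi / 4)" by (simp add: z_def ee_def of_rat_divide)
 have "sqrt 2 = 2 * cos (pi / 4)" by (simp add: cos_45)
 then show ?thesis by (simp add: z cis_inverse complex_eq_iff)
qed

abbreviation "t1 b \<equiv> th z y 1 b"

lemma t1_alt: "t1 b = z * y powi b - inverse z * y powi (- b)"
 by (simp add: th_def power_int_minus)

lemma t1_mem: "is_subfield K ==> z \<in> K ==> y \<in> K ==> t1 b \<in> K"
 by (rule th_mem)

text \<open>Otherwise \<open>\<i> * y ^ (2 b) = 1\<close>, and the \<open>q\<close>-th power gives
  \<open>\<i> ^ q = 1\<close>, which is impossible for odd \<open>q\<close>.\<close>

lemma t1_nonzero: "t1 b \<noteq> 0"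
proof
 assume "t1 b = 0"
 then have "z * y powi b = inverse z * y powi (- b)" by (simp add: t1_alt)
 then have "z * (z * y powi b) * y powi b = (z * inverse z) * (y powi (- b) * y powi b)" by (simp add: mult_ac)
 also have "\<dots> = 1" using z_nonzero nonzero by (simp add: power_int_minus)
 finally have zz: "z * (z * y powi b) * y powi b = 1" .
 have 1: "\<i> * y powi (2 * b) = 1"
 proof -
  have "y powi (2 * b) = y powi b * y powi b" using nonzero power_int_add[of y b b] by simp
  then show ?thesis using zz by (simp add: power2_eq_square mult_ac flip: z_square)
 qed
 have "(y powi (2 * b)) ^ nat q = 1" by (rule powers_eq_1)
 then have "\<i> ^ nat q = (\<i> * y powi (2 * b)) ^ nat q" by (simp add: power_mult_distrib)
 then have i: "\<i> ^ nat q = 1" by (simp add: 1)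
 have "odd (nat q)" using odd_p p_gt_2 by (simp add: even_nat_iff)
 then obtain m where "nat q = 2 * m + 1" by (elim oddE)
 then have "\<i> ^ nat q = (- 1) ^ m * \<i>" by (simp add: power_mult)
 moreover have "(- 1) ^ m * \<i> \<noteq> 1" by (cases "even m") (auto simp: complex_eq_iff)
 ultimately show False using i by simp
qed

lemma t1_periodic: "periodic q t1"
 unfolding periodic_def
proof (intro allI impI)
 fix a b assume "[a = b] (mod q)"
 then have "y powi a = y powi b" "y powi (- a) = y powi (- b)" by (auto simp: powi_eq_iff cong_minus_minus_iff)
 then show "t1 a = t1 b" by (simp add: th_def)
qed

text \<open>Because \<open>z ^ 2 + z ^ (- 2) = 0\<close>, the two factors multiply to
  \<open>- (y ^ (2 b) + y ^ (- 2 b))\<close>, which is a quotient of two values of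
  \<open>od\<close>.\<close>

lemma t1_reflection: "t1 b * t1 (- b) * od y (2 * b) = - od y (4 * b)"
proof -
 define Y where "Y = y powi b"
 have Y: "Y \<noteq> 0" "z \<noteq> 0" using nonzero z_nonzero by (simp_all add: Y_def)
 have "y powi (2 * b) = Y\<^sup>2" "y powi (4 * b) = Y ^ 4"
  unfolding Y_def by (simp_all add: power_int_mult mult.commute[of _ b])
 then have o: "od y (2 * b) = Y\<^sup>2 - inverse (Y\<^sup>2)" "od y (4 * b) = Y ^ 4 - inverse (Y ^ 4)"
  by (simp_all add: od_def power_int_minus)
 have "z * z + inverse z * inverse z = 0"
  using z_square z_inverse_square by (simp add: power2_eq_square)
 moreover have "t1 b * t1 (- b) = z * z + inverse z * inverse z - (Y\<^sup>2 + inverse (Y\<^sup>2))"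
  unfolding t1_alt minus_minus power_int_minus Y_def[symmetric] using Y by (simp add: field_simps power2_eq_square)
 ultimately have eq: "t1 b * t1 (- b) = - (Y\<^sup>2 + inverse (Y\<^sup>2))" by simp
 show ?thesis unfolding eq o using Y by (simp add: field_simps eval_nat_numeral)
qed

definition W :: complex where "W = (\<Prod>b\<in>half q. t1 b)"

text \<open>\<open>t1 0 = z - 1 / z\<close> is a square root of -2. Its power compensates the sign
  that \<open>W\<close> acquires under \<open>z -> - z\<close>, where each of its
  \<open>(q - 1) / 2\<close> factors is negated.\<close>

definition C :: complex where "C = t1 0 ^ card (half q)"

definition V :: complex where "V = W * (C * tele 2 h k)"

lemma q_not_dvd_2: "\<not> q dvd 2"
 using p_gt_2 zdvd_imp_le[of q 2] by auto

lemma q_not_dvd_1: "\<not> q dvd 1"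
 using p_gt_2 zdvd_imp_le[of q 1] by auto

lemma W_nonzero: "W \<noteq> 0" using t1_nonzero by (simp add: W_def)

lemma C_nonzero: "C \<noteq> 0" using t1_nonzero by (simp add: C_def)

lemma V_nonzero: "V \<noteq> 0"
 using W_nonzero C_nonzero tele_nonzero[OF q_not_dvd_2 h(1)] by (simp add: V_def)

lemma mems:
 assumes "is_subfield K" "z \<in> K" "y \<in> K"
 shows "W \<in> K" "C \<in> K" "tele n h j \<in> K" "V \<in> K"
proof -
 show "W \<in> K" "C \<in> K" "tele n h j \<in> K" "V \<in> K"
  unfolding V_def W_def C_def using assms
  by (auto intro!: subfieldD(4) subfield_prod subfield_power t1_mem tele_mem)
qed

lemma gal_V_mult: "s \<in> carrier G_Q ==> s V = s W * (s C * s (tele 2 h k))"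
 unfolding V_def using mems[OF Qbar z_Qbar in_Qbar] subfieldD(4)[OF Qbar] by (simp add: gal_times)

lemma gal_prod_t1: assumes s: "s \<in> carrier G_Q" shows "s (\<Prod>b\<in>I. t1 (f b)) = (\<Prod>b\<in>I. th (s z) (s y) 1 (f b))"
 using gal_prod[OF Qbar s, of I "\<lambda>b. t1 (f b)"] t1_mem[OF Qbar z_Qbar in_Qbar]
 by (simp add: gal_th[OF s z_Qbar in_Qbar])

lemma gal_C: assumes s: "s \<in> carrier G_Q" shows "s C = th (s z) (s y) 1 0 ^ card (half q)"
 using gal_power[OF Qbar s t1_mem[OF Qbar z_Qbar in_Qbar]] by (simp add: C_def gal_th[OF s z_Qbar in_Qbar])

lemma th_minus_z: "th (- z) y 1 b = - t1 b"
 by (simp add: th_def power_int_minus)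

lemma th_inverse_z: "th (inverse z) y 1 b = - t1 (- b)"
 by (simp add: th_def power_int_minus)

definition M :: complex where "M = (\<Prod>b\<in>uppers q h. t1 (h * b))"

definition R :: complex where "R = (\<Prod>b\<in>uppers q h. t1 (- (h * b)))"

definition U :: "int \<Rightarrow> complex" where "U n = upper_prod (od y) n h"

text \<open>The square root of \<open>t V / V\<close> for the generator \<open>t\<close> acting on
  \<open>y\<close>, built as for two odd primes; here the reflections produce
  \<open>U 4 / U 2\<close>.\<close>

definition A :: complex where "A = \<i> ^ card (uppers q h) * (U 4 / (U 2 * R))"

lemma M_nonzero: "M \<noteq> 0" and R_nonzero: "R \<noteq> 0"
 using t1_nonzero by (simp_all add: M_def R_def)

lemma U_nonzero: "U 2 \<noteq> 0"
 unfolding U_def by (rule upper_prod_nonzero[OF q_not_dvd_2 h(1)])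

lemma U_mem: "is_subfield K ==> y \<in> K ==> U n \<in> K"
 unfolding U_def by (intro upper_prod_mem od_mem)

lemma M_mem: "is_subfield K ==> z \<in> K ==> y \<in> K ==> M \<in> K"
 and R_mem: "is_subfield K ==> z \<in> K ==> y \<in> K ==> R \<in> K"
 unfolding M_def R_def by (auto intro!: subfield_prod t1_mem)

lemma i_mem: "is_subfield K ==> z \<in> K ==> \<i> \<in> K"
 using subfield_power[of K z 2] by (simp add: z_square)

lemma A_mem: "is_subfield K ==> z \<in> K ==> y \<in> K ==> A \<in> K"
 unfolding A_def by (intro subfieldD(4) subfield_divide subfield_power U_mem R_mem i_mem)

lemma MRU: "M * R * U 2 = (- 1) ^ card (uppers q h) * U 4"
proof -
 have "M * R * U 2 = (\<Prod>b\<in>uppers q h. t1 (h * b) * t1 (- (h * b)) * od y (2 * (h * b)))"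
  by (simp add: M_def R_def U_def upper_prod_def prod.distrib mult.assoc)
 also have "\<dots> = (\<Prod>b\<in>uppers q h. - od y (4 * (h * b)))" by (simp only: t1_reflection)
 also have "\<dots> = (- 1) ^ card (uppers q h) * U 4"
  by (simp add: prod_uminus U_def upper_prod_def mult.assoc)
 finally show ?thesis .
qed

lemma W_scale: "(\<Prod>b\<in>half q. t1 (h * b)) * R = W * M"
 unfolding R_def M_def W_def by (rule prod_half_scale[OF t1_periodic h(1)])

lemma prod_od_scale:
 assumes m: "\<not> q dvd m" shows "(\<Prod>b\<in>half q. od y (m * b)) = (- 1) ^ card (uppers q m) * (\<Prod>b\<in>half q. od y b)"
proof -
 define u where "u = (\<Prod>b\<in>uppers q m. od y (m * b))"
 have u0: "u \<noteq> 0" using half_not_dvd not_dvd_mult[OF m] by (auto simp: u_def od_eq_0_iff uppers_def)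
 have "(\<Prod>b\<in>half q. od y (m * b)) * ((- 1) ^ card (uppers q m) * u) = (\<Prod>b\<in>half q. od y b) * u"
  using prod_half_scale[OF od_periodic m] by (simp add: od_minus prod_uminus u_def)
 then have "(\<Prod>b\<in>half q. od y (m * b)) * (- 1) ^ card (uppers q m) = (\<Prod>b\<in>half q. od y b)"
  using u0 by simp
 moreover have "(- 1) ^ card (uppers q m) * (- 1) ^ card (uppers q m) = (1 :: complex)"
  by (simp flip: power_mult_distrib)
 ultimately show ?thesis by (metis mult.commute mult.assoc mult_1_right)
qed

text \<open>Inversion of \<open>z\<close> sends \<open>t1 b\<close> to \<open>- t1 (- b)\<close>. By
  the reflections the product of the two half products is the quotient of the products of
  \<open>od y (4 b)\<close> and \<open>od y (2 b)\<close>, and by Gauss' lemma both equal the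
  product of \<open>od y b\<close> up to sign. So \<open>W\<close> goes to its inverse up to
  sign.\<close>

lemma inverse_W: "\<exists>\<epsilon>\<in>{1, - 1}. (\<Prod>b\<in>half q. - t1 (- b)) * W = \<epsilon>"
proof -
 define K where "K = (\<Prod>b\<in>half q. od y b)"
 have "K \<noteq> 0" using half_not_dvd by (auto simp: K_def od_eq_0_iff)
 have "\<not> q dvd 2 * 2" using not_dvd_mult q_not_dvd_2 by blast
 then have n4: "\<not> q dvd 4" by simp
 have "(\<Prod>b\<in>half q. - t1 (- b)) * W * (\<Prod>b\<in>half q. od y (2 * b)) = (\<Prod>b\<in>half q. - (t1 b * t1 (- b) * od y (2 * b)))"
  by (simp add: W_def mult_ac flip: prod.distrib)
 also have "\<dots> = (\<Prod>b\<in>half q. od y (4 * b))" by (simp only: t1_reflection minus_minus)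
 finally have "(\<Prod>b\<in>half q. - t1 (- b)) * W * (- 1) ^ card (uppers q 2) = (- 1) ^ card (uppers q 4)"
  unfolding prod_od_scale[OF q_not_dvd_2] prod_od_scale[OF n4] K_def[symmetric] using \<open>K \<noteq> 0\<close>
  by (simp add: mult.assoc)
 then show ?thesis by (cases "even (card (uppers q 2))"; cases "even (card (uppers q 4))") (auto simp: minus_equation_iff)
qed

theorem D_map_V: "D_map (mod_squares V) = wedge H1ab (e_char 2) (e_char (nat q))"
proof -
 define m n where "m = card (uppers q h)" and "n = card (half q)"
 define W' where "W' = (\<Prod>b\<in>half q. - t1 (- b))"
 obtain \<epsilon> where e: "\<epsilon> = 1 \<or> \<epsilon> = - 1" "W' * W = \<epsilon>" using inverse_W by (auto simp: W'_def)
 have "\<exists>\<iota>. (\<iota> = 1 \<or> \<iota> = \<i>) \<and> \<iota>\<^sup>2 = (- 1) ^ n * \<epsilon>"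
  using e(1) by (cases "even n") (auto intro: exI[of _ 1] exI[of _ \<i>])
 then obtain \<iota> where \<iota>: "\<iota> = 1 \<or> \<iota> = \<i>" "\<iota>\<^sup>2 = (- 1) ^ n * \<epsilon>" by blast
 \<comment> \<open>Inversion of \<open>z\<close> multiplies \<open>V\<close> by
   \<open>(- 1) ^ n * \<epsilon> / W ^ 2\<close>; as \<open>\<iota>\<close> is a square root of this
   sign, \<open>B\<close> is the required square root.\<close>
 define B where "B = \<iota> / W"
 have pos: "q > 0" using p_gt_2 by simp
 \<comment> \<open>The third root of unity in \<open>galois_extend_int\<close> is taken to be
   1.\<close>
 have one_nat: "(1::complex) ^ nat 1 = 1" by simp
 have cop: "coprime 8 q" "coprime 8 (1::int)" "coprime q 1"
 proof -
  have "coprime (2 ^ 3) q" using odd_p unfolding coprime_power_left_iff by simp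
  then show "coprime 8 q" by simp
 qed simp_all
 have c5: "coprime (5::int) 8"
 proof (rule coprimeI)
  fix d :: int assume "d dvd 5" "d dvd 8"
  then have "d dvd 2 * 8 - 3 * 5" by (intro dvd_diff dvd_mult)
  then show "is_unit d" by simp
 qed
 have ch: "coprime h q" using prime_imp_coprime[OF prime_p h(1)] by (simp add: coprime_commute)
 note ext = galois_extend_int[OF z8 power_nat_p one_nat _ pos _ cop]
 \<comment> \<open>\<open>r\<close> negates \<open>z\<close>, so it fixes \<open>\<i>\<close> and
   negates the square root of 2. The automorphism \<open>c\<close> below inverts \<open>z\<close>,
   so it negates \<open>\<i>\<close> and fixes the square root of 2.\<close>
 obtain r where r: "r \<in> carrier G_Q" "r z = z powi 5" "r y = y powi 1"
  by (rule ext[of 5 1 1]) (use c5 in auto)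
 obtain t where t: "t \<in> carrier G_Q" "t z = z powi 1" "t y = y powi h"
  by (rule ext[of 1 h 1]) (use ch in auto)
 obtain c where c: "c \<in> carrier G_Q" "c z = z powi (- 1)" "c y = y powi 1"
  by (rule ext[of "- 1" 1 1]) auto
 have rz: "r z = - z" "r y = y" using r(2,3) unfolding z_powi_5 by simp_all
 have tz: "t z = z" using t by simp
 have cz: "c z = inverse z" "c y = y" using c by (simp_all add: power_int_minus)
 have ui: "u \<i> = (u z)\<^sup>2" if "u \<in> carrier G_Q" for u
  using gal_power[OF Qbar that z_Qbar, of 2] by (simp add: z_square)
 have ri: "r \<i> = \<i>" and ti: "t \<i> = \<i>" and ci: "c \<i> = - \<i>"
  unfolding ui[OF r(1)] ui[OF t(1)] ui[OF c(1)] rz tz cz by (simp_all add: z_square power_inverse)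
 have iQ: "\<i> \<in> Qbar" by (simp add: Qbar_def)
 have fixy: "u w = w" if "u \<in> carrier G_Q" "u y = y" "\<And>K. is_subfield K ==> y \<in> K ==> w \<in> K" for u w
  by (rule gal_fixes[OF that(1) in_Qbar that(2) in_Qbar that(2)]) (rule that(3))
 have Uf: "u (U 4 / U 2) = U 4 / U 2" if "u \<in> carrier G_Q" "u y = y" for u
  using that by (rule fixy) (intro subfield_divide U_mem)
 have telef: "u (tele 2 h k) = tele 2 h k" if "u \<in> carrier G_Q" "u y = y" for u
  using that by (rule fixy) (rule tele_mem)
 note mQ = mems[OF Qbar z_Qbar in_Qbar] M_mem[OF Qbar z_Qbar in_Qbar] R_mem[OF Qbar z_Qbar in_Qbar] U_mem[OF Qbar in_Qbar]
 have A_alt: "A = (\<i> ^ m * (U 4 / U 2)) / R" by (simp add: A_def m_def)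
 have galA: "u A = (u \<i> ^ m * (U 4 / U 2)) / u R" if "u \<in> carrier G_Q" "u y = y" for u
  unfolding A_alt
  using mQ iQ gal_divide[OF Qbar that(1), of "\<i> ^ m * (U 4 / U 2)" R] gal_times[OF that(1), of "\<i> ^ m" "U 4 / U 2"]
   gal_power[OF Qbar that(1) iQ, of m] Uf[OF that] subfieldD(4)[OF Qbar] subfield_divide[OF Qbar] subfield_power[OF Qbar]
  by simp
 have \<iota>Q: "\<iota> \<in> Qbar" using \<iota>(1) iQ subfieldD(2)[OF Qbar] by auto
 have galB: "u B = u \<iota> / u W" if "u \<in> carrier G_Q" for u
  unfolding B_def by (rule gal_divide[OF Qbar that \<iota>Q mQ(1)])
 have \<iota>f: "u \<iota> = \<iota>" if "u \<in> carrier G_Q" "u \<i> = \<i>" for u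
  using \<iota>(1) that gal_1[OF Qbar that(1)] by auto
 have rW: "r W = (- 1) ^ n * W"
  using gal_prod_t1[OF r(1), of "\<lambda>b. b" "half q"] by (simp add: W_def rz th_minus_z prod_uminus n_def)
 have rC: "r C = (- 1) ^ n * C"
  unfolding gal_C[OF r(1)] rz th_minus_z unfolding C_def n_def by (rule power_minus)
 have rR: "r R = (- 1) ^ m * R"
  using gal_prod_t1[OF r(1), of "\<lambda>b. - (h * b)" "uppers q h"] by (simp add: R_def rz th_minus_z prod_uminus m_def)
 have cW: "c W = W'"
  using gal_prod_t1[OF c(1), of "\<lambda>b. b" "half q"] by (simp add: W_def W'_def cz th_inverse_z)
 have cC: "c C = (- 1) ^ n * C"
  unfolding gal_C[OF c(1)] cz th_inverse_z minus_zero unfolding C_def n_def by (rule power_minus)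
 have cR: "c R = (- 1) ^ m * M"
  using gal_prod_t1[OF c(1), of "\<lambda>b. - (h * b)" "uppers q h"] by (simp add: R_def M_def cz th_inverse_z prod_uminus m_def)
 have tW: "t W * R = W * M"
  using gal_prod_t1[OF t(1), of "\<lambda>b. b" "half q"] W_scale by (simp add: W_def tz t(3) th_powi_right)
 have tC: "t C = C"
  unfolding gal_C[OF t(1)] tz t(3) th_powi_right unfolding C_def by simp
 have tT: "t (tele 2 h k) * U 2 = tele 2 h k * U 4"
 proof -
  have "[2 * h ^ k = 2 * 2] (mod q)" by (rule cong_scalar_left[OF hk])
  then show ?thesis unfolding U_def using gal_tele[OF t(1) t(3), of 2 k 4] by simp
 qed
 have sg: "(- 1) ^ j * (- 1) ^ j = (1::complex)" for j by (simp flip: power_mult_distrib)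
 have rV: "r V = V"
  unfolding gal_V_mult[OF r(1)] rW rC telef[OF r(1) rz(2)] unfolding V_def by (cases "even n") simp_all
 have tV: "t V = A\<^sup>2 * V"
 proof -
  have "t V * (R * R * U 2 * U 2) = (t W * R) * (R * U 2) * C * (t (tele 2 h k) * U 2)"
   unfolding gal_V_mult[OF t(1)] tC by (simp only: mult_ac)
  also have "\<dots> = (M * R * U 2) * W * C * tele 2 h k * U 4" unfolding tW tT by (simp only: mult_ac)
  also have "\<dots> = (- 1) ^ m * U 4 * U 4 * V" unfolding MRU V_def m_def by (simp only: mult_ac)
  finally have "t V = ((- 1) ^ m * U 4 * U 4) / (R * R * U 2 * U 2) * V"
   using R_nonzero U_nonzero by (simp add: field_simps)
  moreover have "(\<i> ^ m)\<^sup>2 = (- 1) ^ m" by (metis i_squared mult.commute power_mult power2_i)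
  then have "A\<^sup>2 = ((- 1) ^ m * U 4 * U 4) / (R * R * U 2 * U 2)"
   by (simp add: A_alt power_mult_distrib power_divide) (simp add: power2_eq_square mult_ac)
  ultimately show ?thesis by simp
 qed
 have cV: "c V = B\<^sup>2 * V"
 proof -
  have "W' = \<epsilon> / W" using e(2) W_nonzero by (simp add: field_simps)
  then have "c V = (- 1) ^ n * \<epsilon> / (W * W) * V"
   unfolding gal_V_mult[OF c(1)] cW cC telef[OF c(1) cz(2)] unfolding V_def using W_nonzero by (simp add: field_simps)
  then show ?thesis unfolding B_def power_divide \<iota>(2) by (simp add: power2_eq_square)
 qed
 have sq: "complex_of_real (sqrt (real (nat q))) = of_real (sqrt (of_int q))" using pos by simp
 have two: "u (z + inverse z) = u z + inverse (u z)" if "u \<in> carrier G_Q" for u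
  using gal_add[OF that, of z "inverse z"] gal_inverse[OF Qbar that z_Qbar] z_Qbar subfieldD(6)[OF Qbar z_Qbar] by simp
 have one: "u 1 = 1" if "u \<in> carrier G_Q" for u using gal_1[OF Qbar that] .
 show ?thesis
 proof (rule D_map_of_three_generators[where X = "{z, y}" and ?A1.0 = 1 and ?A2.0 = A and ?A3.0 = B
    and ?s1.0 = r and ?s2.0 = t and ?s3.0 = c
    and ?P1.0 = 1 and ?P2.0 = 0 and ?P3.0 = 0
    and ?Q1.0 = 0 and ?Q2.0 = "of_nat m" and ?Q3.0 = "of_nat n"])
  show "V \<noteq> 0" by (rule V_nonzero)
  show "(2::nat) > 0" "nat q > 0" using pos by simp_all
  show "{z, y} \<subseteq> Qab" using z_Qab in_Qab by simp
  show "V \<in> K \<and> complex_of_real (sqrt (real 2)) \<in> K \<and> complex_of_real (sqrt (real (nat q))) \<in> K \<and>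
    1 \<in> K \<and> A \<in> K \<and> B \<in> K" if K: "is_subfield K" "{z, y} \<subseteq> K" for K
  proof -
   have m: "z \<in> K" "y \<in> K" using K(2) by auto
   have "\<iota> \<in> K" using \<iota>(1) i_mem[OF K(1) m(1)] subfieldD(2)[OF K(1)] by auto
   then have "B \<in> K" unfolding B_def by (intro subfield_divide[OF K(1)] mems(1)[OF K(1) m])
   moreover have "z + inverse z \<in> K" using subfieldD(3,6)[OF K(1)] m by simp
   ultimately show ?thesis unfolding sq sqrt_2
    using mems(4)[OF K(1) m] sqrt_in_subfield[OF K(1) m(2) i_mem[OF K(1) m(1)]] subfieldD(2)[OF K(1)] A_mem[OF K(1) m] by blast
  qed
  show "r \<in> carrier G_Q" "t \<in> carrier G_Q" "c \<in> carrier G_Q" by (fact r t c)+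
  show "r V = 1\<^sup>2 * V" "t V = A\<^sup>2 * V" "c V = B\<^sup>2 * V" using rV tV cV by simp_all
  show "r (of_real (sqrt (real 2))) = bit_sign 1 * of_real (sqrt (real 2))"
   unfolding sqrt_2 two[OF r(1)] rz by simp
  show "t (of_real (sqrt (real 2))) = bit_sign 0 * of_real (sqrt (real 2))"
   unfolding sqrt_2 two[OF t(1)] tz by simp
  show "c (of_real (sqrt (real 2))) = bit_sign 0 * of_real (sqrt (real 2))"
   unfolding sqrt_2 two[OF c(1)] cz by simp
  show "r (of_real (sqrt (real (nat q)))) = bit_sign 0 * of_real (sqrt (real (nat q)))"
   unfolding sq using gal_sqrt[OF r(1,3) q_not_dvd_1, of 0] ri by (simp add: uppers_1)
  show "t (of_real (sqrt (real (nat q)))) = bit_sign (of_nat m) * of_real (sqrt (real (nat q)))"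
   unfolding sq bit_sign_of_nat using gal_sqrt[OF t(1,3) h(1), of 0] ti by (simp add: m_def)
  show "c (of_real (sqrt (real (nat q)))) = bit_sign (of_nat n) * of_real (sqrt (real (nat q)))"
   unfolding sq bit_sign_of_nat using gal_sqrt[OF c(1,3) q_not_dvd_1, of 1] ci by (simp add: uppers_1 n_def)
  show "t 1 * A = bit_sign (1 * of_nat m + 0 * 0) * (r A * 1)"
  proof -
   have "1 * of_nat m + 0 * 0 = (of_nat m :: bit)" unfolding mult_zero_left add_0_right by (rule mult_1_left)
   moreover have "A = (- 1) ^ m * r A"
    unfolding galA[OF r(1) rz(2)] ri rR unfolding A_alt using sg[of m] by (cases "even m") simp_all
   ultimately show ?thesis by (simp only: bit_sign_of_nat one[OF t(1)] mult_1_left mult_1_right)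
  qed
  show "c 1 * B = bit_sign (1 * of_nat n + 0 * 0) * (r B * 1)"
  proof -
   have "1 * of_nat n + 0 * 0 = (of_nat n :: bit)" unfolding mult_zero_left add_0_right by (rule mult_1_left)
   moreover have "B = (- 1) ^ n * r B"
    unfolding galB[OF r(1)] \<iota>f[OF r(1) ri] rW unfolding B_def using sg[of n] by (cases "even n") simp_all
   ultimately show ?thesis by (simp only: bit_sign_of_nat one[OF c(1)] mult_1_left mult_1_right)
  qed
  \<comment> \<open>No sign arises: \<open>t\<close> turns \<open>1 / W\<close> into
    \<open>R / (W * M)\<close>, while \<open>c\<close> turns the \<open>R\<close> in the denominator
    of \<open>A\<close> into \<open>M\<close> up to the sign that the power of \<open>\<i>\<close>
    absorbs.\<close>
  show "c A * B = bit_sign (0 * of_nat n + 0 * of_nat m) * (t B * A)"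
  proof -
   have "t W = W * M / R" using tW R_nonzero by (simp add: field_simps)
   then have "t B * A = (\<iota> * (\<i> ^ m * (U 4 / U 2))) / (W * M)"
    unfolding galB[OF t(1)] \<iota>f[OF t(1) ti] A_alt using W_nonzero M_nonzero R_nonzero by (simp add: field_simps)
   moreover have "c A = (\<i> ^ m * (U 4 / U 2)) / M"
    unfolding galA[OF c(1) cz(2)] ci cR power_minus[of \<i>] by (cases "even m") simp_all
   then have "c A * B = (\<iota> * (\<i> ^ m * (U 4 / U 2))) / (W * M)" unfolding B_def by (simp add: mult_ac)
   ultimately show ?thesis unfolding mult_zero_left add_0_left by simp
  qed
  fix u assume u: "u \<in> carrier G_Q"
  obtain b' where b': "\<not> q dvd b'" "u y = y powi b'" by (rule gal_root[OF u])
  obtain b where b: "[b' = h ^ b] (mod q)" using h(2)[OF b'(1)] by blast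
  have "(u \<i>)\<^sup>2 = \<i>\<^sup>2"
   using gal_power[OF Qbar u iQ, of 2] gal_minus[OF Qbar u subfieldD(2)[OF Qbar]] one[OF u] by simp
  then have "u \<i> = \<i> \<or> u \<i> = - \<i>" unfolding power2_eq_iff .
  then have "(u z)\<^sup>2 = z\<^sup>2 \<or> (u z)\<^sup>2 = (inverse z)\<^sup>2"
   unfolding ui[OF u] z_inverse_square unfolding z_square .
  then have "u z = z \<or> u z = - z \<or> u z = inverse z \<or> u z = - inverse z" unfolding power2_eq_iff by blast
  \<comment> \<open>The units modulo 8 are generated by 5 and -1.\<close>
  then obtain a d :: nat where ad: "u z = z powi (5 ^ a * (- 1) ^ d)"
  proof (elim disjE)
   assume "u z = z" then show thesis using that[of 0 0] by simp
  next
   assume "u z = - z" then show thesis using that[of 1 0] z_powi_5 by simp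
  next
   assume "u z = inverse z" then show thesis using that[of 0 1] by (simp add: power_int_minus)
  next
   assume "u z = - inverse z" then show thesis using that[of 1 1] z_powi_minus_5 by simp
  qed
  have "\<forall>w\<in>{z, y}. u w = (r [^]\<^bsub>G_Q\<^esub> a \<cdot> (t [^]\<^bsub>G_Q\<^esub> b \<cdot> c [^]\<^bsub>G_Q\<^esub> d)) w"
  proof -
   note it = gal_iterate[OF r(1) z_Qbar r(2)] gal_iterate[OF r(1) in_Qbar r(3)]
    gal_iterate[OF t(1) z_Qbar t(2)] gal_iterate[OF t(1) in_Qbar t(3)]
    gal_iterate[OF c(1) z_Qbar c(2)] gal_iterate[OF c(1) in_Qbar c(3)]
   note it' = it[unfolded power_one power_int_1_right]
   have G: "r [^]\<^bsub>G_Q\<^esub> a \<in> carrier G_Q" "t [^]\<^bsub>G_Q\<^esub> b \<in> carrier G_Q" "c [^]\<^bsub>G_Q\<^esub> d \<in> carrier G_Q" using r t c by simp_all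
   have pw: "y powi b' = y powi (h ^ b)" using b by (simp add: powi_eq_iff)
   have mem: "w powi e \<in> Qbar" if "w \<in> Qbar" for w e using subfield_power_int[OF Qbar that] .
   have "(r [^]\<^bsub>G_Q\<^esub> a) (z powi e) = z powi (5 ^ a * e)" "(t [^]\<^bsub>G_Q\<^esub> b) (z powi e) = z powi e"
    "(r [^]\<^bsub>G_Q\<^esub> a) (y powi e) = y powi e" for e
    using gal_power_int[OF Qbar G(1) z_Qbar, of e] gal_power_int[OF Qbar G(2) z_Qbar, of e] gal_power_int[OF Qbar G(1) in_Qbar, of e]
    by (simp_all only: it' power_int_mult)
   then show ?thesis using G z_Qbar in_Qbar mem by (simp add: it' pw b'(2) ad)
  qed
  then show "\<exists>(a::nat) (b::nat) (d::nat). \<forall>w\<in>{z, y}.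
    u w = (r [^]\<^bsub>G_Q\<^esub> a \<cdot> (t [^]\<^bsub>G_Q\<^esub> b \<cdot> c [^]\<^bsub>G_Q\<^esub> d)) w" by blast
 qed
qed

end

section \<open>Reduction of the sine product for the prime 2\<close>

lemma prod_pairs:
 fixes f :: "nat \<Rightarrow> 'a :: comm_monoid_mult"
 shows "(\<Prod>j = 1..2 * e. f j) = (\<Prod>a = 1..e. f (2 * a - 1) * f (2 * a))"
 by (induction e) (simp_all add: mult_ac)

section \<open>Sines with denominator 4 q\<close>

context two_pair
begin

context
 assumes yy: "y\<^sup>2 = ee (1 / of_int q)"
begin

definition S :: "int \<Rightarrow> complex" where "S n = uu (of_int n / of_int (4 * q))"

lemma y_powi_double: "y powi (2 * b) = ee (of_int b / of_int q)"
proof -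
 have "y powi (2 * b) = (y\<^sup>2) powi b" by (simp add: power_int_mult)
 then show ?thesis by (simp add: yy ee_power_int)
qed

lemma S_notin: "\<not> 4 * q dvd n ==> (of_int n / of_int (4 * q) :: rat) \<notin> \<int>"
 using of_int_div_Ints[of "4 * q" n] p_pos by simp

lemma S_unit: "\<not> 4 * q dvd n ==> S n \<in> Qab \<and> S n \<noteq> 0"
 unfolding S_def using uu_mem[OF S_notin] by blast

lemma S_minus: "\<not> 4 * q dvd n ==> sq_eq (S (- n)) (S n)"
 unfolding S_def using uu_minus[OF S_notin, of n] by simp

lemma odd_not_dvd: assumes "odd n" shows "\<not> 4 * q dvd n"
 using assms by (auto elim!: dvdE)

lemma small_not_dvd: assumes "0 < n" "n < 4 * q" shows "\<not> 4 * q dvd n"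
 using assms zdvd_not_zless by blast

lemma z_root: "root_of_unity z"
 using z8 unfolding root_of_unity_def by (intro exI[of _ "nat 8"]) simp

lemma sq_eq_t1: "sq_eq (t1 b) (t1 b)"
 using t1_nonzero t1_mem[OF Qab z_Qab in_Qab] by (intro sq_eq_refl)

lemma sq_eq_od: "\<not> q dvd b ==> sq_eq (od y b) (od y b)"
 using od_mem[OF Qab in_Qab] by (intro sq_eq_refl) (simp_all add: od_eq_0_iff)

text \<open>\<open>ee\<close> takes at \<open>(q + 4 b) / (4 q)\<close> the value
  \<open>\<i> * y ^ (2 b)\<close>, which is the square of \<open>z * y ^ b\<close>.\<close>

lemma S_t1: "sq_eq (S (q + 4 * b)) (t1 b)"
proof -
 have "of_int (q + 4 * b) / of_int (4 * q) = 1 / 4 + (of_int b / of_int q :: rat)"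
  using p_pos by (simp add: field_simps)
 then have "S (q + 4 * b) = 1 - ee (1 / 4) * ee (of_int b / of_int q)" by (simp only: S_def uu_def ee_add)
 also have "ee (1 / 4) = z * z" by (simp add: z_def flip: ee_add)
 also have "ee (of_int b / of_int q) = y powi b * y powi b"
  using power_int_add[of y b b] nonzero by (simp flip: y_powi_double)
 also have "1 - z * z * (y powi b * y powi b) = (- (z * y powi b)) * t1 b"
  unfolding t1_alt using z_nonzero nonzero by (simp add: power_int_minus field_simps)
 finally have "S (q + 4 * b) = (- (z * y powi b)) * t1 b" .
 moreover have "sq_eq ((- (z * y powi b)) * t1 b) (t1 b)"
  by (intro sq_eq_root_of_unity root_of_unity_minus root_of_unity_mult root_of_unity_power_int z_root is_root_of_unity sq_eq_t1)
 ultimately show ?thesis by simp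
qed

lemma S_minus_t1: "sq_eq (S (- (q + 4 * b))) (t1 b)"
proof -
 have "odd (q + 4 * b)" using odd_p by simp
 from sq_eq_trans[OF S_minus[OF odd_not_dvd[OF this]] S_t1] show ?thesis .
qed

lemma uu_od: assumes "\<not> q dvd b" shows "sq_eq (uu (of_int b / of_int q)) (od y b)"
proof -
 have "uu (of_int b / of_int q) = 1 - y powi b * y powi b"
  using power_int_add[of y b b] nonzero by (simp add: uu_def flip: y_powi_double)
 also have "\<dots> = (- (y powi b)) * od y b" using nonzero by (simp add: od_def power_int_minus field_simps)
 finally show ?thesis
  using sq_eq_root_of_unity[OF root_of_unity_minus[OF root_of_unity_power_int[OF is_root_of_unity]] sq_eq_od[OF assms]] by simp
qed

lemma not_dvd_4: "\<not> q dvd 4"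
proof -
 have "\<not> q dvd 2 * 2" using not_dvd_mult q_not_dvd_2 by blast
 then show ?thesis by simp
qed

text \<open>The reflection formula read modulo squares.\<close>

lemma t1_flip: assumes "\<not> q dvd b" shows "sq_eq (t1 (- b)) (t1 b * (od y (4 * b) * od y (2 * b)))"
proof -
 have nd: "\<not> q dvd 2 * b" "\<not> q dvd 4 * b" using not_dvd_mult q_not_dvd_2 not_dvd_4 assms by blast+
 have "t1 (- b) = - od y (4 * b) / (t1 b * od y (2 * b))"
  using t1_reflection[of b] t1_nonzero[of b] nd(1) od_eq_0_iff by (simp add: field_simps)
 moreover have "sq_eq (- od y (4 * b) / (t1 b * od y (2 * b))) (od y (4 * b) * (t1 b * od y (2 * b)))"
  by (intro sq_eq_divide sq_eq_mult sq_eq_minus sq_eq_t1 sq_eq_od nd)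
 ultimately show ?thesis by (simp add: mult_ac)
qed

text \<open>One half modulo \<open>q\<close>.\<close>

definition hv :: int where "hv = (q + 1) div 2"

lemma hv: "2 * hv = q + 1" using odd_p by (auto simp: hv_def elim!: oddE)

lemma hv_not_dvd: "\<not> q dvd hv"
proof
 assume "q dvd hv"
 then have "q dvd 2 * hv - q" by (intro dvd_diff dvd_mult dvd_refl)
 then show False using hv q_not_dvd_1 by simp
qed

text \<open>Modulo squares the left side is \<open>1 + ee (l / (2 q))\<close>. For even
  \<open>l\<close> this is the quotient of \<open>1 - ee (l / q)\<close> by
  \<open>1 - ee (l / (2 q))\<close>; for odd \<open>l\<close> the sign is absorbed into the
  exponent, as \<open>(q + l) / 2\<close> is an integer. In both cases half of \<open>l\<close>
  modulo \<open>q\<close> is \<open>hv * l\<close>.\<close>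

lemma S_even:
 assumes l: "\<not> q dvd l"
 shows "sq_eq (S (2 * q - 2 * l)) (od y (hv * l) * (if even l then od y l else 1))"
proof -
 define a :: rat where "a = of_int (q + l) / of_int (2 * q)"
 have "a \<notin> \<int>"
 proof
  assume "a \<in> \<int>"
  then have "2 * q dvd q + l" using of_int_div_Ints[of "2 * q" "q + l"] p_pos by (simp add: a_def)
  then have "q dvd q + l" by (rule dvd_mult_right)
  then show False using l by simp
 qed
 moreover have "of_int (2 * q - 2 * l) / of_int (4 * q) = - a + of_int 1"
  using p_pos by (simp add: a_def field_simps)
 then have Sa: "S (2 * q - 2 * l) = uu (- a)" unfolding S_def by (simp only: uu_add_int)
 ultimately have 1: "sq_eq (S (2 * q - 2 * l)) (uu a)" using uu_minus by simp
 show ?thesis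
 proof (cases "even l")
  case True
  then obtain c where c: "l = 2 * c" by (elim evenE)
  have nc: "\<not> q dvd c" using l c by auto
  have "a = of_int c / of_int q + of_nat 1 / of_nat 2" using p_pos by (simp add: a_def c field_simps)
  moreover have "(\<Prod>k<2. uu (of_int c / of_int q + of_nat k / of_nat 2)) = uu (of_int l / of_int q)"
   using uu_prod[of 2 "of_int c / of_int q"] by (simp add: c)
  ultimately have "uu (of_int c / of_int q) * uu a = uu (of_int l / of_int q)"
   by (simp add: lessThan_nat_numeral mult.commute)
  moreover have "uu (of_int c / of_int q) \<noteq> 0" using sq_eqD[OF uu_od[OF nc]] by blast
  ultimately have "uu a = uu (of_int l / of_int q) / uu (of_int c / of_int q)" by (simp add: field_simps)
  moreover have "sq_eq (uu (of_int l / of_int q) / uu (of_int c / of_int q)) (od y l * od y c)"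
   by (intro sq_eq_divide uu_od l nc)
  moreover have "od y (hv * l) = od y c"
  proof (rule periodicD[OF od_periodic])
   have "hv * l - c = q * c" using hv by (simp add: c algebra_simps)
   then show "[hv * l = c] (mod q)" by (simp add: cong_iff_dvd_diff)
  qed
  ultimately show ?thesis using sq_eq_trans[OF 1] True by (simp add: mult.commute)
 next
  case False
  then obtain c where c: "q + l = 2 * c" using odd_p by (meson evenE odd_add even_add)
  have "a = of_int c / of_int q" using p_pos by (simp add: a_def c)
  moreover have "\<not> q dvd c"
  proof
   assume "q dvd c"
   then have "q dvd 2 * c - q" by (intro dvd_diff dvd_mult dvd_refl)
   moreover have "2 * c - q = l" using c by linarith
   ultimately show False using l by (simp only:)
  qed
  then have "sq_eq (uu (of_int c / of_int q)) (od y c)" by (rule uu_od)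
  moreover have "od y (hv * l) = od y c"
  proof (rule periodicD[OF od_periodic])
   obtain d where d: "l = 2 * d + 1" using False by (elim oddE)
   have "2 * (hv * l - c) = (2 * hv) * l - 2 * c" by (simp add: algebra_simps)
   also have "\<dots> = 2 * (q * d)" unfolding hv c[symmetric] by (simp add: d algebra_simps)
   finally have "hv * l - c = q * d" by simp
   then show "[hv * l = c] (mod q)" by (simp add: cong_iff_dvd_diff)
  qed
  ultimately show ?thesis using sq_eq_trans[OF 1] False by simp
 qed
qed

definition n :: nat where "n = (nat q - 1) div 2"

lemma n: "q = 2 * int n + 1"
 using odd_p p_gt_2 by (auto simp: n_def elim!: oddE)

lemma card_half_n: "card (half q) = n" using half_card_double n by simp

lemma half_nat: "prod F (half q) = (\<Prod>j = 1..n. F (int j))"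
 using prod_half_nat[of "nat q" F] odd_p p_pos by (simp add: n_def even_nat_iff)

text \<open>The first product runs over \<open>S (2 m)\<close> for all \<open>m\<close> from 1 to
  \<open>q - 1\<close>. Its lower half cancels against the second product, and its upper half is
  reflected to \<open>S (2 q - 2 l)\<close>. In \<open>S_even\<close> the factors with
  \<open>hv\<close> give all \<open>od y l\<close> up to sign, and the even \<open>l\<close> then
  occur twice.\<close>

lemma even_part:
 "sq_eq ((\<Prod>j\<in>half q. S (4 * j) * S (4 * j - 2)) * (\<Prod>j\<in>half q. S (2 * j)))
  (\<Prod>l\<in>half q. if even l then 1 else od y l)"
proof -
 define f where "f m = S (2 * int m)" for m
 define F where "F = (\<Prod>m = 1..n. f m)"
 have fu: "f m \<in> Qab \<and> f m \<noteq> 0" if "m \<in> {1..2 * n}" for m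
  unfolding f_def using that n by (intro S_unit small_not_dvd) auto
 have F: "F \<in> Qab" "F \<noteq> 0" unfolding F_def using fu by (auto intro!: subfield_prod[OF Qab])
 have F2: "(\<Prod>j\<in>half q. S (2 * j)) = F" unfolding half_nat F_def f_def by (rule refl)
 have "(\<Prod>j\<in>half q. S (4 * j) * S (4 * j - 2)) = (\<Prod>j = 1..n. f (2 * j - 1) * f (2 * j))"
  unfolding half_nat f_def by (rule prod.cong) (auto simp: of_nat_diff mult_ac)
 also have "\<dots> = (\<Prod>m = 1..2 * n. f m)" by (rule prod_pairs[symmetric])
 also have "{1..2 * n} = {1..n} \<union> {n + 1..2 * n}" by auto
 also have "prod f \<dots> = F * (\<Prod>m = n + 1..2 * n. f m)" unfolding F_def by (rule prod.union_disjoint) auto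
 also have "(\<Prod>m = n + 1..2 * n. f m) = (\<Prod>l\<in>half q. S (2 * q - 2 * l))"
 proof -
  obtain N where N: "n = N" "q = 2 * int N + 1" by (rule that[OF refl n])
  have f: "f m = S (4 * int N + 2 - 2 * int (2 * N + 1 - m))" if "m \<le> 2 * N" for m
   unfolding f_def using that by (simp add: of_nat_diff)
  have "(\<Prod>m = N + 1..2 * N. f m) = (\<Prod>l = 1..N. S (4 * int N + 2 - 2 * int l))"
   by (rule prod.reindex_bij_witness[of _ "\<lambda>l. 2 * N + 1 - l" "\<lambda>m. 2 * N + 1 - m"]) (auto simp: f)
  moreover have "2 * q - 2 * l = 4 * int N + 2 - 2 * l" for l using N(2) by linarith
  ultimately show ?thesis unfolding half_nat N(1) by (simp only:)
 qed
 finally have "(\<Prod>j\<in>half q. S (4 * j) * S (4 * j - 2)) = F * (\<Prod>l\<in>half q. S (2 * q - 2 * l))" .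
 then have e: "(\<Prod>j\<in>half q. S (4 * j) * S (4 * j - 2)) * (\<Prod>j\<in>half q. S (2 * j)) = F * (F * (\<Prod>l\<in>half q. S (2 * q - 2 * l)))"
  unfolding F2 by (simp only: mult.commute[of _ F])
 define K where "K = (\<Prod>l\<in>half q. od y l)"
 define E where "E = (\<Prod>l\<in>half q. if even l then od y l else 1)"
 define D where "D = (\<Prod>l\<in>half q. if even l then 1 else od y l)"
 have u: "sq_eq (od y l) (od y l)" if "l \<in> half q" for l using sq_eq_od[OF half_not_dvd[OF that]] .
 have KED: "K = E * D" unfolding K_def E_def D_def prod.distrib[symmetric] by (rule prod.cong) auto
 have EE: "sq_eq E E" unfolding E_def by (rule sq_eq_prod) (use u sq_eq_1 in auto)
 have DD: "sq_eq D D" unfolding D_def by (rule sq_eq_prod) (use u sq_eq_1 in auto)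
 have "sq_eq (\<Prod>l\<in>half q. S (2 * q - 2 * l)) (\<Prod>l\<in>half q. od y (hv * l) * (if even l then od y l else 1))"
  by (rule sq_eq_prod, rule S_even, rule half_not_dvd)
 also have "\<dots> = (- 1) ^ card (uppers q hv) * (E * (E * D))"
  unfolding prod.distrib prod_od_scale[OF hv_not_dvd] K_def[symmetric] E_def[symmetric] KED by (simp only: mult_ac)
 also have "sq_eq \<dots> D"
  by (rule sq_eq_root_of_unity[OF root_of_unity_power[OF root_of_unity_minus_1] sq_eq_cancel_left])
   (use sq_eqD[OF EE] DD in auto)
 finally show ?thesis unfolding e D_def[symmetric] by (rule sq_eq_cancel_left[OF F])
qed

text \<open>Here \<open>q = 4 e + 1\<close>. The odd numbers \<open>2 j - 1\<close> are of the form
  \<open>4 a - 3\<close> or \<open>4 a - 1\<close>, and the latter cancel against the first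
  \<open>e\<close> factors of the other product. Modulo 4 the number \<open>4 a - 3\<close> is
  \<open>q\<close> and \<open>4 j - 1\<close> is \<open>- q\<close>, so all remaining arguments are
  \<open>q + 4 b\<close> up to sign; reindexing meets each \<open>b\<close> of the half system once,
  negated exactly when \<open>4 b < q\<close>.\<close>

lemma odd_part_1:
 assumes q: "n = 2 * e"
 shows "sq_eq ((\<Prod>j\<in>half q. S (4 * j - 1)) * (\<Prod>j\<in>half q. S (2 * j - 1)))
  (\<Prod>b\<in>half q. if 4 * b < q then t1 (- b) else t1 b)"
proof -
 have qe: "q = 4 * int e + 1" using n[unfolded q] by simp
 define g where "g j = S (4 * int j - 1)" for j :: nat
 define f where "f j = S (2 * int j - 1)" for j :: nat
 define G where "G = (\<Prod>j = 1..e. g j)"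
 have gu: "g j \<in> Qab \<and> g j \<noteq> 0" for j unfolding g_def by (intro S_unit odd_not_dvd) simp
 have G: "G \<in> Qab" "G \<noteq> 0" unfolding G_def using gu by (auto intro!: subfield_prod[OF Qab])
 have "(\<Prod>j = 1..2 * e. f j) = (\<Prod>a = 1..e. S (4 * int a - 3) * g a)"
  unfolding prod_pairs by (rule prod.cong) (auto simp: f_def g_def of_nat_diff algebra_simps)
 then have f: "(\<Prod>j = 1..2 * e. f j) = (\<Prod>a = 1..e. S (4 * int a - 3)) * G" by (simp add: prod.distrib G_def)
 have s: "{1..2 * e} = {1..e} \<union> {e + 1..2 * e}" by auto
 have g: "(\<Prod>j = 1..2 * e. g j) = G * (\<Prod>j = e + 1..2 * e. g j)"
  unfolding G_def s by (rule prod.union_disjoint) auto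
 have "(\<Prod>j\<in>half q. S (4 * j - 1)) * (\<Prod>j\<in>half q. S (2 * j - 1)) =
   G * (G * ((\<Prod>a = 1..e. S (4 * int a - 3)) * (\<Prod>j = e + 1..2 * e. g j)))"
  unfolding half_nat q using f g by (simp add: f_def g_def mult_ac)
 also have "sq_eq \<dots> ((\<Prod>a = 1..e. t1 (- (int e + 1 - int a))) * (\<Prod>j = e + 1..2 * e. t1 (3 * int e + 1 - int j)))"
 proof (intro sq_eq_cancel_left G sq_eq_mult sq_eq_prod)
  fix a
  have "4 * int a - 3 = q + 4 * (- (int e + 1 - int a))" using qe by simp
  then show "sq_eq (S (4 * int a - 3)) (t1 (- (int e + 1 - int a)))" using S_t1 by metis
 next
  fix j
  have "4 * int j - 1 = - (q + 4 * (- (int j + int e)))" using qe by simp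
  then have "sq_eq (g j) (t1 (- (int j + int e)))" unfolding g_def using S_minus_t1 by metis
  moreover have "t1 (- (int j + int e)) = t1 (3 * int e + 1 - int j)"
  proof (rule periodicD[OF t1_periodic])
   have "- (int j + int e) - (3 * int e + 1 - int j) = - q" using qe by simp
   then show "[- (int j + int e) = 3 * int e + 1 - int j] (mod q)"
    by (simp only: cong_iff_dvd_diff dvd_minus_iff dvd_refl)
  qed
  ultimately show "sq_eq (g j) (t1 (3 * int e + 1 - int j))" by simp
 qed
 also have "(\<Prod>a = 1..e. t1 (- (int e + 1 - int a))) = (\<Prod>b = 1..e. if 4 * int b < q then t1 (- int b) else t1 (int b))"
  by (rule prod.reindex_bij_witness[of _ "\<lambda>a. e + 1 - a" "\<lambda>a. e + 1 - a"]) (auto simp: qe of_nat_diff algebra_simps)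
 also have "(\<Prod>j = e + 1..2 * e. t1 (3 * int e + 1 - int j)) = (\<Prod>b = e + 1..2 * e. if 4 * int b < q then t1 (- int b) else t1 (int b))"
  by (rule prod.reindex_bij_witness[of _ "\<lambda>a. 3 * e + 1 - a" "\<lambda>a. 3 * e + 1 - a"]) (auto simp: qe of_nat_diff algebra_simps)
 also have "(\<Prod>b = 1..e. if 4 * int b < q then t1 (- int b) else t1 (int b)) *
   (\<Prod>b = e + 1..2 * e. if 4 * int b < q then t1 (- int b) else t1 (int b)) =
   (\<Prod>b\<in>half q. if 4 * b < q then t1 (- b) else t1 b)"
  unfolding half_nat q s by (rule prod.union_disjoint[symmetric]) auto
 finally show ?thesis .
qed

text \<open>Here \<open>q = 4 e + 3\<close>, and the two classes modulo 4 change roles, so that the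
  negated \<open>b\<close> are those with \<open>4 b > q\<close>. At \<open>j = e + 1\<close> the
  argument \<open>4 j - 1\<close> is \<open>q\<close> itself, which corresponds to
  \<open>b = 0\<close> and gives the extra factor \<open>t1 0\<close>.\<close>

lemma odd_part_3:
 assumes q: "n = 2 * e + 1"
 shows "sq_eq ((\<Prod>j\<in>half q. S (4 * j - 1)) * (\<Prod>j\<in>half q. S (2 * j - 1)))
  (t1 0 * (\<Prod>b\<in>half q. if 4 * b < q then t1 b else t1 (- b)))"
proof -
 have qe: "q = 4 * int e + 3" using n[unfolded q] by simp
 define g where "g j = S (4 * int j - 1)" for j :: nat
 define f where "f j = S (2 * int j - 1)" for j :: nat
 define G where "G = (\<Prod>j = 1..e. g j)"
 have gu: "g j \<in> Qab \<and> g j \<noteq> 0" for j unfolding g_def by (intro S_unit odd_not_dvd) simp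
 have G: "G \<in> Qab" "G \<noteq> 0" unfolding G_def using gu by (auto intro!: subfield_prod[OF Qab])
 have "(\<Prod>j = 1..2 * e. f j) = (\<Prod>a = 1..e. S (4 * int a - 3) * g a)"
  unfolding prod_pairs by (rule prod.cong) (auto simp: f_def g_def of_nat_diff algebra_simps)
 then have "(\<Prod>j = 1..2 * e + 1. f j) = (\<Prod>a = 1..e. S (4 * int a - 3)) * G * S (4 * int (e + 1) - 3)"
  by (simp add: prod.distrib G_def f_def algebra_simps)
 then have f: "(\<Prod>j = 1..2 * e + 1. f j) = (\<Prod>a = 1..e + 1. S (4 * int a - 3)) * G" by (simp add: mult_ac)
 have s: "{1..2 * e + 1} = {1..e} \<union> {e + 1..2 * e + 1}" by auto
 have g: "(\<Prod>j = 1..2 * e + 1. g j) = G * (\<Prod>j = e + 1..2 * e + 1. g j)"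
  unfolding G_def s by (rule prod.union_disjoint) auto
 have "(\<Prod>j\<in>half q. S (4 * j - 1)) * (\<Prod>j\<in>half q. S (2 * j - 1)) = (\<Prod>j = 1..2 * e + 1. g j) * (\<Prod>j = 1..2 * e + 1. f j)"
  unfolding half_nat q f_def g_def by (rule refl)
 also have "\<dots> = G * (G * ((\<Prod>j = e + 1..2 * e + 1. g j) * (\<Prod>a = 1..e + 1. S (4 * int a - 3))))"
  unfolding f g by (simp only: mult_ac)
 also have "sq_eq \<dots> ((\<Prod>j = e + 1..2 * e + 1. t1 (int j - int e - 1)) * (\<Prod>a = 1..e + 1. t1 (- (int e + int a))))"
 proof (intro sq_eq_cancel_left G sq_eq_mult sq_eq_prod)
  fix a
  have "4 * int a - 3 = - (q + 4 * (- (int e + int a)))" using qe by simp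
  then show "sq_eq (S (4 * int a - 3)) (t1 (- (int e + int a)))" using S_minus_t1 by metis
 next
  fix j
  have "4 * int j - 1 = q + 4 * (int j - int e - 1)" using qe by simp
  then show "sq_eq (g j) (t1 (int j - int e - 1))" unfolding g_def using S_t1 by metis
 qed
 also have "(\<Prod>j = e + 1..2 * e + 1. t1 (int j - int e - 1)) = (\<Prod>b = 0..e. if 4 * int b < q then t1 (int b) else t1 (- int b))"
  by (rule prod.reindex_bij_witness[of _ "\<lambda>b. b + e + 1" "\<lambda>j. j - e - 1"]) (auto simp: qe of_nat_diff algebra_simps)
 also have "\<dots> = t1 0 * (\<Prod>b = 1..e. if 4 * int b < q then t1 (int b) else t1 (- int b))"
  by (subst prod.atLeast_Suc_atMost) (use p_pos in simp_all)
 also have "(\<Prod>a = 1..e + 1. t1 (- (int e + int a))) = (\<Prod>b = e + 1..2 * e + 1. if 4 * int b < q then t1 (int b) else t1 (- int b))"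
  by (rule prod.reindex_bij_witness[of _ "\<lambda>b. b - e" "\<lambda>a. a + e"]) (auto simp: qe of_nat_diff algebra_simps)
 also have "t1 0 * (\<Prod>b = 1..e. if 4 * int b < q then t1 (int b) else t1 (- int b)) *
   (\<Prod>b = e + 1..2 * e + 1. if 4 * int b < q then t1 (int b) else t1 (- int b)) =
   t1 0 * (\<Prod>b\<in>half q. if 4 * b < q then t1 b else t1 (- b))"
  unfolding half_nat q s by (subst prod.union_disjoint) (auto simp: mult_ac)
 finally show ?thesis .
qed

text \<open>\<open>L\<close> and \<open>H\<close> stand for \<open>4 b < q\<close> and
  \<open>4 b > q\<close>, and the digits for \<open>od y (2 b)\<close> and
  \<open>od y (4 b)\<close>. Doubling maps the low \<open>b\<close> onto the even \<open>l\<close>,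
  so \<open>L2 = E\<close>; by Gauss' lemma \<open>L2 * H2\<close> and \<open>L4 * H4\<close> equal
  \<open>K = E * D\<close> up to sign. Modulo squares this leaves \<open>W * H4\<close> and, for odd
  \<open>n\<close>, one factor \<open>t1 0\<close>, just as \<open>C\<close> is a square or
  \<open>t1 0\<close> times a square. Finally \<open>H4\<close> is the product over the sign changes
  of 2, which the telescoping product replaces.\<close>

lemma total:
 "sq_eq (((\<Prod>j\<in>half q. S (4 * j - 1)) * (\<Prod>j\<in>half q. S (2 * j - 1))) *
   ((\<Prod>j\<in>half q. S (4 * j) * S (4 * j - 2)) * (\<Prod>j\<in>half q. S (2 * j)))) V"
proof -
 define L4 H4 L2 H2 D E K where "L4 = (\<Prod>b\<in>half q. if 4 * b < q then od y (4 * b) else 1)"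
  and "H4 = (\<Prod>b\<in>half q. if 4 * b < q then 1 else od y (4 * b))"
  and "L2 = (\<Prod>b\<in>half q. if 4 * b < q then od y (2 * b) else 1)"
  and "H2 = (\<Prod>b\<in>half q. if 4 * b < q then 1 else od y (2 * b))"
  and "D = (\<Prod>l\<in>half q. if even l then 1 else od y l)"
  and "E = (\<Prod>l\<in>half q. if even l then od y l else 1)"
  and "K = (\<Prod>l\<in>half q. od y l)"
 have nd: "\<not> q dvd b" "\<not> q dvd 2 * b" "\<not> q dvd 4 * b" if "b \<in> half q" for b
  using half_not_dvd[OF that] not_dvd_mult q_not_dvd_2 not_dvd_4 by blast+
 have u: "sq_eq L4 L4" "sq_eq H4 H4" "sq_eq L2 L2" "sq_eq D D"
  unfolding L4_def H4_def L2_def D_def by (rule sq_eq_prod, use sq_eq_od nd sq_eq_1 in simp)+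
 have WW: "sq_eq W W" unfolding W_def by (rule sq_eq_prod) (rule sq_eq_t1)
 have KED: "K = E * D" unfolding K_def E_def D_def prod.distrib[symmetric] by (rule prod.cong) auto
 have 4: "L4 * H4 = (- 1) ^ card (uppers q 4) * K"
 proof -
  have "L4 * H4 = (\<Prod>b\<in>half q. od y (4 * b))" unfolding L4_def H4_def prod.distrib[symmetric] by (rule prod.cong) auto
  then show ?thesis unfolding prod_od_scale[OF not_dvd_4] K_def .
 qed
 have 2: "L2 * H2 = (- 1) ^ card (uppers q 2) * K"
 proof -
  have "L2 * H2 = (\<Prod>b\<in>half q. od y (2 * b))" unfolding L2_def H2_def prod.distrib[symmetric] by (rule prod.cong) auto
  then show ?thesis unfolding prod_od_scale[OF q_not_dvd_2] K_def .
 qed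
 have LE: "L2 = E"
 proof -
  have "L2 = (\<Prod>b\<in>{b \<in> half q. 4 * b < q}. od y (2 * b))" unfolding L2_def by (rule prod.inter_filter[symmetric]) simp
  also have "\<dots> = (\<Prod>l\<in>{l \<in> half q. even l}. od y l)"
   by (rule prod.reindex_bij_witness[of _ "\<lambda>l. l div 2" "\<lambda>b. 2 * b"]) (auto simp: half_iff elim!: evenE)
  also have "\<dots> = E" unfolding E_def by (rule prod.inter_filter) simp
  finally show ?thesis .
 qed
 have H4U: "H4 = upper_prod (od y) 2 2"
 proof -
  have "upper q (2 * b) \<longleftrightarrow> \<not> 4 * b < q" if "b \<in> half q" for b
  proof -
   have "(2 * b) mod q = 2 * b" using that by (intro mod_pos_pos_trivial) (auto simp: half_iff)
   moreover have "4 * b \<noteq> q" using odd_p by auto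
   ultimately show ?thesis by (auto simp: upper_def)
  qed
  then show ?thesis unfolding H4_def upper_prod_alt by (intro prod.cong) auto
 qed
 have H4t: "sq_eq H4 (tele 2 h k)" unfolding H4U by (rule upper_prod_tele[OF q_not_dvd_2 h(1) hk])
 have L4H: "sq_eq (L4 * H4) (L4 * H4)" using sq_eq_mult[OF u(1,2)] .
 \<comment> \<open>Common end of both cases: once \<open>even_part\<close> has supplied
   \<open>D\<close>, it suffices to reach \<open>C * (W * H4)\<close>.\<close>
 have cls: "sq_eq (((\<Prod>j\<in>half q. S (4 * j - 1)) * (\<Prod>j\<in>half q. S (2 * j - 1)))) (T * (W * P)) ==> sq_eq (T * (W * P) * D) (C * (W * H4)) ==> ?thesis" for T P
 proof -
  assume a: "sq_eq (((\<Prod>j\<in>half q. S (4 * j - 1)) * (\<Prod>j\<in>half q. S (2 * j - 1)))) (T * (W * P))"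
   and b: "sq_eq (T * (W * P) * D) (C * (W * H4))"
  note sq_eq_trans[OF sq_eq_mult[OF a even_part[folded D_def]] b]
  also have "sq_eq (C * (W * H4)) (C * (W * tele 2 h k))"
   using mems[OF Qab z_Qab in_Qab] C_nonzero by (intro sq_eq_mult WW H4t sq_eq_refl)
  also have "C * (W * tele 2 h k) = V" by (simp add: V_def mult_ac)
  finally show ?thesis .
 qed
 define e where "e = n div 2"
 consider "n = 2 * e" | "n = 2 * e + 1" unfolding e_def by linarith
 then show ?thesis
 proof cases
  case 1
  have "sq_eq (\<Prod>b\<in>half q. if 4 * b < q then t1 (- b) else t1 b)
    (\<Prod>b\<in>half q. t1 b * ((if 4 * b < q then od y (4 * b) else 1) * (if 4 * b < q then od y (2 * b) else 1)))"
   by (rule sq_eq_prod) (use t1_flip sq_eq_t1 nd in simp)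
  also have "\<dots> = 1 * (W * (L4 * L2))" by (simp add: prod.distrib W_def L4_def L2_def)
  finally have a: "sq_eq ((\<Prod>j\<in>half q. S (4 * j - 1)) * (\<Prod>j\<in>half q. S (2 * j - 1))) (1 * (W * (L4 * L2)))"
   using sq_eq_trans[OF odd_part_1[OF 1]] by blast
  have sg: "(- 1) ^ j * ((- 1) ^ j * X) = (X::complex)" for j X by (simp flip: mult.assoc power_mult_distrib)
  have "1 * (W * (L4 * L2)) * D = W * L4 * K" unfolding KED LE by (simp only: mult_ac mult_1_left)
  also have "K = (- 1) ^ card (uppers q 4) * (L4 * H4)" unfolding 4 sg by (rule refl)
  also have "W * L4 * ((- 1) ^ card (uppers q 4) * (L4 * H4)) = (- 1) ^ card (uppers q 4) * (L4 * (L4 * (W * H4)))"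
   by (simp only: mult_ac)
  also have "sq_eq \<dots> (W * H4)"
   by (rule sq_eq_root_of_unity[OF root_of_unity_power[OF root_of_unity_minus_1] sq_eq_cancel_left])
    (use sq_eqD[OF u(1)] sq_eq_mult[OF WW u(2)] in auto)
  also have "sq_eq (W * H4) (C * (W * H4))"
  proof -
   have "C = t1 0 ^ e * t1 0 ^ e" by (simp add: C_def card_half_n 1 mult_2 power_add)
   then have "C * (W * H4) = t1 0 ^ e * (t1 0 ^ e * (W * H4))" by (simp only: mult.assoc)
   moreover have "sq_eq (t1 0 ^ e * (t1 0 ^ e * (W * H4))) (W * H4)"
    using sq_eq_mult[OF WW u(2)] t1_nonzero by (intro sq_eq_cancel_left subfield_power[OF Qab] t1_mem[OF Qab z_Qab in_Qab]) auto
   ultimately have "sq_eq (C * (W * H4)) (W * H4)" by (simp only:)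
   then show ?thesis by (rule sq_eq_sym)
  qed
  finally have b: "sq_eq (1 * (W * (L4 * L2)) * D) (C * (W * H4))" .
  show ?thesis by (rule cls[OF a b])
 next
  case 2
  have "sq_eq (t1 0 * (\<Prod>b\<in>half q. if 4 * b < q then t1 b else t1 (- b)))
    (t1 0 * (\<Prod>b\<in>half q. t1 b * ((if 4 * b < q then 1 else od y (4 * b)) * (if 4 * b < q then 1 else od y (2 * b)))))"
   by (rule sq_eq_mult[OF sq_eq_t1], rule sq_eq_prod) (use t1_flip sq_eq_t1 nd in simp)
  also have "\<dots> = t1 0 * (W * (H4 * H2))" by (simp add: prod.distrib W_def H4_def H2_def)
  finally have a: "sq_eq ((\<Prod>j\<in>half q. S (4 * j - 1)) * (\<Prod>j\<in>half q. S (2 * j - 1))) (t1 0 * (W * (H4 * H2)))"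
   using sq_eq_trans[OF odd_part_3[OF 2]] by blast
  have "E * H2 = E * ((- 1) ^ card (uppers q 2) * D)" using \<open>L2 * H2 = _\<close> unfolding LE KED by (simp only: mult_ac)
  moreover have "E \<noteq> 0" using sq_eqD[OF u(3)] by (simp add: LE)
  ultimately have H2: "H2 = (- 1) ^ card (uppers q 2) * D" by simp
  have "t1 0 * (W * (H4 * H2)) * D = (- 1) ^ card (uppers q 2) * (D * (D * (t1 0 * (W * H4))))"
   unfolding H2 by (simp only: mult_ac)
  also have "sq_eq \<dots> (t1 0 * (W * H4))"
   by (rule sq_eq_root_of_unity[OF root_of_unity_power[OF root_of_unity_minus_1] sq_eq_cancel_left])
    (use sq_eqD[OF u(4)] sq_eq_mult[OF sq_eq_t1 sq_eq_mult[OF WW u(2)]] in auto)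
  also have "sq_eq (t1 0 * (W * H4)) (C * (W * H4))"
  proof -
   have "C = t1 0 ^ (e + e + 1)" by (simp add: C_def card_half_n 2 flip: mult_2)
   then have "C = t1 0 ^ e * (t1 0 ^ e * t1 0)" by (simp only: power_add power_one_right mult.assoc)
   then have "C * (W * H4) = t1 0 ^ e * (t1 0 ^ e * (t1 0 * (W * H4)))" by (simp only: mult.assoc)
   moreover have "sq_eq (t1 0 ^ e * (t1 0 ^ e * (t1 0 * (W * H4)))) (t1 0 * (W * H4))"
    using sq_eq_mult[OF sq_eq_t1 sq_eq_mult[OF WW u(2)]] t1_nonzero
    by (intro sq_eq_cancel_left subfield_power[OF Qab] t1_mem[OF Qab z_Qab in_Qab]) auto
   ultimately have "sq_eq (C * (W * H4)) (t1 0 * (W * H4))" by (simp only:)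
   then show ?thesis by (rule sq_eq_sym)
  qed
  finally have b: "sq_eq (t1 0 * (W * (H4 * H2)) * D) (C * (W * H4))" .
  show ?thesis by (rule cls[OF a b])
 qed
qed

lemma sin_A_sq_eq_V: "sq_eq (sin_A (a_elem 2 (nat q))) V"
proof -
 define r where "r = nat q"
 have r: "int r = q" "odd r" "r > 0" using p_pos odd_p by (simp_all add: r_def even_nat_iff)
 have q_rat: "(of_int q :: rat) = of_nat r" "(of_int q :: rat) \<noteq> 0" using r by (simp_all flip: r(1))
 have s1: "sq_eq (sin1 a) (S m)" if "a = of_int m / of_int (4 * q)" "\<not> 4 * q dvd m" for a m
  unfolding S_def that(1) by (rule sin1_uu[OF S_notin[OF that(2)]])
 have "\<not> 4 dvd (1::nat)" by simp
 \<comment> \<open>The block of the generator at 1/4 is a sine quotient with 4 and 1 in the places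
   of \<open>p\<close> and \<open>i\<close>.\<close>
 from sine_quotient[OF _ r(2) this] have
  1: "sq_eq (sin1 (1 / 4) / (\<Prod>k = 0..(r - 1) div 2. sin1 (1 / of_nat (4 * r) + of_nat k / of_nat r)))
   (\<Prod>j\<in>half q. S (4 * j - 1))"
  by (simp add: S_def r(1) mult.commute)
 have "sq_eq (\<Prod>j = 1..n. sin1 (of_nat j / of_nat r) * sin1 (- 1 / of_nat (2 * r) + of_nat j / of_nat r)
    / sin1 (of_nat j / of_nat (2 * r)) / sin1 (- 1 / of_nat (4 * r) + of_nat j / of_nat (2 * r)))
   (\<Prod>j = 1..n. S (4 * int j) * S (4 * int j - 2) * S (2 * int j) * S (2 * int j - 1))"
 proof (rule sq_eq_prod, intro sq_eq_divide sq_eq_mult s1 small_not_dvd)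
  fix j assume "j \<in> {1..n}"
  then have j: "1 \<le> int j" "2 * int j < q" using n by auto
  show "0 < 4 * int j" "4 * int j < 4 * q" "0 < 4 * int j - 2" "4 * int j - 2 < 4 * q" "0 < 2 * int j"
   "2 * int j < 4 * q" "0 < 2 * int j - 1" "2 * int j - 1 < 4 * q" using j by linarith+
 qed (use q_rat in \<open>simp_all add: field_simps\<close>)
 also have "\<dots> = ((\<Prod>j\<in>half q. S (4 * j) * S (4 * j - 2)) * (\<Prod>j\<in>half q. S (2 * j))) * (\<Prod>j\<in>half q. S (2 * j - 1))"
  unfolding half_nat by (simp only: prod.distrib)
 finally have 2: "sq_eq (\<Prod>j = 1..n. sin1 (of_nat j / of_nat r) * sin1 (- 1 / of_nat (2 * r) + of_nat j / of_nat r)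
    / sin1 (of_nat j / of_nat (2 * r)) / sin1 (- 1 / of_nat (4 * r) + of_nat j / of_nat (2 * r)))
   (((\<Prod>j\<in>half q. S (4 * j) * S (4 * j - 2)) * (\<Prod>j\<in>half q. S (2 * j))) * (\<Prod>j\<in>half q. S (2 * j - 1)))" .
 have nr: "(r - 1) div 2 = n" by (simp add: n_def r_def)
 have "sq_eq (sin_A (a_elem 2 r)) ((\<Prod>j\<in>half q. S (4 * j - 1)) *
   (((\<Prod>j\<in>half q. S (4 * j) * S (4 * j - 2)) * (\<Prod>j\<in>half q. S (2 * j))) * (\<Prod>j\<in>half q. S (2 * j - 1))))"
  unfolding sin_A_two using sq_eq_divide[OF 1 2[folded nr]] .
 also have "\<dots> = ((\<Prod>j\<in>half q. S (4 * j - 1)) * (\<Prod>j\<in>half q. S (2 * j - 1))) *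
   ((\<Prod>j\<in>half q. S (4 * j) * S (4 * j - 2)) * (\<Prod>j\<in>half q. S (2 * j)))" by (simp only: mult_ac)
 also have "sq_eq \<dots> V" by (rule total)
 finally show ?thesis by (simp only: r_def)
qed

end

end

section \<open>Conclusion for the prime 2 and for odd primes\<close>

theorem D_map_two:
 fixes q :: nat
 assumes q: "prime q" "2 < q"
 shows "D_map (mod_squares (sin_A (a_elem 2 q))) = wedge H1ab (e_char 2) (e_char q)"
proof -
 interpret Q: odd_prime "int q" by unfold_locales (use q in simp_all)
 define e where "e = int ((q + 1) div 2)"
 have e: "2 * e = int q + 1" using Q.odd_p by (auto simp: e_def elim!: oddE)
 \<comment> \<open>The exponent \<open>(q + 1) / 2\<close> makes the square of \<open>y\<close>
   equal to \<open>ee (1 / q)\<close>, as the context of \<open>sin_A_sq_eq_V\<close>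
   requires.\<close>
 define y where "y = ee (of_int e / of_int (int q))"
 have ne: "\<not> int q dvd e"
 proof
  assume "int q dvd e"
  then have "int q dvd 2 * e - int q" by (intro dvd_diff dvd_mult dvd_refl)
  then show False using e q by simp
 qed
 have "y \<noteq> 1" using ee_eq_1_iff of_int_div_Ints[of "int q" e] ne q unfolding y_def by simp
 moreover have "y powi int q = ee (of_int e)" unfolding y_def ee_power_int using q by simp
 then have "y powi int q = 1" by (simp only: ee_of_int)
 ultimately interpret prime_root "int q" y by unfold_locales
 obtain h where h: "\<not> int q dvd h" "\<And>a. \<not> int q dvd a ==> \<exists>k. [a = h ^ k] (mod int q)"
 proof (rule Q.primitive_root)
  fix h assume "\<not> int q dvd h" "\<And>a. \<not> int q dvd a ==> \<exists>k. [a = h ^ k] (mod int q)"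
  then show thesis by (rule that)
 qed
 have "\<not> int q dvd 2" using q zdvd_imp_le[of "int q" 2] by auto
 then obtain k where k: "[2 = h ^ k] (mod int q)" using h(2) by blast
 interpret two_pair "int q" y h k by unfold_locales (use h k in \<open>auto intro: cong_sym\<close>)
 have "y\<^sup>2 = ee (of_int (2 * e) / of_int (int q))" by (simp add: y_def ee_power)
 also have "of_int (2 * e) / of_int (int q) = 1 / of_int (int q) + (of_int 1 :: rat)" unfolding e using q by (simp add: field_simps)
 finally have "y\<^sup>2 = ee (1 / of_int (int q))" unfolding ee_add ee_of_int by simp
 from sin_A_sq_eq_V[OF this] have "sq_eq (sin_A (a_elem 2 q)) V" by simp
 then show ?thesis using D_map_V by (simp add: mod_squares_cong)
qed

theorem D_map_odd:
 fixes p q :: nat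
 assumes p: "prime p" "2 < p" and q: "prime q" "p < q"
 shows "D_map (mod_squares (sin_A (a_elem p q))) = wedge H1ab (e_char p) (e_char q)"
proof -
 obtain x y g h k l where *: "odd_pair (int p) x (int q) y g h k l"
  "sq_eq (sin_A (a_elem p q)) (odd_pair.V (int p) x (int q) y g h k l)"
  by (rule sin_A_sq_eq_V[OF assms])
 interpret odd_pair "int p" x "int q" y g h k l by (fact *(1))
 show ?thesis using D_map_V by (simp add: mod_squares_cong[OF *(2)])
qed

theorem mainTheorem2:
 fixes p q :: nat
 assumes "prime p" and "prime q" and "p < q"
 shows "D_map (mod_squares (sin_A (a_elem p q))) = wedge H1ab (e_char p) (e_char q)"
proof (cases "p = 2")
 case True
 then show ?thesis using assms D_map_two by simp
next
 case False
 then have "2 < p" using prime_ge_2_nat[OF assms(1)] by simp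
 then show ?thesis using D_map_odd assms by blast
qed

end
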